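(* Let $\varepsilon>0$ and set $$\alpha(u)=1-\bigl(\log(u+e^2)\bigr)^{-\varepsilon},\qquad u\ge0.$$ Let $(\mathcal E,\mathcal D[\mathcal E])$ be the symmetric translation invariant Dirichlet form on $L^2(\mathbb R)$ given by $$\mathcal E(u,v)=\iint_{x\ne y}\frac{(u(y)-u(x))(v(y)-v(x))}{|x-y|^{1+\alpha(|x-y|)}}\,dxdy,\qquad \mathcal D[\mathcal E]=\{u\in L^2(\mathbb R):\mathcal E(u,u)<\infty\},$$ i.e. the form of the symmetric Lévy process on $\mathbb R$ with Lévy measure $n(dh)=|h|^{-1-\alpha(|h|)}dh$ (up to a constant multiple). Then the form (equivalently, the process) is recurrent if and only if $\varepsilon\ge1$.
   Context: $L^2(\mathbb R)=L^2(\mathbb R;dx)$, $dx$ Lebesgue measure. Recurrence of a Dirichlet form is in the usual sense: with $\{T_t\}$ the associated semigroup and $Gf=\int_0^\infty T_tf\,dt$ for nonnegative $f\in L^1$, the form is recurrent if $Gf\in\{0,\infty\}$ a.e. for every nonnegative $f\in L^1$. *)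

theory Defs
  imports "HOL-Probability.Probability"
begin

text \<open>
  Elements of \<open>L\<^sup>1\<close> and \<open>L\<^sup>2\<close> are represented by measurable functions; all notions below are
  invariant under changes on null sets.
\<close>

definition L1 :: "'a measure \<Rightarrow> ('a \<Rightarrow> real) set" where
  "L1 M = {f. integrable M f}"

definition L2 :: "'a measure \<Rightarrow> ('a \<Rightarrow> real) set" where
  "L2 M = {f \<in> borel_measurable M. integrable M (\<lambda>x. (f x)\<^sup>2)}"

definition L2_inner :: "'a measure \<Rightarrow> ('a \<Rightarrow> real) \<Rightarrow> ('a \<Rightarrow> real) \<Rightarrow> real" where
  "L2_inner M f g = (LINT x|M. f x * g x)"

definition L2_nrm :: "'a measure \<Rightarrow> ('a \<Rightarrow> real) \<Rightarrow> real" where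
  "L2_nrm M f = sqrt (L2_inner M f f)"

locale dirichlet_form =
  fixes M :: "'a measure"
    and E :: "('a \<Rightarrow> real) \<Rightarrow> ('a \<Rightarrow> real) \<Rightarrow> real"
    and D :: "('a \<Rightarrow> real) set"
  assumes dom_L2: "D \<subseteq> L2 M"
    and dom_cong: "\<lbrakk>u \<in> D; v \<in> borel_measurable M; AE x in M. u x = v x\<rbrakk> \<Longrightarrow> v \<in> D"
    and form_cong: "\<lbrakk>u \<in> D; v \<in> D; w \<in> D; AE x in M. u x = v x\<rbrakk> \<Longrightarrow> E u w = E v w"
    and dom_lincomb: "\<lbrakk>u \<in> D; v \<in> D\<rbrakk> \<Longrightarrow> (\<lambda>x. a * u x + b * v x) \<in> D"
    and form_lincomb: "\<lbrakk>u \<in> D; v \<in> D; w \<in> D\<rbrakk>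
        \<Longrightarrow> E (\<lambda>x. a * u x + b * v x) w = a * E u w + b * E v w"
    and form_sym: "\<lbrakk>u \<in> D; v \<in> D\<rbrakk> \<Longrightarrow> E u v = E v u"
    and form_nonneg: "u \<in> D \<Longrightarrow> 0 \<le> E u u"
    and dom_dense: "\<lbrakk>u \<in> L2 M; 0 < e\<rbrakk> \<Longrightarrow> \<exists>v\<in>D. L2_nrm M (\<lambda>x. u x - v x) < e"
    and closed_form: "\<And>s. \<lbrakk>\<And>n::nat. s n \<in> D;
        \<And>e::real. 0 < e \<Longrightarrow> \<exists>N. \<forall>m\<ge>N. \<forall>n\<ge>N.
          E (\<lambda>x. s m x - s n x) (\<lambda>x. s m x - s n x) + (L2_nrm M (\<lambda>x. s m x - s n x))\<^sup>2 < e\<rbrakk>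
        \<Longrightarrow> \<exists>u\<in>D. (\<lambda>n. E (\<lambda>x. s n x - u x) (\<lambda>x. s n x - u x)
              + (L2_nrm M (\<lambda>x. s n x - u x))\<^sup>2) \<longlonglongrightarrow> 0"
    and markov_dom: "u \<in> D \<Longrightarrow> (\<lambda>x. min 1 (max 0 (u x))) \<in> D"
    and markov_form: "u \<in> D \<Longrightarrow> E (\<lambda>x. min 1 (max 0 (u x))) (\<lambda>x. min 1 (max 0 (u x))) \<le> E u u"

definition translation_invariant ::
  "((real \<Rightarrow> real) \<Rightarrow> (real \<Rightarrow> real) \<Rightarrow> real) \<Rightarrow> (real \<Rightarrow> real) set \<Rightarrow> bool" where
  "translation_invariant E D \<longleftrightarrow>
     (\<forall>a. \<forall>u\<in>D. (\<lambda>x. u (x + a)) \<in> D \<and>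
        (\<forall>v\<in>D. E (\<lambda>x. u (x + a)) (\<lambda>x. v (x + a)) = E u v))"

locale symmetric_contraction_semigroup =
  fixes M :: "'a measure"
    and T :: "real \<Rightarrow> ('a \<Rightarrow> real) \<Rightarrow> 'a \<Rightarrow> real"
  assumes closed_L2: "\<lbrakk>0 < t; f \<in> L2 M\<rbrakk> \<Longrightarrow> T t f \<in> L2 M"
    and linear: "\<lbrakk>0 < t; f \<in> L2 M; g \<in> L2 M\<rbrakk>
        \<Longrightarrow> AE x in M. T t (\<lambda>y. a * f y + b * g y) x = a * T t f x + b * T t g x"
    and symmetric: "\<lbrakk>0 < t; f \<in> L2 M; g \<in> L2 M\<rbrakk> \<Longrightarrow> L2_inner M (T t f) g = L2_inner M f (T t g)"
    and contraction: "\<lbrakk>0 < t; f \<in> L2 M\<rbrakk> \<Longrightarrow> L2_nrm M (T t f) \<le> L2_nrm M f"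
    and semigroup: "\<lbrakk>0 < s; 0 < t; f \<in> L2 M\<rbrakk> \<Longrightarrow> AE x in M. T (s + t) f x = T s (T t f) x"
    and strongly_continuous:
      "f \<in> L2 M \<Longrightarrow> ((\<lambda>t. L2_nrm M (\<lambda>x. T t f x - f x)) \<longlongrightarrow> 0) (at_right 0)"

text \<open>Unbounded operators are given by their graphs.\<close>

definition generator ::
  "'a measure \<Rightarrow> (real \<Rightarrow> ('a \<Rightarrow> real) \<Rightarrow> 'a \<Rightarrow> real) \<Rightarrow> (('a \<Rightarrow> real) \<times> ('a \<Rightarrow> real)) set" where
  "generator M T = {(u, f). u \<in> L2 M \<and> f \<in> L2 M \<and>
     ((\<lambda>t. L2_nrm M (\<lambda>x. (T t u x - u x) / t - f x)) \<longlongrightarrow> 0) (at_right 0)}"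

definition form_operator ::
  "'a measure \<Rightarrow> (('a \<Rightarrow> real) \<Rightarrow> ('a \<Rightarrow> real) \<Rightarrow> real) \<Rightarrow> ('a \<Rightarrow> real) set
     \<Rightarrow> (('a \<Rightarrow> real) \<times> ('a \<Rightarrow> real)) set" where
  "form_operator M E D =
     {(u, f). u \<in> D \<and> f \<in> L2 M \<and> (\<forall>v\<in>D. E u v = - L2_inner M f v)}"

definition associated_semigroup ::
  "'a measure \<Rightarrow> (('a \<Rightarrow> real) \<Rightarrow> ('a \<Rightarrow> real) \<Rightarrow> real) \<Rightarrow> ('a \<Rightarrow> real) set
     \<Rightarrow> (real \<Rightarrow> ('a \<Rightarrow> real) \<Rightarrow> 'a \<Rightarrow> real) \<Rightarrow> bool" where
  "associated_semigroup M E D T \<longleftrightarrow>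
     symmetric_contraction_semigroup M T \<and> generator M T = form_operator M E D"

text \<open>
  The semigroup of a Dirichlet form is an \<open>L\<^sup>1\<close>-contraction on the dense subspace
  \<open>L\<^sup>1 \<inter> L\<^sup>2\<close> of \<open>L\<^sup>1\<close>; \<open>S\<close> is its unique extension to \<open>L\<^sup>1\<close>.
\<close>

definition L1_extension ::
  "'a measure \<Rightarrow> (real \<Rightarrow> ('a \<Rightarrow> real) \<Rightarrow> 'a \<Rightarrow> real)
     \<Rightarrow> (real \<Rightarrow> ('a \<Rightarrow> real) \<Rightarrow> 'a \<Rightarrow> real) \<Rightarrow> bool" where
  "L1_extension M T S \<longleftrightarrow>
     (\<forall>t>0. (\<forall>f\<in>L1 M. S t f \<in> L1 M \<and> (LINT x|M. \<bar>S t f x\<bar>) \<le> (LINT x|M. \<bar>f x\<bar>)) \<and>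
            (\<forall>f\<in>L1 M. \<forall>g\<in>L1 M. \<forall>a b.
               AE x in M. S t (\<lambda>y. a * f y + b * g y) x = a * S t f x + b * S t g x) \<and>
            (\<forall>f\<in>L1 M \<inter> L2 M. AE x in M. S t f x = T t f x))"

text \<open>
  \<open>g\<close> is a version of \<open>G f = \<integral>\<^sub>0\<^sup>\<infinity> T\<^sub>t f dt\<close>. As each \<open>T\<^sub>t f\<close> is only determined up to
  a null set depending on \<open>t\<close>, the pointwise integral is taken of a jointly measurable
  version \<open>F\<close> of \<open>(t, x) \<mapsto> T\<^sub>t f x\<close>; by Fubini the result is a.e. independent of \<open>F\<close>.
\<close>

definition green_version ::
  "'a measure \<Rightarrow> (real \<Rightarrow> ('a \<Rightarrow> real) \<Rightarrow> 'a \<Rightarrow> real) \<Rightarrow> ('a \<Rightarrow> real) \<Rightarrow> ('a \<Rightarrow> ennreal) \<Rightarrow> bool" where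
  "green_version M S f g \<longleftrightarrow>
     (\<exists>F \<in> borel_measurable (lborel \<Otimes>\<^sub>M M).
        (\<forall>t>0. AE x in M. F (t, x) = S t f x) \<and>
        g = (\<lambda>x. \<integral>\<^sup>+t\<in>{0<..}. ennreal (F (t, x)) \<partial>lborel))"

definition recurrent ::
  "'a measure \<Rightarrow> (('a \<Rightarrow> real) \<Rightarrow> ('a \<Rightarrow> real) \<Rightarrow> real) \<Rightarrow> ('a \<Rightarrow> real) set \<Rightarrow> bool" where
  "recurrent M E D \<longleftrightarrow>
     (\<exists>T S. associated_semigroup M E D T \<and> L1_extension M T S \<and>
        (\<forall>f\<in>L1 M. (AE x in M. 0 \<le> f x) \<longrightarrow>
           (\<exists>g. green_version M S f g \<and> (AE x in M. g x = 0 \<or> g x = \<infinity>))))"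

definition alpha :: "real \<Rightarrow> real \<Rightarrow> real" where
  "alpha \<epsilon> u = 1 - (ln (u + exp 2)) powr (- \<epsilon>)"

definition levy_form :: "real \<Rightarrow> (real \<Rightarrow> real) \<Rightarrow> (real \<Rightarrow> real) \<Rightarrow> real" where
  "levy_form \<epsilon> u v = (LINT (x, y):{(x, y). x \<noteq> y}|(lborel \<Otimes>\<^sub>M lborel).
     (u y - u x) * (v y - v x) / \<bar>x - y\<bar> powr (1 + alpha \<epsilon> \<bar>x - y\<bar>))"

text \<open>
  Finiteness of \<open>\<E>(u,u)\<close> is expressed by the \<open>[0,\<infinity>]\<close>-valued integral, since the
  real-valued integral of a non-integrable function is \<open>0\<close>.
\<close>

definition levy_dom :: "real \<Rightarrow> (real \<Rightarrow> real) set" where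
  "levy_dom \<epsilon> = {u \<in> L2 lborel.
     (\<integral>\<^sup>+(x, y)\<in>{(x, y). x \<noteq> y}.
        ennreal ((u y - u x)\<^sup>2 / \<bar>x - y\<bar> powr (1 + alpha \<epsilon> \<bar>x - y\<bar>))
      \<partial>(lborel \<Otimes>\<^sub>M lborel)) < \<infinity>}"

end

theory Submission
  imports Defs "HOL-Real_Asymp.Real_Asymp"
begin

text \<open>
  Let \<open>A\<^sub>k\<close> be convolution with the Levy measure truncated near zero, minus its mass. The \<open>A\<^sub>k\<close> are
  bounded commuting self-adjoint dissipative operators, and since \<open>\<alpha> < 1\<close> gives the jumps finite
  variation, \<open>A\<^sub>k f\<close> converges for all \<open>f\<close> that are Lipschitz along translations in \<open>L\<^sup>2\<close>. Hence
  \<open>exp (t A\<^sub>k)\<close> converges strongly to a Markovian semigroup. Its form is the increasing limit of the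
  bounded forms \<open>- \<langle>A\<^sub>k u, u\<rangle>\<close>, which is the given one by monotone convergence.

  By irreducibility the form is transient if and only if \<open>\<langle>x, v\<rangle>\<^sup>2 \<le> C \<E>(v, v)\<close> for some \<open>x \<ge> 0\<close>,
  \<open>x \<noteq> 0\<close>. Comparing the means of \<open>v\<close> over successive dyadic intervals of length \<open>2\<^sup>k\<close> costs
  \<open>exp (- c k\<^bsup>1 - \<epsilon>\<^esup>)\<close>, which is summable if \<open>\<epsilon> < 1\<close>. If \<open>\<epsilon> \<ge> 1\<close>, then
  the density is at most \<open>e / h\<^sup>2\<close>, and sums of \<open>n\<close> cutoffs at the scales
  \<open>4\<^sup>k\<close> have energy \<open>O(n)\<close> while the square of their pairing with \<open>x\<close> grows like \<open>n\<^sup>2\<close>.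
\<close>

section \<open>Bounded operators and contraction semigroups\<close>

text \<open>The threshold is visible once the density is written as
  \<open>exp (ln h * ln (h + exp 2) powr (- \<epsilon>)) / h\<^sup>2\<close>. The exponent behaves
  like \<open>(ln h) powr (1 - \<epsilon>)\<close>. It is bounded if \<epsilon> \<ge> 1, so that
  large jumps are no heavier than for the critical Cauchy density; if \<epsilon> < 1 it grows, and
  this gain, smaller than every power of h, is enough for transience.

  Recurrence is stated through some associated semigroup, its extension to L1 and the resulting
  Green function. Two things must therefore be settled before any estimate: such a semigroup exists,
  with exactly the operator of the form as its generator, and it is unique, because a claim of
  recurrence comes with an arbitrary semigroup as witness.

  All that follows concerns integrals of \<open>inner (P t x) y\<close> over time. The energy
  inequality controls them for x = y, whereas a Green function that is finite on a set only bounds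
  the pairing of two different vectors. Resolvents of the two vectors overlap, and the minimum of
  these resolvents is one nonzero vector with a finite potential against itself.\<close>

typedef (overloaded) 'a endo = "UNIV :: ('a::real_normed_vector \<Rightarrow>\<^sub>L 'a) set"
  morphisms blinfun_of_endo endo_of_blinfun ..

setup_lifting type_definition_endo

lift_definition app :: "'a::real_normed_vector endo \<Rightarrow> 'a \<Rightarrow> 'a" is blinfun_apply .

text \<open>Self-maps get a type of their own with composition as product, so that
  \<open>exp\<close> and geometric series of operators are those of a Banach algebra.\<close>

instantiation endo :: (real_normed_vector) real_normed_algebra
begin

lift_definition zero_endo :: "'a endo" is 0 .
lift_definition plus_endo :: "'a endo \<Rightarrow> 'a endo \<Rightarrow> 'a endo" is "(+)" .
lift_definition minus_endo :: "'a endo \<Rightarrow> 'a endo \<Rightarrow> 'a endo" is "(-)" .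
lift_definition uminus_endo :: "'a endo \<Rightarrow> 'a endo" is uminus .
lift_definition scaleR_endo :: "real \<Rightarrow> 'a endo \<Rightarrow> 'a endo" is scaleR .
lift_definition times_endo :: "'a endo \<Rightarrow> 'a endo \<Rightarrow> 'a endo" is "(o\<^sub>L)" .
lift_definition norm_endo :: "'a endo \<Rightarrow> real" is norm .

definition sgn_endo :: "'a endo \<Rightarrow> 'a endo" where "sgn_endo x = scaleR (inverse (norm x)) x"
definition dist_endo :: "'a endo \<Rightarrow> 'a endo \<Rightarrow> real" where "dist_endo x y = norm (x - y)"
definition uniformity_endo :: "('a endo \<times> 'a endo) filter"
  where "uniformity_endo = (INF e\<in>{0<..}. principal {(x, y). dist x y < e})"
definition open_endo :: "'a endo set \<Rightarrow> bool"
  where "open_endo U \<longleftrightarrow> (\<forall>x\<in>U. eventually (\<lambda>(x', y). x' = x \<longrightarrow> y \<in> U) uniformity)"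

instance
proof
  fix x y z :: "'a endo" and a b :: real
  show "x + y + z = x + (y + z)" "x + y = y + x" "0 + x = x" "- x + x = 0" "x - y = x + - y"
    by (transfer, simp)+
  show "a *\<^sub>R (x + y) = a *\<^sub>R x + a *\<^sub>R y" "(a + b) *\<^sub>R x = a *\<^sub>R x + b *\<^sub>R x"
    "a *\<^sub>R b *\<^sub>R x = (a * b) *\<^sub>R x" "1 *\<^sub>R x = x"
    by (transfer, simp add: algebra_simps)+
  show "x * y * z = x * (y * z)"
    by transfer (auto intro: blinfun_eqI)
  show "(x + y) * z = x * z + y * z" "x * (y + z) = x * y + x * z"
    "a *\<^sub>R x * y = a *\<^sub>R (x * y)" "x * a *\<^sub>R y = a *\<^sub>R (x * y)"
    by (transfer, auto intro: blinfun_eqI simp: blinfun.bilinear_simps)+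
  show "norm x = 0 \<longleftrightarrow> x = 0" by transfer simp
  show "norm (x + y) \<le> norm x + norm y" by transfer (rule norm_triangle_ineq)
  show "norm (a *\<^sub>R x) = \<bar>a\<bar> * norm x" by transfer simp
  show "norm (x * y) \<le> norm x * norm y" by transfer (rule norm_blinfun_compose)
qed (fact sgn_endo_def dist_endo_def uniformity_endo_def open_endo_def)+

end

text \<open>\<open>perfect_space\<close> excludes the zero space, in which the identity has norm 0
  instead of 1.\<close>

instantiation endo :: ("{real_normed_vector, perfect_space}") real_normed_algebra_1
begin

lift_definition one_endo :: "'a endo" is id_blinfun .

instance
proof
  fix x :: "'a endo"
  show "1 * x = x" "x * 1 = x" by (transfer, auto intro: blinfun_eqI)+
  show "norm (1 :: 'a endo) = 1" by transfer simp
  then show "(0 :: 'a endo) \<noteq> 1"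
    by (metis norm_zero zero_neq_one)
qed

end

instance endo :: (banach) banach
proof
  fix X :: "nat \<Rightarrow> 'a endo"
  assume "Cauchy X"
  then have "Cauchy (\<lambda>n. blinfun_of_endo (X n))"
    by (simp add: Cauchy_iff norm_endo.rep_eq minus_endo.rep_eq)
  then obtain L where "(\<lambda>n. blinfun_of_endo (X n)) \<longlonglongrightarrow> L"
    using Cauchy_convergent convergent_def by blast
  then have "X \<longlonglongrightarrow> endo_of_blinfun L"
    by (simp add: LIMSEQ_iff norm_endo.rep_eq minus_endo.rep_eq endo_of_blinfun_inverse)
  then show "convergent X"
    by (auto simp: convergent_def)
qed

lemma bounded_bilinear_app: "bounded_bilinear app"
proof
  show "\<exists>K. \<forall>a b. norm (app a b) \<le> norm a * norm b * K"
    by transfer (metis mult_1_right norm_blinfun)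
qed (transfer, simp add: blinfun.bilinear_simps)+

interpretation app: bounded_bilinear app
  by (rule bounded_bilinear_app)

lemma app_one [simp]: "app 1 x = x"
  by transfer simp

lemma app_mult: "app (S * T) x = app S (app T x)"
  by transfer simp

lemma norm_app: "norm (app S x) \<le> norm S * norm x"
  by transfer (rule norm_blinfun)

lemma norm_app_le: "norm S \<le> 1 \<Longrightarrow> norm (app S x) \<le> norm x"
  by (meson mult_left_le_one_le norm_app norm_ge_zero order_trans)

lemma endo_eqI: "(\<And>x. app S x = app T x) \<Longrightarrow> S = T"
  by transfer (rule blinfun_eqI)

lemma norm_endo_bound: "0 \<le> b \<Longrightarrow> (\<And>x. norm (app S x) \<le> b * norm x) \<Longrightarrow> norm S \<le> b"
  by transfer (rule norm_blinfun_bound)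

section \<open>Generators of contraction semigroups on a Hilbert space\<close>

definition gen :: "(real \<Rightarrow> 'h::real_normed_vector \<Rightarrow> 'h) \<Rightarrow> ('h \<times> 'h) set" where
  "gen Q = {(u, f). ((\<lambda>t. (Q t u - u) /\<^sub>R t) \<longlongrightarrow> f) (at_right 0)}"

locale contraction_semigroup =
  fixes Q :: "real \<Rightarrow> 'h::{real_inner, banach} \<Rightarrow> 'h"
  assumes lin: "0 \<le> t \<Longrightarrow> linear (Q t)"
    and contr: "0 \<le> t \<Longrightarrow> norm (Q t x) \<le> norm x"
    and at_zero: "Q 0 x = x"
    and add: "0 \<le> s \<Longrightarrow> 0 \<le> t \<Longrightarrow> Q (s + t) x = Q s (Q t x)"
    and cont0: "((\<lambda>t. Q t x) \<longlongrightarrow> x) (at_right 0)"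
begin

lemma bounded_linear: "0 \<le> t \<Longrightarrow> bounded_linear (Q t)"
  by (rule bounded_linear_intro[where K = 1])
    (simp_all add: linear_add[OF lin] linear_scale[OF lin] contr)

lemmas diff = bounded_linear[THEN bounded_linear.linear, THEN linear_diff]
lemmas plus = bounded_linear[THEN bounded_linear.linear, THEN linear_add]
lemmas scale = bounded_linear[THEN bounded_linear.linear, THEN linear_scale]

lemma near_zero:
  assumes "0 < e"
  obtains d where "0 < d" "\<And>r. 0 \<le> r \<Longrightarrow> r < d \<Longrightarrow> norm (Q r x - x) < e"
proof -
  from cont0[of x] assms have "\<forall>\<^sub>F t in at_right 0. dist (Q t x) x < e"
    by (rule tendstoD)
  then obtain d where "0 < d" "\<And>r. 0 < r \<Longrightarrow> r < d \<Longrightarrow> norm (Q r x - x) < e"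
    by (auto simp: eventually_at_right_field dist_norm)
  with that[of d] assms show thesis
    by (metis at_zero diff_self norm_zero order_le_less)
qed

text \<open>If a is the smaller and b the larger time, the difference is the image of
  \<open>Q (b - a) x - x\<close> under the contraction \<open>Q a\<close>. Continuity at 0 thus
  becomes uniform in time.\<close>

lemma norm_diff_le:
  assumes "0 \<le> s" "0 \<le> t"
  shows "norm (Q t x - Q s x) \<le> norm (Q \<bar>t - s\<bar> x - x)"
proof -
  have *: "norm (Q b x - Q a x) \<le> norm (Q (b - a) x - x)" if "0 \<le> a" "a \<le> b" for a b
    using add[of a "b - a" x] contr[of a "Q (b - a) x - x"] diff[of a] that by simp
  show ?thesis
    using *[of s t] *[of t s] assms by (cases "s \<le> t") (auto simp: norm_minus_commute)
qed

lemma continuous: "continuous_on {0..} (\<lambda>t. Q t x)"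
  unfolding continuous_on_iff
proof (intro ballI allI impI)
  fix s e :: real assume "s \<in> {0..}" "0 < e"
  from near_zero[OF \<open>0 < e\<close>] obtain d where d: "0 < d"
    "\<And>r. 0 \<le> r \<Longrightarrow> r < d \<Longrightarrow> norm (Q r x - x) < e" by metis
  show "\<exists>d>0. \<forall>t\<in>{0..}. dist t s < d \<longrightarrow> dist (Q t x) (Q s x) < e"
  proof (intro exI[of _ d] conjI ballI impI d(1))
    fix t assume "t \<in> {0..}" "dist t s < d"
    then have "norm (Q \<bar>t - s\<bar> x - x) < e"
      by (intro d(2)) (auto simp: dist_real_def)
    with norm_diff_le[of s t x] \<open>s \<in> {0..}\<close> \<open>t \<in> {0..}\<close> show "dist (Q t x) (Q s x) < e"
      by (simp add: dist_norm)
  qed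
qed

lemma integrable: "0 \<le> a \<Longrightarrow> (\<lambda>t. Q t x) integrable_on {a..b}"
  by (rule integrable_continuous_real) (auto intro: continuous_on_subset[OF continuous])

lemma gen_near_zero:
  assumes "(u, f) \<in> gen Q" "0 < e"
  obtains d where "0 < d" "\<And>r. 0 \<le> r \<Longrightarrow> r < d \<Longrightarrow> norm (Q r u - u - r *\<^sub>R f) \<le> e * r"
proof -
  from assms have "\<forall>\<^sub>F t in at_right 0. dist ((Q t u - u) /\<^sub>R t) f < e"
    unfolding gen_def by (auto dest: tendstoD)
  then obtain d where d: "0 < d" "\<And>r. 0 < r \<Longrightarrow> r < d \<Longrightarrow> norm ((Q r u - u) /\<^sub>R r - f) < e"
    by (auto simp: eventually_at_right_field dist_norm)
  have "norm (Q r u - u - r *\<^sub>R f) \<le> e * r" if "0 \<le> r" "r < d" for r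
  proof (cases "r = 0")
    case False
    then have "Q r u - u - r *\<^sub>R f = r *\<^sub>R ((Q r u - u) /\<^sub>R r - f)"
      by (simp add: algebra_simps)
    with d(2)[of r] False that show ?thesis
      by (simp add: mult.commute mult_left_mono less_imp_le)
  qed (simp add: at_zero)
  with d(1) that show thesis by blast
qed

text \<open>To the right of t the semigroup law suffices. To the left the increment can only be
  pulled back to the earlier time y, which leaves the extra error \<open>Q t f - Q y f\<close>,
  small by strong continuity.\<close>

lemma gen_derivative:
  assumes "(u, f) \<in> gen Q" "0 \<le> t"
  shows "((\<lambda>t. Q t u) has_vector_derivative Q t f) (at t within {0..})"
  unfolding has_vector_derivative_def has_derivative_within_alt
proof (intro conjI allI impI)
  show "bounded_linear (\<lambda>x. x *\<^sub>R Q t f)"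
    by (rule bounded_linear_scaleR_left)
  fix e :: real assume "0 < e"
  then have "0 < e / 2" by simp
  from gen_near_zero[OF assms(1) this] obtain d1 where d1: "0 < d1"
    "\<And>r. 0 \<le> r \<Longrightarrow> r < d1 \<Longrightarrow> norm (Q r u - u - r *\<^sub>R f) \<le> e / 2 * r" by metis
  from near_zero[OF \<open>0 < e / 2\<close>] obtain d2 where d2: "0 < d2"
    "\<And>r. 0 \<le> r \<Longrightarrow> r < d2 \<Longrightarrow> norm (Q r f - f) < e / 2" by metis
  show "\<exists>d>0. \<forall>y\<in>{0..}. norm (y - t) < d \<longrightarrow>
      norm (Q y u - Q t u - (y - t) *\<^sub>R Q t f) \<le> e * norm (y - t)"
  proof (intro exI[of _ "min d1 d2"] conjI ballI impI)
    fix y assume y: "y \<in> {0..}" "norm (y - t) < min d1 d2"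
    define h where "h = \<bar>y - t\<bar>"
    have h: "0 \<le> h" "h < d1" "h < d2" using y by (auto simp: h_def)
    have b1: "norm (Q r (Q h u - u - h *\<^sub>R f)) \<le> e / 2 * h" if "0 \<le> r" for r
      using contr[OF that] d1(2)[of h] h order_trans by blast
    show "norm (Q y u - Q t u - (y - t) *\<^sub>R Q t f) \<le> e * norm (y - t)"
    proof (cases "t \<le> y")
      case True
      then have "Q y u - Q t u - (y - t) *\<^sub>R Q t f = Q t (Q h u - u - h *\<^sub>R f)"
        using assms(2) add[of t h u] h by (simp add: diff scale h_def)
      then have "norm (Q y u - Q t u - (y - t) *\<^sub>R Q t f) \<le> e / 2 * h"
        using b1[of t] assms(2) by simp
      also have "\<dots> \<le> e * h"
        using h \<open>0 < e\<close> by (intro mult_right_mono) auto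
      finally show ?thesis by (simp add: h_def)
    next
      case False
      then have "Q y u - Q t u - (y - t) *\<^sub>R Q t f
          = h *\<^sub>R (Q t f - Q y f) - Q y (Q h u - u - h *\<^sub>R f)"
        using y(1) add[of y h u] h by (simp add: diff plus scale h_def algebra_simps)
      also have "norm \<dots> \<le> norm (h *\<^sub>R (Q t f - Q y f)) + norm (Q y (Q h u - u - h *\<^sub>R f))"
        by (rule norm_triangle_ineq4)
      also have "\<dots> \<le> h * (e / 2) + e / 2 * h"
      proof (rule add_mono)
        have "norm (Q t f - Q y f) \<le> e / 2"
          using norm_diff_le[of y t f] d2(2)[of h] h y(1) assms(2) by (simp add: h_def abs_minus_commute)
        then show "norm (h *\<^sub>R (Q t f - Q y f)) \<le> h * (e / 2)"
          using mult_left_mono[OF _ h(1)] h(1) by fastforce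
      qed (use b1 y in auto)
      finally show ?thesis by (simp add: h_def algebra_simps)
    qed
  qed (use d1 d2 in auto)
qed

lemma gen_diff:
  assumes "(u, f) \<in> gen Q" "(v, g) \<in> gen Q"
  shows "(u - v, f - g) \<in> gen Q"
proof -
  have *: "((\<lambda>t. (Q t u - u) /\<^sub>R t - (Q t v - v) /\<^sub>R t) \<longlongrightarrow> f - g) (at_right 0)"
    using assms by (intro tendsto_diff) (auto simp: gen_def)
  have "\<forall>\<^sub>F t in at_right (0::real). 0 < t"
    by (simp add: eventually_at_right_less)
  then have "\<forall>\<^sub>F t in at_right 0. (Q t u - u) /\<^sub>R t - (Q t v - v) /\<^sub>R t = (Q t (u - v) - (u - v)) /\<^sub>R t"
    by eventually_elim (simp add: diff algebra_simps)
  with * show ?thesis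
    unfolding gen_def by (auto intro: Lim_transform_eventually)
qed

lemma gen_bounded_linear_image:
  assumes "(u, f) \<in> gen Q" "bounded_linear B" "\<And>t x. 0 < t \<Longrightarrow> Q t (B x) = B (Q t x)"
  shows "(B u, B f) \<in> gen Q"
proof -
  interpret B: bounded_linear B by fact
  have *: "((\<lambda>t. B ((Q t u - u) /\<^sub>R t)) \<longlongrightarrow> B f) (at_right 0)"
    using assms by (intro B.tendsto) (auto simp: gen_def)
  have "\<forall>\<^sub>F t in at_right (0::real). 0 < t"
    by (simp add: eventually_at_right_less)
  then have "\<forall>\<^sub>F t in at_right 0. B ((Q t u - u) /\<^sub>R t) = (Q t (B u) - B u) /\<^sub>R t"
    by eventually_elim (simp add: assms B.diff B.scaleR)
  with * show ?thesis
    unfolding gen_def by (auto intro: Lim_transform_eventually)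
qed

lemma gen_scale: "(u, f) \<in> gen Q \<Longrightarrow> (c *\<^sub>R u, c *\<^sub>R f) \<in> gen Q"
  by (rule gen_bounded_linear_image[OF _ bounded_linear_scaleR_right]) (auto simp: scale)

lemma gen_Q: "(u, f) \<in> gen Q \<Longrightarrow> 0 \<le> s \<Longrightarrow> (Q s u, Q s f) \<in> gen Q"
  by (rule gen_bounded_linear_image[OF _ bounded_linear]) (auto simp: add.commute simp flip: add)

text \<open>The potential operator stopped at time s. Its values lie in the domain of the generator,
  and for s to infinity it approximates the Green operator.\<close>

definition U :: "real \<Rightarrow> 'h \<Rightarrow> 'h" where
  "U s x = integral {0..s} (\<lambda>t. Q t x)"

lemma U_0 [simp]: "U 0 x = 0"
  by (simp add: U_def)

lemma U_derivative:
  assumes "0 \<le> s"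
  shows "((\<lambda>s. U s x) has_vector_derivative Q s x) (at s within {0..})"
proof -
  have "((\<lambda>s. U s x) has_vector_derivative Q s x) (at s within {0..s + 1})"
    unfolding U_def
    by (rule integral_has_vector_derivative)
      (use assms in \<open>auto intro: continuous_on_subset[OF continuous]\<close>)
  moreover have "at s within {0..s + 1} = at s within {0..}"
    by (rule at_within_nhd[where S = "{s - 1<..<s + 1}"]) (use assms in auto)
  ultimately show ?thesis by simp
qed

lemma U_inner: "inner (U s x) y = integral {0..s} (\<lambda>t. inner (Q t x) y)"
  using integral_linear[OF integrable[of 0 x s] bounded_linear_inner_left[of y]]
  by (simp add: U_def o_def)

text \<open>The time integral is shifted by h: both sides vanish at s = 0 and have the same
  derivative in s.\<close>

lemma Q_U:
  assumes "0 \<le> h" "0 \<le> s"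
  shows "Q h (U s x) = U (h + s) x - U h x"
proof -
  have "((\<lambda>s. Q h (U s x) - U (h + s) x) has_derivative (\<lambda>_. 0)) (at r within {0..})"
    if "r \<in> {0..}" for r
  proof -
    have 1: "((\<lambda>s. Q h (U s x)) has_vector_derivative Q h (Q r x)) (at r within {0..})"
      using bounded_linear.has_vector_derivative[OF bounded_linear U_derivative] assms that by auto
    have "((\<lambda>s. U s x) has_vector_derivative Q (h + r) x) (at (h + r) within (+) h ` {0..})"
      using assms that by (intro has_vector_derivative_within_subset[OF U_derivative]) auto
    moreover have "((\<lambda>s. h + s) has_vector_derivative 1) (at r within {0..})"
      by (auto intro!: derivative_eq_intros)
    ultimately have 2: "((\<lambda>s. U (h + s) x) has_vector_derivative Q (h + r) x) (at r within {0..})"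
      using vector_diff_chain_within[of "\<lambda>s. h + s" 1 r "{0..}" "\<lambda>s. U s x"] by (simp add: o_def)
    show ?thesis
      using has_vector_derivative_diff[OF 1 2] assms that add[of h r x]
      by (simp add: has_vector_derivative_def)
  qed
  from has_derivative_zero_constant[OF _ this] obtain c
    where c: "\<And>r. r \<in> {0..} \<Longrightarrow> Q h (U r x) - U (h + r) x = c"
    by (auto simp: convex_real_interval)
  from c[of 0] c[of s] assms show ?thesis
    using linear_0[OF lin[of h]] by (auto simp: algebra_simps)
qed

lemma has_vector_derivative_right_limit:
  assumes "((\<lambda>s. g s) has_vector_derivative d) (at s within {0..})" "0 \<le> (s::real)"
  shows "((\<lambda>h. (g (s + h) - g s) /\<^sub>R h) \<longlongrightarrow> (d::'h)) (at_right 0)"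
proof -
  have "(g has_vector_derivative d) (at_right s)"
    by (rule has_vector_derivative_within_subset[OF assms(1)]) (use assms(2) in auto)
  then have "((\<lambda>y. (1 / norm (y - s)) *\<^sub>R (g y - (g s + (y - s) *\<^sub>R d))) \<longlongrightarrow> 0) (at_right s)"
    by (simp add: has_vector_derivative_def has_derivative_within)
  then have "((\<lambda>h. (1 / norm h) *\<^sub>R (g (h + s) - (g s + h *\<^sub>R d))) \<longlongrightarrow> 0) (at_right 0)"
    by (simp add: filterlim_at_right_to_0[of _ _ s])
  then have *: "((\<lambda>h. (1 / norm h) *\<^sub>R (g (h + s) - (g s + h *\<^sub>R d)) + d) \<longlongrightarrow> 0 + d) (at_right 0)"
    by (intro tendsto_intros)
  have "\<forall>\<^sub>F h in at_right (0::real). 0 < h"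
    by (simp add: eventually_at_right_less)
  then have "\<forall>\<^sub>F h in at_right 0. (1 / norm h) *\<^sub>R (g (h + s) - (g s + h *\<^sub>R d)) + d = (g (s + h) - g s) /\<^sub>R h"
    by eventually_elim (simp add: algebra_simps divide_inverse)
  with * show ?thesis
    by (auto intro: Lim_transform_eventually)
qed

text \<open>By \<open>Q_U\<close> the difference quotient of the semigroup at \<open>U s x\<close>
  is the quotient of \<open>U\<close> at s minus that of \<open>U\<close> at 0, and the derivative
  of \<open>U\<close> is \<open>Q\<close>.\<close>

lemma U_gen:
  assumes "0 \<le> s"
  shows "(U s x, Q s x - x) \<in> gen Q"
proof -
  have "((\<lambda>h. (U (s + h) x - U s x) /\<^sub>R h - (U (0 + h) x - U 0 x) /\<^sub>R h) \<longlongrightarrow> Q s x - Q 0 x) (at_right 0)"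
    by (intro tendsto_diff has_vector_derivative_right_limit U_derivative assms order_refl)
  then have "((\<lambda>h. (Q h (U s x) - U s x) /\<^sub>R h) \<longlongrightarrow> Q s x - Q 0 x) (at_right 0)"
  proof (rule Lim_transform_eventually)
    have "\<forall>\<^sub>F h in at_right (0::real). 0 < h"
      by (simp add: eventually_at_right_less)
    then show "\<forall>\<^sub>F h in at_right 0. (U (s + h) x - U s x) /\<^sub>R h - (U (0 + h) x - U 0 x) /\<^sub>R h
        = (Q h (U s x) - U s x) /\<^sub>R h"
      by eventually_elim (use assms in \<open>simp add: Q_U algebra_simps\<close>)
  qed
  then show ?thesis by (simp add: gen_def at_zero)
qed

lemma U_limit: "((\<lambda>s. U s x /\<^sub>R s) \<longlongrightarrow> x) (at_right 0)"
  using has_vector_derivative_right_limit[OF U_derivative, of 0 x] by (simp add: at_zero)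

lemma closure_gen_domain: "closure (Domain (gen Q)) = UNIV"
proof -
  have "x \<in> closure (Domain (gen Q))" for x
  proof (rule Lim_in_closed_set[OF closed_closure _ _ U_limit])
    have "\<forall>\<^sub>F s in at_right (0::real). 0 < s"
      by (simp add: eventually_at_right_less)
    then show "\<forall>\<^sub>F s in at_right 0. U s x /\<^sub>R s \<in> closure (Domain (gen Q))"
    proof eventually_elim
      case (elim s)
      have "(U s x /\<^sub>R s, (Q s x - x) /\<^sub>R s) \<in> gen Q"
        using elim by (intro gen_scale U_gen) simp
      then show ?case
        by (rule subsetD[OF closure_subset DomainI])
    qed
  qed simp
  then show ?thesis by auto
qed

lemma gen_dissipative:
  assumes "(u, f) \<in> gen Q"
  shows "inner f u \<le> 0"
proof (rule tendsto_upperbound)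
  show "((\<lambda>t. inner ((Q t u - u) /\<^sub>R t) u) \<longlongrightarrow> inner f u) (at_right 0)"
    using assms by (intro tendsto_intros) (simp add: gen_def)
  have "\<forall>\<^sub>F t in at_right (0::real). 0 < t"
    by (simp add: eventually_at_right_less)
  then show "\<forall>\<^sub>F t in at_right 0. inner ((Q t u - u) /\<^sub>R t) u \<le> 0"
  proof eventually_elim
    case (elim t)
    have "inner (Q t u) u \<le> norm (Q t u) * norm u"
      by (rule norm_cauchy_schwarz)
    also have "\<dots> \<le> norm u * norm u"
      using contr[of t u] elim by (simp add: mult_right_mono)
    also have "\<dots> = inner u u"
      by (simp add: power2_norm_eq_inner flip: power2_eq_square)
    finally show ?case
      using elim by (simp add: inner_diff_left mult_le_0_iff)
  qed
qed simp

end

text \<open>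
  For \<open>u\<close> in the common domain, \<open>w t = P t u - Q t u\<close> solves \<open>w' = L w\<close>, and
  dissipativity of \<open>L\<close> makes \<open>\<parallel>w\<parallel>\<^sup>2\<close> nonincreasing.
\<close>

lemma contraction_semigroup_unique:
  assumes P: "contraction_semigroup P" and Q: "contraction_semigroup Q"
    and eq: "gen P = gen Q" and "0 \<le> t"
  shows "P t x = Q t x"
proof -
  interpret P: contraction_semigroup P by (rule P)
  interpret Q: contraction_semigroup Q by (rule Q)
  have on_domain: "P t u = Q t u" if "(u, f) \<in> gen P" for u f
  proof -
    define w where "w s = P s u - Q s u" for s
    define w' where "w' s = P s f - Q s f" for s
    have w: "(w has_vector_derivative w' s) (at s within {0..})" if "0 \<le> s" for s
      unfolding w_def w'_def
      using P.gen_derivative Q.gen_derivative \<open>(u, f) \<in> gen P\<close> that eq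
      by (intro has_vector_derivative_diff) auto
    have gen_w: "(w s, w' s) \<in> gen P" if "0 \<le> s" for s
      unfolding w_def w'_def
      using Q.gen_Q[of u f s] \<open>(u, f) \<in> gen P\<close> that eq
      by (intro P.gen_diff P.gen_Q) auto
    have "inner (w t) (w t) \<le> inner (w 0) (w 0)"
    proof (rule DERIV_nonpos_imp_decreasing_open[where f = "\<lambda>s. inner (w s) (w s)"])
      show "0 \<le> t" by fact
      show "\<exists>y. ((\<lambda>s. inner (w s) (w s)) has_real_derivative y) (at s) \<and> y \<le> 0" if "0 < s" "s < t" for s
      proof (intro exI conjI)
        have "at s within {0..} = at s"
          by (rule at_within_interior) (use that in auto)
        with w[of s] that have "(w has_derivative (\<lambda>h. h *\<^sub>R w' s)) (at s)"
          by (simp add: has_vector_derivative_def)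
        from has_derivative_inner[OF this this]
        show "((\<lambda>s. inner (w s) (w s)) has_real_derivative 2 * inner (w' s) (w s)) (at s)"
          unfolding has_field_derivative_def
          by (rule has_derivative_eq_rhs) (simp add: fun_eq_iff inner_commute[of "w s"])
        show "2 * inner (w' s) (w s) \<le> 0"
          using P.gen_dissipative[OF gen_w[of s]] that by simp
      qed
      show "continuous_on {0..t} (\<lambda>s. inner (w s) (w s))"
        unfolding w_def
        by (intro continuous_intros continuous_on_subset[OF P.continuous]
            continuous_on_subset[OF Q.continuous]) auto
    qed
    then have "inner (w t) (w t) \<le> 0"
      by (simp add: w_def P.at_zero Q.at_zero)
    then have "w t = 0"
      by (metis antisym inner_eq_zero_iff inner_ge_zero)
    then show ?thesis by (simp add: w_def)
  qed
  have "closed {x. P t x = Q t x}"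
    using P.bounded_linear Q.bounded_linear \<open>0 \<le> t\<close>
    by (intro closed_Collect_eq linear_continuous_on) auto
  moreover have "Domain (gen P) \<subseteq> {x. P t x = Q t x}"
    using on_domain by auto
  ultimately have "closure (Domain (gen P)) \<subseteq> {x. P t x = Q t x}"
    by (rule closure_minimal[rotated])
  then show ?thesis
    using P.closure_gen_domain by auto
qed

section \<open>Semigroups from approximating generators\<close>

lemma norm_vector_derivative_bound:
  fixes f :: "real \<Rightarrow> 'a::real_normed_vector"
  assumes "0 \<le> t"
    and f': "\<And>s. s \<in> {0..t} \<Longrightarrow> (f has_vector_derivative f' s) (at s within {0..t})"
    and B: "\<And>s. s \<in> {0..t} \<Longrightarrow> norm (f' s) \<le> B"
  shows "norm (f t - f 0) \<le> t * B"
proof -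
  have "norm (f t - f 0) \<le> B * norm (t - 0)"
  proof (rule differentiable_bound[OF convex_real_interval(5)])
    fix s assume "s \<in> {0..t}"
    from f'[OF this] show "(f has_derivative (\<lambda>h. h *\<^sub>R f' s)) (at s within {0..t})"
      by (simp add: has_vector_derivative_def)
    show "onorm (\<lambda>h. h *\<^sub>R f' s) \<le> B"
      using B[OF \<open>s \<in> {0..t}\<close>] by (intro onorm_le) (simp add: mult.commute[of B] mult_left_mono)
  qed (use assms(1) in auto)
  then show ?thesis using assms(1) by (simp add: mult.commute)
qed

lemma geometric_inverse:
  fixes x :: "'a::{real_normed_algebra_1, banach}"
  assumes "norm x < 1"
  shows "(\<Sum>n. x ^ n) * (1 - x) = 1" "(1 - x) * (\<Sum>n. x ^ n) = 1"
proof -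
  have s: "summable (\<lambda>n. x ^ n)"
    by (rule complete_algebra_summable_geometric[OF assms])
  have "(\<Sum>n. x ^ n) - (\<Sum>n. x ^ Suc n) = 1"
    using suminf_split_head[OF s] by simp
  moreover have "(\<Sum>n. x ^ Suc n) = (\<Sum>n. x ^ n) * x"
    using suminf_mult2[OF s, of x] by (simp add: power_commutes)
  moreover have "(\<Sum>n. x ^ Suc n) = x * (\<Sum>n. x ^ n)"
    using suminf_mult[OF s, of x] by simp
  ultimately show "(\<Sum>n. x ^ n) * (1 - x) = 1" "(1 - x) * (\<Sum>n. x ^ n) = 1"
    by (simp_all add: algebra_simps)
qed

definition self_adjoint :: "'h::real_inner endo \<Rightarrow> bool" where
  "self_adjoint S \<longleftrightarrow> (\<forall>x y. inner (app S x) y = inner x (app S y))"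

lemma self_adjointD: "self_adjoint S \<Longrightarrow> inner (app S x) y = inner x (app S y)"
  by (simp add: self_adjoint_def)

lemma self_adjoint_one: "self_adjoint 1"
  by (simp add: self_adjoint_def)

lemma self_adjoint_scaleR: "self_adjoint S \<Longrightarrow> self_adjoint (c *\<^sub>R S)"
  by (simp add: self_adjoint_def app.scaleR_left)

lemma self_adjoint_diff: "self_adjoint S \<Longrightarrow> self_adjoint T \<Longrightarrow> self_adjoint (S - T)"
  by (simp add: self_adjoint_def app.diff_left inner_diff_left inner_diff_right)

lemma self_adjoint_power: "self_adjoint S \<Longrightarrow> self_adjoint (S ^ n)"
proof (induction n)
  case (Suc n)
  then show ?case
    unfolding self_adjoint_def power_Suc
    by (metis app_mult power_commutes power_Suc)
qed (simp add: self_adjoint_one)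

lemma self_adjoint_exp:
  fixes S :: "'h::{real_inner, banach, perfect_space} endo"
  assumes "self_adjoint S"
  shows "self_adjoint (exp S)"
  unfolding self_adjoint_def
proof (intro allI)
  fix x y
  have *: "(\<lambda>n. app (S ^ n /\<^sub>R fact n) z) sums app (exp S) z" for z
    by (intro bounded_linear.sums[OF app.bounded_linear_left] exp_converges)
  have "(\<lambda>n. inner (app (S ^ n /\<^sub>R fact n) x) y) sums inner (app (exp S) x) y"
    by (intro bounded_linear.sums[OF bounded_linear_inner_left] *)
  moreover have "(\<lambda>n. inner x (app (S ^ n /\<^sub>R fact n) y)) sums inner x (app (exp S) y)"
    by (intro bounded_linear.sums[OF bounded_linear_inner_right] *)
  moreover have "self_adjoint (S ^ n /\<^sub>R fact n)" for n
    using assms by (intro self_adjoint_scaleR self_adjoint_power)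
  ultimately show "inner (app (exp S) x) y = inner x (app (exp S) y)"
    by (simp add: self_adjointD sums_iff)
qed

lemma convergent_app_dense:
  fixes B :: "nat \<Rightarrow> 'h::banach endo"
  assumes "\<And>k. norm (B k) \<le> 1" "closure W = UNIV"
    and "\<And>x. x \<in> W \<Longrightarrow> convergent (\<lambda>k. app (B k) x)"
  shows "convergent (\<lambda>k. app (B k) x)"
proof -
  have "Cauchy (\<lambda>k. app (B k) x)"
    unfolding Cauchy_iff
  proof (intro allI impI)
    fix e :: real assume "0 < e"
    then obtain w where w: "w \<in> W" "dist w x < e / 3"
      using assms(2) closure_approachable[of x W] by (metis UNIV_I zero_less_divide_iff zero_less_numeral)
    with assms(3) have "Cauchy (\<lambda>k. app (B k) w)"
      by (simp add: convergent_Cauchy)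
    with \<open>0 < e\<close> obtain M where M: "\<And>m n. m \<ge> M \<Longrightarrow> n \<ge> M \<Longrightarrow> norm (app (B m) w - app (B n) w) < e / 3"
      unfolding Cauchy_iff by (metis zero_less_divide_iff zero_less_numeral)
    show "\<exists>M. \<forall>m\<ge>M. \<forall>n\<ge>M. norm (app (B m) x - app (B n) x) < e"
    proof (intro exI[of _ M] allI impI)
      fix m n assume mn: "M \<le> m" "M \<le> n"
      have *: "norm (app (B k) x - app (B k) w) < e / 3" for k
        using norm_app_le[OF assms(1), of k "x - w"] w(2)
        by (simp add: app.diff_right dist_norm norm_minus_commute)
      show "norm (app (B m) x - app (B n) x) < e"
        using *[of m] *[of n] M[OF mn] by norm
    qed
  qed
  then show ?thesis by (rule Cauchy_convergent)
qed

lemma tendsto_app_contraction: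
  fixes B :: "nat \<Rightarrow> 'h::banach endo"
  assumes "\<And>k. norm (B k) \<le> 1" "(\<lambda>k. app (B k) x) \<longlonglongrightarrow> y" "X \<longlonglongrightarrow> x"
  shows "(\<lambda>k. app (B k) (X k)) \<longlonglongrightarrow> y"
proof -
  have "(\<lambda>k. norm (X k - x)) \<longlonglongrightarrow> 0"
    using assms(3) by (simp add: tendsto_norm_zero_iff LIM_zero_iff)
  then have "(\<lambda>k. app (B k) (X k - x)) \<longlonglongrightarrow> 0"
    by (rule Lim_null_comparison[rotated]) (simp add: norm_app_le[OF assms(1)])
  from tendsto_add[OF this assms(2)] show ?thesis
    by (simp add: app.diff_right)
qed

text \<open>Meant for \<open>q = pos_mass\<close>, the integral of the positive part:
  \<open>pos_mass (- x) = 0\<close> expresses positivity and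
  \<open>pos_mass x + pos_mass (- x)\<close> is the L1 norm, so bounding this one functional
  preserves both. Closed sublevel sets carry the bound from the partial sums to the limit.\<close>

lemma sublinear_series_bound:
  fixes q :: "'h::real_normed_vector \<Rightarrow> ennreal" and S T :: "'h endo"
  assumes q_add: "\<And>x y. q (x + y) \<le> q x + q y"
    and q_scale: "\<And>c x. 0 \<le> c \<Longrightarrow> q (c *\<^sub>R x) \<le> ennreal c * q x"
    and q_closed: "\<And>r. closed {x. q x \<le> r}"
    and V: "(\<lambda>n. app (V n) x) sums y"
    and b: "\<And>n. 0 \<le> b n" "b sums m" "\<And>n. q (app (V n) x) \<le> ennreal (b n) * q x"
  shows "q y \<le> ennreal m * q x"
proof -
  have q0: "q 0 = 0"
    using q_scale[of 0 0] by simp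
  have "q (\<Sum>i<n. app (V i) x) \<le> ennreal (\<Sum>i<n. b i) * q x" for n
  proof (induction n)
    case (Suc n)
    have "q (\<Sum>i<Suc n. app (V i) x) \<le> q (\<Sum>i<n. app (V i) x) + q (app (V n) x)"
      by (simp add: q_add)
    also have "\<dots> \<le> ennreal (\<Sum>i<n. b i) * q x + ennreal (b n) * q x"
      by (intro add_mono Suc b)
    also have "\<dots> = ennreal (\<Sum>i<Suc n. b i) * q x"
      using b(1) by (simp add: distrib_right sum_nonneg)
    finally show ?case .
  qed (simp add: q0)
  also have "ennreal (\<Sum>i<n. b i) * q x \<le> ennreal m * q x" for n
    using b(1,2) sum_le_suminf[of b "{..<n}"]
    by (intro mult_right_mono ennreal_leI) (auto simp: sums_iff)
  finally have all: "\<forall>n. (\<Sum>i<n. app (V i) x) \<in> {z. q z \<le> ennreal m * q x}"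
    by auto
  have lim: "(\<lambda>n. \<Sum>i<n. app (V i) x) \<longlonglongrightarrow> y"
    using V by (simp add: sums_def)
  have "y \<in> {z. q z \<le> ennreal m * q x}"
    using all by (intro closed_sequentially[OF q_closed _ lim]) auto
  then show ?thesis by simp
qed

lemma sublinear_power_bound:
  fixes q :: "'h::{real_normed_vector, perfect_space} \<Rightarrow> ennreal"
  assumes "\<And>x. q (app S x) \<le> ennreal l * q x" "0 \<le> l"
  shows "q (app (S ^ n) x) \<le> ennreal (l ^ n) * q x"
proof (induction n)
  case (Suc n)
  have "q (app (S ^ Suc n) x) \<le> ennreal l * q (app (S ^ n) x)"
    using assms(1) by (simp add: app_mult)
  also have "\<dots> \<le> ennreal l * (ennreal (l ^ n) * q x)"
    by (intro mult_left_mono Suc) simp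
  finally show ?case
    using assms(2) by (simp add: ennreal_mult mult.assoc)
qed simp

text \<open>\<open>N k\<close> will be convolution with a truncated jump kernel and
  \<open>\<Lambda> k\<close> its total mass, so that \<open>N k - \<Lambda> k\<close> generates a
  compound Poisson process. \<open>mono\<close> says that the quadratic forms grow as the truncation
  is removed; \<open>W\<close> is a common dense set on which the generators converge.\<close>

locale approximating_generators =
  fixes N :: "nat \<Rightarrow> 'h::{real_inner, banach, perfect_space} endo"
    and \<Lambda> :: "nat \<Rightarrow> real" and W :: "'h set"
  assumes comm: "N j * N k = N k * N j"
    and sym: "self_adjoint (N k)"
    and norm_N: "norm (N k) \<le> \<Lambda> k"
    and mono: "j \<le> k \<Longrightarrow> \<Lambda> j * inner x x - inner (app (N j) x) x \<le> \<Lambda> k * inner x x - inner (app (N k) x) x"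
    and dense: "closure W = UNIV"
    and conv: "x \<in> W \<Longrightarrow> convergent (\<lambda>k. app (N k) x - \<Lambda> k *\<^sub>R x)"
begin

definition A :: "nat \<Rightarrow> 'h endo" where "A k = N k - \<Lambda> k *\<^sub>R 1"

lemma \<Lambda>_nonneg: "0 \<le> \<Lambda> k"
  using norm_N[of k] norm_ge_zero[of "N k"] by linarith

lemma app_A: "app (A k) x = app (N k) x - \<Lambda> k *\<^sub>R x"
  by (simp add: A_def app.diff_left app.scaleR_left)

lemma convergent_A: "x \<in> W \<Longrightarrow> convergent (\<lambda>k. app (A k) x)"
  using conv by (simp add: app_A)

lemma A_comm: "A j * A k = A k * A j"
  by (simp add: A_def algebra_simps comm)

lemma A_sym: "self_adjoint (A k)"
  unfolding A_def by (intro self_adjoint_diff self_adjoint_scaleR self_adjoint_one sym)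

definition X :: "nat \<Rightarrow> real \<Rightarrow> 'h endo" where "X k t = exp (t *\<^sub>R A k)"

text \<open>Splitting off the scalar part leaves a power series in \<open>N k\<close> with
  nonnegative coefficients. Contractivity, and later positivity, is read off from this
  product.\<close>

lemma X_split: "X k t = exp (- (t * \<Lambda> k)) *\<^sub>R exp (t *\<^sub>R N k)"
proof -
  have "t *\<^sub>R A k = of_real (- (t * \<Lambda> k)) + t *\<^sub>R N k"
    by (simp add: A_def of_real_def algebra_simps)
  moreover have "of_real (- (t * \<Lambda> k)) * t *\<^sub>R N k = t *\<^sub>R N k * of_real (- (t * \<Lambda> k))"
    by (simp add: of_real_def)
  ultimately show ?thesis
    unfolding X_def by (simp only: exp_add_commuting exp_of_real) (simp add: of_real_def)
qed

lemma norm_X: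
  assumes "0 \<le> t"
  shows "norm (X k t) \<le> 1"
proof -
  have "norm (exp (t *\<^sub>R N k)) \<le> exp (norm (t *\<^sub>R N k))"
    by (rule norm_exp)
  also have "\<dots> \<le> exp (t * \<Lambda> k)"
    using norm_N assms by (simp add: mult_left_mono)
  finally have "norm (X k t) \<le> exp (- (t * \<Lambda> k)) * exp (t * \<Lambda> k)"
    by (simp add: X_split)
  then show ?thesis by (simp flip: exp_add)
qed

lemma X_add: "X k (s + t) = X k s * X k t"
  unfolding X_def by (subst exp_add_commuting[symmetric]) (auto simp: algebra_simps)

lemma X_sym: "self_adjoint (X k t)"
  unfolding X_def by (intro self_adjoint_exp self_adjoint_scaleR A_sym)

lemma X_derivative:
  "((\<lambda>s. app (X k s) x) has_vector_derivative app (X k s) (app (A k) x)) (at s within S)"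
  unfolding X_def app_mult[symmetric]
  by (intro bounded_linear.has_vector_derivative[OF app.bounded_linear_left]
      exp_scaleR_has_vector_derivative_right)

lemma X_at_0: "X k 0 = 1"
  by (simp add: X_def)

lemma norm_X_diff_id:
  assumes "0 \<le> t"
  shows "norm (app (X k t) x - x) \<le> t * norm (app (A k) x)"
  using norm_vector_derivative_bound[OF assms X_derivative, of k x "norm (app (A k) x)"]
    norm_app_le[OF norm_X] by (simp add: X_at_0)

text \<open>
  Commutativity gives
  \<open>e\<^bsup>tA\<^esup> - e\<^bsup>tB\<^esup> = \<integral>\<^sub>0\<^sup>t e\<^bsup>(t-s)B\<^esup> e\<^bsup>sA\<^esup> (A - B) ds\<close> with contractive factors.
\<close>

lemma norm_X_diff:
  assumes "0 \<le> t"
  shows "norm (app (X j t) x - app (X k t) x) \<le> t * norm (app (A j) x - app (A k) x)"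
proof -
  define B where "B = A j - A k"
  define f where "f s = app (X k t * exp (s *\<^sub>R B)) x" for s
  have BA: "B * A i = A i * B" for i
    by (simp add: B_def algebra_simps A_comm)
  have eq: "X k t * exp (s *\<^sub>R B) = X k (t - s) * X j s" for s
    unfolding X_def B_def
    by (subst (1 2) exp_add_commuting[symmetric]) (simp_all add: algebra_simps A_comm)
  have "norm (f t - f 0) \<le> t * norm (app B x)"
  proof (rule norm_vector_derivative_bound[OF assms])
    fix s assume s: "s \<in> {0..t}"
    show "(f has_vector_derivative app (X k t * (exp (s *\<^sub>R B) * B)) x) (at s within {0..t})"
      unfolding f_def
      by (intro bounded_linear.has_vector_derivative[OF app.bounded_linear_left]
          bounded_linear.has_vector_derivative[OF bounded_linear_mult_right]
          exp_scaleR_has_vector_derivative_right)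
    have "app (X k t * (exp (s *\<^sub>R B) * B)) x = app (X k (t - s)) (app (X j s) (app B x))"
      by (simp add: eq app_mult flip: mult.assoc)
    also have "norm \<dots> \<le> norm (app (X j s) (app B x))"
      using s by (intro norm_app_le norm_X) auto
    also have "\<dots> \<le> norm (app B x)"
      using s by (intro norm_app_le norm_X) auto
    finally show "norm (app (X k t * (exp (s *\<^sub>R B) * B)) x) \<le> norm (app B x)" .
  qed
  moreover have "f t = app (X j t) x" "f 0 = app (X k t) x"
    unfolding f_def eq by (simp_all add: X_at_0)
  ultimately show ?thesis
    by (simp add: B_def app.diff_left)
qed

definition P :: "real \<Rightarrow> 'h \<Rightarrow> 'h" where
  "P t x = lim (\<lambda>k. app (X k t) x)"

lemma P_LIMSEQ:
  assumes "0 \<le> t"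
  shows "(\<lambda>k. app (X k t) x) \<longlonglongrightarrow> P t x"
proof -
  have "convergent (\<lambda>k. app (X k t) x)"
  proof (rule convergent_app_dense[OF norm_X[OF assms] dense])
    fix w assume "w \<in> W"
    then have "Cauchy (\<lambda>k. app (A k) w)"
      by (intro convergent_Cauchy convergent_A)
    have "Cauchy (\<lambda>k. app (X k t) w)"
      unfolding Cauchy_iff
    proof (intro allI impI)
      fix e :: real assume "0 < e"
      then have "0 < e / (t + 1)" using assms by simp
      with \<open>Cauchy (\<lambda>k. app (A k) w)\<close> obtain M where M:
        "\<And>m n. m \<ge> M \<Longrightarrow> n \<ge> M \<Longrightarrow> norm (app (A m) w - app (A n) w) < e / (t + 1)"
        unfolding Cauchy_iff by metis
      show "\<exists>M. \<forall>m\<ge>M. \<forall>n\<ge>M. norm (app (X m t) w - app (X n t) w) < e"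
      proof (intro exI[of _ M] allI impI)
        fix m n assume "M \<le> m" "M \<le> n"
        have "norm (app (X m t) w - app (X n t) w) \<le> t * norm (app (A m) w - app (A n) w)"
          by (rule norm_X_diff[OF assms])
        also have "\<dots> \<le> t * (e / (t + 1))"
          using M[OF \<open>M \<le> m\<close> \<open>M \<le> n\<close>] assms by (intro mult_left_mono) auto
        also have "\<dots> < e"
          using \<open>0 < e\<close> assms by (simp add: field_simps)
        finally show "norm (app (X m t) w - app (X n t) w) < e" .
      qed
    qed
    then show "convergent (\<lambda>k. app (X k t) w)"
      by (rule Cauchy_convergent)
  qed
  then show ?thesis
    unfolding P_def by (simp add: convergent_LIMSEQ_iff)
qed

lemma bound_A:
  assumes "w \<in> W"
  obtains C where "0 < C" "\<And>k. norm (app (A k) w) \<le> C"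
  using convergent_imp_Bseq[OF convergent_A[OF assms]] by (auto elim: BseqE)

lemma W_approx:
  assumes "0 < e"
  obtains w where "w \<in> W" "norm (x - w) < e"
  using dense closure_approachable[of x W] assms by (metis UNIV_I dist_norm norm_minus_commute)

lemma contraction_semigroup_P: "contraction_semigroup P"
proof (rule contraction_semigroup.intro)
  fix x y :: 'h and s t :: real
  show "P 0 x = x"
    using LIMSEQ_unique[OF P_LIMSEQ[of 0 x]] by (simp add: X_at_0)
  show norm_P: "norm (P t x) \<le> norm x" if "0 \<le> t" for t x
    using that
    by (intro LIMSEQ_le_const2[OF tendsto_norm[OF P_LIMSEQ]]) (auto intro: norm_app_le norm_X)
  show lin: "linear (P t)" if "0 \<le> t" for t
  proof (rule linearI)
    fix x y :: 'h and c :: real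
    show "P t (x + y) = P t x + P t y"
      using LIMSEQ_unique[OF P_LIMSEQ[OF that, of "x + y"]] tendsto_add[OF P_LIMSEQ[OF that] P_LIMSEQ[OF that]]
      by (simp add: app.add_right)
    show "P t (c *\<^sub>R x) = c *\<^sub>R P t x"
      using LIMSEQ_unique[OF P_LIMSEQ[OF that, of "c *\<^sub>R x"]] tendsto_scaleR[OF tendsto_const P_LIMSEQ[OF that]]
      by (simp add: app.scaleR_right)
  qed
  show "P (s + t) x = P s (P t x)" if "0 \<le> s" "0 \<le> t"
  proof (rule LIMSEQ_unique[OF P_LIMSEQ])
    show "(\<lambda>k. app (X k (s + t)) x) \<longlonglongrightarrow> P s (P t x)"
      unfolding X_add app_mult
      by (rule tendsto_app_contraction[OF norm_X P_LIMSEQ P_LIMSEQ]) (use that in auto)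
  qed (use that in auto)
  show "((\<lambda>t. P t x) \<longlongrightarrow> x) (at_right 0)"
  proof (rule tendstoI)
    fix e :: real assume "0 < e"
    then have "0 < e / 3" by simp
    then obtain w where w: "w \<in> W" "norm (x - w) < e / 3" using W_approx by metis
    obtain C where C: "0 < C" "\<And>k. norm (app (A k) w) \<le> C" using bound_A[OF w(1)] by metis
    \<comment> \<open>\<open>X k t\<close> moves w by at most \<open>t * C\<close> for every k, so
      the limit does too; the other two thirds come from replacing x by w.\<close>
    have "dist (P t x) x < e" if t: "0 < t" "t < e / (3 * C)" for t
    proof -
      have "norm (app (X k t) w - w) \<le> t * C" for k
        using norm_X_diff_id[of t k w] C(2)[of k] t(1)
        by (meson less_imp_le mult_left_mono order_trans)
      then have "norm (P t w - w) \<le> t * C"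
        using t(1) by (intro LIMSEQ_le_const2[OF tendsto_norm[OF tendsto_diff[OF P_LIMSEQ tendsto_const]]]) auto
      moreover have "t * C < e / 3"
        using t C(1) by (simp add: field_simps)
      moreover have "norm (P t x - P t w) < e / 3"
        using norm_P[of t "x - w"] w(2) t(1) linear_diff[OF lin, of t x w] by simp
      moreover have "norm (P t x - x) \<le> norm (P t x - P t w) + norm (P t w - w) + norm (x - w)"
        by norm
      ultimately show ?thesis
        using w(2) unfolding dist_norm by linarith
    qed
    moreover have "0 < e / (3 * C)" using \<open>0 < e\<close> C(1) by simp
    ultimately show "\<forall>\<^sub>F t in at_right 0. dist (P t x) x < e"
      unfolding eventually_at_right_field by auto
  qed
qed

sublocale P: contraction_semigroup P
  by (rule contraction_semigroup_P)

lemma P_sym: "0 \<le> t \<Longrightarrow> inner (P t x) y = inner x (P t y)"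
  by (rule LIMSEQ_unique[OF tendsto_inner[OF P_LIMSEQ tendsto_const]])
    (auto simp: self_adjointD[OF X_sym] intro!: tendsto_inner P_LIMSEQ)

text \<open>The inverse of \<open>1 - A k\<close> as a Neumann series: \<open>1 - A k\<close> is
  \<open>1 + \<Lambda> k\<close> times \<open>1 - N k / (1 + \<Lambda> k)\<close>, and the
  subtracted operator has norm below 1. As for \<open>X k t\<close>, all coefficients are
  nonnegative.\<close>

definition Rk :: "nat \<Rightarrow> 'h endo" where
  "Rk k = (1 / (1 + \<Lambda> k)) *\<^sub>R (\<Sum>n. ((1 / (1 + \<Lambda> k)) *\<^sub>R N k) ^ n)"

lemma norm_scaled_N: "norm ((1 / (1 + \<Lambda> k)) *\<^sub>R N k) < 1"
  using norm_N[of k] \<Lambda>_nonneg[of k] by (simp add: field_simps)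

lemma one_minus_A: "1 - A k = (1 + \<Lambda> k) *\<^sub>R (1 - (1 / (1 + \<Lambda> k)) *\<^sub>R N k)"
  using \<Lambda>_nonneg[of k] by (simp add: A_def algebra_simps)

lemma Rk_inverse: "Rk k * (1 - A k) = 1" "(1 - A k) * Rk k = 1"
  unfolding one_minus_A Rk_def
  using \<Lambda>_nonneg[of k] by (simp_all add: geometric_inverse[OF norm_scaled_N])

lemma Rk_commutes:
  assumes "Y * A k = A k * Y"
  shows "Rk k * Y = Y * Rk k"
proof -
  have *: "Y * (1 - A k) = (1 - A k) * Y"
    using assms by (simp add: algebra_simps)
  have "Rk k * Y = Rk k * (Y * (1 - A k)) * Rk k"
    using Rk_inverse(2)[of k] by (simp add: mult.assoc)
  also have "\<dots> = (Rk k * (1 - A k)) * Y * Rk k"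
    unfolding * by (simp add: mult.assoc)
  finally show ?thesis by (simp add: Rk_inverse)
qed

lemma A_Rk: "app (A k) (app (Rk k) x) = app (Rk k) x - x"
proof -
  have "app ((1 - A k) * Rk k) x = x" by (simp add: Rk_inverse)
  then show ?thesis by (simp add: app_mult app.diff_left algebra_simps)
qed

lemma A_nonpos: "inner (app (A k) x) x \<le> 0"
proof -
  have "inner (app (N k) x) x \<le> norm (app (N k) x) * norm x"
    by (rule norm_cauchy_schwarz)
  also have "\<dots> \<le> \<Lambda> k * norm x * norm x"
    using norm_app[of "N k" x] norm_N[of k]
    by (meson mult_right_mono norm_ge_zero order_trans)
  finally show ?thesis
    by (simp add: app_A inner_diff_left dot_square_norm power2_eq_square)
qed

lemma norm_Rk: "norm (Rk k) \<le> 1"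
proof (rule norm_endo_bound)
  fix x
  define y where "y = app (Rk k) x"
  have "inner y y \<le> inner x y"
    using A_nonpos[of k y] A_Rk[of k x] by (simp add: y_def inner_diff_left)
  also have "\<dots> \<le> norm x * norm y"
    by (rule norm_cauchy_schwarz)
  finally have "norm y * norm y \<le> norm x * norm y"
    by (simp add: dot_square_norm power2_eq_square)
  then show "norm (app (Rk k) x) \<le> 1 * norm x"
    unfolding y_def[symmetric] by (cases "y = 0") auto
qed simp

definition R :: "'h \<Rightarrow> 'h" where
  "R x = lim (\<lambda>k. app (Rk k) x)"

lemma R_LIMSEQ: "(\<lambda>k. app (Rk k) x) \<longlonglongrightarrow> R x"
proof -
  have "convergent (\<lambda>k. app (Rk k) x)"
  proof (rule convergent_app_dense[OF norm_Rk dense])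
    fix w assume "w \<in> W"
    then have c: "Cauchy (\<lambda>k. app (A k) w)"
      by (intro convergent_Cauchy convergent_A)
    \<comment> \<open>Resolvent identity. Commuting \<open>A j - A k\<close> past the resolvent
      places it directly on w, where the approximants converge.\<close>
    have *: "norm (app (Rk j) w - app (Rk k) w) \<le> norm (app (A j) w - app (A k) w)" for j k
    proof -
      have "Rk j - Rk k = Rk j * ((1 - A k) * Rk k) - (Rk j * (1 - A j)) * Rk k"
        by (simp add: Rk_inverse)
      also have "\<dots> = Rk j * ((A j - A k) * Rk k)"
        by (simp add: algebra_simps)
      also have "(A j - A k) * Rk k = Rk k * (A j - A k)"
        by (rule Rk_commutes[symmetric]) (simp add: algebra_simps A_comm)
      finally have "app (Rk j) w - app (Rk k) w = app (Rk j) (app (Rk k) (app (A j) w - app (A k) w))"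
        by (simp add: app_mult flip: app.diff_left)
      also have "norm \<dots> \<le> norm (app (Rk k) (app (A j) w - app (A k) w))"
        by (rule norm_app_le[OF norm_Rk])
      also have "\<dots> \<le> norm (app (A j) w - app (A k) w)"
        by (rule norm_app_le[OF norm_Rk])
      finally show ?thesis .
    qed
    have "Cauchy (\<lambda>k. app (Rk k) w)"
      using c unfolding Cauchy_iff by (meson "*" order_le_less_trans)
    then show "convergent (\<lambda>k. app (Rk k) w)"
      by (rule Cauchy_convergent)
  qed
  then show ?thesis
    unfolding R_def by (simp add: convergent_LIMSEQ_iff)
qed

lemma norm_R: "norm (R x) \<le> norm x"
  by (rule LIMSEQ_le_const2[OF tendsto_norm[OF R_LIMSEQ]]) (auto intro: norm_app_le norm_Rk)

text \<open>For fixed k the path \<open>X k s g\<close> with \<open>g = Rk k f\<close> has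
  derivative \<open>g - f\<close> at 0. Its distance from the linearization is bounded uniformly in
  k: \<open>g - f\<close> tends to \<open>w\<close>, \<open>w\<close> is close to some v in
  \<open>W\<close>, and \<open>X k s\<close> moves v by at most \<open>s * C\<close>.\<close>

lemma R_gen: "(R f, R f - f) \<in> gen P"
proof -
  define w where "w = R f - f"
  have est: "norm (P t (R f) - R f - t *\<^sub>R w) \<le> t * (2 * norm (w - v) + t * C)"
    if "0 \<le> t" and C: "\<And>k. norm (app (A k) v) \<le> C" for t v C
  proof (rule LIMSEQ_le[OF tendsto_norm])
    show "(\<lambda>k. app (X k t) (app (Rk k) f) - app (Rk k) f - t *\<^sub>R (app (Rk k) f - f))
        \<longlonglongrightarrow> P t (R f) - R f - t *\<^sub>R w"
      unfolding w_def
      by (intro tendsto_intros R_LIMSEQ tendsto_app_contraction[OF norm_X[OF that(1)] P_LIMSEQ[OF that(1)]])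
    show "(\<lambda>k. t * (2 * norm (app (Rk k) f - f - v) + t * C)) \<longlonglongrightarrow> t * (2 * norm (w - v) + t * C)"
      unfolding w_def by (intro tendsto_intros R_LIMSEQ)
    show "\<exists>K. \<forall>k\<ge>K. norm (app (X k t) (app (Rk k) f) - app (Rk k) f - t *\<^sub>R (app (Rk k) f - f))
        \<le> t * (2 * norm (app (Rk k) f - f - v) + t * C)"
    proof (intro exI allI impI)
      fix k :: nat
      define g where "g = app (Rk k) f"
      define u where "u = g - f"
      have u: "app (A k) g = u" by (simp add: g_def u_def A_Rk)
      have bd: "norm (app (X k s) u - u) \<le> 2 * norm (u - v) + t * C" if "s \<in> {0..t}" for s
      proof -
        have "norm (app (X k s) v - v) \<le> s * norm (app (A k) v)"
          using that by (intro norm_X_diff_id) auto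
        also have "\<dots> \<le> t * C"
          using that C[of k] by (intro mult_mono) auto
        finally have 1: "norm (app (X k s) v - v) \<le> t * C" .
        have "norm (app (X k s) (u - v)) \<le> norm (u - v)"
          using that by (intro norm_app_le norm_X) auto
        then have 2: "norm (app (X k s) u - app (X k s) v) \<le> norm (u - v)"
          by (simp add: app.diff_right)
        have "norm (app (X k s) u - u) \<le> norm (app (X k s) u - app (X k s) v) + norm (app (X k s) v - v) + norm (u - v)"
          by norm
        with 1 2 show ?thesis by linarith
      qed
      have "norm (app (X k t) g - app (X k 0) g - (t - 0) *\<^sub>R app (X k 0) u)
          \<le> norm (t - 0) * (2 * norm (u - v) + t * C)"
      proof (rule vector_differentiable_bound_linearization[where S = "{0..t}"])
        show "((\<lambda>s. app (X k s) g) has_vector_derivative app (X k s) u) (at s within {0..t})" for s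
          unfolding u[symmetric] by (rule X_derivative)
        show "closed_segment 0 t \<subseteq> {0..t}"
          using \<open>0 \<le> t\<close> by (simp add: closed_segment_eq_real_ivl)
        show "norm (app (X k s) u - app (X k 0) u) \<le> 2 * norm (u - v) + t * C" if "s \<in> {0..t}" for s
          using bd[OF that] by (simp add: X_at_0)
      qed (use \<open>0 \<le> t\<close> in auto)
      then show "norm (app (X k t) (app (Rk k) f) - app (Rk k) f - t *\<^sub>R (app (Rk k) f - f))
        \<le> t * (2 * norm (app (Rk k) f - f - v) + t * C)"
        using \<open>0 \<le> t\<close> by (simp add: X_at_0 g_def u_def)
    qed
  qed
  have "((\<lambda>t. (P t (R f) - R f) /\<^sub>R t) \<longlongrightarrow> w) (at_right 0)"
  proof (rule tendstoI)
    fix e :: real assume "0 < e"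
    then have "0 < e / 4" by simp
    then obtain v where v: "v \<in> W" "norm (w - v) < e / 4" using W_approx by metis
    obtain C where C: "0 < C" "\<And>k. norm (app (A k) v) \<le> C" using bound_A[OF v(1)] by metis
    have "dist ((P t (R f) - R f) /\<^sub>R t) w < e" if t: "0 < t" "t < e / (2 * C)" for t
    proof -
      have "(P t (R f) - R f) /\<^sub>R t - w = (P t (R f) - R f - t *\<^sub>R w) /\<^sub>R t"
        using t by (simp add: algebra_simps)
      then have "norm ((P t (R f) - R f) /\<^sub>R t - w) = norm ((P t (R f) - R f - t *\<^sub>R w) /\<^sub>R t)"
        by (rule arg_cong)
      also have "\<dots> = norm (P t (R f) - R f - t *\<^sub>R w) / t"
        unfolding norm_scaleR using t(1) by (simp add: divide_inverse)
      also have "\<dots> \<le> 2 * norm (w - v) + t * C"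
        by (subst pos_divide_le_eq[OF t(1)], subst mult.commute, rule est) (use t C in auto)
      finally have "norm ((P t (R f) - R f) /\<^sub>R t - w) \<le> 2 * norm (w - v) + t * C" .
      moreover have "t * C < e / 2"
        using t C(1) by (simp add: field_simps)
      ultimately show ?thesis
        using v(2) by (simp add: dist_norm)
    qed
    moreover have "0 < e / (2 * C)" using \<open>0 < e\<close> C(1) by simp
    ultimately show "\<forall>\<^sub>F t in at_right 0. dist ((P t (R f) - R f) /\<^sub>R t) w < e"
      unfolding eventually_at_right_field by auto
  qed
  then show ?thesis by (simp add: gen_def w_def)
qed

text \<open>Both \<open>X k t\<close> and \<open>Rk k\<close> are multiples of series in
  \<open>N k\<close> with nonnegative coefficients. Replacing \<open>N k\<close> by its bound
  \<open>\<Lambda> k\<close> gives \<open>exp (t * \<Lambda> k)\<close> and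
  \<open>1 / (1 - c * \<Lambda> k)\<close>, which the scalar prefactors cancel exactly; hence the
  constant 1.\<close>

lemma P_R_sublinear:
  fixes q :: "'h \<Rightarrow> ennreal"
  assumes q_add: "\<And>x y. q (x + y) \<le> q x + q y"
    and q_scale: "\<And>c x. 0 \<le> c \<Longrightarrow> q (c *\<^sub>R x) \<le> ennreal c * q x"
    and q_closed: "\<And>r. closed {x. q x \<le> r}"
    and q_N: "\<And>k x. q (app (N k) x) \<le> ennreal (\<Lambda> k) * q x"
  shows "0 \<le> t \<Longrightarrow> q (P t x) \<le> q x" "q (R x) \<le> q x"
proof -
  note bound = sublinear_series_bound[of q, OF q_add q_scale q_closed]
  have scaled: "q (app (c *\<^sub>R N k) x) \<le> ennreal (c * \<Lambda> k) * q x" if "0 \<le> c" for c k x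
  proof -
    have "q (app (c *\<^sub>R N k) x) \<le> ennreal c * q (app (N k) x)"
      using q_scale[OF that] by (simp add: app.scaleR_left)
    also have "\<dots> \<le> ennreal c * (ennreal (\<Lambda> k) * q x)"
      by (intro mult_left_mono q_N) simp
    finally show ?thesis
      using that \<Lambda>_nonneg[of k] by (simp add: ennreal_mult mult.assoc)
  qed
  have limit: "q y \<le> q x" if "\<And>k. q (Y k) \<le> q x" "Y \<longlonglongrightarrow> y" for Y y
    using closed_sequentially[OF q_closed[of "q x"], of Y y] that by auto
  have finish: "q (c *\<^sub>R z) \<le> q x" if "q z \<le> ennreal m * q x" "0 \<le> c" "0 \<le> m" "c * m = 1" for c m z
  proof -
    have "q (c *\<^sub>R z) \<le> ennreal c * (ennreal m * q x)"
      using q_scale[OF that(2), of z] that(1) by (meson mult_left_mono order_trans zero_le)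
    also have "\<dots> = q x"
      using that by (simp add: mult.assoc[symmetric] ennreal_mult[symmetric])
    finally show ?thesis .
  qed
  show "q (P t x) \<le> q x" if "0 \<le> t"
  proof (rule limit[OF _ P_LIMSEQ[OF that]])
    fix k
    have "q (app (exp (t *\<^sub>R N k)) x) \<le> ennreal (exp (t * \<Lambda> k)) * q x"
    proof (rule bound)
      show "(\<lambda>n. app ((t *\<^sub>R N k) ^ n /\<^sub>R fact n) x) sums app (exp (t *\<^sub>R N k)) x"
        by (intro bounded_linear.sums[OF app.bounded_linear_left] exp_converges)
      show "(\<lambda>n. (t * \<Lambda> k) ^ n /\<^sub>R fact n) sums exp (t * \<Lambda> k)"
        by (rule exp_converges)
      show nn: "0 \<le> (t * \<Lambda> k) ^ n /\<^sub>R fact n" for n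
        using that \<Lambda>_nonneg[of k] by simp
      fix n
      have "q (app ((t *\<^sub>R N k) ^ n /\<^sub>R fact n) x) \<le> ennreal (inverse (fact n)) * q (app ((t *\<^sub>R N k) ^ n) x)"
        unfolding app.scaleR_left by (rule q_scale) simp
      also have "\<dots> \<le> ennreal (inverse (fact n)) * (ennreal ((t * \<Lambda> k) ^ n) * q x)"
        using that \<Lambda>_nonneg[of k] by (intro mult_left_mono sublinear_power_bound scaled) auto
      also have "\<dots> = ennreal ((t * \<Lambda> k) ^ n /\<^sub>R fact n) * q x"
        using that \<Lambda>_nonneg[of k] by (simp add: ennreal_mult mult.assoc)
      finally show "q (app ((t *\<^sub>R N k) ^ n /\<^sub>R fact n) x) \<le> ennreal ((t * \<Lambda> k) ^ n /\<^sub>R fact n) * q x" .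
    qed
    then show "q (app (X k t) x) \<le> q x"
      unfolding X_split app.scaleR_left by (rule finish) (simp_all flip: exp_add)
  qed
  show "q (R x) \<le> q x"
  proof (rule limit[OF _ R_LIMSEQ])
    fix k
    define c where "c = 1 / (1 + \<Lambda> k)"
    have c: "0 < c" "c * (1 + \<Lambda> k) = 1" "c * \<Lambda> k < 1" "0 \<le> c * \<Lambda> k"
      using \<Lambda>_nonneg[of k] by (simp_all add: c_def field_simps)
    have "q (app (\<Sum>n. (c *\<^sub>R N k) ^ n) x) \<le> ennreal (1 / (1 - c * \<Lambda> k)) * q x"
    proof (rule bound)
      show "(\<lambda>n. app ((c *\<^sub>R N k) ^ n) x) sums app (\<Sum>n. (c *\<^sub>R N k) ^ n) x"
        unfolding c_def
        by (intro bounded_linear.sums[OF app.bounded_linear_left] summable_sums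
            complete_algebra_summable_geometric norm_scaled_N)
      show "(\<lambda>n. (c * \<Lambda> k) ^ n) sums (1 / (1 - c * \<Lambda> k))"
        using c by (intro geometric_sums) simp
      show "q (app ((c *\<^sub>R N k) ^ n) x) \<le> ennreal ((c * \<Lambda> k) ^ n) * q x" for n
        using c by (intro sublinear_power_bound scaled) auto
    qed (auto intro: zero_le_power[OF c(4)])
    then show "q (app (Rk k) x) \<le> q x"
      unfolding Rk_def app.scaleR_left c_def[symmetric]
      by (rule finish) (use c in \<open>auto simp: field_simps\<close>)
  qed
qed

end

section \<open>The form of the limit semigroup\<close>

lemma quadratic_nonneg_imp_discriminant:
  fixes a b d :: real
  assumes "\<And>c. 0 \<le> a + 2 * c * b + c\<^sup>2 * d" "0 \<le> d"
  shows "b\<^sup>2 \<le> a * d"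
proof (cases "d = 0")
  case True
  have "b = 0"
  proof (rule ccontr)
    assume "b \<noteq> 0"
    \<comment> \<open>For d = 0 this choice of c gives the expression the value -1.\<close>
    with assms(1)[of "- (a + 1) / (2 * b)"] True show False by (simp add: field_simps)
  qed
  with True show ?thesis by simp
next
  case False
  with assms have "0 < d" by simp
  with assms(1)[of "- b / d"] show ?thesis
    by (simp add: power2_eq_square field_simps)
qed

context approximating_generators
begin

definition F :: "nat \<Rightarrow> 'h \<Rightarrow> 'h \<Rightarrow> real" where "F k x y = - inner (app (A k) x) y"

lemma F_lincomb_left: "F k (a *\<^sub>R x + b *\<^sub>R y) z = a * F k x z + b * F k y z"
  by (simp add: F_def app.add_right app.scaleR_right inner_add_left algebra_simps)

lemma F_sym: "F k x y = F k y x"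
  using self_adjointD[OF A_sym, of k x y] by (simp add: F_def inner_commute)

lemma F_quadratic: "F k (x + c *\<^sub>R y) (x + c *\<^sub>R y) = F k x x + 2 * c * F k x y + c\<^sup>2 * F k y y"
  using F_lincomb_left[of k 1 x c y] F_sym[of k _ "x + c *\<^sub>R y"] F_sym[of k y x]
  by (simp add: algebra_simps power2_eq_square)

lemma F_nonneg: "0 \<le> F k x x"
  using A_nonpos by (simp add: F_def)

lemma F_mono: "j \<le> k \<Longrightarrow> F j x x \<le> F k x x"
  using mono[of j k x] by (simp add: F_def app_A inner_diff_left)

lemma F_polarization: "F k x y = (F k (x + y) (x + y) - F k (x - y) (x - y)) / 4"
  using F_quadratic[of k x 1 y] F_quadratic[of k x "-1" y] by simp

lemma tendsto_F: "Y \<longlonglongrightarrow> y \<Longrightarrow> (\<lambda>n. F k (Y n) z) \<longlonglongrightarrow> F k y z"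
  unfolding F_def by (intro tendsto_intros app.tendsto)

lemma tendsto_F_diag: "Y \<longlonglongrightarrow> y \<Longrightarrow> (\<lambda>n. F k (Y n) (Y n)) \<longlonglongrightarrow> F k y y"
  unfolding F_def by (intro tendsto_intros app.tendsto)

definition D :: "'h set" where "D = {x. \<exists>b. \<forall>k. F k x x \<le> b}"

text \<open>Meaningful on \<open>D\<close> only: there the diagonal values converge by monotonicity
  and the others by polarization.\<close>

definition E :: "'h \<Rightarrow> 'h \<Rightarrow> real" where "E x y = lim (\<lambda>k. F k x y)"

lemma in_D: "x \<in> D \<longleftrightarrow> (\<exists>b. \<forall>k. F k x x \<le> b)"
  by (simp add: D_def)

lemma D_scale: "x \<in> D \<Longrightarrow> c *\<^sub>R x \<in> D"
proof -
  assume "x \<in> D"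
  then obtain b where "\<And>k. F k x x \<le> b" by (auto simp: in_D)
  moreover have "F k (c *\<^sub>R x) (c *\<^sub>R x) = c\<^sup>2 * F k x x" for k
    by (simp add: F_def app.scaleR_right power2_eq_square)
  ultimately show ?thesis
    unfolding in_D by (intro exI[of _ "c\<^sup>2 * b"]) (simp add: mult_left_mono)
qed

lemma D_add:
  assumes "x \<in> D" "y \<in> D"
  shows "x + y \<in> D"
proof -
  obtain a b where ab: "\<And>k. F k x x \<le> a" "\<And>k. F k y y \<le> b"
    using assms by (auto simp: in_D)
  have "F k (x + y) (x + y) \<le> 2 * a + 2 * b" for k
    using F_quadratic[of k x 1 y] F_quadratic[of k x "-1" y] F_nonneg[of k "x - y"] ab[of k]
    by simp
  then show ?thesis unfolding in_D by blast
qed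

lemma D_lincomb: "x \<in> D \<Longrightarrow> y \<in> D \<Longrightarrow> a *\<^sub>R x + b *\<^sub>R y \<in> D"
  by (intro D_add D_scale)

lemma D_diff: "x \<in> D \<Longrightarrow> y \<in> D \<Longrightarrow> x - y \<in> D"
  using D_lincomb[of x y 1 "-1"] by simp

lemma E_diag_LIMSEQ:
  assumes "x \<in> D"
  shows "(\<lambda>k. F k x x) \<longlonglongrightarrow> E x x"
proof -
  obtain b where b: "\<And>k. F k x x \<le> b" using assms by (auto simp: in_D)
  have "incseq (\<lambda>k. F k x x)"
    by (simp add: incseq_def F_mono)
  with b have "convergent (\<lambda>k. F k x x)"
    by (metis convergentI incseq_convergent)
  then show ?thesis by (simp add: E_def convergent_LIMSEQ_iff)
qed

lemma E_LIMSEQ: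
  assumes "x \<in> D" "y \<in> D"
  shows "(\<lambda>k. F k x y) \<longlonglongrightarrow> E x y"
proof -
  have "(\<lambda>k. F k x y) \<longlonglongrightarrow> (E (x + y) (x + y) - E (x - y) (x - y)) / 4"
    unfolding F_polarization[of _ x y]
    by (intro tendsto_intros E_diag_LIMSEQ D_add D_diff assms) simp
  then show ?thesis
    by (metis E_def limI)
qed

lemma E_lincomb_left:
  assumes "x \<in> D" "y \<in> D" "z \<in> D"
  shows "E (a *\<^sub>R x + b *\<^sub>R y) z = a * E x z + b * E y z"
proof (rule LIMSEQ_unique[OF E_LIMSEQ])
  show "(\<lambda>k. F k (a *\<^sub>R x + b *\<^sub>R y) z) \<longlonglongrightarrow> a * E x z + b * E y z"
    unfolding F_lincomb_left by (intro tendsto_intros E_LIMSEQ assms)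
qed (use assms D_lincomb in auto)

lemma E_sym: "x \<in> D \<Longrightarrow> y \<in> D \<Longrightarrow> E x y = E y x"
  by (rule LIMSEQ_unique[OF E_LIMSEQ]) (auto simp: F_sym[of _ x y] intro: E_LIMSEQ)

lemma E_nonneg: "x \<in> D \<Longrightarrow> 0 \<le> E x x"
  by (rule LIMSEQ_le_const[OF E_LIMSEQ]) (auto intro: F_nonneg)

lemma F_le_E: "x \<in> D \<Longrightarrow> F k x x \<le> E x x"
  by (rule LIMSEQ_le_const[OF E_LIMSEQ]) (auto intro: F_mono)

lemma E_le: "x \<in> D \<Longrightarrow> (\<And>k. F k x x \<le> b) \<Longrightarrow> E x x \<le> b"
  by (rule LIMSEQ_le_const2[OF E_LIMSEQ]) auto

lemma E_quadratic:
  assumes "x \<in> D" "y \<in> D"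
  shows "E (x + c *\<^sub>R y) (x + c *\<^sub>R y) = E x x + 2 * c * E x y + c\<^sup>2 * E y y"
proof (rule LIMSEQ_unique[OF E_LIMSEQ])
  show "(\<lambda>k. F k (x + c *\<^sub>R y) (x + c *\<^sub>R y)) \<longlonglongrightarrow> E x x + 2 * c * E x y + c\<^sup>2 * E y y"
    unfolding F_quadratic by (intro tendsto_intros E_LIMSEQ assms)
qed (use assms D_add D_scale in auto)

lemma E_Cauchy_Schwarz:
  assumes "x \<in> D" "y \<in> D"
  shows "(E x y)\<^sup>2 \<le> E x x * E y y"
  using assms by (intro quadratic_nonneg_imp_discriminant)
    (auto simp flip: E_quadratic intro: E_nonneg D_add D_scale)

text \<open>
  The form is the supremum of the continuous forms \<open>F k\<close>, so it is lower semicontinuous;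
  this is what makes it closed.
\<close>

lemma D_closed:
  assumes S: "\<And>n. S n \<in> D" "S \<longlonglongrightarrow> x"
    and e: "\<And>m n. m \<ge> M \<Longrightarrow> n \<ge> M \<Longrightarrow> E (S m - S n) (S m - S n) \<le> e"
  shows "x \<in> D" "n \<ge> M \<Longrightarrow> E (S n - x) (S n - x) \<le> e"
proof -
  have *: "F k (S n - x) (S n - x) \<le> e" if "n \<ge> M" for k n
  proof (rule LIMSEQ_le_const2)
    show "(\<lambda>m. F k (S n - S m) (S n - S m)) \<longlonglongrightarrow> F k (S n - x) (S n - x)"
      by (intro tendsto_F_diag tendsto_intros S)
    show "\<exists>K. \<forall>m\<ge>K. F k (S n - S m) (S n - S m) \<le> e"
      using F_le_E[OF D_diff[OF S(1) S(1)], of k n] e[OF that] by (meson order_trans)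
  qed
  then have diff: "S n - x \<in> D" if "n \<ge> M" for n
    using that unfolding in_D by blast
  have "S M - (S M - x) \<in> D"
    by (intro D_diff S diff) simp
  then show "x \<in> D" by simp
  show "n \<ge> M \<Longrightarrow> E (S n - x) (S n - x) \<le> e"
    using * diff by (intro E_le) auto
qed

text \<open>Fix j and let k grow: at \<open>g = Rk k f\<close> the form \<open>F j\<close> is at
  most \<open>F k g g = inner (f - g) g\<close>, which is bounded independently of j and k.\<close>

lemma R_in_D: "R f \<in> D"
proof -
  have "F j (R f) (R f) \<le> 2 * (norm f)\<^sup>2" for j
  proof (rule LIMSEQ_le_const2[OF tendsto_F_diag[OF R_LIMSEQ]])
    have "F j (app (Rk k) f) (app (Rk k) f) \<le> 2 * (norm f)\<^sup>2" if "k \<ge> j" for k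
    proof -
      define g where "g = app (Rk k) f"
      have g: "norm g \<le> norm f" unfolding g_def by (rule norm_app_le[OF norm_Rk])
      have "F j g g \<le> F k g g" by (rule F_mono[OF that])
      also have "\<dots> = inner (f - g) g"
        by (simp add: F_def g_def A_Rk inner_diff_left)
      also have "\<dots> \<le> norm (f - g) * norm g" by (rule norm_cauchy_schwarz)
      also have "\<dots> \<le> (2 * norm f) * norm f"
        using g norm_triangle_ineq4[of f g] by (intro mult_mono) auto
      finally show ?thesis by (simp add: g_def power2_eq_square)
    qed
    then show "\<exists>K. \<forall>k\<ge>K. F j (app (Rk k) f) (app (Rk k) f) \<le> 2 * (norm f)\<^sup>2" by blast
  qed
  then show ?thesis unfolding in_D by blast
qed

text \<open>The resolvent equation holds for \<open>F k\<close> at \<open>Rk k f\<close>, but both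
  depend on k. For j \<le> k the difference \<open>F k - F j\<close> is a nonnegative form, so
  Cauchy-Schwarz bounds the error of using \<open>F j\<close> instead by
  \<open>E v v - F j v v\<close>, which tends to 0 because v has finite energy.\<close>

lemma E_R:
  assumes v: "v \<in> D"
  shows "E (R f) v = inner (f - R f) v"
proof -
  define M where "M = 2 * (norm f)\<^sup>2"
  have bound: "(inner (f - R f) v - F j (R f) v)\<^sup>2 \<le> M * (E v v - F j v v)" for j
  proof (rule LIMSEQ_le_const2)
    show "(\<lambda>k. (inner (f - app (Rk k) f) v - F j (app (Rk k) f) v)\<^sup>2)
        \<longlonglongrightarrow> (inner (f - R f) v - F j (R f) v)\<^sup>2"
      by (intro tendsto_intros tendsto_F R_LIMSEQ)
    have "(inner (f - app (Rk k) f) v - F j (app (Rk k) f) v)\<^sup>2 \<le> M * (E v v - F j v v)" if "k \<ge> j" for k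
    proof -
      define g where "g = app (Rk k) f"
      have Fg: "F k g y = inner (f - g) y" for y
        by (simp add: F_def g_def A_Rk inner_diff_left)
      have "norm g \<le> norm f" unfolding g_def by (rule norm_app_le[OF norm_Rk])
      have "(F k g v - F j g v)\<^sup>2 \<le> (F k g g - F j g g) * (F k v v - F j v v)"
      proof (rule quadratic_nonneg_imp_discriminant)
        show "0 \<le> F k v v - F j v v" using F_mono[OF that, of v] by simp
        show "0 \<le> F k g g - F j g g + 2 * c * (F k g v - F j g v) + c\<^sup>2 * (F k v v - F j v v)" for c
          using F_mono[OF that, of "g + c *\<^sub>R v"] by (simp add: F_quadratic algebra_simps)
      qed
      also have "\<dots> \<le> M * (E v v - F j v v)"
      proof (intro mult_mono)
        have "F k g g \<le> norm (f - g) * norm g"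
          unfolding Fg by (rule norm_cauchy_schwarz)
        also have "\<dots> \<le> (2 * norm f) * norm f"
          using \<open>norm g \<le> norm f\<close> norm_triangle_ineq4[of f g] by (intro mult_mono) auto
        finally show "F k g g - F j g g \<le> M"
          using F_nonneg[of j g] by (simp add: M_def power2_eq_square)
      qed (use F_le_E[OF v] F_mono[OF that, of v] in \<open>auto simp: M_def\<close>)
      finally show ?thesis
        by (simp add: g_def[symmetric] Fg)
    qed
    then show "\<exists>K. \<forall>k\<ge>K. (inner (f - app (Rk k) f) v - F j (app (Rk k) f) v)\<^sup>2 \<le> M * (E v v - F j v v)"
      by blast
  qed
  have "(\<lambda>j. (inner (f - R f) v - F j (R f) v)\<^sup>2) \<longlonglongrightarrow> (inner (f - R f) v - E (R f) v)\<^sup>2"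
    by (intro tendsto_intros E_LIMSEQ v R_in_D)
  moreover have "(\<lambda>j. M * (E v v - F j v v)) \<longlonglongrightarrow> M * (E v v - E v v)"
    by (intro tendsto_intros E_LIMSEQ v)
  ultimately have "(inner (f - R f) v - E (R f) v)\<^sup>2 \<le> M * (E v v - E v v)"
    by (rule LIMSEQ_le) (use bound in auto)
  then show ?thesis by simp
qed

text \<open>Both operators are dissipative and contain all pairs \<open>(R f, R f - f)\<close>. If
  \<open>(u, f)\<close> belongs to either of them, u and \<open>R (u - f)\<close> have the same
  image under 1 minus the operator, hence they agree.\<close>

theorem gen_P: "gen P = {(u, f). u \<in> D \<and> (\<forall>v\<in>D. E u v = - inner f v)}"
proof (intro equalityI subsetI; clarsimp)
  fix u f assume "(u, f) \<in> gen P"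
  define g where "g = R (u - f)"
  have "(g, g - (u - f)) \<in> gen P" unfolding g_def by (rule R_gen)
  from P.gen_dissipative[OF P.gen_diff[OF \<open>(u, f) \<in> gen P\<close> this]]
  have "inner (u - g) (u - g) \<le> 0" by simp
  then have "u = g"
    by (metis antisym inner_eq_zero_iff inner_ge_zero right_minus_eq)
  then show "u \<in> D \<and> (\<forall>v\<in>D. E u v = - inner f v)"
    using R_in_D[of "u - f"] E_R[of _ "u - f"] unfolding g_def[symmetric]
    by (auto simp: inner_diff_left)
next
  fix u f assume u: "u \<in> D" and f: "\<forall>v\<in>D. E u v = - inner f v"
  define g where "g = R (u - f)"
  have g: "g \<in> D" unfolding g_def by (rule R_in_D)
  have "E (u - g) (u - g) = E u (u - g) - E g (u - g)"
    using E_lincomb_left[OF u g D_diff[OF u g], of 1 "-1"] by simp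
  also have "\<dots> = - inner (u - g) (u - g)"
    using f E_R[OF D_diff[OF u g], of "u - f"] D_diff[OF u g] unfolding g_def[symmetric]
    by (simp add: inner_diff_left)
  finally have "inner (u - g) (u - g) \<le> 0"
    using E_nonneg[OF D_diff[OF u g]] by simp
  then have "u = g"
    by (metis antisym inner_eq_zero_iff inner_ge_zero right_minus_eq)
  then show "(u, f) \<in> gen P"
    using R_gen[of "u - f"] unfolding g_def[symmetric] by simp
qed

section \<open>Energy inequalities and time integrals of the semigroup\<close>

lemma U_form:
  assumes "0 \<le> s"
  shows "P.U s f \<in> D" "v \<in> D \<Longrightarrow> E (P.U s f) v = inner (f - P s f) v"
  using P.U_gen[OF assms, of f] unfolding gen_P by (auto simp: inner_diff_left)

lemma P_half: "0 \<le> t \<Longrightarrow> inner (P t f) f = (norm (P (t / 2) f))\<^sup>2"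
  using P.add[of "t / 2" "t / 2" f] P_sym[of "t / 2" "P (t / 2) f" f]
  by (simp add: power2_norm_eq_inner)

lemma P_inner_nonneg: "0 \<le> t \<Longrightarrow> 0 \<le> inner (P t f) f"
  by (simp add: P_half)

text \<open>The energy is \<open>inner (f - P s f) (P.U s f)\<close>. The term dropped is an
  integral of \<open>inner (P (s + t) f) f\<close>, nonnegative by symmetry.\<close>

lemma U_energy:
  assumes "0 \<le> s"
  shows "E (P.U s f) (P.U s f) \<le> inner (P.U s f) f"
proof -
  have "inner (P.U s f) (P s f) = integral {0..s} (\<lambda>t. inner (P t f) (P s f))"
    by (rule P.U_inner)
  also have "\<dots> \<ge> 0"
  proof (rule integral_nonneg)
    show "(\<lambda>t. inner (P t f) (P s f)) integrable_on {0..s}"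
      using integrable_linear[OF P.integrable[of 0 f s] bounded_linear_inner_left[of "P s f"]]
      by (simp add: o_def)
    show "0 \<le> inner (P t f) (P s f)" if "t \<in> {0..s}" for t
      using P_inner_nonneg[of "s + t" f] P.add[of s t f] P_sym[of s "P t f" f] assms that by simp
  qed
  finally show ?thesis
    using U_form(2)[OF assms U_form(1)[OF assms]] by (simp add: inner_diff_right inner_commute)
qed

text \<open>The energy bound is tested with the potential \<open>P.U s f\<close> itself: its pairing
  a with f satisfies \<open>a\<^sup>2 \<le> C * a\<close>.\<close>

lemma potential_bounded:
  assumes "\<And>v. v \<in> D \<Longrightarrow> (inner f v)\<^sup>2 \<le> C * E v v" "0 \<le> C" "0 \<le> s"
  shows "integral {0..s} (\<lambda>t. inner (P t f) f) \<le> C"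
proof -
  define a where "a = inner (P.U s f) f"
  have "a\<^sup>2 \<le> C * E (P.U s f) (P.U s f)"
    using assms(1)[OF U_form(1)[OF assms(3)]] by (simp add: a_def inner_commute)
  also have "\<dots> \<le> C * a"
    using U_energy[OF assms(3)] assms(2) by (simp add: a_def mult_left_mono)
  finally have "a * a \<le> C * a" by (simp add: power2_eq_square)
  then have "a \<le> C"
    using assms(2) by (cases "0 < a") auto
  then show ?thesis by (simp add: a_def P.U_inner)
qed

lemma inner_integrable: "0 \<le> a \<Longrightarrow> (\<lambda>t. inner (P t f) g) integrable_on {a..b}"
  using integrable_linear[OF P.integrable[of a f b] bounded_linear_inner_left[of g]]
  by (simp add: o_def)

text \<open>
  Letting \<open>s \<rightarrow> \<infinity>\<close> in \<open>\<langle>f, v\<rangle> = E (U s f) v + \<langle>P s f, v\<rangle>\<close>; a bounded potential forces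
  \<open>\<parallel>P s f\<parallel> \<rightarrow> 0\<close> because \<open>\<langle>P t f, f\<rangle>\<close> is nonincreasing in \<open>t\<close>.
\<close>

lemma energy_bound_of_potential:
  assumes bd: "\<And>s. 0 \<le> s \<Longrightarrow> integral {0..s} (\<lambda>t. inner (P t f) f) \<le> C" and v: "v \<in> D"
  shows "(inner f v)\<^sup>2 \<le> C * E v v"
proof -
  have C: "0 \<le> C" using bd[of 0] by simp
  have decay: "(norm (P s f))\<^sup>2 \<le> C / (2 * s)" if "0 < s" for s
  proof -
    \<comment> \<open>By \<open>P_half\<close> the constant on the left is the value of the right
      integrand at the end point \<open>2 * s\<close>, its smallest on the interval.\<close>
    have "integral {0..2 * s} (\<lambda>t. (norm (P s f))\<^sup>2) \<le> integral {0..2 * s} (\<lambda>t. inner (P t f) f)"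
    proof (rule integral_le[OF integrable_const_ivl inner_integrable])
      fix t assume t: "t \<in> {0..2 * s}"
      then have "norm (P s f) \<le> norm (P (t / 2) f)"
        using P.add[of "s - t / 2" "t / 2" f] P.contr[of "s - t / 2" "P (t / 2) f"] by simp
      then show "(norm (P s f))\<^sup>2 \<le> inner (P t f) f"
        using t by (simp add: P_half power_mono)
    qed simp
    also have "\<dots> \<le> C" using bd that by simp
    finally show ?thesis using that by (simp add: field_simps)
  qed
  have main: "\<bar>inner f v\<bar> \<le> sqrt (C * E v v) + sqrt (C / (2 * s)) * norm v" if "0 < s" for s
  proof -
    have U: "P.U s f \<in> D" using U_form that by simp
    have "(E (P.U s f) v)\<^sup>2 \<le> E (P.U s f) (P.U s f) * E v v"
      by (rule E_Cauchy_Schwarz[OF U v])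
    also have "\<dots> \<le> C * E v v"
      using U_energy[of s f] bd[of s] that E_nonneg[OF v]
      by (intro mult_right_mono) (auto simp: P.U_inner)
    finally have 1: "\<bar>E (P.U s f) v\<bar> \<le> sqrt (C * E v v)"
      by (metis real_sqrt_abs real_sqrt_le_iff)
    have "\<bar>inner (P s f) v\<bar> \<le> norm (P s f) * norm v"
      by (rule Cauchy_Schwarz_ineq2)
    also have "\<dots> \<le> sqrt (C / (2 * s)) * norm v"
      using decay[OF that] by (intro mult_right_mono real_le_rsqrt) auto
    finally show ?thesis
      using 1 U_form(2)[OF less_imp_le[OF that] v, of f] by (simp add: inner_diff_left)
  qed
  have "\<bar>inner f v\<bar> \<le> sqrt (C * E v v)"
  proof (rule tendsto_lowerbound)
    have "((\<lambda>s::real. sqrt (C / (2 * s))) \<longlongrightarrow> 0) at_top"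
    proof -
      have "filterlim (\<lambda>s::real. 2 * s) at_top at_top"
        by real_asymp
      from tendsto_real_sqrt[OF real_tendsto_divide_at_top[OF tendsto_const this]]
      show ?thesis by simp
    qed
    from tendsto_add[OF tendsto_const[of "sqrt (C * E v v)"] tendsto_mult[OF this tendsto_const[of "norm v"]]]
    show "((\<lambda>s. sqrt (C * E v v) + sqrt (C / (2 * s)) * norm v) \<longlongrightarrow> sqrt (C * E v v)) at_top"
      by simp
    show "\<forall>\<^sub>F s in at_top. \<bar>inner f v\<bar> \<le> sqrt (C * E v v) + sqrt (C / (2 * s)) * norm v"
      using eventually_gt_at_top[of 0] by eventually_elim (rule main)
  qed simp
  then show ?thesis
    using sqrt_ge_absD by blast
qed

text \<open>The derivative of \<open>inner (P t (R f)) g\<close> in t is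
  \<open>inner (P t (R f) - P t f) g\<close>. Exchanging \<open>R f\<close> for f under the time
  integral therefore costs two boundary terms, bounded independently of s.\<close>

lemma integral_P_R_le:
  assumes "0 \<le> s"
  shows "integral {0..s} (\<lambda>t. inner (P t (R f)) g) \<le> integral {0..s} (\<lambda>t. inner (P t f) g) + 2 * norm f * norm g"
proof -
  have der: "((\<lambda>t. inner (P t (R f)) g) has_vector_derivative inner (P t (R f) - P t f) g) (at t within {0..s})"
    if "t \<in> {0..s}" for t
  proof -
    have "((\<lambda>t. P t (R f)) has_vector_derivative P t (R f - f)) (at t within {0..s})"
      by (rule has_vector_derivative_within_subset[OF P.gen_derivative[OF R_gen]]) (use that in auto)
    from bounded_linear.has_vector_derivative[OF bounded_linear_inner_left this, of g]
    show ?thesis using that by (simp add: P.diff)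
  qed
  have "integral {0..s} (\<lambda>t. inner (P t (R f) - P t f) g) = inner (P s (R f)) g - inner (P 0 (R f)) g"
    by (intro integral_unique fundamental_theorem_of_calculus assms der)
  moreover have "integral {0..s} (\<lambda>t. inner (P t (R f) - P t f) g) =
      integral {0..s} (\<lambda>t. inner (P t (R f)) g) - integral {0..s} (\<lambda>t. inner (P t f) g)"
    unfolding inner_diff_left by (intro integral_diff inner_integrable) auto
  moreover have "inner (P s (R f)) g \<le> norm f * norm g"
    by (rule order_trans[OF norm_cauchy_schwarz mult_right_mono[OF order_trans[OF P.contr norm_R]]])
      (use assms in auto)
  moreover have "- inner (P 0 (R f)) g \<le> norm f * norm g"
    using Cauchy_Schwarz_ineq2[of "R f" g] mult_right_mono[OF norm_R[of f], of "norm g"]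
    by (simp add: P.at_zero)
  ultimately show ?thesis by simp
qed

end

section \<open>The Hilbert space of square integrable functions\<close>

lemma L2_measurable [measurable_dest]: "f \<in> L2 M \<Longrightarrow> f \<in> borel_measurable M"
  by (simp add: L2_def)

lemma L2_square_integrable: "f \<in> L2 M \<Longrightarrow> integrable M (\<lambda>x. (f x)\<^sup>2)"
  by (simp add: L2_def)

lemma L2_mult_integrable:
  assumes "f \<in> L2 M" "g \<in> L2 M"
  shows "integrable M (\<lambda>x. f x * g x)"
proof (rule Bochner_Integration.integrable_bound)
  show "integrable M (\<lambda>x. (f x)\<^sup>2 + (g x)\<^sup>2)"
    using assms by (simp add: L2_square_integrable)
  have "\<bar>a * b\<bar> \<le> a\<^sup>2 + b\<^sup>2" for a b :: real
  proof -
    have "2 * \<bar>a\<bar> * \<bar>b\<bar> \<le> a\<^sup>2 + b\<^sup>2"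
      using sum_squares_bound[of "\<bar>a\<bar>" "\<bar>b\<bar>"] by simp
    moreover have "\<bar>a * b\<bar> \<le> 2 * \<bar>a\<bar> * \<bar>b\<bar>"
      by (simp add: abs_mult)
    ultimately show ?thesis by (rule order_trans[rotated])
  qed
  then show "AE x in M. norm (f x * g x) \<le> norm ((f x)\<^sup>2 + (g x)\<^sup>2)"
    by simp
qed (use assms in measurable)

lemma L2_cmult:
  assumes "f \<in> L2 M"
  shows "(\<lambda>x. c * f x) \<in> L2 M"
proof -
  note [measurable] = L2_measurable[OF assms]
  show ?thesis
    by (simp add: L2_def power_mult_distrib L2_square_integrable[OF assms])
qed

lemma L2_add:
  assumes "f \<in> L2 M" "g \<in> L2 M"
  shows "(\<lambda>x. f x + g x) \<in> L2 M"
proof -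
  have "integrable M (\<lambda>x. (f x)\<^sup>2 + 2 * (f x * g x) + (g x)\<^sup>2)"
    using assms by (intro Bochner_Integration.integrable_add integrable_mult_right
        L2_square_integrable L2_mult_integrable)
  moreover note assms[THEN L2_measurable, measurable]
  ultimately show ?thesis
    by (simp add: L2_def power2_sum algebra_simps)
qed

lemma L2_lincomb: "f \<in> L2 M \<Longrightarrow> g \<in> L2 M \<Longrightarrow> (\<lambda>x. a * f x + b * g x) \<in> L2 M"
  by (intro L2_add L2_cmult)

lemma L2_diff: "f \<in> L2 M \<Longrightarrow> g \<in> L2 M \<Longrightarrow> (\<lambda>x. f x - g x) \<in> L2 M"
  using L2_lincomb[of f M g 1 "-1"] by simp

lemma L2_dominated:
  assumes "g \<in> L2 M" "f \<in> borel_measurable M" "\<And>x. \<bar>f x\<bar> \<le> \<bar>g x\<bar>"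
  shows "f \<in> L2 M"
proof -
  have "integrable M (\<lambda>x. (f x)\<^sup>2)"
    using assms(2,3)
    by (intro Bochner_Integration.integrable_bound[OF L2_square_integrable[OF assms(1)]])
      (auto simp: abs_le_square_iff)
  with assms(2) show ?thesis by (simp add: L2_def)
qed

lemma L2_abs: "f \<in> L2 M \<Longrightarrow> (\<lambda>x. \<bar>f x\<bar>) \<in> L2 M"
  by (rule L2_dominated) auto

lemma L2_cong_AE: "f \<in> L2 M \<Longrightarrow> g \<in> borel_measurable M \<Longrightarrow> AE x in M. f x = g x \<Longrightarrow> g \<in> L2 M"
  unfolding L2_def
  by (auto elim!: integrable_cong_AE_imp simp: elim: AE_mp)

lemma L2_zero: "(\<lambda>x. 0) \<in> L2 M"
  by (simp add: L2_def)

lemma L2_iff_nn_integral: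
  "f \<in> L2 M \<longleftrightarrow> f \<in> borel_measurable M \<and> (\<integral>\<^sup>+x. ennreal ((f x)\<^sup>2) \<partial>M) < \<infinity>"
  by (auto simp: L2_def integrable_iff_bounded)

lemma L2_nn_integral:
  "f \<in> L2 M \<Longrightarrow> (\<integral>\<^sup>+x. ennreal ((f x)\<^sup>2) \<partial>M) = ennreal (LINT x|M. (f x)\<^sup>2)"
  by (simp add: nn_integral_eq_integral L2_square_integrable)

\<comment> \<open>Functions up to null sets, so that semigroups acting on functions become operators
  on a genuine Hilbert space. The relation is partial since only square integrable functions
  represent an element.\<close>
quotient_type l2 = "real \<Rightarrow> real" / partial:
  "\<lambda>f g. f \<in> L2 lborel \<and> g \<in> L2 lborel \<and> (AE x in lborel. f x = g x)"
proof (rule part_equivpI)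
  show "\<exists>f. f \<in> L2 lborel \<and> f \<in> L2 lborel \<and> (AE x in lborel. f x = f x)"
    by (rule exI[of _ "\<lambda>_. 0"]) (simp add: L2_zero)
  show "symp (\<lambda>f g. f \<in> L2 lborel \<and> g \<in> L2 lborel \<and> (AE x in lborel. f x = g x))"
    by (auto intro!: sympI elim: AE_mp)
  show "transp (\<lambda>f g. f \<in> L2 lborel \<and> g \<in> L2 lborel \<and> (AE x in lborel. f x = g x))"
    by (auto intro!: transpI elim: AE_mp)
qed

lemma rep_l2_L2 [simp]: "rep_l2 x \<in> L2 lborel"
  using Quotient3_rep_reflp[OF Quotient3_l2, of x] by simp

lemma rep_l2_measurable [measurable, simp]: "rep_l2 x \<in> borel_measurable borel"
  using L2_measurable[OF rep_l2_L2] by simp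

lemma abs_rep_l2 [simp]: "abs_l2 (rep_l2 x) = x"
  by (rule Quotient3_abs_rep[OF Quotient3_l2])

lemma rep_abs_l2: "f \<in> L2 lborel \<Longrightarrow> AE t in lborel. rep_l2 (abs_l2 f) t = f t"
  using Quotient3_rep_abs[OF Quotient3_l2, of f] by simp

lemma abs_l2_eq_iff:
  "f \<in> L2 lborel \<Longrightarrow> g \<in> L2 lborel \<Longrightarrow> abs_l2 f = abs_l2 g \<longleftrightarrow> (AE t in lborel. f t = g t)"
  using Quotient3_rel[OF Quotient3_l2, of f g] by simp

lemma l2_eq_iff: "x = y \<longleftrightarrow> (AE t in lborel. rep_l2 x t = rep_l2 y t)"
  using abs_l2_eq_iff[of "rep_l2 x" "rep_l2 y"] by simp

instantiation l2 :: real_inner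
begin

definition zero_l2 :: l2 where "zero_l2 = abs_l2 (\<lambda>_. 0)"
definition plus_l2 :: "l2 \<Rightarrow> l2 \<Rightarrow> l2" where "plus_l2 x y = abs_l2 (\<lambda>t. rep_l2 x t + rep_l2 y t)"
definition minus_l2 :: "l2 \<Rightarrow> l2 \<Rightarrow> l2" where "minus_l2 x y = abs_l2 (\<lambda>t. rep_l2 x t - rep_l2 y t)"
definition uminus_l2 :: "l2 \<Rightarrow> l2" where "uminus_l2 x = abs_l2 (\<lambda>t. - rep_l2 x t)"
definition scaleR_l2 :: "real \<Rightarrow> l2 \<Rightarrow> l2" where "scaleR_l2 c x = abs_l2 (\<lambda>t. c * rep_l2 x t)"
definition inner_l2 :: "l2 \<Rightarrow> l2 \<Rightarrow> real" where "inner_l2 x y = L2_inner lborel (rep_l2 x) (rep_l2 y)"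
definition norm_l2 :: "l2 \<Rightarrow> real" where "norm_l2 x = sqrt (inner x x)"
definition sgn_l2 :: "l2 \<Rightarrow> l2" where "sgn_l2 x = scaleR (inverse (norm x)) x"
definition dist_l2 :: "l2 \<Rightarrow> l2 \<Rightarrow> real" where "dist_l2 x y = norm (x - y)"
definition uniformity_l2 :: "(l2 \<times> l2) filter"
  where "uniformity_l2 = (INF e\<in>{0<..}. principal {(x, y). dist x y < e})"
definition open_l2 :: "l2 set \<Rightarrow> bool"
  where "open_l2 U \<longleftrightarrow> (\<forall>x\<in>U. eventually (\<lambda>(x', y). x' = x \<longrightarrow> y \<in> U) uniformity)"

lemma rep_zero: "AE t in lborel. rep_l2 0 t = 0"
  unfolding zero_l2_def by (intro rep_abs_l2 L2_zero)

lemma rep_plus: "AE t in lborel. rep_l2 (x + y) t = rep_l2 x t + rep_l2 y t"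
  unfolding plus_l2_def by (intro rep_abs_l2 L2_add) auto

lemma rep_minus: "AE t in lborel. rep_l2 (x - y) t = rep_l2 x t - rep_l2 y t"
  unfolding minus_l2_def by (intro rep_abs_l2 L2_diff) auto

lemma rep_scaleR: "AE t in lborel. rep_l2 (c *\<^sub>R x) t = c * rep_l2 x t"
  unfolding scaleR_l2_def by (intro rep_abs_l2 L2_cmult) auto

lemma rep_uminus: "AE t in lborel. rep_l2 (- x) t = - rep_l2 x t"
  unfolding uminus_l2_def using L2_cmult[of "rep_l2 x" lborel "-1"] by (intro rep_abs_l2) auto

instance
proof
  fix x y z :: l2 and a b :: real
  show "x + y + z = x + (y + z)"
    using rep_plus[of x y] rep_plus[of y z] rep_plus[of "x + y" z] rep_plus[of x "y + z"]
    unfolding l2_eq_iff by eventually_elim simp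
  show "x + y = y + x"
    using rep_plus[of x y] rep_plus[of y x] unfolding l2_eq_iff by eventually_elim simp
  show "0 + x = x"
    using rep_plus[of 0 x] rep_zero unfolding l2_eq_iff by eventually_elim simp
  show "- x + x = 0"
    using rep_plus[of "- x" x] rep_uminus[of x] rep_zero unfolding l2_eq_iff by eventually_elim simp
  show "x - y = x + - y"
    using rep_plus[of x "- y"] rep_uminus[of y] rep_minus[of x y] unfolding l2_eq_iff
    by eventually_elim simp
  show "a *\<^sub>R (x + y) = a *\<^sub>R x + a *\<^sub>R y"
    using rep_plus[of x y] rep_plus[of "a *\<^sub>R x" "a *\<^sub>R y"] rep_scaleR[of a x] rep_scaleR[of a y]
      rep_scaleR[of a "x + y"] unfolding l2_eq_iff
    by eventually_elim (simp add: algebra_simps)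
  show "(a + b) *\<^sub>R x = a *\<^sub>R x + b *\<^sub>R x"
    using rep_plus[of "a *\<^sub>R x" "b *\<^sub>R x"] rep_scaleR[of a x] rep_scaleR[of b x] rep_scaleR[of "a + b" x]
    unfolding l2_eq_iff by eventually_elim (simp add: algebra_simps)
  show "a *\<^sub>R b *\<^sub>R x = (a * b) *\<^sub>R x"
    using rep_scaleR[of a "b *\<^sub>R x"] rep_scaleR[of b x] rep_scaleR[of "a * b" x]
    unfolding l2_eq_iff by eventually_elim simp
  show "1 *\<^sub>R x = x"
    using rep_scaleR[of 1 x] unfolding l2_eq_iff by eventually_elim simp
  show "inner x y = inner y x"
    by (simp add: inner_l2_def L2_inner_def mult.commute)
  show "inner (x + y) z = inner x z + inner y z"
  proof -
    have "inner (x + y) z = (LINT t|lborel. rep_l2 x t * rep_l2 z t + rep_l2 y t * rep_l2 z t)"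
      unfolding inner_l2_def L2_inner_def using rep_plus[of x y]
      by (intro integral_cong_AE) (auto simp: algebra_simps)
    then show ?thesis
      by (simp add: inner_l2_def L2_inner_def L2_mult_integrable)
  qed
  show "inner (a *\<^sub>R x) y = a * inner x y"
  proof -
    have "inner (a *\<^sub>R x) y = (LINT t|lborel. a * (rep_l2 x t * rep_l2 y t))"
      unfolding inner_l2_def L2_inner_def using rep_scaleR[of a x]
      by (intro integral_cong_AE) auto
    then show ?thesis
      by (simp add: inner_l2_def L2_inner_def)
  qed
  show "0 \<le> inner x x"
    by (simp add: inner_l2_def L2_inner_def)
  show "inner x x = 0 \<longleftrightarrow> x = 0"
  proof -
    have "inner x x = 0 \<longleftrightarrow> (AE t in lborel. rep_l2 x t * rep_l2 x t = 0)"
      unfolding inner_l2_def L2_inner_def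
      by (intro integral_nonneg_eq_0_iff_AE) (auto intro: L2_mult_integrable)
    also have "\<dots> \<longleftrightarrow> x = 0"
    proof
      assume "AE t in lborel. rep_l2 x t * rep_l2 x t = 0"
      with rep_zero show "x = 0" unfolding l2_eq_iff by eventually_elim simp
    qed (use rep_zero in eventually_elim, simp)
    finally show ?thesis .
  qed
qed (fact sgn_l2_def dist_l2_def uniformity_l2_def open_l2_def norm_l2_def)+

end

lemma inner_abs_l2:
  assumes "f \<in> L2 lborel" "g \<in> L2 lborel"
  shows "inner (abs_l2 f) (abs_l2 g) = (LINT t|lborel. f t * g t)"
  unfolding inner_l2_def L2_inner_def
proof (intro integral_cong_AE)
  show "AE t in lborel. rep_l2 (abs_l2 f) t * rep_l2 (abs_l2 g) t = f t * g t"
    using rep_abs_l2[OF assms(1)] rep_abs_l2[OF assms(2)] by eventually_elim simp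
qed (use L2_measurable[OF assms(1)] L2_measurable[OF assms(2)] in auto)

lemma norm_abs_l2: "f \<in> L2 lborel \<Longrightarrow> norm (abs_l2 f) = L2_nrm lborel f"
  by (simp add: norm_eq_sqrt_inner inner_abs_l2 L2_nrm_def L2_inner_def)

lemma abs_l2_lincomb:
  assumes "f \<in> L2 lborel" "g \<in> L2 lborel"
  shows "abs_l2 (\<lambda>t. a * f t + b * g t) = a *\<^sub>R abs_l2 f + b *\<^sub>R abs_l2 g"
  unfolding l2_eq_iff
  using rep_abs_l2[OF assms(1)] rep_abs_l2[OF assms(2)] rep_abs_l2[OF L2_lincomb[OF assms, of a b]]
    rep_scaleR[of a "abs_l2 f"] rep_scaleR[of b "abs_l2 g"] rep_plus[of "a *\<^sub>R abs_l2 f" "b *\<^sub>R abs_l2 g"]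
  by eventually_elim simp

lemma abs_l2_diff: "f \<in> L2 lborel \<Longrightarrow> g \<in> L2 lborel \<Longrightarrow> abs_l2 (\<lambda>t. f t - g t) = abs_l2 f - abs_l2 g"
  using abs_l2_lincomb[of f g 1 "-1"] by simp

instance l2 :: perfect_space
proof
  fix x :: l2
  show "\<not> open {x}"
  proof
    assume "open {x}"
    then obtain e where e: "0 < e" "ball x e \<subseteq> {x}"
      by (auto simp: open_contains_ball)
    define f :: "real \<Rightarrow> real" where "f = indicator {0..1}"
    have "integrable lborel f" by (simp add: f_def)
    moreover have "(\<lambda>t. (f t)\<^sup>2) = f"
      by (auto simp: f_def indicator_def fun_eq_iff)
    ultimately have f: "f \<in> L2 lborel"
      by (auto simp: L2_def)
    have "norm (abs_l2 f) = 1"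
      unfolding norm_abs_l2[OF f] L2_nrm_def L2_inner_def
      by (simp add: f_def flip: indicator_inter_arith)
    then have "x + (e / 2) *\<^sub>R abs_l2 f \<in> ball x e" "abs_l2 f \<noteq> 0"
      using e(1) by (auto simp: dist_norm)
    with e show False by auto
  qed
qed

text \<open>The rate 1/8 leaves room for the weight \<open>4 ^ n\<close>: the weighted squares have
  integrals at most \<open>(1 / 2) ^ n\<close>, so almost everywhere they are bounded in n, and the
  increments themselves decay like \<open>(1 / 2) ^ n\<close>.\<close>

lemma L2_AE_convergent:
  assumes f: "\<And>n. f n \<in> L2 M"
    and small: "\<And>n. (LINT x|M. (f (Suc n) x - f n x)\<^sup>2) \<le> (1 / 8) ^ n"
  shows "AE x in M. convergent (\<lambda>n. f n x)"
proof -
  define d where "d n x = f (Suc n) x - f n x" for n x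
  have d: "d n \<in> L2 M" for n unfolding d_def using f by (intro L2_diff)
  have [measurable]: "d n \<in> borel_measurable M" for n using d by (simp add: L2_def)
  have "(\<integral>\<^sup>+x. (\<Sum>n. ennreal (4 ^ n * (d n x)\<^sup>2)) \<partial>M) = (\<Sum>n. \<integral>\<^sup>+x. ennreal (4 ^ n * (d n x)\<^sup>2) \<partial>M)"
    by (rule nn_integral_suminf) measurable
  also have "\<dots> \<le> (\<Sum>n. ennreal ((1 / 2) ^ n))"
  proof (intro suminf_le)
    fix n
    have "(\<integral>\<^sup>+x. ennreal (4 ^ n * (d n x)\<^sup>2) \<partial>M) = ennreal (LINT x|M. 4 ^ n * (d n x)\<^sup>2)"
      by (intro nn_integral_eq_integral integrable_mult_right L2_square_integrable d) simp
    also have "\<dots> \<le> ennreal ((1 / 2) ^ n)"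
    proof (intro ennreal_leI)
      have "(LINT x|M. 4 ^ n * (d n x)\<^sup>2) \<le> 4 ^ n * (1 / 8) ^ n"
        using small[of n] by (simp add: d_def)
      also have "\<dots> = (1 / 2) ^ n" by (simp flip: power_mult_distrib)
      finally show "(LINT x|M. 4 ^ n * (d n x)\<^sup>2) \<le> (1 / 2) ^ n" .
    qed
    finally show "(\<integral>\<^sup>+x. ennreal (4 ^ n * (d n x)\<^sup>2) \<partial>M) \<le> ennreal ((1 / 2) ^ n)" .
  qed auto
  also have "\<dots> < \<infinity>"
    by (subst suminf_ennreal2) (auto simp: summable_geometric)
  finally have "AE x in M. (\<Sum>n. ennreal (4 ^ n * (d n x)\<^sup>2)) \<noteq> \<infinity>"
    by (intro nn_integral_noteq_infinite) auto
  then show ?thesis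
  proof eventually_elim
    case (elim x)
    then have "summable (\<lambda>n. 4 ^ n * (d n x)\<^sup>2)"
      by (intro summable_suminf_not_top) auto
    from convergent_imp_Bseq[OF convergentI[OF summable_LIMSEQ_zero[OF this]]]
    obtain C where "\<And>n. norm (4 ^ n * (d n x)\<^sup>2) \<le> C"
      unfolding Bseq_def by blast
    then have C: "4 ^ n * (d n x)\<^sup>2 \<le> C" for n by simp
    have bound: "norm (d n x) \<le> sqrt C * (1 / 2) ^ n" for n
    proof -
      have "((2::real) ^ n)\<^sup>2 = 4 ^ n"
        by (simp add: power2_eq_square flip: power_mult_distrib)
      then have "(2 ^ n * \<bar>d n x\<bar>)\<^sup>2 \<le> C"
        using C[of n] by (simp add: power_mult_distrib)
      then have "2 ^ n * \<bar>d n x\<bar> \<le> sqrt C" by (rule real_le_rsqrt)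
      then show ?thesis by (simp add: field_simps power_one_over)
    qed
    have "summable (\<lambda>n. sqrt C * (1 / 2) ^ n)"
      by (intro summable_mult summable_geometric) simp
    then have "summable (\<lambda>n. d n x)"
      by (rule summable_comparison_test'[where N = 0]) (rule bound)
    then have "convergent (\<lambda>n. (\<Sum>i<n. d i x) + f 0 x)"
      by (intro convergent_add convergent_const) (simp add: summable_iff_convergent)
    moreover have "(\<Sum>i<n. d i x) + f 0 x = f n x" for n
      by (induction n) (simp_all add: d_def)
    ultimately show ?case by simp
  qed
qed

lemma L2_Fatou:
  assumes "\<And>n. f n \<in> L2 M" "g \<in> L2 M" "h \<in> borel_measurable M"
    and "AE x in M. (\<lambda>n. f n x) \<longlonglongrightarrow> h x"
    and bound: "\<And>n. n \<ge> N \<Longrightarrow> (LINT x|M. (f n x - g x)\<^sup>2) \<le> c"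
  shows "(\<integral>\<^sup>+x. ennreal ((h x - g x)\<^sup>2) \<partial>M) \<le> ennreal c"
proof -
  have [measurable]: "f n \<in> borel_measurable M" "g \<in> borel_measurable M" for n
    using assms(1,2) by (auto simp: L2_def)
  note assms(3)[measurable]
  have "(\<integral>\<^sup>+x. ennreal ((h x - g x)\<^sup>2) \<partial>M) = (\<integral>\<^sup>+x. liminf (\<lambda>n. ennreal ((f n x - g x)\<^sup>2)) \<partial>M)"
  proof (intro nn_integral_cong_AE)
    show "AE x in M. ennreal ((h x - g x)\<^sup>2) = liminf (\<lambda>n. ennreal ((f n x - g x)\<^sup>2))"
      using assms(4)
      by eventually_elim (intro lim_imp_Liminf[symmetric] tendsto_ennrealI tendsto_intros, auto)
  qed
  also have "\<dots> \<le> liminf (\<lambda>n. \<integral>\<^sup>+x. ennreal ((f n x - g x)\<^sup>2) \<partial>M)"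
    by (rule nn_integral_liminf) measurable
  also have "\<dots> \<le> limsup (\<lambda>n. \<integral>\<^sup>+x. ennreal ((f n x - g x)\<^sup>2) \<partial>M)"
    by (rule Liminf_le_Limsup) simp
  also have "\<dots> \<le> ennreal c"
  proof (rule Limsup_bounded)
    show "\<forall>\<^sub>F n in sequentially. (\<integral>\<^sup>+x. ennreal ((f n x - g x)\<^sup>2) \<partial>M) \<le> ennreal c"
      using eventually_ge_at_top[of N]
      by eventually_elim (simp add: L2_nn_integral L2_diff assms bound ennreal_leI)
  qed
  finally show ?thesis .
qed

instance l2 :: banach
proof
  fix X :: "nat \<Rightarrow> l2"
  assume X: "Cauchy X"
  have "\<forall>n. \<exists>M. \<forall>i\<ge>M. \<forall>j\<ge>M. norm (X i - X j) < sqrt ((1 / 8) ^ n)"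
    using X unfolding Cauchy_iff by simp
  then obtain M where M: "\<And>n i j. i \<ge> M n \<Longrightarrow> j \<ge> M n \<Longrightarrow> norm (X i - X j) < sqrt ((1 / 8) ^ n)"
    by metis
  \<comment> \<open>Summation makes r strictly increasing and keeps it above every earlier
    \<open>M n\<close>.\<close>
  define r where "r n = (\<Sum>i\<le>n. M i + 1)" for n
  have r: "strict_mono r" by (simp add: strict_mono_Suc_iff r_def)
  have rM: "M n \<le> r m" if "n \<le> m" for n m
    using member_le_sum[of n "{..m}" "\<lambda>i. M i + 1"] that by (simp add: r_def)
  define f where "f n = rep_l2 (X (r n))" for n
  have fL: "f n \<in> L2 lborel" for n by (simp add: f_def)
  have dist: "(LINT t|lborel. (f i t - f j t)\<^sup>2) = (norm (X (r i) - X (r j)))\<^sup>2" for i j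
    using norm_abs_l2[OF L2_diff[OF fL fL, of i j]]
    by (simp add: f_def abs_l2_diff L2_nrm_def L2_inner_def power2_eq_square)
  have small: "(LINT t|lborel. (f m t - f n t)\<^sup>2) \<le> (1 / 8) ^ n" if "m \<ge> n" for m n
  proof -
    have "norm (X (r m) - X (r n)) < sqrt ((1 / 8) ^ n)"
      using M rM that by auto
    then have "(norm (X (r m) - X (r n)))\<^sup>2 \<le> (sqrt ((1 / 8) ^ n))\<^sup>2"
      by (intro power_mono) auto
    then show ?thesis by (simp add: dist)
  qed
  define g where "g t = lim (\<lambda>n. f n t)" for t
  have [measurable]: "f n \<in> borel_measurable borel" for n by (simp add: f_def)
  have gm [measurable]: "g \<in> borel_measurable borel" unfolding g_def by measurable
  have "AE t in lborel. convergent (\<lambda>n. f n t)"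
    using fL small by (intro L2_AE_convergent) auto
  then have lim: "AE t in lborel. (\<lambda>n. f n t) \<longlonglongrightarrow> g t"
    by eventually_elim (simp add: g_def convergent_LIMSEQ_iff)
  have close: "(\<integral>\<^sup>+t. ennreal ((g t - f n t)\<^sup>2) \<partial>lborel) \<le> ennreal ((1 / 8) ^ n)" for n
    by (rule L2_Fatou[OF fL fL _ lim]) (use small in auto)
  have "(\<lambda>t. g t - f 0 t) \<in> L2 lborel"
    using close[of 0] by (simp add: L2_iff_nn_integral order_le_less_trans)
  from L2_add[OF this fL[of 0]] have g: "g \<in> L2 lborel" by simp
  have bound: "(norm (X (r n) - abs_l2 g))\<^sup>2 \<le> (1 / 8) ^ n" for n
  proof -
    have "(norm (X (r n) - abs_l2 g))\<^sup>2 = (LINT t|lborel. (g t - f n t)\<^sup>2)"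
      using norm_abs_l2[OF L2_diff[OF g fL, of n]]
      by (simp add: f_def abs_l2_diff g L2_nrm_def L2_inner_def power2_eq_square norm_minus_commute)
    then show ?thesis
      using close[of n] by (simp add: L2_nn_integral L2_diff g fL)
  qed
  have "(\<lambda>n. (1 / 8 :: real) ^ n) \<longlonglongrightarrow> 0" by (rule LIMSEQ_power_zero) simp
  then have "(\<lambda>n. (norm (X (r n) - abs_l2 g))\<^sup>2) \<longlonglongrightarrow> 0"
    by (rule Lim_null_comparison[rotated]) (simp add: bound)
  then have "(\<lambda>n. X (r n) - abs_l2 g) \<longlonglongrightarrow> 0"
    by (simp add: tendsto_norm_zero_iff)
  then have "(X \<circ> r) \<longlonglongrightarrow> abs_l2 g"
    by (simp add: LIM_zero_iff o_def)
  from Cauchy_converges_subseq[OF X r this] show "convergent X"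
    by (auto simp: convergent_def)
qed

lemma l2_AE_subseq:
  assumes "X \<longlonglongrightarrow> (x::l2)"
  obtains r where "strict_mono r" "AE t in lborel. (\<lambda>n. rep_l2 (X (r n)) t) \<longlonglongrightarrow> rep_l2 x t"
proof -
  define u where "u n t = (rep_l2 (X n) t - rep_l2 x t)\<^sup>2" for n t
  have u: "integrable lborel (u n)" for n
    unfolding u_def by (intro L2_square_integrable L2_diff) auto
  have "(LINT t|lborel. norm (u n t)) = (norm (X n - x))\<^sup>2" for n
    using norm_abs_l2[OF L2_diff, of "rep_l2 (X n)" "rep_l2 x"]
    by (simp add: u_def abs_l2_diff L2_nrm_def L2_inner_def power2_eq_square)
  moreover have "(\<lambda>n. (norm (X n - x))\<^sup>2) \<longlonglongrightarrow> 0"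
    using assms by (intro tendsto_null_power) (auto simp: tendsto_norm_zero_iff LIM_zero_iff)
  ultimately have "(\<lambda>n. LINT t|lborel. norm (u n t)) \<longlonglongrightarrow> 0"
    by simp
  from tendsto_L1_AE_subseq[of lborel u, OF u this]
  obtain r where r: "strict_mono r" "AE t in lborel. (\<lambda>n. u (r n) t) \<longlonglongrightarrow> 0"
    by blast
  from r(2) have "AE t in lborel. (\<lambda>n. rep_l2 (X (r n)) t) \<longlonglongrightarrow> rep_l2 x t"
  proof eventually_elim
    case (elim t)
    from tendsto_real_sqrt[OF this] have "(\<lambda>n. rep_l2 (X (r n)) t - rep_l2 x t) \<longlonglongrightarrow> 0"
      by (simp add: u_def tendsto_rabs_zero_iff)
    then show ?case by (simp add: LIM_zero_iff)
  qed
  with r(1) that show thesis by blast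
qed

section \<open>Translations and convolution operators\<close>

lemma AE_lborel_shift:
  fixes h :: real
  assumes "AE t in lborel. P t" "Measurable.pred borel P"
  shows "AE t in lborel. P (t + h)"
  using AE_borel_affine[of 1 P h] assms by (simp add: add.commute)

lemma lborel_integral_shift:
  fixes f :: "real \<Rightarrow> real"
  shows "(LINT t|lborel. f (t + h)) = (LINT t|lborel. f t)"
  using lborel_integral_real_affine[of 1 f h] by (simp add: add.commute)

lemma lborel_nn_integral_shift:
  fixes f :: "real \<Rightarrow> ennreal"
  assumes "f \<in> borel_measurable borel"
  shows "(\<integral>\<^sup>+t. f (t + h) \<partial>lborel) = (\<integral>\<^sup>+t. f t \<partial>lborel)"
  using nn_integral_real_affine[of f 1 h] assms by (simp add: add.commute)

lemma L2_shift:
  fixes h :: real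
  assumes "f \<in> L2 lborel"
  shows "(\<lambda>t. f (t + h)) \<in> L2 lborel"
proof -
  note [measurable] = L2_measurable[OF assms]
  have "integrable lborel (\<lambda>t. (f (h + 1 * t))\<^sup>2)"
    by (rule lborel_integrable_real_affine[OF L2_square_integrable[OF assms]]) simp
  then show ?thesis
    by (simp add: L2_def add.commute)
qed

definition tau :: "real \<Rightarrow> l2 \<Rightarrow> l2" where
  "tau h x = abs_l2 (\<lambda>t. rep_l2 x (t + h))"

lemma rep_tau: "AE t in lborel. rep_l2 (tau h x) t = rep_l2 x (t + h)"
  unfolding tau_def by (intro rep_abs_l2 L2_shift) simp

lemma tau_abs_l2:
  assumes "f \<in> L2 lborel"
  shows "tau h (abs_l2 f) = abs_l2 (\<lambda>t. f (t + h))"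
proof -
  note [measurable] = L2_measurable[OF assms]
  have "AE t in lborel. rep_l2 (abs_l2 f) (t + h) = f (t + h)"
    using rep_abs_l2[OF assms] by (rule AE_lborel_shift) measurable
  then show ?thesis
    unfolding tau_def using assms by (simp add: abs_l2_eq_iff L2_shift)
qed

lemma inner_tau_rep: "inner (tau h x) y = (LINT t|lborel. rep_l2 x (t + h) * rep_l2 y t)"
  using inner_abs_l2[OF L2_shift[OF rep_l2_L2[of x]] rep_l2_L2[of y]] by (simp add: tau_def)

lemma inner_tau_tau [simp]: "inner (tau h x) (tau h y) = inner x y"
proof -
  have "inner (tau h x) (tau h y) = (LINT t|lborel. rep_l2 x (t + h) * rep_l2 y (t + h))"
    unfolding tau_def by (intro inner_abs_l2 L2_shift) auto
  also have "\<dots> = (LINT t|lborel. rep_l2 x t * rep_l2 y t)"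
    by (rule lborel_integral_shift)
  finally show ?thesis by (simp add: inner_l2_def L2_inner_def)
qed

lemma norm_tau [simp]: "norm (tau h x) = norm x"
  by (simp add: norm_eq_sqrt_inner)

lemma tau_tau: "tau g (tau h x) = tau (g + h) x"
  using tau_abs_l2[OF L2_shift[OF rep_l2_L2[of x], of h], of g]
  by (simp add: tau_def[of h] tau_def[of "g + h"] add.assoc)

lemma tau_0 [simp]: "tau 0 x = x"
  by (simp add: tau_def)

lemma inner_tau_left: "inner (tau h x) y = inner x (tau (- h) y)"
  using inner_tau_tau[of h x "tau (- h) y"] by (simp add: tau_tau)

lemma tau_lincomb: "tau h (a *\<^sub>R x + b *\<^sub>R y) = a *\<^sub>R tau h x + b *\<^sub>R tau h y"
proof -
  have "tau h (a *\<^sub>R x + b *\<^sub>R y) = tau h (abs_l2 (\<lambda>t. a * rep_l2 x t + b * rep_l2 y t))"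
    by (simp add: abs_l2_lincomb)
  also have "\<dots> = a *\<^sub>R tau h x + b *\<^sub>R tau h y"
    by (subst tau_abs_l2) (simp_all add: tau_def L2_lincomb abs_l2_lincomb L2_shift)
  finally show ?thesis .
qed

lemma tau_add: "tau h (x + y) = tau h x + tau h y"
  using tau_lincomb[of h 1 x 1 y] by simp

lemma tau_diff: "tau h (x - y) = tau h x - tau h y"
  using tau_lincomb[of h 1 x "-1" y] by simp

lemma tau_scaleR: "tau h (c *\<^sub>R x) = c *\<^sub>R tau h x"
  using tau_lincomb[of h c x 0 x] by simp

lemma inner_tau_measurable [measurable]: "(\<lambda>h. inner (tau h x) y) \<in> borel_measurable borel"
  unfolding inner_tau_rep by measurable

lemma abs_inner_tau_le: "\<bar>inner (tau h x) y\<bar> \<le> norm x * norm y"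
  using Cauchy_Schwarz_ineq2[of "tau h x" y] by simp

lemma norm_tau_diff_sq: "(norm (tau h x - x))\<^sup>2 = 2 * (inner x x - inner (tau h x) x)"
  by (simp add: power2_norm_eq_inner inner_diff_left inner_diff_right inner_commute)

lemma norm_tau_diff_measurable [measurable]: "(\<lambda>h. (norm (tau h x - x))\<^sup>2) \<in> borel_measurable borel"
  unfolding norm_tau_diff_sq by measurable

text \<open>\<open>ennreal\<close> sends negative numbers to 0, so this is the integral of the
  positive part.\<close>

definition pos_mass :: "l2 \<Rightarrow> ennreal" where
  "pos_mass x = (\<integral>\<^sup>+t. ennreal (rep_l2 x t) \<partial>lborel)"

lemma pos_mass_add: "pos_mass (x + y) \<le> pos_mass x + pos_mass y"
proof -
  have "pos_mass (x + y) = (\<integral>\<^sup>+t. ennreal (rep_l2 x t + rep_l2 y t) \<partial>lborel)"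
    unfolding pos_mass_def using rep_plus[of x y] by (intro nn_integral_cong_AE) auto
  also have "\<dots> \<le> (\<integral>\<^sup>+t. ennreal (rep_l2 x t) + ennreal (rep_l2 y t) \<partial>lborel)"
  proof (intro nn_integral_mono)
    fix t
    have "ennreal (a + b) \<le> ennreal a + ennreal b" for a b
      by (cases "0 \<le> a"; cases "0 \<le> b")
        (auto simp flip: ennreal_plus simp: ennreal_neg intro!: ennreal_leI)
    then show "ennreal (rep_l2 x t + rep_l2 y t) \<le> ennreal (rep_l2 x t) + ennreal (rep_l2 y t)" .
  qed
  also have "\<dots> = pos_mass x + pos_mass y"
    unfolding pos_mass_def by (rule nn_integral_add) measurable
  finally show ?thesis .
qed

lemma pos_mass_scale:
  assumes "0 \<le> c"
  shows "pos_mass (c *\<^sub>R x) \<le> ennreal c * pos_mass x"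
proof -
  have "pos_mass (c *\<^sub>R x) = (\<integral>\<^sup>+t. ennreal c * ennreal (rep_l2 x t) \<partial>lborel)"
    unfolding pos_mass_def using rep_scaleR[of c x] assms
    by (intro nn_integral_cong_AE) (auto simp: ennreal_mult')
  then show ?thesis
    unfolding pos_mass_def by (simp add: nn_integral_cmult)
qed

text \<open>Fatou's lemma along a subsequence that converges almost everywhere.\<close>

lemma closed_pos_mass: "closed {x. pos_mass x \<le> r}"
  unfolding closed_sequential_limits
proof (intro allI impI, elim conjE)
  fix X :: "nat \<Rightarrow> l2" and x
  assume X: "\<forall>n. X n \<in> {x. pos_mass x \<le> r}" "X \<longlonglongrightarrow> x"
  obtain s where s: "strict_mono s" "AE t in lborel. (\<lambda>n. rep_l2 (X (s n)) t) \<longlonglongrightarrow> rep_l2 x t"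
    using l2_AE_subseq[OF X(2)] by blast
  have "pos_mass x = (\<integral>\<^sup>+t. liminf (\<lambda>n. ennreal (rep_l2 (X (s n)) t)) \<partial>lborel)"
    unfolding pos_mass_def
  proof (intro nn_integral_cong_AE)
    show "AE t in lborel. ennreal (rep_l2 x t) = liminf (\<lambda>n. ennreal (rep_l2 (X (s n)) t))"
      using s(2) by eventually_elim (intro lim_imp_Liminf[symmetric] tendsto_ennrealI, auto)
  qed
  also have "\<dots> \<le> liminf (\<lambda>n. pos_mass (X (s n)))"
    unfolding pos_mass_def by (rule nn_integral_liminf) measurable
  also have "\<dots> \<le> limsup (\<lambda>n. pos_mass (X (s n)))"
    by (rule Liminf_le_Limsup) simp
  also have "\<dots> \<le> r"
    using X(1) by (intro Limsup_bounded) auto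
  finally show "x \<in> {x. pos_mass x \<le> r}" by simp
qed

section \<open>Convolution with an even integrable kernel\<close>

locale conv_kernel =
  fixes \<kappa> :: "real \<Rightarrow> real"
  assumes nonneg: "0 \<le> \<kappa> h"
    and integrable: "integrable lborel \<kappa>"
    and even: "\<kappa> (- h) = \<kappa> h"
    and mass_pos: "0 < (LINT h|lborel. \<kappa> h)"
begin

definition mass :: real where "mass = (LINT h|lborel. \<kappa> h)"

lemma kernel_measurable [measurable]: "\<kappa> \<in> borel_measurable borel"
  using integrable by (auto dest: borel_measurable_integrable)

lemma integrable_bounded_mult:
  assumes [measurable]: "g \<in> borel_measurable borel" and "\<And>h. \<bar>g h\<bar> \<le> C"
  shows "integrable lborel (\<lambda>h. \<kappa> h * g h)"
proof (rule Bochner_Integration.integrable_bound[OF integrable_mult_left[OF integrable, of C]])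
  show "AE h in lborel. norm (\<kappa> h * g h) \<le> norm (\<kappa> h * C)"
    using assms(2) nonneg by (intro AE_I2) (auto simp: abs_mult intro!: mult_left_mono order_trans[OF assms(2) abs_ge_self])
qed measurable

lemma integrable_inner_tau: "integrable lborel (\<lambda>h. \<kappa> h * inner (tau h x) y)"
  by (rule integrable_bounded_mult[OF _ abs_inner_tau_le]) measurable

definition conv :: "(real \<Rightarrow> real) \<Rightarrow> real \<Rightarrow> real" where
  "conv f t = (LINT h|lborel. \<kappa> h * f (t + h))"

lemma conv_measurable [measurable]:
  assumes [measurable]: "f \<in> borel_measurable borel"
  shows "conv f \<in> borel_measurable borel"
  unfolding conv_def[abs_def] by measurable

text \<open>Cauchy-Schwarz for the measure with density \<open>\<kappa>\<close>, from a nonnegative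
  quadratic polynomial in c. Where the integral on the right is infinite, \<open>conv\<close> may be
  a default value, but positive mass makes the right side infinite as well.\<close>

lemma conv_square_le:
  assumes [measurable]: "f \<in> borel_measurable borel"
  shows "ennreal ((conv f t)\<^sup>2) \<le> ennreal mass * (\<integral>\<^sup>+h. ennreal (\<kappa> h * (f (t + h))\<^sup>2) \<partial>lborel)"
proof (cases "(\<integral>\<^sup>+h. ennreal (\<kappa> h * (f (t + h))\<^sup>2) \<partial>lborel) < \<infinity>")
  case True
  have int2: "integrable lborel (\<lambda>h. \<kappa> h * (f (t + h))\<^sup>2)"
    using True nonneg by (intro integrableI_nonneg) auto
  have int1: "integrable lborel (\<lambda>h. \<kappa> h * f (t + h))"
  proof (rule Bochner_Integration.integrable_bound[OF Bochner_Integration.integrable_add[OF integrable int2]])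
    show "AE h in lborel. norm (\<kappa> h * f (t + h)) \<le> norm (\<kappa> h + \<kappa> h * (f (t + h))\<^sup>2)"
    proof (intro AE_I2)
      fix h
      have "\<bar>a\<bar> \<le> 1 + a\<^sup>2" for a :: real
        using sum_squares_bound[of "\<bar>a\<bar>" 1] by (simp add: abs_if split: if_splits)
      then have "\<kappa> h * \<bar>f (t + h)\<bar> \<le> \<kappa> h * (1 + (f (t + h))\<^sup>2)"
        by (intro mult_left_mono nonneg)
      then show "norm (\<kappa> h * f (t + h)) \<le> norm (\<kappa> h + \<kappa> h * (f (t + h))\<^sup>2)"
        using nonneg[of h] by (simp add: abs_mult algebra_simps)
    qed
  qed measurable
  have "(conv f t)\<^sup>2 \<le> (LINT h|lborel. \<kappa> h * (f (t + h))\<^sup>2) * mass"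
  proof (rule quadratic_nonneg_imp_discriminant)
    show "0 \<le> mass" using mass_pos by (simp add: mass_def)
    fix c
    have "0 \<le> (LINT h|lborel. \<kappa> h * (f (t + h) + c)\<^sup>2)"
      by (intro integral_nonneg_AE AE_I2 mult_nonneg_nonneg nonneg) simp
    also have "(\<lambda>h. \<kappa> h * (f (t + h) + c)\<^sup>2)
        = (\<lambda>h. \<kappa> h * (f (t + h))\<^sup>2 + (2 * c) * (\<kappa> h * f (t + h)) + c\<^sup>2 * \<kappa> h)"
      by (simp add: power2_sum algebra_simps fun_eq_iff)
    also have "(LINT h|lborel. \<dots> h) = (LINT h|lborel. \<kappa> h * (f (t + h))\<^sup>2) + 2 * c * conv f t + c\<^sup>2 * mass"
      using int1 int2 integrable by (simp add: conv_def mass_def)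
    finally show "0 \<le> (LINT h|lborel. \<kappa> h * (f (t + h))\<^sup>2) + 2 * c * conv f t + c\<^sup>2 * mass" .
  qed
  then have "ennreal ((conv f t)\<^sup>2) \<le> ennreal (mass * (LINT h|lborel. \<kappa> h * (f (t + h))\<^sup>2))"
    by (simp add: ennreal_leI mult.commute)
  also have "\<dots> = ennreal mass * (\<integral>\<^sup>+h. ennreal (\<kappa> h * (f (t + h))\<^sup>2) \<partial>lborel)"
  proof -
    have "(\<integral>\<^sup>+h. ennreal (\<kappa> h * (f (t + h))\<^sup>2) \<partial>lborel) = ennreal (LINT h|lborel. \<kappa> h * (f (t + h))\<^sup>2)"
      by (rule nn_integral_eq_integral[OF int2]) (simp add: nonneg)
    then show ?thesis
      using mass_pos by (simp only: ennreal_mult' mass_def less_imp_le)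
  qed
  finally show ?thesis .
next
  case False
  then have "(\<integral>\<^sup>+h. ennreal (\<kappa> h * (f (t + h))\<^sup>2) \<partial>lborel) = \<infinity>"
    by (simp add: less_top[symmetric])
  then show ?thesis
    using mass_pos by (simp add: mass_def ennreal_mult_top)
qed

lemma nn_integral_kernel: "(\<integral>\<^sup>+h. ennreal (\<kappa> h) \<partial>lborel) = ennreal mass"
  unfolding mass_def by (intro nn_integral_eq_integral integrable AE_I2 nonneg)

lemma nn_integral_shift_kernel:
  assumes [measurable]: "f \<in> borel_measurable borel"
  shows "(\<integral>\<^sup>+t. \<integral>\<^sup>+h. ennreal (\<kappa> h) * f (t + h) \<partial>lborel \<partial>lborel) = ennreal mass * (\<integral>\<^sup>+t. f t \<partial>lborel)"
proof -
  have "(\<integral>\<^sup>+t. \<integral>\<^sup>+h. ennreal (\<kappa> h) * f (t + h) \<partial>lborel \<partial>lborel)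
      = (\<integral>\<^sup>+h. \<integral>\<^sup>+t. ennreal (\<kappa> h) * f (t + h) \<partial>lborel \<partial>lborel)"
    by (rule lborel_pair.Fubini') measurable
  also have "\<dots> = (\<integral>\<^sup>+h. ennreal (\<kappa> h) * (\<integral>\<^sup>+t. f t \<partial>lborel) \<partial>lborel)"
    by (simp add: nn_integral_cmult lborel_nn_integral_shift)
  also have "\<dots> = ennreal mass * (\<integral>\<^sup>+t. f t \<partial>lborel)"
    by (simp add: nn_integral_multc nn_integral_kernel)
  finally show ?thesis .
qed

lemma conv_L2:
  assumes "f \<in> L2 lborel"
  shows "conv f \<in> L2 lborel"
proof -
  have [measurable]: "f \<in> borel_measurable borel" using assms by (simp add: L2_def)
  have "(\<integral>\<^sup>+t. ennreal ((conv f t)\<^sup>2) \<partial>lborel)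
      \<le> (\<integral>\<^sup>+t. ennreal mass * (\<integral>\<^sup>+h. ennreal (\<kappa> h * (f (t + h))\<^sup>2) \<partial>lborel) \<partial>lborel)"
    by (intro nn_integral_mono conv_square_le) measurable
  also have "\<dots> = ennreal mass * (\<integral>\<^sup>+t. \<integral>\<^sup>+h. ennreal (\<kappa> h) * ennreal ((f (t + h))\<^sup>2) \<partial>lborel \<partial>lborel)"
    using nonneg by (simp add: nn_integral_cmult ennreal_mult')
  also have "\<dots> = ennreal mass * (ennreal mass * (\<integral>\<^sup>+t. ennreal ((f t)\<^sup>2) \<partial>lborel))"
    using nn_integral_shift_kernel[of "\<lambda>t. ennreal ((f t)\<^sup>2)"] by simp
  also have "\<dots> < \<infinity>"
    using assms by (simp add: L2_nn_integral ennreal_mult_less_top)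
  finally show ?thesis
    by (simp add: L2_iff_nn_integral)
qed

definition op :: "l2 \<Rightarrow> l2" where "op x = abs_l2 (conv (rep_l2 x))"

lemma rep_op: "AE t in lborel. rep_l2 (op x) t = conv (rep_l2 x) t"
  unfolding op_def by (intro rep_abs_l2 conv_L2) simp

lemma inner_op: "inner (op x) y = (LINT h|lborel. \<kappa> h * inner (tau h x) y)"
proof -
  let ?G = "\<lambda>h t. \<kappa> h * (rep_l2 x (t + h) * rep_l2 y t)"
  have intG: "integrable (lborel \<Otimes>\<^sub>M lborel) (\<lambda>(h, t). ?G h t)"
  proof (rule lborel_pair.Fubini_integrable)
    \<comment> \<open>With absolute values in place of both functions, the integral of the norm
      becomes a pairing of the same kind, whose integrability is known.\<close>
    define ax where "ax = abs_l2 (\<lambda>t. \<bar>rep_l2 x t\<bar>)"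
    define ay where "ay = abs_l2 (\<lambda>t. \<bar>rep_l2 y t\<bar>)"
    have "(LINT t|lborel. norm (?G h t)) = \<kappa> h * inner (tau h ax) ay" for h
    proof -
      have "inner (tau h ax) ay = (LINT t|lborel. \<bar>rep_l2 x (t + h)\<bar> * \<bar>rep_l2 y t\<bar>)"
        unfolding ax_def ay_def
        by (simp add: tau_abs_l2 L2_abs) (intro inner_abs_l2 L2_shift L2_abs; simp)
      then show ?thesis
        using nonneg[of h] by (simp add: abs_mult)
    qed
    then show "integrable lborel (\<lambda>h. LINT t|lborel. norm ((\<lambda>(h, t). ?G h t) (h, t)))"
      using integrable_inner_tau[of ax ay] by simp
    show "AE h in lborel. integrable lborel (\<lambda>t. (\<lambda>(h, t). ?G h t) (h, t))"
      by (simp, intro AE_I2 disjI2 L2_mult_integrable L2_shift rep_l2_L2)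
  qed measurable
  have "inner (op x) y = (LINT t|lborel. conv (rep_l2 x) t * rep_l2 y t)"
    unfolding op_def using inner_abs_l2[OF conv_L2[OF rep_l2_L2] rep_l2_L2, of x y] by simp
  also have "\<dots> = (LINT t|lborel. LINT h|lborel. ?G h t)"
    by (simp add: conv_def mult.assoc flip: integral_mult_left_zero)
  also have "\<dots> = (LINT h|lborel. LINT t|lborel. ?G h t)"
    using lborel_pair.Fubini_integral[OF intG] by simp
  also have "\<dots> = (LINT h|lborel. \<kappa> h * inner (tau h x) y)"
    by (simp add: inner_tau_rep)
  finally show ?thesis .
qed

lemma op_inner_le: "\<bar>inner (op x) y\<bar> \<le> mass * (norm x * norm y)"
proof -
  have "\<bar>inner (op x) y\<bar> \<le> (LINT h|lborel. \<kappa> h * (norm x * norm y))"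
    unfolding inner_op
  proof (rule integral_abs_bound_integral[OF integrable_inner_tau])
    show "\<bar>\<kappa> h * inner (tau h x) y\<bar> \<le> \<kappa> h * (norm x * norm y)" for h
      using mult_left_mono[OF abs_inner_tau_le nonneg] nonneg[of h] by (simp add: abs_mult)
  qed (simp add: integrable)
  then show ?thesis by (simp add: mass_def)
qed

lemma norm_op: "norm (op x) \<le> mass * norm x"
proof (cases "op x = 0")
  case False
  have "norm (op x) * norm (op x) = inner (op x) (op x)"
    by (simp add: dot_square_norm power2_eq_square)
  also have "\<dots> \<le> mass * norm x * norm (op x)"
    using op_inner_le[of x "op x"] by simp
  finally show ?thesis using False by simp
qed (use mass_pos in \<open>simp add: mass_def\<close>)

lemma bounded_linear_op: "bounded_linear op"
proof (rule bounded_linear_intro)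
  show "op (x + y) = op x + op y" for x y
    by (rule vector_eq_rdot[THEN iffD1])
      (simp add: inner_op inner_add_left tau_add integrable_inner_tau distrib_left)
  show "op (c *\<^sub>R x) = c *\<^sub>R op x" for c x
    by (rule vector_eq_rdot[THEN iffD1])
      (simp add: inner_op tau_scaleR mult.left_commute[of _ c])
  show "norm (op x) \<le> norm x * mass" for x
    using norm_op[of x] by (simp add: mult.commute)
qed

definition endo :: "l2 endo" where "endo = endo_of_blinfun (Blinfun op)"

lemma app_endo: "app endo = op"
  by (simp add: endo_def app.abs_eq bounded_linear_Blinfun_apply bounded_linear_op)

lemma inner_endo: "inner (app endo x) y = (LINT h|lborel. \<kappa> h * inner (tau h x) y)"
  by (simp add: app_endo inner_op)

lemma norm_endo: "norm endo \<le> mass"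
  using mass_pos norm_op by (intro norm_endo_bound) (auto simp: app_endo mass_def)

lemma endo_self_adjoint: "self_adjoint endo"
  unfolding self_adjoint_def
proof (intro allI)
  fix x y
  have "inner (app endo x) y = (LINT h|lborel. \<kappa> h * inner (tau (- h) y) x)"
    by (simp only: inner_endo inner_tau_left[of _ x] inner_commute[of x])
  also have "\<dots> = (LINT h|lborel. \<kappa> h * inner (tau h y) x)"
    using lborel_integral_real_affine[of "-1" "\<lambda>h. \<kappa> h * inner (tau (- h) y) x" 0] by (simp add: even)
  also have "\<dots> = inner x (app endo y)"
    by (simp add: inner_endo inner_commute[of x])
  finally show "inner (app endo x) y = inner x (app endo y)" .
qed

lemma endo_tau: "app endo (tau h x) = tau h (app endo x)"
proof -
  have "inner (tau g x) (tau (- h) y) = inner (tau g (tau h x)) y" for g y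
    using inner_tau_left[of h "tau g x" y] by (simp add: tau_tau add.commute)
  then have "inner (app endo (tau h x)) y = inner (tau h (app endo x)) y" for y
    by (simp only: inner_endo inner_tau_left[of h "app endo x"])
  then show ?thesis
    using vector_eq_rdot by blast
qed

lemma pos_mass_endo: "pos_mass (app endo x) \<le> ennreal mass * pos_mass x"
proof -
  \<comment> \<open>An integral is at most the integral of the positive part; for a non-integrable g
    the left side is the default value 0.\<close>
  have le: "ennreal (LINT h|lborel. g h) \<le> (\<integral>\<^sup>+h. ennreal (g h) \<partial>lborel)" for g :: "real \<Rightarrow> real"
  proof (cases "integrable lborel g")
    case True
    then have "(LINT h|lborel. g h) \<le> enn2real (\<integral>\<^sup>+h. ennreal (g h) \<partial>lborel)"
      by (simp add: real_lebesgue_integral_def)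
    moreover have "(\<integral>\<^sup>+h. ennreal (g h) \<partial>lborel) < \<infinity>"
      using True by (simp add: real_integrable_def top.not_eq_extremum)
    ultimately show ?thesis
      by (metis ennreal_enn2real ennreal_leI infinity_ennreal_def)
  qed (simp add: not_integrable_integral_eq)
  have "pos_mass (app endo x) = (\<integral>\<^sup>+t. ennreal (conv (rep_l2 x) t) \<partial>lborel)"
    unfolding pos_mass_def app_endo using rep_op[of x] by (intro nn_integral_cong_AE) auto
  also have "\<dots> \<le> (\<integral>\<^sup>+t. \<integral>\<^sup>+h. ennreal (\<kappa> h * rep_l2 x (t + h)) \<partial>lborel \<partial>lborel)"
    unfolding conv_def by (intro nn_integral_mono le)
  also have "\<dots> = ennreal mass * pos_mass x"
    using nn_integral_shift_kernel[of "\<lambda>t. ennreal (rep_l2 x t)"] nonneg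
    by (simp add: ennreal_mult' pos_mass_def)
  finally show ?thesis .
qed

text \<open>Expand the squared norm by invariance of the inner product under translations. This
  turns a bounded operator into a jump form.\<close>

lemma energy:
  "mass * inner x x - inner (app endo x) x = (LINT h|lborel. \<kappa> h * (norm (tau h x - x))\<^sup>2) / 2"
proof -
  have "(LINT h|lborel. \<kappa> h * (norm (tau h x - x))\<^sup>2)
      = (LINT h|lborel. 2 * (\<kappa> h * inner x x - \<kappa> h * inner (tau h x) x))"
    by (simp add: norm_tau_diff_sq algebra_simps)
  also have "\<dots> = 2 * (mass * inner x x - inner (app endo x) x)"
    by (simp add: integrable integrable_inner_tau inner_endo mass_def)
  finally show ?thesis by simp
qed

end

text \<open>The second operator commutes with translations, and the first is an average of
  translations.\<close>

lemma conv_kernel_commute: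
  assumes "conv_kernel \<kappa>" "conv_kernel \<mu>"
  shows "conv_kernel.endo \<kappa> * conv_kernel.endo \<mu> = conv_kernel.endo \<mu> * conv_kernel.endo \<kappa>"
proof -
  interpret K: conv_kernel \<kappa> by fact
  interpret M: conv_kernel \<mu> by fact
  have "inner (app K.endo (app M.endo x)) y = inner (app M.endo (app K.endo x)) y" for x y
  proof -
    have "inner (app K.endo (app M.endo x)) y = (LINT h|lborel. \<kappa> h * inner (app M.endo (tau h x)) y)"
      by (simp add: K.inner_endo M.endo_tau)
    also have "\<dots> = inner (app K.endo x) (app M.endo y)"
      by (simp add: K.inner_endo self_adjointD[OF M.endo_self_adjoint])
    finally show ?thesis
      by (simp add: self_adjointD[OF M.endo_self_adjoint])
  qed
  then have "app K.endo (app M.endo x) = app M.endo (app K.endo x)" for x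
    using vector_eq_rdot by blast
  then show ?thesis
    by (intro endo_eqI) (simp add: app_mult)
qed

section \<open>Functions that are Lipschitz along translations, and their density\<close>

lemma abs_l2_tendsto_dominated:
  assumes meas: "\<And>n. f n \<in> borel_measurable borel" "f' \<in> borel_measurable borel"
    and g: "g \<in> L2 lborel" and le: "\<And>n t. \<bar>f n t\<bar> \<le> g t"
    and lim: "\<And>t. (\<lambda>n. f n t) \<longlonglongrightarrow> f' t"
  shows "f' \<in> L2 lborel" "(\<lambda>n. abs_l2 (f n)) \<longlonglongrightarrow> abs_l2 f'"
proof -
  note [measurable] = meas L2_measurable[OF g]
  have g0: "0 \<le> g t" for t using le[of undefined t] by linarith
  have le': "\<bar>f' t\<bar> \<le> g t" for t
    by (rule LIMSEQ_le_const2[OF tendsto_rabs[OF lim]]) (use le in auto)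
  have L: "f n \<in> L2 lborel" for n
    using le g0 by (intro L2_dominated[OF g]) auto
  show L': "f' \<in> L2 lborel"
    using le' g0 by (intro L2_dominated[OF g]) auto
  have "(\<lambda>n. LINT t|lborel. (f n t - f' t)\<^sup>2) \<longlonglongrightarrow> (LINT t|(lborel :: real measure). 0)"
  proof (rule integral_dominated_convergence[where w = "\<lambda>t. 4 * (g t)\<^sup>2"])
    show "integrable lborel (\<lambda>t. 4 * (g t)\<^sup>2)"
      using g by (simp add: L2_square_integrable)
    show "AE t in lborel. (\<lambda>n. (f n t - f' t)\<^sup>2) \<longlonglongrightarrow> 0"
      using lim by (intro AE_I2 tendsto_null_power) (simp_all add: LIM_zero_iff)
    show "AE t in lborel. norm ((f n t - f' t)\<^sup>2) \<le> 4 * (g t)\<^sup>2" for n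
    proof (intro AE_I2)
      fix t
      have "\<bar>f n t - f' t\<bar> \<le> 2 * g t" using le[of n t] le'[of t] by linarith
      then have "\<bar>f n t - f' t\<bar>\<^sup>2 \<le> (2 * g t)\<^sup>2" by (rule power_mono) simp
      then show "norm ((f n t - f' t)\<^sup>2) \<le> 4 * (g t)\<^sup>2" by (simp add: power_mult_distrib)
    qed
  qed measurable
  moreover have "(LINT t|lborel. (f n t - f' t)\<^sup>2) = (norm (abs_l2 (f n) - abs_l2 f'))\<^sup>2" for n
    using norm_abs_l2[OF L2_diff[OF L L', of n]]
    by (simp add: abs_l2_diff L L' L2_nrm_def L2_inner_def power2_eq_square)
  ultimately have "(\<lambda>n. (norm (abs_l2 (f n) - abs_l2 f'))\<^sup>2) \<longlonglongrightarrow> 0" by simp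
  from tendsto_real_sqrt[OF this] show "(\<lambda>n. abs_l2 (f n)) \<longlonglongrightarrow> abs_l2 f'"
    by (simp add: tendsto_norm_zero_iff LIM_zero_iff)
qed

lemma integrable_indicator_Icc: "integrable lborel (indicator {a..b} :: real \<Rightarrow> real)"
  by (rule integrable_real_indicator) (auto simp: emeasure_lborel_Icc_eq)

lemma L2_indicator_bounded:
  assumes "A \<in> sets borel" "A \<subseteq> {- r..r}"
  shows "(indicator A :: real \<Rightarrow> real) \<in> L2 lborel"
proof -
  have "emeasure lborel A \<le> emeasure lborel {- r..r}"
    using assms by (intro emeasure_mono) auto
  also have "\<dots> < \<infinity>" by (rule emeasure_lborel_cbox_finite[of "- r" r, unfolded cbox_interval])
  finally have "integrable lborel (indicator A :: real \<Rightarrow> real)"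
    using assms by (intro integrable_real_indicator) auto
  moreover have "(\<lambda>t. (indicator A t :: real)\<^sup>2) = indicator A"
    by (auto simp: indicator_def fun_eq_iff)
  ultimately show ?thesis using assms by (simp add: L2_def)
qed

lemma L2_bounded_support:
  fixes f :: "real \<Rightarrow> real"
  assumes [measurable]: "f \<in> borel_measurable borel"
    and "\<And>t. \<bar>f t\<bar> \<le> B" "\<And>t. r < \<bar>t\<bar> \<Longrightarrow> f t = 0"
  shows "f \<in> L2 lborel"
proof (rule L2_dominated)
  show "(\<lambda>t. B * indicator {- r..r} t) \<in> L2 lborel"
    by (intro L2_cmult L2_indicator_bounded[where r = r]) auto
  show "\<bar>f t\<bar> \<le> \<bar>B * indicator {- r..r} t\<bar>" for t
    using assms(2)[of t] assms(3)[of t] by (auto simp: indicator_def abs_le_iff split: if_splits)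
qed simp

text \<open>The difference vanishes unless t or t + h lies in \<open>{- r..r}\<close>, a set of
  measure at most 4 r.\<close>

lemma translation_energy_le:
  fixes f :: "real \<Rightarrow> real"
  assumes [measurable]: "f \<in> borel_measurable borel"
    and f: "f \<in> L2 lborel" and supp: "\<And>t. r < \<bar>t\<bar> \<Longrightarrow> f t = 0" and "0 \<le> r"
    and c: "\<And>t. \<bar>f (t + h) - f t\<bar> \<le> c"
  shows "(norm (tau h (abs_l2 f) - abs_l2 f))\<^sup>2 \<le> 4 * r * c\<^sup>2"
proof -
  have fh: "(\<lambda>t. f (t + h)) \<in> L2 lborel" by (rule L2_shift[OF f])
  have I: "(LINT t|lborel. indicator {- r..r} t) = 2 * r"
    using \<open>0 \<le> r\<close> by simp
  have "(norm (tau h (abs_l2 f) - abs_l2 f))\<^sup>2 = (LINT t|lborel. (f (t + h) - f t)\<^sup>2)"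
    using norm_abs_l2[OF L2_diff[OF fh f]]
    by (simp add: abs_l2_diff f fh tau_abs_l2 L2_nrm_def L2_inner_def power2_eq_square)
  also have "\<dots> \<le> (LINT t|lborel. c\<^sup>2 * (indicator {- r..r} (t + h) + indicator {- r..r} t))"
  proof (rule integral_mono)
    show "integrable lborel (\<lambda>t. (f (t + h) - f t)\<^sup>2)"
      by (intro L2_square_integrable L2_diff fh f)
    have "integrable lborel (\<lambda>t. indicator {- r..r} (h + 1 * t) :: real)"
      by (rule lborel_integrable_real_affine[OF integrable_indicator_Icc]) simp
    with integrable_indicator_Icc show "integrable lborel (\<lambda>t. c\<^sup>2 * (indicator {- r..r} (t + h) + indicator {- r..r} t))"
      by (simp add: add.commute)
    show "(f (t + h) - f t)\<^sup>2 \<le> c\<^sup>2 * (indicator {- r..r} (t + h) + indicator {- r..r} t)" for t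
    proof (cases "t + h \<in> {- r..r} \<or> t \<in> {- r..r}")
      case True
      have "(f (t + h) - f t)\<^sup>2 \<le> c\<^sup>2"
        using power_mono[OF c[of t], of 2] by simp
      also have "c\<^sup>2 * 1 \<le> c\<^sup>2 * (indicator {- r..r} (t + h) + indicator {- r..r} t)"
        using True by (intro mult_left_mono) (auto simp: indicator_def)
      finally show ?thesis by simp
    next
      case False
      then have "f (t + h) = 0" "f t = 0" by (auto intro!: supp)
      then show ?thesis by simp
    qed
  qed
  also have "\<dots> = c\<^sup>2 * (2 * r + 2 * r)"
  proof -
    have "integrable lborel (\<lambda>t. indicator {- r..r} (h + 1 * t) :: real)"
      by (rule lborel_integrable_real_affine[OF integrable_indicator_Icc]) simp
    then show ?thesis
      using I integrable_indicator_Icc lborel_integral_shift[of "indicator {- r..r}" h] by (simp add: add.commute)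
  qed
  finally show ?thesis by (simp add: mult.commute)
qed

text \<open>\<open>min 1 \<bar>h\<bar>\<close> is the weight that the Levy density integrates, see
  \<open>integrable_lev\<close>; on this set the truncated generators converge in norm.\<close>

definition lip :: "l2 set" where
  "lip = {x. \<exists>C. \<forall>h. norm (tau h x - x) \<le> C * min 1 \<bar>h\<bar>}"

lemma lip_lincomb:
  assumes "x \<in> lip" "y \<in> lip"
  shows "a *\<^sub>R x + b *\<^sub>R y \<in> lip"
proof -
  obtain C D where C: "\<And>h. norm (tau h x - x) \<le> C * min 1 \<bar>h\<bar>" and D: "\<And>h. norm (tau h y - y) \<le> D * min 1 \<bar>h\<bar>"
    using assms by (auto simp: lip_def)
  have "norm (tau h (a *\<^sub>R x + b *\<^sub>R y) - (a *\<^sub>R x + b *\<^sub>R y)) \<le> (\<bar>a\<bar> * C + \<bar>b\<bar> * D) * min 1 \<bar>h\<bar>" for h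
  proof -
    have "tau h (a *\<^sub>R x + b *\<^sub>R y) - (a *\<^sub>R x + b *\<^sub>R y) = a *\<^sub>R (tau h x - x) + b *\<^sub>R (tau h y - y)"
      by (simp add: tau_lincomb algebra_simps)
    also have "norm \<dots> \<le> \<bar>a\<bar> * norm (tau h x - x) + \<bar>b\<bar> * norm (tau h y - y)"
      by (rule order_trans[OF norm_triangle_ineq]) simp
    also have "\<dots> \<le> \<bar>a\<bar> * (C * min 1 \<bar>h\<bar>) + \<bar>b\<bar> * (D * min 1 \<bar>h\<bar>)"
      by (intro add_mono mult_left_mono C D) auto
    finally show ?thesis by (simp add: algebra_simps)
  qed
  then show ?thesis unfolding lip_def by blast
qed

lemma lip_abs_l2:
  fixes f :: "real \<Rightarrow> real"
  assumes [measurable]: "f \<in> borel_measurable borel"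
    and B: "\<And>t. \<bar>f t\<bar> \<le> B" and supp: "\<And>t. r < \<bar>t\<bar> \<Longrightarrow> f t = 0"
    and L: "\<And>s t. \<bar>f s - f t\<bar> \<le> L * \<bar>s - t\<bar>"
  shows "abs_l2 f \<in> lip"
proof -
  define K where "K = max L (2 * B)"
  define r' where "r' = max r 0"
  have "0 \<le> B" using B[of 0] by linarith
  then have K: "0 \<le> K" by (simp add: K_def)
  have f: "f \<in> L2 lborel" by (rule L2_bounded_support[OF _ B supp]) simp
  have "norm (tau h (abs_l2 f) - abs_l2 f) \<le> (2 * sqrt r' * K) * min 1 \<bar>h\<bar>" for h
  proof -
    have "\<bar>f (t + h) - f t\<bar> \<le> K * min 1 \<bar>h\<bar>" for t
    proof -
      have "\<bar>f (t + h) - f t\<bar> \<le> L * \<bar>h\<bar>" using L[of "t + h" t] by simp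
      also have "\<dots> \<le> K * \<bar>h\<bar>" by (intro mult_right_mono) (auto simp: K_def)
      finally have 1: "\<bar>f (t + h) - f t\<bar> \<le> K * \<bar>h\<bar>" .
      have "\<bar>f (t + h) - f t\<bar> \<le> 2 * B" using B[of t] B[of "t + h"] by linarith
      then have "\<bar>f (t + h) - f t\<bar> \<le> K * 1" by (simp add: K_def)
      with 1 show ?thesis by (simp add: min_def)
    qed
    from translation_energy_le[OF _ f _ _ this, of r'] supp
    have "(norm (tau h (abs_l2 f) - abs_l2 f))\<^sup>2 \<le> 4 * r' * (K * min 1 \<bar>h\<bar>)\<^sup>2"
      by (simp add: r'_def)
    also have "\<dots> = ((2 * sqrt r' * K) * min 1 \<bar>h\<bar>)\<^sup>2"
      by (simp add: power_mult_distrib r'_def)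
    finally show ?thesis
      by (rule power2_le_imp_le) (use K in \<open>simp add: r'_def\<close>)
  qed
  then show ?thesis unfolding lip_def by blast
qed

lemma zero_in_lip: "0 \<in> lip"
proof -
  have "abs_l2 (\<lambda>_. 0) \<in> lip"
    by (rule lip_abs_l2[where B = 0 and r = 0 and L = 0]) auto
  then show ?thesis by (simp add: zero_l2_def)
qed

lemma closure_lip_lincomb:
  assumes "x \<in> closure lip" "y \<in> closure lip"
  shows "a *\<^sub>R x + b *\<^sub>R y \<in> closure lip"
proof -
  obtain X Y where "\<And>n. X n \<in> lip" "X \<longlonglongrightarrow> x" "\<And>n. Y n \<in> lip" "Y \<longlonglongrightarrow> y"
    using assms unfolding closure_sequential by metis
  then show ?thesis
    unfolding closure_sequential
    by (intro exI[of _ "\<lambda>n. a *\<^sub>R X n + b *\<^sub>R Y n"] conjI allI lip_lincomb tendsto_intros)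
qed

lemma closure_lip_LIMSEQ: "(\<And>n. X n \<in> closure lip) \<Longrightarrow> X \<longlonglongrightarrow> x \<Longrightarrow> x \<in> closure lip"
  by (rule closed_sequentially[OF closed_closure])

lemma indicator_compact_in_closure_lip:
  assumes "compact T" "T \<subseteq> {- r..r}"
  shows "abs_l2 (indicator T) \<in> closure lip"
proof (cases "T = {}")
  case True
  then have "indicator T = (\<lambda>_. 0 :: real)" by (auto simp: fun_eq_iff)
  then show ?thesis
    using zero_in_lip closure_subset by (auto simp: zero_l2_def)
next
  case False
  define f where "f n t = max 0 (1 - real n * infdist t T)" for n t
  have [measurable]: "f n \<in> borel_measurable borel" for n
    unfolding f_def by (intro borel_measurable_continuous_onI continuous_intros)
  have f01: "0 \<le> f n t" "f n t \<le> 1" for n t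
    using infdist_nonneg[of t T] by (auto simp: f_def)
  \<comment> \<open>From index 1 on the functions vanish at distance 1 from T and thus share a
    bounded support; \<open>f 0\<close> is constantly 1.\<close>
  have supp: "f (Suc n) t = 0" if "r + 1 < \<bar>t\<bar>" for n t
  proof -
    have "1 \<le> infdist t T"
      unfolding infdist_notempty[OF False]
    proof (intro cINF_greatest[OF False])
      fix s assume "s \<in> T"
      with assms(2) have "s \<in> {- r..r}" by blast
      then have "\<bar>s\<bar> \<le> r" by (simp add: abs_le_iff)
      then show "1 \<le> dist t s" using that by (simp add: dist_real_def)
    qed
    then have "1 * 1 \<le> real (Suc n) * infdist t T"
      by (intro mult_mono) auto
    then show ?thesis by (simp add: f_def)
  qed
  have Lip: "\<bar>f n s - f n t\<bar> \<le> real n * \<bar>s - t\<bar>" for n s t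
  proof -
    have "\<bar>infdist s T - infdist t T\<bar> \<le> \<bar>s - t\<bar>"
      using infdist_triangle_abs[of s T t] by (simp add: dist_real_def)
    then have "\<bar>real n * infdist s T - real n * infdist t T\<bar> \<le> real n * \<bar>s - t\<bar>"
      by (metis abs_mult abs_of_nat mult_left_mono of_nat_0_le_iff right_diff_distrib)
    then show ?thesis unfolding f_def by linarith
  qed
  have "(\<lambda>n. abs_l2 (f (Suc n))) \<longlonglongrightarrow> abs_l2 (indicator T)"
  proof (rule abs_l2_tendsto_dominated)
    show "(indicator {- (r + 1)..r + 1} :: real \<Rightarrow> real) \<in> L2 lborel"
      by (rule L2_indicator_bounded[where r = "r + 1"]) auto
    show "\<bar>f (Suc n) t\<bar> \<le> indicator {- (r + 1)..r + 1} t" for n t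
      using f01[of "Suc n" t] supp[of t n] by (auto simp: indicator_def)
    show "(\<lambda>n. f (Suc n) t) \<longlonglongrightarrow> indicator T t" for t
    proof (cases "t \<in> T")
      case True
      then show ?thesis by (simp add: f_def)
    next
      case notin: False
      then have pos: "0 < infdist t T"
        using infdist_pos_not_in_closed[OF compact_imp_closed[OF assms(1)] False] by simp
      then obtain N where N: "1 < real N * infdist t T"
        using reals_Archimedean3 by blast
      have "f (Suc n) t = 0" if "n \<ge> N" for n
      proof -
        have "real N * infdist t T \<le> real (Suc n) * infdist t T"
          using that pos by (intro mult_right_mono) auto
        with N show ?thesis by (simp add: f_def)
      qed
      then have "\<forall>\<^sub>F n in sequentially. f (Suc n) t = 0"
        unfolding eventually_sequentially by blast
      then show ?thesis
        using notin by (simp add: tendsto_eventually)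
    qed
    show "indicator T \<in> borel_measurable borel"
      using compact_imp_closed[OF assms(1)] by simp
  qed simp
  moreover have "abs_l2 (f (Suc n)) \<in> lip" for n
    by (rule lip_abs_l2[OF _ _ supp Lip, where B = 1]) (use f01 in auto)
  ultimately show ?thesis
    unfolding closure_sequential by (intro exI[of _ "\<lambda>n. abs_l2 (f (Suc n))"]) auto
qed

text \<open>Inner regularity: a compact subset can be removed from A so that the rest has measure
  below \<open>e\<^sup>2\<close>, and this measure is the squared L2 distance of the two
  indicators.\<close>

lemma indicator_bounded_in_closure_lip:
  assumes A: "A \<in> sets borel" "A \<subseteq> {- r..r}"
  shows "abs_l2 (indicator A) \<in> closure lip"
proof -
  have "\<exists>x\<in>closure lip. dist x (abs_l2 (indicator A)) < e" if "0 < e" for e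
  proof -
    have "A \<in> sets lebesgue" "0 < e\<^sup>2" using A that by simp_all
    from this obtain T where T: "closed T" "T \<subseteq> A" "emeasure lebesgue (A - T) < ennreal (e\<^sup>2)"
      by (rule sets_lebesgue_inner_closed)
    have TA: "indicator T \<in> L2 lborel" "indicator A \<in> L2 lborel"
      using A T by (auto intro!: L2_indicator_bounded[where r = r])
    have "emeasure lborel (A - T) < ennreal (e\<^sup>2)"
      using T A by simp
    moreover from this have "emeasure lborel (A - T) = ennreal (measure lborel (A - T))"
      by (intro emeasure_eq_ennreal_measure) auto
    ultimately have m: "measure lborel (A - T) < e\<^sup>2"
      by (simp add: ennreal_less_iff)
    have "(norm (abs_l2 (indicator T) - abs_l2 (indicator A)))\<^sup>2
        = (LINT t|lborel. (indicator T t - indicator A t)\<^sup>2)"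
      using norm_abs_l2[OF L2_diff[OF TA]]
      by (simp add: abs_l2_diff TA L2_nrm_def L2_inner_def power2_eq_square)
    also have "(\<lambda>t. (indicator T t - indicator A t :: real)\<^sup>2) = indicator (A - T)"
      using T(2) by (auto simp: indicator_def fun_eq_iff)
    also have "(LINT t|lborel. indicator (A - T) t :: real) = measure lborel (A - T)"
      by simp
    finally have "(norm (abs_l2 (indicator T) - abs_l2 (indicator A)))\<^sup>2 < e\<^sup>2"
      using m by simp
    then have "norm (abs_l2 (indicator T) - abs_l2 (indicator A)) < e"
      using \<open>0 < e\<close> by (intro power2_less_imp_less[of _ e]) auto
    moreover have "compact T"
      using T(1,2) A(2) by (meson bounded_closed_interval bounded_subset compact_eq_bounded_closed)
    then have "abs_l2 (indicator T) \<in> closure lip"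
      using T(2) A(2) by (intro indicator_compact_in_closure_lip) auto
    ultimately show ?thesis by (auto simp: dist_norm)
  qed
  then have "abs_l2 (indicator A) \<in> closure (closure lip)"
    unfolding closure_approachable by blast
  then show ?thesis by simp
qed

lemma closure_lip: "closure lip = UNIV"
proof -
  have "x \<in> closure lip" for x
  proof -
    obtain s where s: "\<And>i. simple_function borel (s i)" "\<And>t. (\<lambda>i. s i t) \<longlonglongrightarrow> rep_l2 x t"
      "\<And>i t. \<bar>s i t\<bar> \<le> 2 * \<bar>rep_l2 x t\<bar>"
      using borel_measurable_implies_sequence_metric[OF rep_l2_measurable[of x], of 0]
      by (auto simp: dist_real_def)
    define f where "f i t = s i t * indicator {- real i..real i} t" for i t
    have [measurable]: "s i \<in> borel_measurable borel" for i
      by (rule borel_measurable_simple_function[OF s(1)])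
    have [measurable]: "f i \<in> borel_measurable borel" for i
      unfolding f_def by measurable
    have "(\<lambda>i. abs_l2 (f i)) \<longlonglongrightarrow> abs_l2 (rep_l2 x)"
    proof (rule abs_l2_tendsto_dominated)
      show "(\<lambda>t. 2 * \<bar>rep_l2 x t\<bar>) \<in> L2 lborel" by (intro L2_cmult L2_abs) simp
      show "\<bar>f i t\<bar> \<le> 2 * \<bar>rep_l2 x t\<bar>" for i t
        using s(3)[of i t] by (auto simp: f_def indicator_def)
      fix t
      obtain N where N: "\<bar>t\<bar> \<le> real N" using real_arch_simple by blast
      have "\<forall>\<^sub>F i in sequentially. s i t = f i t"
        using eventually_ge_at_top[of N]
      proof eventually_elim
        case (elim i)
        then have "\<bar>t\<bar> \<le> real i" using N by linarith
        then show ?case by (simp add: f_def indicator_def abs_le_iff)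
      qed
      with s(2) show "(\<lambda>i. f i t) \<longlonglongrightarrow> rep_l2 x t"
        by (rule Lim_transform_eventually)
    qed simp_all
    moreover have "abs_l2 (f i) \<in> closure lip" for i
    proof -
      define S where "S y = s i -` {y} \<inter> {- real i..real i}" for y
      have S: "S y \<in> sets borel" "S y \<subseteq> {- real i..real i}" for y
        unfolding S_def using simple_functionD(2)[OF s(1)[of i], of "{y}"] by auto
      have fin: "finite (range (s i))" using simple_functionD(1)[OF s(1)[of i]] by simp
      have "(\<lambda>t. \<Sum>y\<in>Y. y * indicator (S y) t) \<in> L2 lborel \<and>
          abs_l2 (\<lambda>t. \<Sum>y\<in>Y. y * indicator (S y) t) \<in> closure lip" if "finite Y" for Y
        using that
      proof (induction Y rule: finite_induct)
        case empty
        then show ?case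
          using zero_in_lip closure_subset by (auto simp: zero_l2_def L2_zero)
      next
        case (insert y Y)
        note ind = L2_indicator_bounded[OF S(1) S(2), of y]
        have "(\<lambda>t. y * indicator (S y) t + 1 * (\<Sum>y\<in>Y. y * indicator (S y) t)) \<in> L2 lborel"
          using insert.IH ind by (intro L2_lincomb) auto
        moreover have "abs_l2 (\<lambda>t. y * indicator (S y) t + 1 * (\<Sum>y\<in>Y. y * indicator (S y) t)) \<in> closure lip"
          using insert.IH ind indicator_bounded_in_closure_lip[OF S(1) S(2), of y]
          by (subst abs_l2_lincomb) (blast intro: closure_lip_lincomb)+
        ultimately show ?case by (simp only: sum.insert[OF insert.hyps] mult_1)
      qed
      from this[OF fin] have "abs_l2 (\<lambda>t. \<Sum>y\<in>range (s i). y * indicator (S y) t) \<in> closure lip"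
        by simp
      moreover have "(\<Sum>y\<in>range (s i). y * indicator (S y) t) = f i t" for t
      proof -
        have "(\<Sum>y\<in>range (s i). y * indicator (S y) t) = (\<Sum>y\<in>{s i t}. y * indicator (S y) t)"
          using fin by (intro sum.mono_neutral_right) (auto simp: S_def indicator_def)
        then show ?thesis by (simp add: S_def f_def indicator_def)
      qed
      ultimately show ?thesis by simp
    qed
    ultimately show ?thesis
      using closure_lip_LIMSEQ by fastforce
  qed
  then show ?thesis by auto
qed

section \<open>The Levy measure and its truncations\<close>

definition lev :: "real \<Rightarrow> real \<Rightarrow> real" where
  "lev \<epsilon> h = 1 / \<bar>h\<bar> powr (1 + alpha \<epsilon> \<bar>h\<bar>)"

lemma lev_measurable [measurable]: "lev \<epsilon> \<in> borel_measurable borel"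
  unfolding lev_def[abs_def] alpha_def by measurable

lemma lev_0 [simp]: "lev \<epsilon> 0 = 0"
  by (simp add: lev_def)

lemma lev_nonneg [simp]: "0 \<le> lev \<epsilon> h"
  by (simp add: lev_def)

lemma lev_pos: "h \<noteq> 0 \<Longrightarrow> 0 < lev \<epsilon> h"
  by (simp add: lev_def)

lemma lev_minus [simp]: "lev \<epsilon> (- h) = lev \<epsilon> h"
  by (simp add: lev_def)

lemma ln_shift_ge_2: "0 \<le> u \<Longrightarrow> 2 \<le> ln (u + exp 2)" for u :: real
  using ln_mono[of "exp 2" "u + exp 2"] by simp

lemma alpha_mono:
  assumes "0 < \<epsilon>" "0 \<le> u" "u \<le> v"
  shows "alpha \<epsilon> u \<le> alpha \<epsilon> v"
proof -
  have "ln (u + exp 2) \<le> ln (v + exp 2)"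
    using assms add_nonneg_pos[of u "exp 2"] by (intro ln_mono) auto
  then have "ln (v + exp 2) powr - \<epsilon> \<le> ln (u + exp 2) powr - \<epsilon>"
    using assms ln_shift_ge_2[of u] by (intro powr_mono2') auto
  then show ?thesis by (simp add: alpha_def)
qed

lemma alpha_less_1: "0 \<le> u \<Longrightarrow> alpha \<epsilon> u < 1"
  using ln_shift_ge_2[of u] by (simp add: alpha_def)

lemma alpha_0_pos: "0 < \<epsilon> \<Longrightarrow> 0 < alpha \<epsilon> 0"
  by (simp add: alpha_def powr_less_one)

lemma alpha_pos: "0 < \<epsilon> \<Longrightarrow> 0 \<le> u \<Longrightarrow> 0 < alpha \<epsilon> u"
  using alpha_mono[of \<epsilon> 0 u] alpha_0_pos[of \<epsilon>] by simp

lemma integrable_lborel_has_integral: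
  fixes f :: "real \<Rightarrow> real"
  assumes "(f has_integral I) S" "\<And>x. x \<in> S \<Longrightarrow> 0 \<le> f x" "f \<in> borel_measurable borel" "S \<in> sets borel"
  shows "integrable lborel (\<lambda>x. f x * indicator S x)"
proof (rule integrableI_nonneg)
  have "(\<integral>\<^sup>+x. ennreal (f x * indicator S x) \<partial>lborel) = (\<integral>\<^sup>+x. ennreal (f x) * indicator S x \<partial>lborel)"
    by (intro nn_integral_cong) (auto simp: indicator_def)
  also have "\<dots> = ennreal I"
    using assms by (intro nn_integral_has_integral_lebesgue')
  finally show "(\<integral>\<^sup>+x. ennreal (f x * indicator S x) \<partial>lborel) < \<infinity>" by simp
qed (use assms in \<open>auto simp: indicator_def\<close>)

lemma integrable_abs_argument:
  fixes g :: "real \<Rightarrow> real"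
  assumes "integrable lborel g"
  shows "integrable lborel (\<lambda>h. g \<bar>h\<bar>)"
proof -
  have [measurable]: "g \<in> borel_measurable borel"
    using borel_measurable_integrable[OF assms] by simp
  have "integrable lborel (\<lambda>h. g (0 + (-1) * h))"
    by (rule lborel_integrable_real_affine[OF assms]) simp
  then have "integrable lborel (\<lambda>h. \<bar>g h\<bar> + \<bar>g (- h)\<bar>)"
    using assms by (intro Bochner_Integration.integrable_add integrable_abs) auto
  then show ?thesis
    by (rule Bochner_Integration.integrable_bound) (auto simp: abs_if)
qed

text \<open>On [0, 1] the weight leaves the power \<open>- alpha \<epsilon> h\<close>, integrable
  since \<open>alpha \<epsilon> h \<le> alpha \<epsilon> 1 < 1\<close>; on [1, \<infinity>) the
  exponent of the density is at most \<open>- 1 - alpha \<epsilon> 0\<close>, where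
  \<open>alpha \<epsilon> 0 > 0\<close>.\<close>

lemma integrable_lev:
  assumes "0 < \<epsilon>"
  shows "integrable lborel (\<lambda>h. min 1 \<bar>h\<bar> * lev \<epsilon> h)"
proof -
  define a0 a1 where "a0 = alpha \<epsilon> 0" and "a1 = alpha \<epsilon> 1"
  have a: "0 < a0" "a1 < 1"
    using assms by (simp_all add: a0_def a1_def alpha_0_pos alpha_less_1)
  define g where "g h = h powr (- a1) * indicator {0..1} h + h powr (- 1 - a0) * indicator {1..} h" for h
  have "integrable lborel (\<lambda>h. h powr (- a1) * indicator {0..1} h)"
    using has_integral_powr_from_0[of "- a1" 1] a by (intro integrable_lborel_has_integral) auto
  moreover have "integrable lborel (\<lambda>h. h powr (- 1 - a0) * indicator {1..} h)"
    using has_integral_powr_to_inf[of "- 1 - a0" 1] a by (intro integrable_lborel_has_integral) auto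
  ultimately have "integrable lborel g"
    unfolding g_def by (rule Bochner_Integration.integrable_add)
  then have "integrable lborel (\<lambda>h. g \<bar>h\<bar>)"
    by (rule integrable_abs_argument)
  then show ?thesis
  proof (rule Bochner_Integration.integrable_bound)
    have "min 1 \<bar>h\<bar> * lev \<epsilon> h \<le> g \<bar>h\<bar>" for h
    proof (cases "h = 0")
      case False
      define s where "s = \<bar>h\<bar>"
      have s: "0 < s" using False by (simp add: s_def)
      have lev: "lev \<epsilon> h = s powr (- 1 - alpha \<epsilon> s)"
        by (simp add: lev_def s_def powr_minus_divide flip: powr_minus_divide)
      show ?thesis
      proof (cases "s \<le> 1")
        case True
        have "s * s powr (- 1 - alpha \<epsilon> s) = s powr (- alpha \<epsilon> s)"
          using s by (simp add: powr_diff powr_minus_divide field_simps)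
        also have "\<dots> \<le> s powr (- a1)"
          using s True alpha_mono[OF assms, of s 1] by (intro powr_mono') (auto simp: a1_def)
        finally show ?thesis
          using s True by (simp add: lev g_def s_def[symmetric] indicator_def min_def)
      next
        case False
        have "s powr (- 1 - alpha \<epsilon> s) \<le> s powr (- 1 - a0)"
          using s False alpha_mono[OF assms, of 0 s] by (intro powr_mono) (auto simp: a0_def)
        then show ?thesis
          using s False by (simp add: lev g_def s_def[symmetric] indicator_def min_def)
      qed
    qed (simp add: g_def)
    moreover have "0 \<le> g \<bar>h\<bar>" for h
      by (simp add: g_def)
    ultimately show "AE h in lborel. norm (min 1 \<bar>h\<bar> * lev \<epsilon> h) \<le> norm (g \<bar>h\<bar>)"
      by simp
  qed measurable
qed

text \<open>The factor 2 cancels the 1/2 of \<open>conv_kernel.energy\<close>, so that the bounded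
  forms increase to the given double integral, in which every pair of points counts twice.\<close>

definition kap :: "real \<Rightarrow> nat \<Rightarrow> real \<Rightarrow> real" where
  "kap \<epsilon> k h = 2 * lev \<epsilon> h * indicator {h. 1 / real (Suc k) < \<bar>h\<bar>} h"

lemma kap_measurable [measurable]: "kap \<epsilon> k \<in> borel_measurable borel"
  unfolding kap_def[abs_def] by measurable

lemma kap_nonneg [simp]: "0 \<le> kap \<epsilon> k h"
  by (simp add: kap_def)

lemma kap_mono:
  assumes "j \<le> k"
  shows "kap \<epsilon> j h \<le> kap \<epsilon> k h"
proof -
  have "1 / real (Suc k) \<le> 1 / real (Suc j)"
    using assms by (intro divide_left_mono) auto
  then show ?thesis
    unfolding kap_def by (intro mult_left_mono) (auto simp: indicator_def)
qed

lemma kap_le: "kap \<epsilon> k h \<le> 2 * lev \<epsilon> h"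
  by (simp add: kap_def indicator_def)

lemma kap_LIMSEQ: "(\<lambda>k. kap \<epsilon> k h) \<longlonglongrightarrow> 2 * lev \<epsilon> h"
proof (cases "h = 0")
  case False
  then obtain N where N: "1 / real (Suc N) < \<bar>h\<bar>"
    using reals_Archimedean[of "\<bar>h\<bar>"] by (auto simp: inverse_eq_divide)
  have "kap \<epsilon> k h = 2 * lev \<epsilon> h" if "k \<ge> N" for k
    using kap_mono[OF that, of \<epsilon> h] kap_le[of \<epsilon> k h] N by (simp add: kap_def[of _ N])
  then show ?thesis
    by (intro tendsto_eventually) (auto simp: eventually_sequentially)
qed (simp add: kap_def)

lemma conv_kernel_kap:
  assumes "0 < \<epsilon>"
  shows "conv_kernel (kap \<epsilon> k)"
proof
  show int: "integrable lborel (kap \<epsilon> k)"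
  proof (rule Bochner_Integration.integrable_bound)
    show "integrable lborel (\<lambda>h. (2 * real (Suc k)) * (min 1 \<bar>h\<bar> * lev \<epsilon> h))"
      using integrable_lev[OF assms] by (rule integrable_mult_right)
    have "kap \<epsilon> k h \<le> (2 * real (Suc k)) * (min 1 \<bar>h\<bar> * lev \<epsilon> h)" for h
    proof (cases "1 / real (Suc k) < \<bar>h\<bar>")
      case True
      then have "1 \<le> real (Suc k) * min 1 \<bar>h\<bar>"
        by (simp add: min_def field_simps)
      then have "2 * lev \<epsilon> h * 1 \<le> 2 * lev \<epsilon> h * (real (Suc k) * min 1 \<bar>h\<bar>)"
        by (intro mult_left_mono) auto
      moreover have "kap \<epsilon> k h = 2 * lev \<epsilon> h * 1"
        using True by (simp add: kap_def)
      ultimately show ?thesis by (simp only: mult_ac)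
    qed (simp add: kap_def)
    then show "AE h in lborel. norm (kap \<epsilon> k h) \<le> norm ((2 * real (Suc k)) * (min 1 \<bar>h\<bar> * lev \<epsilon> h))"
      by (intro AE_I2) (simp add: abs_mult)
  qed measurable
  show "kap \<epsilon> k (- h) = kap \<epsilon> k h" for h
    by (simp add: kap_def indicator_def)
  \<comment> \<open>On [2, 3] no truncation is active and the power of h is at most 2, so the
    density is at least 1/9.\<close>
  have "(1 / 9) * (LINT h|lborel. indicator {2..3 :: real} h) \<le> (LINT h|lborel. kap \<epsilon> k h)"
    unfolding integral_mult_right_zero[symmetric]
  proof (rule integral_mono[OF _ int])
    show "integrable lborel (\<lambda>h::real. 1 / 9 * indicator {2..3} h :: real)"
      using integrable_indicator_Icc by (rule integrable_mult_right)
    fix h :: real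
    show "1 / 9 * indicator {2..3} h \<le> kap \<epsilon> k h"
    proof (cases "h \<in> {2..3}")
      case True
      have "h powr (1 + alpha \<epsilon> h) \<le> h powr 2"
        using True alpha_less_1[of h \<epsilon>] by (intro powr_mono) auto
      also have "\<dots> \<le> 3 ^ 2"
        using True power_mono[of h 3 2] by (simp add: powr_numeral)
      finally have "1 / 9 \<le> lev \<epsilon> h"
        using True by (simp add: lev_def field_simps)
      moreover have "1 / real (Suc k) \<le> 1"
        by simp
      then have "1 / real (Suc k) < h"
        by (rule order_le_less_trans) (use True in auto)
      ultimately show ?thesis
        using True by (simp add: kap_def)
    qed simp
  qed
  then show "0 < (LINT h|lborel. kap \<epsilon> k h)" by simp
qed simp

locale levy =
  fixes \<epsilon> :: real
  assumes eps: "0 < \<epsilon>"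
begin

sublocale K: conv_kernel "kap \<epsilon> k" for k
  by (rule conv_kernel_kap[OF eps])

definition N :: "nat \<Rightarrow> l2 endo" where "N k = conv_kernel.endo (kap \<epsilon> k)"
definition \<Lambda> :: "nat \<Rightarrow> real" where "\<Lambda> k = conv_kernel.mass (kap \<epsilon> k)"

lemma inner_N: "inner (app (N k) x) y = (LINT h|lborel. kap \<epsilon> k h * inner (tau h x) y)"
  by (simp add: N_def K.inner_endo)

lemma N_energy:
  "\<Lambda> k * inner x x - inner (app (N k) x) x = (LINT h|lborel. kap \<epsilon> k h * (norm (tau h x - x))\<^sup>2) / 2"
  by (simp add: N_def \<Lambda>_def K.energy)

lemma norm_tau_diff_sq_le: "(norm (tau h x - x))\<^sup>2 \<le> (2 * norm x)\<^sup>2"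
  using norm_triangle_ineq4[of "tau h x" x] by (intro power_mono) auto

lemma integrable_kap_energy: "integrable lborel (\<lambda>h. kap \<epsilon> k h * (norm (tau h x - x))\<^sup>2)"
  using norm_tau_diff_sq_le[of _ x] by (intro K.integrable_bounded_mult[where C = "(2 * norm x)\<^sup>2"]) auto

lemma N_mono:
  assumes "j \<le> k"
  shows "\<Lambda> j * inner x x - inner (app (N j) x) x \<le> \<Lambda> k * inner x x - inner (app (N k) x) x"
  unfolding N_energy
  using integral_mono[OF integrable_kap_energy integrable_kap_energy, of j x k] kap_mono[OF assms]
  by (simp add: mult_right_mono)

lemma inner_N_diff:
  "inner (app (N k) x - \<Lambda> k *\<^sub>R x) y = (LINT h|lborel. kap \<epsilon> k h * inner (tau h x - x) y)"
proof -
  have "(LINT h|lborel. kap \<epsilon> k h * inner (tau h x - x) y)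
      = (LINT h|lborel. kap \<epsilon> k h * inner (tau h x) y - kap \<epsilon> k h * inner x y)"
    by (simp add: inner_diff_left right_diff_distrib)
  also have "\<dots> = inner (app (N k) x) y - \<Lambda> k * inner x y"
    by (simp add: K.integrable K.integrable_inner_tau inner_N \<Lambda>_def K.mass_def)
  finally show ?thesis by (simp add: inner_diff_left)
qed

text \<open>\<open>c k\<close> is the integral of the weight \<open>min 1 \<bar>h\<bar>\<close>
  against the truncated kernel; it increases and is bounded by \<open>integrable_lev\<close>.
  Pairing \<open>B k - B j\<close> with itself bounds its norm by
  \<open>C * (c k - c j)\<close>.\<close>

lemma N_convergent:
  assumes "x \<in> lip"
  shows "convergent (\<lambda>k. app (N k) x - \<Lambda> k *\<^sub>R x)"
proof -
  define B where "B k = app (N k) x - \<Lambda> k *\<^sub>R x" for k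
  obtain C where C: "\<And>h. norm (tau h x - x) \<le> C * min 1 \<bar>h\<bar>"
    using assms by (auto simp: lip_def)
  have "0 \<le> C" using C[of 1] norm_ge_zero[of "tau 1 x - x"] by linarith
  define c where "c k = (LINT h|lborel. kap \<epsilon> k h * min 1 \<bar>h\<bar>)" for k
  have int_c: "integrable lborel (\<lambda>h. kap \<epsilon> k h * min 1 \<bar>h\<bar>)" for k
    by (rule K.integrable_bounded_mult[where C = 1]) auto
  have "incseq c"
    unfolding incseq_def c_def
    by (intro allI impI integral_mono int_c mult_right_mono kap_mono) auto
  moreover have "c k \<le> (LINT h|lborel. 2 * (min 1 \<bar>h\<bar> * lev \<epsilon> h))" for k
    unfolding c_def
  proof (intro integral_mono int_c integrable_mult_right integrable_lev[OF eps])
    show "kap \<epsilon> k h * min 1 \<bar>h\<bar> \<le> 2 * (min 1 \<bar>h\<bar> * lev \<epsilon> h)" for h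
      using mult_right_mono[OF kap_le[of \<epsilon> k h], of "min 1 \<bar>h\<bar>"] by (simp add: mult_ac)
  qed
  ultimately have "convergent c"
    by (metis convergentI incseq_convergent)
  then have "Cauchy c" by (rule convergent_Cauchy)
  have main: "norm (B k - B j) \<le> C * (c k - c j)" if "j \<le> k" for j k
  proof (cases "B k - B j = 0")
    case True
    then show ?thesis using \<open>incseq c\<close> \<open>0 \<le> C\<close> that by (simp add: incseq_def)
  next
    case False
    have int: "integrable lborel (\<lambda>h. kap \<epsilon> i h * inner (tau h x - x) y)" for i y
      unfolding inner_diff_left right_diff_distrib
      by (intro Bochner_Integration.integrable_diff K.integrable_inner_tau integrable_mult_left K.integrable)
    define y where "y = B k - B j"
    have split: "(kap \<epsilon> k h - kap \<epsilon> j h) * (C * min 1 \<bar>h\<bar> * norm y)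
        = (C * norm y) * (kap \<epsilon> k h * min 1 \<bar>h\<bar>) - (C * norm y) * (kap \<epsilon> j h * min 1 \<bar>h\<bar>)" for h
      by (simp add: algebra_simps)
    have "norm y * norm y = inner (B k - B j) y"
      by (simp add: y_def dot_square_norm power2_eq_square)
    also have "\<dots> = (LINT h|lborel. (kap \<epsilon> k h - kap \<epsilon> j h) * inner (tau h x - x) y)"
      unfolding B_def inner_diff_left[of "_ - _" "_ - _"] inner_N_diff
      using int by (simp add: left_diff_distrib)
    also have "\<dots> \<le> (LINT h|lborel. (kap \<epsilon> k h - kap \<epsilon> j h) * (C * min 1 \<bar>h\<bar> * norm y))"
    proof (rule integral_mono)
      show "integrable lborel (\<lambda>h. (kap \<epsilon> k h - kap \<epsilon> j h) * inner (tau h x - x) y)"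
        using int by (simp add: left_diff_distrib)
      show "integrable lborel (\<lambda>h. (kap \<epsilon> k h - kap \<epsilon> j h) * (C * min 1 \<bar>h\<bar> * norm y))"
        unfolding split by (intro Bochner_Integration.integrable_diff integrable_mult_right int_c)
      show "(kap \<epsilon> k h - kap \<epsilon> j h) * inner (tau h x - x) y
          \<le> (kap \<epsilon> k h - kap \<epsilon> j h) * (C * min 1 \<bar>h\<bar> * norm y)" for h
      proof (rule mult_left_mono)
        have "inner (tau h x - x) y \<le> norm (tau h x - x) * norm y" by (rule norm_cauchy_schwarz)
        also have "\<dots> \<le> C * min 1 \<bar>h\<bar> * norm y" by (intro mult_right_mono C) simp
        finally show "inner (tau h x - x) y \<le> C * min 1 \<bar>h\<bar> * norm y" .
      qed (use kap_mono[OF that] in simp)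
    qed
    also have "\<dots> = (C * norm y) * c k - (C * norm y) * c j"
      unfolding c_def split using int_c by (subst Bochner_Integration.integral_diff) auto
    finally have "norm y * norm y \<le> (C * (c k - c j)) * norm y" by (simp add: algebra_simps)
    then show ?thesis using False by (simp add: y_def)
  qed
  have "Cauchy B"
    unfolding Cauchy_iff
  proof (intro allI impI)
    fix e :: real assume "0 < e"
    then have "0 < e / (C + 1)" using \<open>0 \<le> C\<close> by simp
    then obtain M where M: "\<And>m n. m \<ge> M \<Longrightarrow> n \<ge> M \<Longrightarrow> norm (c m - c n) < e / (C + 1)"
      using \<open>Cauchy c\<close> unfolding Cauchy_iff by metis
    have *: "norm (B k - B j) < e" if "M \<le> j" "j \<le> k" for j k
    proof -
      have "C * (c k - c j) \<le> C * (e / (C + 1))"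
        using M[of k j] that \<open>0 \<le> C\<close> by (intro mult_left_mono) auto
      also have "\<dots> < e" using \<open>0 < e\<close> \<open>0 \<le> C\<close> by (simp add: field_simps)
      finally show ?thesis using main[OF that(2)] by simp
    qed
    show "\<exists>M. \<forall>m\<ge>M. \<forall>n\<ge>M. norm (B m - B n) < e"
      using * by (metis nle_le norm_minus_commute)
  qed
  then show ?thesis
    unfolding B_def by (rule Cauchy_convergent)
qed

sublocale G: approximating_generators N \<Lambda> lip
proof
  show "N j * N k = N k * N j" for j k
    unfolding N_def by (intro conv_kernel_commute conv_kernel_kap eps)
  show "self_adjoint (N k)" for k
    unfolding N_def by (rule K.endo_self_adjoint)
  show "norm (N k) \<le> \<Lambda> k" for k
    unfolding N_def \<Lambda>_def by (rule K.norm_endo)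
qed (fact N_mono closure_lip N_convergent)+

lemma pos_mass_P: "0 \<le> t \<Longrightarrow> pos_mass (G.P t x) \<le> pos_mass x"
  and pos_mass_R: "pos_mass (G.R x) \<le> pos_mass x"
  by (rule G.P_R_sublinear[OF pos_mass_add pos_mass_scale closed_pos_mass],
      simp_all add: N_def \<Lambda>_def K.pos_mass_endo)+

lemma F_energy: "G.F k x x = (LINT h|lborel. kap \<epsilon> k h * (norm (tau h x - x))\<^sup>2) / 2"
  using N_energy[of k x] by (simp add: G.F_def G.app_A inner_diff_left)

definition energy :: "l2 \<Rightarrow> ennreal" where
  "energy x = (\<integral>\<^sup>+h. ennreal (lev \<epsilon> h * (norm (tau h x - x))\<^sup>2) \<partial>lborel)"

lemma F_nn_integral: "ennreal (G.F k x x) = (\<integral>\<^sup>+h. ennreal (kap \<epsilon> k h / 2 * (norm (tau h x - x))\<^sup>2) \<partial>lborel)"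
proof -
  have "G.F k x x = (LINT h|lborel. kap \<epsilon> k h / 2 * (norm (tau h x - x))\<^sup>2)"
    using F_energy[of k x] by simp
  moreover have "integrable lborel (\<lambda>h. kap \<epsilon> k h / 2 * (norm (tau h x - x))\<^sup>2)"
    using integrable_mult_right[OF integrable_kap_energy[of k x], of "1 / 2"] by simp
  ultimately show ?thesis
    by (simp only:) (rule nn_integral_eq_integral[symmetric], auto)
qed

lemma energy_LIMSEQ: "(\<lambda>k. ennreal (G.F k x x)) \<longlonglongrightarrow> energy x"
  unfolding F_nn_integral energy_def
proof (rule nn_integral_LIMSEQ)
  show "incseq (\<lambda>k h. ennreal (kap \<epsilon> k h / 2 * (norm (tau h x - x))\<^sup>2))"
    by (auto simp: incseq_def le_fun_def intro!: ennreal_leI mult_right_mono divide_right_mono kap_mono)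
  show "(\<lambda>k. ennreal (kap \<epsilon> k h / 2 * (norm (tau h x - x))\<^sup>2))
      \<longlonglongrightarrow> ennreal (lev \<epsilon> h * (norm (tau h x - x))\<^sup>2)" for h
  proof (intro tendsto_ennrealI)
    have "(\<lambda>k. kap \<epsilon> k h / 2 * (norm (tau h x - x))\<^sup>2) \<longlonglongrightarrow> 2 * lev \<epsilon> h / 2 * (norm (tau h x - x))\<^sup>2"
      by (intro tendsto_intros kap_LIMSEQ) simp
    then show "(\<lambda>k. kap \<epsilon> k h / 2 * (norm (tau h x - x))\<^sup>2) \<longlonglongrightarrow> lev \<epsilon> h * (norm (tau h x - x))\<^sup>2"
      by simp
  qed
qed measurable

lemma in_D_iff: "x \<in> G.D \<longleftrightarrow> energy x < \<infinity>"
proof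
  assume "x \<in> G.D"
  then have "(\<lambda>k. ennreal (G.F k x x)) \<longlonglongrightarrow> ennreal (G.E x x)"
    by (intro tendsto_ennrealI G.E_LIMSEQ)
  with energy_LIMSEQ have "energy x = ennreal (G.E x x)"
    using LIMSEQ_unique by blast
  then show "energy x < \<infinity>" by simp
next
  assume "energy x < \<infinity>"
  then obtain b where b: "energy x = ennreal b" "0 \<le> b" by (cases "energy x") auto
  have "incseq (\<lambda>k. ennreal (G.F k x x))"
    by (auto simp: incseq_def intro: ennreal_leI G.F_mono)
  then have "ennreal (G.F k x x) \<le> ennreal b" for k
    unfolding b(1)[symmetric] by (rule incseq_le[OF _ energy_LIMSEQ])
  then have "G.F k x x \<le> b" for k
    using b(2) by simp
  then show "x \<in> G.D" unfolding G.in_D by blast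
qed

lemma energy_eq_E: "x \<in> G.D \<Longrightarrow> energy x = ennreal (G.E x x)"
  using LIMSEQ_unique[OF energy_LIMSEQ tendsto_ennrealI[OF G.E_LIMSEQ]] by blast

end

section \<open>Identification with the given form, and its Dirichlet property\<close>

context levy
begin

lemma energy_double:
  assumes u: "u \<in> L2 lborel"
  shows "energy (abs_l2 u) = (\<integral>\<^sup>+x. \<integral>\<^sup>+y. ennreal (lev \<epsilon> (y - x) * (u y - u x)\<^sup>2) \<partial>lborel \<partial>lborel)"
proof -
  have [measurable]: "u \<in> borel_measurable borel" using u by (simp add: L2_def)
  have "(\<integral>\<^sup>+x. \<integral>\<^sup>+y. ennreal (lev \<epsilon> (y - x) * (u y - u x)\<^sup>2) \<partial>lborel \<partial>lborel)
      = (\<integral>\<^sup>+x. \<integral>\<^sup>+h. ennreal (lev \<epsilon> h * (u (x + h) - u x)\<^sup>2) \<partial>lborel \<partial>lborel)"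
  proof (rule nn_integral_cong)
    fix x
    show "(\<integral>\<^sup>+y. ennreal (lev \<epsilon> (y - x) * (u y - u x)\<^sup>2) \<partial>lborel)
        = (\<integral>\<^sup>+h. ennreal (lev \<epsilon> h * (u (x + h) - u x)\<^sup>2) \<partial>lborel)"
      using lborel_nn_integral_shift[of "\<lambda>y. ennreal (lev \<epsilon> (y - x) * (u y - u x)\<^sup>2)" x]
      by (simp add: add.commute)
  qed
  also have "\<dots> = (\<integral>\<^sup>+h. \<integral>\<^sup>+x. ennreal (lev \<epsilon> h * (u (x + h) - u x)\<^sup>2) \<partial>lborel \<partial>lborel)"
    by (rule lborel_pair.Fubini') measurable
  also have "\<dots> = energy (abs_l2 u)"
    unfolding energy_def
  proof (rule nn_integral_cong)
    fix h
    have uh: "(\<lambda>t. u (t + h)) \<in> L2 lborel" by (rule L2_shift[OF u])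
    have "(\<integral>\<^sup>+x. ennreal (lev \<epsilon> h * (u (x + h) - u x)\<^sup>2) \<partial>lborel)
        = ennreal (lev \<epsilon> h) * (\<integral>\<^sup>+x. ennreal ((u (x + h) - u x)\<^sup>2) \<partial>lborel)"
      by (simp add: ennreal_mult' nn_integral_cmult)
    also have "(\<integral>\<^sup>+x. ennreal ((u (x + h) - u x)\<^sup>2) \<partial>lborel) = ennreal ((norm (tau h (abs_l2 u) - abs_l2 u))\<^sup>2)"
      unfolding L2_nn_integral[OF L2_diff[OF uh u]] using norm_abs_l2[OF L2_diff[OF uh u]]
      by (simp add: uh u tau_abs_l2 abs_l2_diff L2_nrm_def L2_inner_def power2_eq_square)
    finally show "(\<integral>\<^sup>+x. ennreal (lev \<epsilon> h * (u (x + h) - u x)\<^sup>2) \<partial>lborel)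
        = ennreal (lev \<epsilon> h * (norm (tau h (abs_l2 u) - abs_l2 u))\<^sup>2)"
      by (simp add: ennreal_mult')
  qed
  finally show ?thesis by (rule sym)
qed

lemma nn_integral_jump:
  assumes u: "u \<in> L2 lborel"
  shows "(\<integral>\<^sup>+(x, y)\<in>{(x, y). x \<noteq> y}. ennreal ((u y - u x)\<^sup>2 / \<bar>x - y\<bar> powr (1 + alpha \<epsilon> \<bar>x - y\<bar>))
      \<partial>(lborel \<Otimes>\<^sub>M lborel)) = energy (abs_l2 u)"
proof -
  have [measurable]: "u \<in> borel_measurable borel" using u by (simp add: L2_def)
  have "(\<integral>\<^sup>+(x, y)\<in>{(x, y). x \<noteq> y}. ennreal ((u y - u x)\<^sup>2 / \<bar>x - y\<bar> powr (1 + alpha \<epsilon> \<bar>x - y\<bar>))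
      \<partial>(lborel \<Otimes>\<^sub>M lborel))
      = (\<integral>\<^sup>+p. ennreal (lev \<epsilon> (snd p - fst p) * (u (snd p) - u (fst p))\<^sup>2) \<partial>(lborel \<Otimes>\<^sub>M lborel))"
    by (intro nn_integral_cong) (auto simp: lev_def indicator_def abs_minus_commute split: prod.splits)
  also have "\<dots> = (\<integral>\<^sup>+x. \<integral>\<^sup>+y. ennreal (lev \<epsilon> (y - x) * (u y - u x)\<^sup>2) \<partial>lborel \<partial>lborel)"
    using lborel.nn_integral_fst[of "\<lambda>p. ennreal (lev \<epsilon> (snd p - fst p) * (u (snd p) - u (fst p))\<^sup>2)" lborel]
    by simp
  finally show ?thesis by (simp add: energy_double[OF u])
qed

lemma levy_dom_iff: "u \<in> levy_dom \<epsilon> \<longleftrightarrow> u \<in> L2 lborel \<and> abs_l2 u \<in> G.D"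
  unfolding levy_dom_def using nn_integral_jump by (auto simp: in_D_iff)

definition jump :: "(real \<Rightarrow> real) \<Rightarrow> (real \<Rightarrow> real) \<Rightarrow> real \<times> real \<Rightarrow> real" where
  "jump u v = (\<lambda>(x, y). (u y - u x) * (v y - v x) * lev \<epsilon> (x - y))"

lemma levy_form_eq: "levy_form \<epsilon> u v = (LINT p|(lborel \<Otimes>\<^sub>M lborel). jump u v p)"
  unfolding levy_form_def set_lebesgue_integral_def
  by (intro Bochner_Integration.integral_cong) (auto simp: jump_def lev_def indicator_def)

lemma jump_diag_nn_integral:
  assumes "u \<in> L2 lborel"
  shows "(\<integral>\<^sup>+p. ennreal (jump u u p) \<partial>(lborel \<Otimes>\<^sub>M lborel)) = energy (abs_l2 u)"
  unfolding nn_integral_jump[OF assms, symmetric]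
  by (intro nn_integral_cong)
    (auto simp: jump_def lev_def indicator_def power2_eq_square split: prod.splits)

lemma jump_measurable [measurable]:
  assumes "u \<in> L2 lborel" "v \<in> L2 lborel"
  shows "jump u v \<in> borel_measurable (lborel \<Otimes>\<^sub>M lborel)"
proof -
  have [measurable]: "u \<in> borel_measurable borel" "v \<in> borel_measurable borel"
    using assms by (auto simp: L2_def)
  show ?thesis unfolding jump_def by measurable
qed

lemma jump_diag_integrable:
  assumes "u \<in> levy_dom \<epsilon>"
  shows "integrable (lborel \<Otimes>\<^sub>M lborel) (jump u u)"
proof (rule integrableI_nonneg)
  show "(\<integral>\<^sup>+p. ennreal (jump u u p) \<partial>(lborel \<Otimes>\<^sub>M lborel)) < \<infinity>"
    using assms by (simp add: levy_dom_iff jump_diag_nn_integral in_D_iff)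
  show "AE p in lborel \<Otimes>\<^sub>M lborel. 0 \<le> jump u u p"
    by (auto simp: jump_def)
qed (use assms levy_dom_iff in auto)

lemma levy_form_diag:
  assumes "u \<in> levy_dom \<epsilon>"
  shows "levy_form \<epsilon> u u = G.E (abs_l2 u) (abs_l2 u)"
proof -
  have u: "u \<in> L2 lborel" "abs_l2 u \<in> G.D" using assms by (simp_all add: levy_dom_iff)
  have "ennreal (levy_form \<epsilon> u u) = (\<integral>\<^sup>+p. ennreal (jump u u p) \<partial>(lborel \<Otimes>\<^sub>M lborel))"
    unfolding levy_form_eq
    by (intro nn_integral_eq_integral[symmetric] jump_diag_integrable assms) (auto simp: jump_def)
  also have "\<dots> = ennreal (G.E (abs_l2 u) (abs_l2 u))"
    using u by (simp add: jump_diag_nn_integral energy_eq_E)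
  finally show ?thesis
    using G.E_nonneg[OF u(2)] by (subst (asm) ennreal_inj) (auto simp: levy_form_eq jump_def intro!: integral_nonneg_AE)
qed

text \<open>Polarization inside the integral: the product of the increments of u and v is a quarter
  of the difference of the squares for u + v and u - v, and both squares are integrable.\<close>

lemma levy_form_E:
  assumes u: "u \<in> levy_dom \<epsilon>" and v: "v \<in> levy_dom \<epsilon>"
  shows "levy_form \<epsilon> u v = G.E (abs_l2 u) (abs_l2 v)"
proof -
  have uL: "u \<in> L2 lborel" "abs_l2 u \<in> G.D" and vL: "v \<in> L2 lborel" "abs_l2 v \<in> G.D"
    using assms by (simp_all add: levy_dom_iff)
  have abs_p: "abs_l2 (\<lambda>t. u t + v t) = abs_l2 u + abs_l2 v"
    using abs_l2_lincomb[OF uL(1) vL(1), of 1 1] by simp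
  have p: "(\<lambda>t. u t + v t) \<in> levy_dom \<epsilon>"
    using uL vL by (simp add: levy_dom_iff L2_add abs_p G.D_add)
  have m: "(\<lambda>t. u t - v t) \<in> levy_dom \<epsilon>"
    using uL vL by (simp add: levy_dom_iff L2_diff abs_l2_diff G.D_diff)
  have "levy_form \<epsilon> u v = (LINT q|(lborel \<Otimes>\<^sub>M lborel). (jump (\<lambda>t. u t + v t) (\<lambda>t. u t + v t) q
      - jump (\<lambda>t. u t - v t) (\<lambda>t. u t - v t) q) / 4)"
    unfolding levy_form_eq
    by (intro Bochner_Integration.integral_cong) (auto simp: jump_def algebra_simps)
  also have "\<dots> = (levy_form \<epsilon> (\<lambda>t. u t + v t) (\<lambda>t. u t + v t) - levy_form \<epsilon> (\<lambda>t. u t - v t) (\<lambda>t. u t - v t)) / 4"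
    by (simp add: levy_form_eq jump_diag_integrable p m)
  also have "\<dots> = (G.E (abs_l2 u + abs_l2 v) (abs_l2 u + abs_l2 v) - G.E (abs_l2 u - abs_l2 v) (abs_l2 u - abs_l2 v)) / 4"
    by (simp add: levy_form_diag p m abs_p abs_l2_diff uL vL)
  also have "\<dots> = G.E (abs_l2 u) (abs_l2 v)"
    using G.E_quadratic[OF uL(2) vL(2), of 1] G.E_quadratic[OF uL(2) vL(2), of "-1"] by simp
  finally show ?thesis .
qed

lemma levy_dom_diff: "u \<in> levy_dom \<epsilon> \<Longrightarrow> v \<in> levy_dom \<epsilon> \<Longrightarrow> (\<lambda>t. u t - v t) \<in> levy_dom \<epsilon>"
  by (simp add: levy_dom_iff L2_diff abs_l2_diff G.D_diff)

lemma rep_levy_dom: "x \<in> G.D \<Longrightarrow> rep_l2 x \<in> levy_dom \<epsilon>"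
  by (simp add: levy_dom_iff)

lemma lip_subset_D: "lip \<subseteq> G.D"
proof
  fix x assume "x \<in> lip"
  then obtain C where C: "\<And>h. norm (tau h x - x) \<le> C * min 1 \<bar>h\<bar>"
    by (auto simp: lip_def)
  have "energy x \<le> (\<integral>\<^sup>+h. ennreal (C\<^sup>2 * (min 1 \<bar>h\<bar> * lev \<epsilon> h)) \<partial>lborel)"
    unfolding energy_def
  proof (intro nn_integral_mono ennreal_leI)
    fix h :: real
    have "(norm (tau h x - x))\<^sup>2 \<le> (C * min 1 \<bar>h\<bar>)\<^sup>2"
      by (intro power_mono C) simp
    also have "\<dots> \<le> C\<^sup>2 * min 1 \<bar>h\<bar>"
      unfolding power_mult_distrib
      by (intro mult_left_mono) (auto simp: power2_eq_square mult_left_le min_def)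
    finally have "lev \<epsilon> h * (norm (tau h x - x))\<^sup>2 \<le> lev \<epsilon> h * (C\<^sup>2 * min 1 \<bar>h\<bar>)"
      by (intro mult_left_mono) simp_all
    then show "lev \<epsilon> h * (norm (tau h x - x))\<^sup>2 \<le> C\<^sup>2 * (min 1 \<bar>h\<bar> * lev \<epsilon> h)"
      by (simp add: mult_ac)
  qed
  also have "\<dots> < \<infinity>"
    using nn_integral_eq_integral[OF integrable_mult_right[OF integrable_lev[OF eps]], of "C\<^sup>2"]
    by simp
  finally show "x \<in> G.D" by (simp add: in_D_iff)
qed

lemma energy_contraction:
  assumes u: "u \<in> L2 lborel" and v: "v \<in> L2 lborel"
    and le: "\<And>x y. \<bar>v y - v x\<bar> \<le> \<bar>u y - u x\<bar>"
  shows "energy (abs_l2 v) \<le> energy (abs_l2 u)"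
  unfolding jump_diag_nn_integral[OF u, symmetric] jump_diag_nn_integral[OF v, symmetric]
proof (intro nn_integral_mono ennreal_leI)
  fix p :: "real \<times> real"
  have "(v y - v x) * (v y - v x) \<le> (u y - u x) * (u y - u x)" for x y
    using le[where x = x and y = y] by (simp add: abs_le_square_iff power2_eq_square)
  then show "jump v v p \<le> jump u u p"
    by (auto simp: jump_def split: prod.split intro!: mult_right_mono)
qed

lemma dirichlet_form: "dirichlet_form lborel (levy_form \<epsilon>) (levy_dom \<epsilon>)"
proof
  show "levy_dom \<epsilon> \<subseteq> L2 lborel"
    by (auto simp: levy_dom_iff)
next
  fix u v :: "real \<Rightarrow> real"
  assume u: "u \<in> levy_dom \<epsilon>" and v: "v \<in> borel_measurable lborel" and eq: "AE x in lborel. u x = v x"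
  have "v \<in> L2 lborel"
    using u v eq by (auto simp: levy_dom_iff intro: L2_cong_AE)
  moreover from this have "abs_l2 v = abs_l2 u"
    using u eq by (subst abs_l2_eq_iff) (auto simp: levy_dom_iff elim: AE_mp)
  ultimately show "v \<in> levy_dom \<epsilon>"
    using u by (simp add: levy_dom_iff)
next
  fix u v w :: "real \<Rightarrow> real"
  assume "u \<in> levy_dom \<epsilon>" "v \<in> levy_dom \<epsilon>" "w \<in> levy_dom \<epsilon>" "AE x in lborel. u x = v x"
  moreover from this have "abs_l2 u = abs_l2 v"
    by (subst abs_l2_eq_iff) (auto simp: levy_dom_iff)
  ultimately show "levy_form \<epsilon> u w = levy_form \<epsilon> v w"
    by (simp add: levy_form_E)
next
  fix u v :: "real \<Rightarrow> real" and a b :: real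
  assume "u \<in> levy_dom \<epsilon>" "v \<in> levy_dom \<epsilon>"
  then show *: "(\<lambda>x. a * u x + b * v x) \<in> levy_dom \<epsilon>"
    by (simp add: levy_dom_iff L2_lincomb abs_l2_lincomb G.D_lincomb)
  fix w assume "w \<in> levy_dom \<epsilon>"
  with * \<open>u \<in> levy_dom \<epsilon>\<close> \<open>v \<in> levy_dom \<epsilon>\<close>
  show "levy_form \<epsilon> (\<lambda>x. a * u x + b * v x) w = a * levy_form \<epsilon> u w + b * levy_form \<epsilon> v w"
    by (simp add: levy_form_E) (simp add: levy_dom_iff abs_l2_lincomb G.E_lincomb_left)
next
  fix u v :: "real \<Rightarrow> real"
  assume "u \<in> levy_dom \<epsilon>" "v \<in> levy_dom \<epsilon>"
  then show "levy_form \<epsilon> u v = levy_form \<epsilon> v u"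
    by (simp add: levy_form_E G.E_sym levy_dom_iff)
next
  fix u :: "real \<Rightarrow> real"
  assume "u \<in> levy_dom \<epsilon>"
  then show "0 \<le> levy_form \<epsilon> u u"
    by (simp add: levy_form_E G.E_nonneg levy_dom_iff)
next
  fix u :: "real \<Rightarrow> real" and e :: real
  assume u: "u \<in> L2 lborel" and "0 < e"
  then obtain w where w: "w \<in> lip" "norm (abs_l2 u - w) < e"
    using G.W_approx by blast
  show "\<exists>v\<in>levy_dom \<epsilon>. L2_nrm lborel (\<lambda>x. u x - v x) < e"
  proof
    show "rep_l2 w \<in> levy_dom \<epsilon>"
      using w(1) lip_subset_D by (auto intro: rep_levy_dom)
    show "L2_nrm lborel (\<lambda>x. u x - rep_l2 w x) < e"
      using w(2) u by (simp add: norm_abs_l2[symmetric] L2_diff abs_l2_diff)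
  qed
next
  fix s :: "nat \<Rightarrow> real \<Rightarrow> real"
  assume s: "\<And>n. s n \<in> levy_dom \<epsilon>"
    and C: "\<And>e::real. 0 < e \<Longrightarrow> \<exists>N. \<forall>m\<ge>N. \<forall>n\<ge>N.
      levy_form \<epsilon> (\<lambda>x. s m x - s n x) (\<lambda>x. s m x - s n x) + (L2_nrm lborel (\<lambda>x. s m x - s n x))\<^sup>2 < e"
  define S where "S n = abs_l2 (s n)" for n
  have sL: "s n \<in> L2 lborel" and SD: "S n \<in> G.D" for n
    using s[of n] by (simp_all add: levy_dom_iff S_def)
  have form: "levy_form \<epsilon> (\<lambda>x. s m x - v x) (\<lambda>x. s m x - v x) = G.E (S m - abs_l2 v) (S m - abs_l2 v)"
    and nrm: "L2_nrm lborel (\<lambda>x. s m x - v x) = norm (S m - abs_l2 v)"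
    if "v \<in> levy_dom \<epsilon>" for m v
  proof -
    have v: "v \<in> L2 lborel" using that by (simp add: levy_dom_iff)
    note d = levy_dom_diff[OF s that, of m]
    show "levy_form \<epsilon> (\<lambda>x. s m x - v x) (\<lambda>x. s m x - v x) = G.E (S m - abs_l2 v) (S m - abs_l2 v)"
      using levy_form_E[OF d d] by (simp add: abs_l2_diff[OF sL v] S_def)
    show "L2_nrm lborel (\<lambda>x. s m x - v x) = norm (S m - abs_l2 v)"
      using norm_abs_l2[OF L2_diff[OF sL v]] by (simp add: abs_l2_diff[OF sL v] S_def)
  qed
  have C': "\<exists>N. \<forall>m\<ge>N. \<forall>n\<ge>N. G.E (S m - S n) (S m - S n) + (norm (S m - S n))\<^sup>2 < e" if "0 < e" for e
    using C[OF that] unfolding form[OF s] nrm[OF s] S_def by simp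
  have Enn: "0 \<le> G.E (S m - S n) (S m - S n)" for m n
    by (intro G.E_nonneg G.D_diff SD)
  have "Cauchy S"
    unfolding Cauchy_iff
  proof (intro allI impI)
    fix e :: real assume "0 < e"
    then obtain N where N: "\<And>m n. m \<ge> N \<Longrightarrow> n \<ge> N \<Longrightarrow> G.E (S m - S n) (S m - S n) + (norm (S m - S n))\<^sup>2 < e\<^sup>2"
      using C'[of "e\<^sup>2"] by auto
    have "norm (S m - S n) < e" if "m \<ge> N" "n \<ge> N" for m n
      by (rule power2_less_imp_less) (use N[OF that] Enn[of m n] \<open>0 < e\<close> in auto)
    then show "\<exists>M. \<forall>m\<ge>M. \<forall>n\<ge>M. norm (S m - S n) < e" by blast
  qed
  then obtain x where x: "S \<longlonglongrightarrow> x"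
    using Cauchy_convergent convergent_def by blast
  have ev: "\<exists>M. \<forall>n\<ge>M. x \<in> G.D \<and> G.E (S n - x) (S n - x) \<le> e" if e: "0 < e" for e
  proof -
    obtain N where N: "\<And>m n. m \<ge> N \<Longrightarrow> n \<ge> N \<Longrightarrow> G.E (S m - S n) (S m - S n) + (norm (S m - S n))\<^sup>2 < e"
      using C'[OF e] by auto
    have "G.E (S m - S n) (S m - S n) \<le> e" if "m \<ge> N" "n \<ge> N" for m n
      using N[OF that] zero_le_power2[of "norm (S m - S n)"] by linarith
    from G.D_closed[OF SD x this] show ?thesis by blast
  qed
  have xD: "x \<in> G.D" using ev[of 1] by auto
  have "(\<lambda>n. G.E (S n - x) (S n - x)) \<longlonglongrightarrow> 0"
    unfolding LIMSEQ_iff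
  proof (intro allI impI)
    fix r :: real assume "0 < r"
    then obtain M where "\<forall>n\<ge>M. G.E (S n - x) (S n - x) \<le> r / 2" using ev[of "r / 2"] by auto
    then show "\<exists>no. \<forall>n\<ge>no. norm (G.E (S n - x) (S n - x) - 0) < r"
      using \<open>0 < r\<close> G.E_nonneg[OF G.D_diff[OF SD xD]] by (intro exI[of _ M]) fastforce
  qed
  moreover have "(\<lambda>n. (norm (S n - x))\<^sup>2) \<longlonglongrightarrow> 0"
    using x by (intro tendsto_null_power) (auto simp: tendsto_norm_zero_iff LIM_zero_iff)
  ultimately have "(\<lambda>n. G.E (S n - x) (S n - x) + (norm (S n - x))\<^sup>2) \<longlonglongrightarrow> 0"
    using tendsto_add_zero by blast
  then show "\<exists>u\<in>levy_dom \<epsilon>. (\<lambda>n. levy_form \<epsilon> (\<lambda>x. s n x - u x) (\<lambda>x. s n x - u x)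
      + (L2_nrm lborel (\<lambda>x. s n x - u x))\<^sup>2) \<longlonglongrightarrow> 0"
    by (intro bexI[of _ "rep_l2 x"] rep_levy_dom xD)
      (simp add: form nrm rep_levy_dom xD)
next
  fix u :: "real \<Rightarrow> real"
  assume u: "u \<in> levy_dom \<epsilon>"
  let ?v = "\<lambda>x. min 1 (max 0 (u x))"
  have uL: "u \<in> L2 lborel" using u by (simp add: levy_dom_iff)
  have [measurable]: "u \<in> borel_measurable borel" using uL by (simp add: L2_def)
  have vL: "?v \<in> L2 lborel"
    by (rule L2_dominated[OF uL]) auto
  have le: "energy (abs_l2 ?v) \<le> energy (abs_l2 u)"
    by (rule energy_contraction[OF uL vL]) auto
  show v: "?v \<in> levy_dom \<epsilon>"
    using u le vL by (auto simp: levy_dom_iff in_D_iff)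
  have "ennreal (levy_form \<epsilon> ?v ?v) \<le> ennreal (levy_form \<epsilon> u u)"
    using le u v by (simp add: levy_form_diag energy_eq_E levy_dom_iff)
  then show "levy_form \<epsilon> ?v ?v \<le> levy_form \<epsilon> u u"
    using u by (simp add: levy_form_diag G.E_nonneg levy_dom_iff)
qed

lemma F_tau: "G.F k (tau a x) (tau a y) = G.F k x y"
proof -
  have "app (G.A k) (tau a x) = tau a (app (G.A k) x)"
    by (simp add: G.app_A N_def K.endo_tau tau_diff tau_scaleR)
  then show ?thesis by (simp add: G.F_def)
qed

lemma translation_invariant: "translation_invariant (levy_form \<epsilon>) (levy_dom \<epsilon>)"
  unfolding translation_invariant_def
proof (intro allI ballI conjI)
  fix a :: real and u v :: "real \<Rightarrow> real"
  have D: "tau a x \<in> G.D" if "x \<in> G.D" for x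
    using that by (simp add: G.in_D F_tau)
  have dom: "(\<lambda>x. u (x + a)) \<in> levy_dom \<epsilon>" if "u \<in> levy_dom \<epsilon>" for u
    using that by (simp add: levy_dom_iff L2_shift D flip: tau_abs_l2)
  assume u: "u \<in> levy_dom \<epsilon>"
  then show "(\<lambda>x. u (x + a)) \<in> levy_dom \<epsilon>" by (rule dom)
  assume v: "v \<in> levy_dom \<epsilon>"
  have "G.E (tau a x) (tau a y) = G.E x y" for x y
    by (simp add: G.E_def F_tau)
  then show "levy_form \<epsilon> (\<lambda>x. u (x + a)) (\<lambda>x. v (x + a)) = levy_form \<epsilon> u v"
    using u v by (simp add: levy_form_E dom) (simp add: levy_dom_iff flip: tau_abs_l2)
qed

end

section \<open>Transience for small exponents\<close>

text \<open>For s \<ge> 1 base and exponent both grow, as \<open>alpha\<close> is increasing. For s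
  < 1 the two powers are separated by 1, which is where \<open>1 \<le> H\<close> enters.\<close>

lemma lev_antimono:
  assumes "0 < \<epsilon>" "0 < s" "s \<le> H" "1 \<le> H"
  shows "lev \<epsilon> H \<le> lev \<epsilon> s"
proof -
  have "s powr (1 + alpha \<epsilon> s) \<le> H powr (1 + alpha \<epsilon> H)"
  proof (cases "1 \<le> s")
    case True
    have "s powr (1 + alpha \<epsilon> s) \<le> s powr (1 + alpha \<epsilon> H)"
      using True assms alpha_mono[of \<epsilon> s H] by (intro powr_mono) auto
    also have "\<dots> \<le> H powr (1 + alpha \<epsilon> H)"
      using assms alpha_pos[of \<epsilon> H] by (intro powr_mono2) auto
    finally show ?thesis .
  next
    case False
    have "s powr (1 + alpha \<epsilon> s) \<le> 1"
      using False assms alpha_pos[of \<epsilon> s] by (intro powr_le1) auto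
    also have "1 \<le> H powr (1 + alpha \<epsilon> H)"
      using assms alpha_pos[of \<epsilon> H] by (intro ge_one_powr_ge_zero) auto
    finally show ?thesis .
  qed
  then show ?thesis
    using assms by (simp add: lev_def frac_le)
qed

lemma lev_eq_exp:
  assumes "0 < H"
  shows "lev \<epsilon> H = exp (ln H * ln (H + exp 2) powr (- \<epsilon>)) / H\<^sup>2"
proof -
  define q where "q = ln (H + exp 2) powr (- \<epsilon>)"
  have "lev \<epsilon> H = 1 / H powr (2 - q)"
    using assms by (simp add: lev_def alpha_def q_def)
  also have "\<dots> = exp (- (ln H * (2 - q)))"
    using assms by (simp add: powr_def exp_minus divide_inverse mult.commute)
  finally have "lev \<epsilon> H = exp (- (ln H * (2 - ln (H + exp 2) powr (- \<epsilon>))))"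
    by (simp add: q_def)
  also have "\<dots> = exp (ln H * ln (H + exp 2) powr (- \<epsilon>)) / exp (2 * ln H)"
    by (simp add: algebra_simps flip: exp_diff)
  also have "exp (2 * ln H) = H\<^sup>2"
    using assms by (simp add: exp_double flip: power2_eq_square)
  finally show ?thesis .
qed

text \<open>For s = \<bar>h\<bar> \<ge> 1 and \<open>L = ln (s + exp 2)\<close> the exponent of the
  correction to \<open>1 / s\<^sup>2\<close> is at most \<open>ln s / L \<le> 1\<close>; for s < 1
  it is at most 0. Hence the constant \<open>exp 1\<close>.\<close>

lemma lev_le_inverse_square:
  assumes "1 \<le> \<epsilon>" "h \<noteq> 0"
  shows "lev \<epsilon> h \<le> exp 1 / h\<^sup>2"
proof -
  define s where "s = \<bar>h\<bar>"
  have s: "0 < s" using assms(2) by (simp add: s_def)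
  define L where "L = ln (s + exp 2)"
  have L: "2 \<le> L" using ln_shift_ge_2[of s] s by (simp add: L_def)
  have "ln s * L powr (- \<epsilon>) \<le> 1"
  proof (cases "1 \<le> s")
    case True
    have "L powr (- \<epsilon>) \<le> L powr (- 1)"
      using L assms(1) by (intro powr_mono) auto
    then have "ln s * L powr (- \<epsilon>) \<le> ln s * (1 / L)"
      using True L by (intro mult_left_mono) (auto simp: powr_minus_divide)
    also have "\<dots> \<le> L * (1 / L)"
      using s L by (intro mult_right_mono) (auto simp: L_def intro!: ln_mono)
    finally show ?thesis using L by simp
  next
    case False
    then have "ln s * L powr (- \<epsilon>) \<le> 0"
      using s by (intro mult_nonpos_nonneg) auto
    then show ?thesis by simp
  qed
  then have "lev \<epsilon> s \<le> exp 1 / s\<^sup>2"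
    unfolding lev_eq_exp[OF s] L_def by (intro divide_right_mono) auto
  moreover have "lev \<epsilon> s = lev \<epsilon> h" by (simp add: lev_def s_def)
  ultimately show ?thesis by (simp add: s_def)
qed

lemma nn_Cauchy_Schwarz_set:
  fixes g :: "real \<Rightarrow> real"
  assumes A: "A \<in> sets borel" "A \<subseteq> {- r..r}" and g: "(\<lambda>t. indicator A t * g t) \<in> L2 lborel"
  shows "ennreal ((LINT t|lborel. indicator A t * g t)\<^sup>2)
    \<le> ennreal (measure lborel A) * (\<integral>\<^sup>+t. ennreal (indicator A t * (g t)\<^sup>2) \<partial>lborel)"
proof -
  let ?G = "\<lambda>t. indicator A t * g t"
  have i: "indicator A \<in> L2 lborel" by (rule L2_indicator_bounded[OF A])
  have e: "indicator A t * ?G t = ?G t" "(?G t)\<^sup>2 = indicator A t * (g t)\<^sup>2"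
    "indicator A t * indicator A t = (indicator A t :: real)" for t
    by (auto simp: indicator_def)
  have "(inner (abs_l2 (indicator A)) (abs_l2 ?G))\<^sup>2
      \<le> inner (abs_l2 (indicator A)) (abs_l2 (indicator A)) * inner (abs_l2 ?G) (abs_l2 ?G)"
    by (rule Cauchy_Schwarz_ineq)
  then have "(LINT t|lborel. ?G t)\<^sup>2 \<le> measure lborel A * (LINT t|lborel. (?G t)\<^sup>2)"
    unfolding inner_abs_l2[OF i g] inner_abs_l2[OF i i] inner_abs_l2[OF g g] e(1,3)
    by (simp add: power2_eq_square)
  then have "ennreal ((LINT t|lborel. ?G t)\<^sup>2) \<le> ennreal (measure lborel A * (LINT t|lborel. (?G t)\<^sup>2))"
    by (rule ennreal_leI)
  also have "\<dots> = ennreal (measure lborel A) * (\<integral>\<^sup>+t. ennreal ((?G t)\<^sup>2) \<partial>lborel)"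
    by (simp only: L2_nn_integral[OF g] ennreal_mult' measure_nonneg)
  finally show ?thesis unfolding e(2) .
qed

context levy
begin

text \<open>A Poincare inequality, multiplied through by both measures to avoid division.
  Cauchy-Schwarz over I and then over J bounds the left side by the double integral of
  \<open>(f x - f y)\<^sup>2\<close> over I and J, where every jump has density at least
  \<open>lev \<epsilon> H\<close>.\<close>

lemma difference_of_means:
  assumes I: "I \<in> sets borel" "I \<subseteq> {- r..r}" and J: "J \<in> sets borel" "J \<subseteq> {- r..r}"
    and disj: "I \<inter> J = {}" and H: "1 \<le> H" "\<And>x y. x \<in> I \<Longrightarrow> y \<in> J \<Longrightarrow> \<bar>y - x\<bar> \<le> H"
    and v: "v \<in> G.D"
  shows "(measure lborel J * inner (abs_l2 (indicator I)) v - measure lborel I * inner (abs_l2 (indicator J)) v)\<^sup>2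
    \<le> measure lborel I * measure lborel J * (G.E v v / lev \<epsilon> H)"
proof -
  define f where "f = rep_l2 v"
  have f: "f \<in> L2 lborel" "abs_l2 f = v" and [measurable]: "f \<in> borel_measurable borel"
    by (simp_all add: f_def)
  note [measurable] = I(1) J(1)
  have iI: "indicator I \<in> L2 lborel" and iJ: "indicator J \<in> L2 lborel"
    by (rule L2_indicator_bounded[OF I] L2_indicator_bounded[OF J])+
  define a b where "a = measure lborel I" and "b = measure lborel J"
  define mI mJ where "mI = (LINT t|lborel. indicator I t * f t)" and "mJ = (LINT t|lborel. indicator J t * f t)"
  have ib: "inner (abs_l2 (indicator I)) v = mI" "inner (abs_l2 (indicator J)) v = mJ"
    using inner_abs_l2[OF iI f(1)] inner_abs_l2[OF iJ f(1)] by (simp_all add: f(2) mI_def mJ_def)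
  have Jf: "(\<lambda>t. indicator J t * f t) \<in> L2 lborel" and If: "(\<lambda>t. indicator I t * f t) \<in> L2 lborel"
    by (rule L2_dominated[OF f(1)]; auto simp: indicator_def)+
  have intI: "integrable lborel (indicator I :: real \<Rightarrow> real)" "integrable lborel (\<lambda>t. indicator I t * f t)"
    and intJ: "integrable lborel (indicator J :: real \<Rightarrow> real)" "integrable lborel (\<lambda>t. indicator J t * f t)"
    using L2_mult_integrable[OF iI iI] L2_mult_integrable[OF iI f(1)]
      L2_mult_integrable[OF iJ iJ] L2_mult_integrable[OF iJ f(1)]
    by (simp_all flip: indicator_inter_arith)
  have inner_step: "ennreal ((b * f x - mJ)\<^sup>2) \<le> ennreal b * (\<integral>\<^sup>+y. ennreal (indicator J y * (f x - f y)\<^sup>2) \<partial>lborel)" for x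
  proof -
    have "(LINT y|lborel. indicator J y * (f x - f y)) = b * f x - mJ"
      using intJ by (simp add: right_diff_distrib b_def mJ_def)
    moreover have "(\<lambda>y. indicator J y * (f x - f y)) \<in> L2 lborel"
      using L2_lincomb[OF iJ Jf, of "f x" "-1"] by (simp add: algebra_simps)
    ultimately show ?thesis
      using nn_Cauchy_Schwarz_set[OF J, of "\<lambda>y. f x - f y"] by (simp add: b_def)
  qed
  have "ennreal ((b * mI - a * mJ)\<^sup>2) \<le> ennreal a * (\<integral>\<^sup>+x. ennreal (indicator I x * (b * f x - mJ)\<^sup>2) \<partial>lborel)"
  proof -
    have "(\<lambda>x. indicator I x * (b * f x - mJ)) = (\<lambda>x. b * (indicator I x * f x) - mJ * indicator I x)"
      by (simp add: algebra_simps fun_eq_iff)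
    then have "(LINT x|lborel. indicator I x * (b * f x - mJ)) = b * mI - a * mJ"
      using intI by (simp add: a_def mI_def)
    moreover have "(\<lambda>x. indicator I x * (b * f x - mJ)) \<in> L2 lborel"
      using L2_lincomb[OF If iI, of b "- mJ"] by (simp add: algebra_simps)
    ultimately show ?thesis
      using nn_Cauchy_Schwarz_set[OF I, of "\<lambda>x. b * f x - mJ"] by (simp add: a_def)
  qed
  also have "\<dots> \<le> ennreal a * (\<integral>\<^sup>+x. ennreal b * (\<integral>\<^sup>+y. ennreal (indicator I x * indicator J y * (f x - f y)\<^sup>2) \<partial>lborel) \<partial>lborel)"
  proof (intro mult_left_mono nn_integral_mono)
    show "ennreal (indicator I x * (b * f x - mJ)\<^sup>2)
        \<le> ennreal b * (\<integral>\<^sup>+y. ennreal (indicator I x * indicator J y * (f x - f y)\<^sup>2) \<partial>lborel)" for x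
      using inner_step[of x] by (cases "x \<in> I") auto
  qed simp
  also have "\<dots> = ennreal (a * b) * (\<integral>\<^sup>+x. \<integral>\<^sup>+y. ennreal (indicator I x * indicator J y * (f x - f y)\<^sup>2) \<partial>lborel \<partial>lborel)"
    by (simp add: nn_integral_cmult ennreal_mult' a_def mult.assoc)
  also have "(\<integral>\<^sup>+x. \<integral>\<^sup>+y. ennreal (indicator I x * indicator J y * (f x - f y)\<^sup>2) \<partial>lborel \<partial>lborel)
      \<le> (\<integral>\<^sup>+x. \<integral>\<^sup>+y. ennreal (1 / lev \<epsilon> H) * ennreal (lev \<epsilon> (y - x) * (f y - f x)\<^sup>2) \<partial>lborel \<partial>lborel)"
  proof (intro nn_integral_mono)
    fix x y
    have levH: "0 < lev \<epsilon> H" using H(1) by (intro lev_pos) auto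
    show "ennreal (indicator I x * indicator J y * (f x - f y)\<^sup>2)
        \<le> ennreal (1 / lev \<epsilon> H) * ennreal (lev \<epsilon> (y - x) * (f y - f x)\<^sup>2)"
    proof (cases "x \<in> I \<and> y \<in> J")
      case True
      then have "x \<noteq> y" using disj by auto
      have "lev \<epsilon> H \<le> lev \<epsilon> \<bar>y - x\<bar>"
        using H True \<open>x \<noteq> y\<close> by (intro lev_antimono eps) auto
      then have "lev \<epsilon> H \<le> lev \<epsilon> (y - x)" by (simp add: lev_def)
      then have "1 \<le> 1 / lev \<epsilon> H * lev \<epsilon> (y - x)"
        using levH by (simp add: field_simps)
      then have "1 * (f x - f y)\<^sup>2 \<le> (1 / lev \<epsilon> H * lev \<epsilon> (y - x)) * (f y - f x)\<^sup>2"
        by (subst power2_commute) (rule mult_right_mono, auto)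
      then show ?thesis
        using True levH by (simp add: mult.assoc ennreal_leI flip: ennreal_mult')
    qed (auto simp: indicator_def)
  qed
  also have "\<dots> = ennreal (1 / lev \<epsilon> H) * energy v"
    using energy_double[OF f(1)] by (simp add: nn_integral_cmult f(2))
  also have "ennreal (a * b) * (ennreal (1 / lev \<epsilon> H) * energy v) = ennreal (a * b * (G.E v v / lev \<epsilon> H))"
    using energy_eq_E[OF v] G.E_nonneg[OF v] by (simp add: a_def b_def flip: ennreal_mult')
  finally have "ennreal ((b * mI - a * mJ)\<^sup>2) \<le> ennreal (a * b * (G.E v v / lev \<epsilon> H))"
    by (simp add: mult_left_mono)
  then show ?thesis
    using G.E_nonneg[OF v] by (subst (asm) ennreal_le_iff) (auto simp: ib a_def b_def)
qed

end

section \<open>Means over dyadic intervals\<close>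

lemma exp_2_le: "exp 2 \<le> (9 :: real)"
proof -
  have "exp (1 :: real) \<le> 3" by (rule exp_le)
  then have "exp (1 :: real) ^ 2 \<le> 3 ^ 2" by (intro power_mono) auto
  then show ?thesis by (simp flip: exp_of_nat_mult)
qed

text \<open>A stretched exponential decays faster than \<open>1 / k ^ 2\<close>, however small the
  positive \<delta>, which will be \<open>1 - \<epsilon>\<close>.\<close>

lemma summable_exp_powr:
  fixes c \<delta> :: real
  assumes "0 < c" "0 < \<delta>"
  shows "summable (\<lambda>k. exp (- c * real (k + 2) powr \<delta>))"
proof -
  have "((\<lambda>x::real. x ^ 2 * exp (- c * (x + 2) powr \<delta>)) \<longlongrightarrow> 0) at_top"
    using assms by real_asymp
  then have "(\<lambda>k. real k ^ 2 * exp (- c * (real k + 2) powr \<delta>)) \<longlonglongrightarrow> 0"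
    by (rule filterlim_compose[OF _ filterlim_real_sequentially])
  then have "\<forall>\<^sub>F k in sequentially. real k ^ 2 * exp (- c * (real k + 2) powr \<delta>) < 1"
    by (rule order_tendstoD) simp
  then have "\<forall>\<^sub>F k in sequentially. norm (exp (- c * real (k + 2) powr \<delta>)) \<le> inverse (real k ^ 2)"
    using eventually_gt_at_top[of 0]
    by eventually_elim (simp add: field_simps)
  then show ?thesis
    by (rule summable_comparison_test_ev) (rule inverse_power_summable, simp)
qed

context levy
begin

definition dyadic :: "nat \<Rightarrow> real set" where "dyadic k = {2 ^ k..<2 ^ Suc k}"

lemma dyadic: "dyadic k \<in> sets borel" "dyadic k \<subseteq> {- (2 ^ Suc k)..2 ^ Suc k}" "measure lborel (dyadic k) = 2 ^ k"
proof -
  show "dyadic k \<subseteq> {- (2 ^ Suc k)..2 ^ Suc k}"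
  proof
    fix x assume "x \<in> dyadic k"
    then have "2 ^ k \<le> x" "x < 2 ^ Suc k" by (auto simp: dyadic_def)
    moreover have "(0::real) < 2 ^ k" by simp
    ultimately show "x \<in> {- (2 ^ Suc k)..2 ^ Suc k}"
      unfolding atLeastAtMost_iff by (intro conjI) linarith+
  qed
  show "measure lborel (dyadic k) = 2 ^ k"
    unfolding dyadic_def by (subst measure_lborel_Ico) auto
qed (simp add: dyadic_def)

lemma dyadic_L2: "indicator (dyadic k) \<in> L2 lborel"
  by (rule L2_indicator_bounded[OF dyadic(1,2)])

definition mean :: "l2 \<Rightarrow> nat \<Rightarrow> real" where
  "mean v k = inner (abs_l2 (indicator (dyadic k))) v / 2 ^ k"

text \<open>By Cauchy-Schwarz the mean over a set of measure \<open>2 ^ k\<close> is at most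
  \<open>norm v / sqrt (2 ^ k)\<close>.\<close>

lemma mean_tendsto_0: "mean v \<longlonglongrightarrow> 0"
proof -
  have "norm (mean v k) \<le> norm v * sqrt ((1 / 2) ^ k)" for k
  proof -
    have "(norm (abs_l2 (indicator (dyadic k))))\<^sup>2 = (LINT t|lborel. indicator (dyadic k) t)"
      by (simp add: power2_norm_eq_inner inner_abs_l2 dyadic_L2 flip: indicator_inter_arith)
    also have "\<dots> = 2 ^ k" by (simp add: dyadic)
    finally have "norm (abs_l2 (indicator (dyadic k))) = sqrt (2 ^ k)"
      by (metis norm_ge_zero real_sqrt_unique)
    then have "\<bar>inner (abs_l2 (indicator (dyadic k))) v\<bar> \<le> sqrt (2 ^ k) * norm v"
      using Cauchy_Schwarz_ineq2[of "abs_l2 (indicator (dyadic k))" v] by simp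
    then have "norm (mean v k) \<le> (sqrt (2 ^ k) * norm v) / 2 ^ k"
      by (simp add: mean_def divide_right_mono)
    also have "\<dots> = norm v * (sqrt (2 ^ k) / 2 ^ k)" by simp
    also have "sqrt (2 ^ k) / 2 ^ k = sqrt ((1 / 2 :: real) ^ k)"
    proof -
      have "sqrt (2 ^ k) / 2 ^ k = 1 / sqrt (2 ^ k :: real)"
        by (simp add: sqrt_divide_self_eq inverse_eq_divide)
      then show ?thesis by (simp add: power_divide real_sqrt_divide)
    qed
    finally show ?thesis .
  qed
  moreover have "(\<lambda>k. norm v * sqrt ((1 / 2) ^ k)) \<longlonglongrightarrow> norm v * sqrt 0"
    by (intro tendsto_intros LIMSEQ_power_zero) simp
  ultimately show ?thesis
    by (intro Lim_null_comparison[of "mean v"]) auto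
qed

text \<open>
  Means over neighbouring dyadic intervals differ by at most
  \<open>(E v v / (2\<^sup>2\<^sup>k lev 2\<^sup>k))\<^sup>1\<^sup>/\<^sup>2\<close>; for \<open>\<epsilon> < 1\<close> these bounds are summable, and telescoping to
  infinity, where the means vanish, bounds the mean over \<open>[1, 2)\<close> by the energy alone.
\<close>

lemma mean_diff:
  assumes v: "v \<in> G.D"
  shows "\<bar>mean v k - mean v (Suc k)\<bar> \<le>
    sqrt 8 * sqrt (G.E v v) * exp (- ((ln 2) powr (1 - \<epsilon>) * 2 powr (- \<epsilon>) / 2) * real (k + 2) powr (1 - \<epsilon>))"
proof -
  \<comment> \<open>The right end of the second interval, hence a bound for all distances between
    points of the two intervals.\<close>
  define H :: real where "H = 2 ^ (k + 2)"
  define p :: real where "p = 2 ^ k"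
  have p: "0 < p" "H = 4 * p" by (simp_all add: p_def H_def power_add)
  have H: "4 \<le> H"
    using one_le_power[of "2::real" k] by (simp add: H_def power_add)
  have meas: "measure lborel (dyadic k) = p" "measure lborel (dyadic (Suc k)) = 2 * p"
    by (simp_all add: dyadic p_def)
  have sub: "dyadic k \<subseteq> {- H..H}" "dyadic (Suc k) \<subseteq> {- H..H}"
  proof -
    have "dyadic k \<subseteq> {- (2 * p)..2 * p}" "dyadic (Suc k) \<subseteq> {- (4 * p)..4 * p}"
      using dyadic(2)[of k] dyadic(2)[of "Suc k"] by (simp_all add: p_def)
    then show "dyadic k \<subseteq> {- H..H}" "dyadic (Suc k) \<subseteq> {- H..H}"
      using p by auto
  qed
  have "(measure lborel (dyadic (Suc k)) * inner (abs_l2 (indicator (dyadic k))) v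
      - measure lborel (dyadic k) * inner (abs_l2 (indicator (dyadic (Suc k)))) v)\<^sup>2
      \<le> measure lborel (dyadic k) * measure lborel (dyadic (Suc k)) * (G.E v v / lev \<epsilon> H)"
  proof (rule difference_of_means[OF dyadic(1) sub(1) dyadic(1) sub(2) _ _ _ v])
    show "dyadic k \<inter> dyadic (Suc k) = {}" by (auto simp: dyadic_def)
    show "1 \<le> H" using H by simp
    fix x y assume "x \<in> dyadic k" "y \<in> dyadic (Suc k)"
    then have "p \<le> x" "x < 2 * p" "2 * p \<le> y" "y < 4 * p" by (simp_all add: dyadic_def p_def)
    then show "\<bar>y - x\<bar> \<le> H" using p by linarith
  qed
  moreover have "measure lborel (dyadic (Suc k)) * inner (abs_l2 (indicator (dyadic k))) v
      - measure lborel (dyadic k) * inner (abs_l2 (indicator (dyadic (Suc k)))) v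
      = 2 * p\<^sup>2 * (mean v k - mean v (Suc k))"
    unfolding meas using p by (simp add: mean_def p_def[symmetric] power2_eq_square field_simps)
  ultimately have "(2 * p\<^sup>2 * (mean v k - mean v (Suc k)))\<^sup>2 \<le> p * (2 * p) * (G.E v v / lev \<epsilon> H)"
    by (simp add: meas)
  also have "(2 * p\<^sup>2 * (mean v k - mean v (Suc k)))\<^sup>2 = p * (2 * p) * (2 * p\<^sup>2 * (mean v k - mean v (Suc k))\<^sup>2)"
    by (simp add: power2_eq_square algebra_simps)
  finally have 1: "2 * p\<^sup>2 * (mean v k - mean v (Suc k))\<^sup>2 \<le> G.E v v / lev \<epsilon> H"
    by (rule mult_left_le_imp_le) (use p in simp)
  define \<theta> where "\<theta> = ln H * ln (H + exp 2) powr (- \<epsilon>)"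
  have "G.E v v / lev \<epsilon> H = G.E v v * H\<^sup>2 * exp (- \<theta>)"
    using H by (simp add: lev_eq_exp \<theta>_def exp_minus divide_inverse)
  with 1 have 2: "(mean v k - mean v (Suc k))\<^sup>2 \<le> 8 * G.E v v * exp (- \<theta>)"
    using p by (simp add: power2_eq_square mult_ac)
  define c where "c = (ln 2) powr (1 - \<epsilon>) * 2 powr (- \<epsilon>)"
  have "c * real (k + 2) powr (1 - \<epsilon>) \<le> \<theta>"
  proof -
    have lnH: "ln H = real (k + 2) * ln 2"
      unfolding H_def by (rule ln_realpow)
    have pos: "0 < ln H" using H by simp
    \<comment> \<open>As H \<ge> 4, this leads to \<open>ln (H + exp 2) \<le> 2 * ln H\<close>: the
      shift in the logarithm costs a factor 2, which becomes \<open>2 powr (- \<epsilon>)\<close> in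
      \<open>c\<close>. The other factor of \<open>c\<close> comes from
      \<open>ln H = (k + 2) * ln 2\<close>.\<close>
    have "H + exp 2 \<le> H + 9" using exp_2_le by simp
    also have "\<dots> \<le> H\<^sup>2"
      using H mult_mono[of 4 H "3" "H - 1"] by (simp add: power2_eq_square algebra_simps)
    finally have "ln (H + exp 2) \<le> ln (H\<^sup>2)"
      using H by (intro ln_mono) (auto intro: add_pos_pos)
    also have "\<dots> = 2 * ln H" using H by (simp add: ln_realpow)
    finally have "(2 * ln H) powr (- \<epsilon>) \<le> ln (H + exp 2) powr (- \<epsilon>)"
      using eps ln_shift_ge_2[of H] H by (intro powr_mono2') auto
    then have "ln H * (2 * ln H) powr (- \<epsilon>) \<le> \<theta>"
      unfolding \<theta>_def using pos by (intro mult_left_mono) auto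
    also have "ln H * (2 * ln H) powr (- \<epsilon>) = 2 powr (- \<epsilon>) * (ln H powr 1 * ln H powr (- \<epsilon>))"
      using pos by (simp add: powr_mult)
    also have "\<dots> = 2 powr (- \<epsilon>) * ln H powr (1 - \<epsilon>)"
      using powr_add[of "ln H" 1 "- \<epsilon>"] by simp
    also have "\<dots> = c * real (k + 2) powr (1 - \<epsilon>)"
      unfolding lnH c_def by (subst powr_mult) (simp_all add: mult_ac)
    finally show ?thesis .
  qed
  then have "exp (- \<theta>) \<le> exp (- (c * real (k + 2) powr (1 - \<epsilon>)))" by simp
  with 2 have "(mean v k - mean v (Suc k))\<^sup>2 \<le> 8 * G.E v v * exp (- (c * real (k + 2) powr (1 - \<epsilon>)))"
    using G.E_nonneg[OF v] by (meson mult_left_mono order_trans mult_nonneg_nonneg zero_le_numeral)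
  also have "\<dots> = (sqrt 8 * sqrt (G.E v v) * exp (- (c / 2) * real (k + 2) powr (1 - \<epsilon>)))\<^sup>2"
    using G.E_nonneg[OF v] by (simp add: power_mult_distrib flip: exp_double)
  finally show ?thesis
    unfolding c_def[symmetric] using G.E_nonneg[OF v]
    by (intro power2_le_imp_le[of "\<bar>_\<bar>"]) auto
qed

lemma transience_bound:
  assumes "\<epsilon> < 1"
  obtains C where "0 \<le> C" "\<And>v. v \<in> G.D \<Longrightarrow> (inner (abs_l2 (indicator {1..<2})) v)\<^sup>2 \<le> C * G.E v v"
proof -
  define a where "a k = exp (- ((ln 2) powr (1 - \<epsilon>) * 2 powr (- \<epsilon>) / 2) * real (k + 2) powr (1 - \<epsilon>))" for k :: nat
  have a: "summable a"
    unfolding a_def using assms by (intro summable_exp_powr) auto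
  define B where "B = sqrt 8 * suminf a"
  show thesis
  proof (rule that)
    show "0 \<le> B\<^sup>2" by simp
    fix v assume v: "v \<in> G.D"
    have bound: "\<bar>mean v 0 - mean v n\<bar> \<le> B * sqrt (G.E v v)" for n
    proof -
      have "mean v 0 - mean v n = (\<Sum>k<n. mean v k - mean v (Suc k))"
        by (simp add: sum_lessThan_telescope')
      also have "\<bar>\<dots>\<bar> \<le> (\<Sum>k<n. \<bar>mean v k - mean v (Suc k)\<bar>)"
        by (rule sum_abs)
      also have "\<dots> \<le> (\<Sum>k<n. sqrt 8 * sqrt (G.E v v) * a k)"
        unfolding a_def by (intro sum_mono mean_diff v)
      also have "\<dots> = sqrt 8 * sqrt (G.E v v) * (\<Sum>k<n. a k)"
        by (simp add: sum_distrib_left)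
      also have "\<dots> \<le> sqrt 8 * sqrt (G.E v v) * suminf a"
        using G.E_nonneg[OF v] by (intro mult_left_mono sum_le_suminf a) (auto simp: a_def)
      finally show ?thesis by (simp add: B_def mult_ac)
    qed
    have "\<bar>mean v 0 - 0\<bar> \<le> B * sqrt (G.E v v)"
      by (rule LIMSEQ_le_const2[OF tendsto_rabs[OF tendsto_diff[OF tendsto_const mean_tendsto_0]]])
        (use bound in blast)
    then have "(mean v 0)\<^sup>2 \<le> (B * sqrt (G.E v v))\<^sup>2"
      by (metis abs_ge_zero diff_zero power2_abs power_mono)
    \<comment> \<open>\<open>dyadic 0\<close> is [1, 2) and has measure 1, so
      \<open>mean v 0\<close> is the pairing itself.\<close>
    then show "(inner (abs_l2 (indicator {1..<2})) v)\<^sup>2 \<le> B\<^sup>2 * G.E v v"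
      using G.E_nonneg[OF v] by (simp add: mean_def dyadic_def power_mult_distrib)
  qed
qed

end

text \<open>For the cutoffs of the recurrent case. The terms grow like \<open>2 ^ k\<close> until
  \<open>2 ^ k\<close> reaches \<open>sqrt x\<close> and decay like \<open>x / 2 ^ k\<close>
  afterwards. Past that point the induction keeps \<open>2 * x / 2 ^ n\<close> in reserve, the whole
  geometric tail still to come.\<close>

lemma sum_min_powers_le:
  fixes x :: real
  assumes "0 < x"
  shows "(\<Sum>k<n. min (2 ^ k) (x / 2 ^ k)) \<le> 4 * sqrt x"
proof -
  define s where "s n = (\<Sum>k<n. min (2 ^ k) (x / 2 ^ k))" for n :: nat
  have le_pow: "s n \<le> 2 ^ n" for n
  proof (induction n)
    case (Suc n)
    have "s (Suc n) \<le> s n + 2 ^ n" by (simp add: s_def)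
    with Suc show ?case by simp
  qed (simp add: s_def)
  define r where "r = sqrt x"
  have r: "0 < r" "x = r\<^sup>2" using assms by (simp_all add: r_def)
  have step: "r < 2 ^ n \<Longrightarrow> s n \<le> 4 * r - 2 * x / 2 ^ n" for n
  proof (induction n)
    case 0
    then have "r * r \<le> r * 1" using r by (intro mult_left_mono) auto
    then show ?case using r by (simp add: s_def power2_eq_square)
  next
    case (Suc n)
    define q :: real where "q = 2 ^ n"
    have q: "0 < q" by (simp add: q_def)
    show ?case
    proof (cases "r < q")
      case True
      have "s (Suc n) \<le> s n + x / q" by (simp add: s_def q_def)
      also have "\<dots> \<le> 4 * r - 2 * x / q + x / q"
        using Suc.IH True by (simp add: q_def)
      also have "\<dots> = 4 * r - 2 * x / 2 ^ Suc n"
        using q by (simp add: q_def[symmetric] field_simps)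
      finally show ?thesis .
    next
      case False
      have r2: "r < 2 * q" using Suc.prems by (simp add: q_def)
      \<comment> \<open>At the crossing, \<open>q \<le> r < 2 * q\<close>, only the bound
        \<open>2 * q\<close> on the sum is available; the sign of this product shows that it already
        satisfies the invariant.\<close>
      have "(r - q) * (r - 2 * q) \<le> 0"
        using False r2 by (intro mult_nonneg_nonpos) auto
      then have "r * r + 2 * (q * q) \<le> 3 * (q * r)"
        by (simp add: algebra_simps)
      moreover have "0 \<le> q * r" using q r by simp
      ultimately have "2 * q * q + r * r \<le> 4 * r * q"
        by (simp add: algebra_simps)
      then have "2 * q \<le> 4 * r - x / q"
        unfolding r(2) power2_eq_square using q by (simp add: le_diff_eq pos_divide_le_eq add_divide_eq_iff algebra_simps)
      then show ?thesis
        using le_pow[of "Suc n"] by (simp add: q_def)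
    qed
  qed
  have "s n \<le> 4 * r"
  proof (cases "r < 2 ^ n")
    case True
    have "0 \<le> 2 * x / 2 ^ n" using assms by simp
    with step[OF True] show ?thesis by linarith
  next
    case False
    then show ?thesis using le_pow[of n] r by linarith
  qed
  then show ?thesis by (simp add: s_def r_def)
qed

lemma sum_min_powers_le_linear:
  fixes x :: real
  assumes "0 \<le> x"
  shows "(\<Sum>k<n. min (2 ^ k) (x / 2 ^ k)) \<le> 2 * x"
proof -
  have "(\<Sum>k<n. min (2 ^ k) (x / 2 ^ k)) \<le> (\<Sum>k<n. x * (1 / 2) ^ k)"
    by (intro sum_mono) (simp add: power_divide)
  also have "\<dots> = x * (\<Sum>k<n. (1 / 2) ^ k)" by (simp add: sum_distrib_left)
  also have "(\<Sum>k<n. (1 / 2 :: real) ^ k) = 2 * (1 - (1 / 2) ^ n)"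
    by (subst sum_gp_strict) simp
  also have "x * (2 * (1 - (1 / 2) ^ n)) \<le> x * 2"
    using assms by (intro mult_left_mono) auto
  finally show ?thesis by simp
qed

lemma sum_min_powers_le_const:
  "(\<Sum>k<n. min (2 ^ k) (x / 2 ^ k)) \<le> (2 ^ n :: real)"
proof (induction n)
  case (Suc n)
  have "min (2 ^ n) (x / 2 ^ n) \<le> 2 ^ n" by simp
  with Suc show ?case by simp
qed simp

section \<open>Vanishing capacity for large exponents\<close>

text \<open>A cutoff that is 1 up to \<open>4 ^ k\<close> and 0 beyond \<open>2 * 4 ^ k\<close>.
  With these scales its L2 norm is of order \<open>2 ^ k\<close>, so no square roots of the scale
  appear later.\<close>

definition hat :: "nat \<Rightarrow> real \<Rightarrow> real" where
  "hat k t = max 0 (min 1 (2 - \<bar>t\<bar> / 4 ^ k))"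

lemma hat_measurable [measurable]: "hat k \<in> borel_measurable borel"
  unfolding hat_def[abs_def] by measurable

lemma hat_bounds: "0 \<le> hat k t" "hat k t \<le> 1"
  by (auto simp: hat_def)

lemma hat_support: "2 * 4 ^ k < \<bar>t\<bar> \<Longrightarrow> hat k t = 0"
  by (simp add: hat_def field_simps)

lemma hat_eq_1: "\<bar>t\<bar> \<le> 4 ^ k \<Longrightarrow> hat k t = 1"
  by (simp add: hat_def field_simps)

lemma hat_Lipschitz: "\<bar>hat k s - hat k t\<bar> \<le> \<bar>s - t\<bar> / 4 ^ k"
proof -
  have "\<bar>max 0 (min 1 (2 - a)) - max 0 (min 1 (2 - b))\<bar> \<le> \<bar>a - b\<bar>" for a b :: real
    by linarith
  then have "\<bar>hat k s - hat k t\<bar> \<le> \<bar>\<bar>s\<bar> / 4 ^ k - \<bar>t\<bar> / 4 ^ k\<bar>"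
    unfolding hat_def .
  also have "\<dots> = \<bar>\<bar>s\<bar> - \<bar>t\<bar>\<bar> / 4 ^ k"
    unfolding diff_divide_distrib[symmetric] by (simp add: abs_divide)
  also have "\<dots> \<le> \<bar>s - t\<bar> / 4 ^ k"
    by (rule divide_right_mono[OF abs_triangle_ineq3]) simp
  finally show ?thesis .
qed

lemma hat_mono: "j \<le> k \<Longrightarrow> hat j t \<le> hat k t"
proof -
  assume "j \<le> k"
  then have "(4::real) ^ j \<le> 4 ^ k" by (intro power_increasing) auto
  then have "\<bar>t\<bar> / 4 ^ k \<le> \<bar>t\<bar> / 4 ^ j" by (intro divide_left_mono) auto
  then show ?thesis unfolding hat_def by linarith
qed

lemma hat_L2: "hat k \<in> L2 lborel"
  by (rule L2_bounded_support[where B = 1, OF _ _ hat_support]) (auto simp: hat_bounds abs_le_iff intro: order_trans[OF _ hat_bounds(1)])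

definition hats :: "nat \<Rightarrow> l2" where
  "hats n = (\<Sum>k<n. abs_l2 (hat k))"

text \<open>\<open>translation_energy_le\<close> with radius \<open>2 * 4 ^ k\<close> and increments
  at most \<open>min 1 (\<bar>h\<bar> / 4 ^ k)\<close>; the radius turns the constant 4 into
  8.\<close>

lemma norm_tau_hat:
  "norm (tau h (abs_l2 (hat k)) - abs_l2 (hat k)) \<le> sqrt 8 * min (2 ^ k) (\<bar>h\<bar> / 2 ^ k)"
proof -
  define q :: real where "q = 2 ^ k"
  have q: "0 < q" "4 ^ k = q * q"
    by (simp_all add: q_def flip: power_mult_distrib)
  have *: "\<bar>hat k (t + h) - hat k t\<bar> \<le> min 1 (\<bar>h\<bar> / (q * q))" for t
    using hat_Lipschitz[of k "t + h" t] hat_bounds[of k t] hat_bounds[of k "t + h"] q by simp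
  have "(norm (tau h (abs_l2 (hat k)) - abs_l2 (hat k)))\<^sup>2 \<le> 4 * (2 * (q * q)) * (min 1 (\<bar>h\<bar> / (q * q)))\<^sup>2"
    by (rule translation_energy_le[OF hat_measurable hat_L2 _ _ *]) (use hat_support[of k] q in auto)
  also have "\<dots> = (sqrt 8 * (q * min 1 (\<bar>h\<bar> / (q * q))))\<^sup>2"
    by (simp add: power_mult_distrib power2_eq_square)
  also have "q * min 1 (\<bar>h\<bar> / (q * q)) = min q (\<bar>h\<bar> / q)"
    using q by (simp add: min_def field_simps)
  finally show ?thesis
    unfolding q_def by (rule power2_le_imp_le) simp
qed

lemma norm_tau_hats:
  "norm (tau h (hats n) - hats n) \<le> sqrt 8 * (\<Sum>k<n. min (2 ^ k) (\<bar>h\<bar> / 2 ^ k))"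
proof -
  have "tau h (hats n) = (\<Sum>k<n. tau h (abs_l2 (hat k)))"
    unfolding hats_def
  proof (induction n)
    case 0
    show ?case using tau_scaleR[of h 0 0] by simp
  qed (simp add: tau_add)
  then have "tau h (hats n) - hats n = (\<Sum>k<n. tau h (abs_l2 (hat k)) - abs_l2 (hat k))"
    by (simp add: hats_def sum_subtractf)
  also have "norm \<dots> \<le> (\<Sum>k<n. sqrt 8 * min (2 ^ k) (\<bar>h\<bar> / 2 ^ k))"
    by (rule order_trans[OF norm_sum sum_mono[OF norm_tau_hat]])
  finally show ?thesis by (simp add: sum_distrib_left)
qed

text \<open>Up to a constant, a majorant of the energy density of \<open>hats n\<close> at jump size
  u. The ranges are jumps below all scales of the cutoffs, between them and beyond them.\<close>

definition profile :: "nat \<Rightarrow> real \<Rightarrow> real" where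
  "profile n u = 4 * indicator {0..1} u + 16 * (1 / u * indicator {1..4 ^ n} u)
     + 4 ^ n * (u powr (- 2) * indicator {4 ^ n..} u)"

lemma profile_measurable [measurable]: "profile n \<in> borel_measurable borel"
  unfolding profile_def[abs_def] by measurable

lemma profile_nonneg: "0 \<le> profile n u"
  by (auto simp: profile_def indicator_def)

text \<open>The three ranges contribute 4, \<open>16 * (n * ln 4)\<close> and 1. Only the middle
  one, with its integral of \<open>1 / u\<close> up to \<open>4 ^ n\<close>, grows with n, and only
  linearly.\<close>

lemma profile_nn_integral: "(\<integral>\<^sup>+u. ennreal (profile n u) \<partial>lborel) \<le> ennreal (5 + 16 * (real n * ln 4))"
proof -
  have a: "(1::real) \<le> 4 ^ n" by simp
  have "((\<lambda>u::real. 1 / u) has_integral (ln (4 ^ n) - ln 1)) {1..4 ^ n}"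
  proof (rule fundamental_theorem_of_calculus[OF a])
    show "(ln has_vector_derivative 1 / u) (at u within {1..4 ^ n})" if "u \<in> {1..4 ^ n}" for u :: real
    proof (rule has_vector_derivative_at_within)
      from that have "0 < u" by simp
      then show "(ln has_vector_derivative 1 / u) (at u)"
        unfolding has_real_derivative_iff_has_vector_derivative[symmetric] by (rule DERIV_ln_divide)
    qed
  qed
  then have 1: "(\<integral>\<^sup>+u. ennreal (1 / u) * indicator {1..4 ^ n} u \<partial>lborel) = ennreal (real n * ln 4)"
    by (subst nn_integral_has_integral_lebesgue') (auto simp: ln_realpow)
  have "((\<lambda>u::real. u powr (- 2)) has_integral - ((4 ^ n) powr (- 2 + 1)) / (- 2 + 1)) {4 ^ n..}"
    by (rule has_integral_powr_to_inf) auto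
  then have 2: "(\<integral>\<^sup>+u. ennreal (u powr (- 2)) * indicator {4 ^ n..} u \<partial>lborel) = ennreal (1 / 4 ^ n)"
    by (subst nn_integral_has_integral_lebesgue') (auto simp: powr_minus_divide)
  have "(\<integral>\<^sup>+u. ennreal (profile n u) \<partial>lborel)
      = (\<integral>\<^sup>+u. 4 * indicator {0..1::real} u + 16 * (ennreal (1 / u) * indicator {1..4 ^ n} u)
        + ennreal (4 ^ n) * (ennreal (u powr (- 2)) * indicator {4 ^ n..} u) \<partial>lborel)"
  proof (rule nn_integral_cong)
    fix u :: real
    have nn: "0 \<le> 4 * (indicator {0..1} u :: real)" "0 \<le> 16 * (1 / u * indicator {1..4 ^ n} u)"
      "0 \<le> 4 ^ n * (u powr (- 2) * indicator {4 ^ n..} u)"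
      by (auto simp: indicator_def)
    have "ennreal (profile n u) = ennreal (4 * indicator {0..1} u) + ennreal (16 * (1 / u * indicator {1..4 ^ n} u))
        + ennreal (4 ^ n * (u powr (- 2) * indicator {4 ^ n..} u))"
      unfolding profile_def by (simp only: ennreal_plus nn add_nonneg_nonneg)
    also have "ennreal (4 * indicator {0..1} u) = 4 * indicator {0..1} u"
      by (simp add: indicator_def)
    also have "ennreal (16 * (1 / u * indicator {1..4 ^ n} u)) = 16 * (ennreal (1 / u) * indicator {1..4 ^ n} u)"
      using ennreal_mult'[of 16 "1 / u"] by (auto simp: indicator_def)
    also have "ennreal (4 ^ n * (u powr (- 2) * indicator {4 ^ n..} u))
        = ennreal (4 ^ n) * (ennreal (u powr (- 2)) * indicator {4 ^ n..} u)"
      by (auto simp: indicator_def ennreal_mult'')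
    finally show "ennreal (profile n u) = 4 * indicator {0..1} u + 16 * (ennreal (1 / u) * indicator {1..4 ^ n} u)
        + ennreal (4 ^ n) * (ennreal (u powr (- 2)) * indicator {4 ^ n..} u)" .
  qed
  also have "\<dots> = 4 * (\<integral>\<^sup>+u. indicator {0..1::real} u \<partial>lborel) + 16 * (\<integral>\<^sup>+u. ennreal (1 / u) * indicator {1..4 ^ n} u \<partial>lborel)
      + ennreal (4 ^ n) * (\<integral>\<^sup>+u. ennreal (u powr (- 2)) * indicator {4 ^ n..} u \<partial>lborel)"
    by (simp add: nn_integral_add nn_integral_cmult)
  also have "\<dots> = 4 + 16 * ennreal (real n * ln 4) + ennreal (4 ^ n) * ennreal (1 / 4 ^ n)"
    unfolding 1 2 by simp
  also have "\<dots> = ennreal (5 + 16 * (real n * ln 4))"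
  proof -
    define y where "y = real n * ln 4"
    have y: "0 \<le> y" by (simp add: y_def)
    have "ennreal ((4 + 16 * y) + 1) = ennreal (4 + 16 * y) + ennreal 1"
      by (rule ennreal_plus) (use y in auto)
    also have "ennreal (4 + 16 * y) = ennreal 4 + ennreal (16 * y)"
      by (rule ennreal_plus) (use y in auto)
    also have "ennreal (16 * y) = 16 * ennreal y"
      by (subst ennreal_mult') auto
    also have "ennreal 1 = ennreal (4 ^ n) * ennreal (1 / 4 ^ n)"
      by (subst ennreal_mult'[symmetric]) auto
    also have "(4 + 16 * y) + 1 = 5 + 16 * y" by simp
    finally show ?thesis unfolding y_def by simp
  qed
  finally show ?thesis by simp
qed

context levy
begin

lemma hat_in_D: "abs_l2 (hat k) \<in> G.D"
proof -
  have "abs_l2 (hat k) \<in> lip"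
    by (rule lip_abs_l2[where B = 1 and L = "1 / 4 ^ k", OF _ _ hat_support])
      (use hat_bounds hat_Lipschitz in auto)
  then show ?thesis using lip_subset_D by blast
qed

lemma hats_in_D: "hats n \<in> G.D"
  unfolding hats_def
proof (induction n)
  case 0
  show ?case using G.D_scale[OF hat_in_D, of 0] by simp
qed (simp add: G.D_add hat_in_D)

text \<open>In the three ranges of u the sum is bounded by \<open>2 * u\<close>,
  \<open>4 * sqrt u\<close> and \<open>2 ^ n\<close> respectively.\<close>

lemma square_increment_le_profile:
  assumes "h \<noteq> 0"
  shows "(\<Sum>k<n. min (2 ^ k) (\<bar>h\<bar> / 2 ^ k))\<^sup>2 / h\<^sup>2 \<le> profile n \<bar>h\<bar>"
proof -
  define u where "u = \<bar>h\<bar>"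
  define s where "s = (\<Sum>k<n. min (2 ^ k) (u / 2 ^ k))"
  have u: "0 < u" using assms by (simp add: u_def)
  have s0: "0 \<le> s" unfolding s_def using u by (intro sum_nonneg) auto
  consider "u \<le> 1" | "1 < u" "u \<le> 4 ^ n" | "1 < u" "4 ^ n < u" by linarith
  then have "s\<^sup>2 / u\<^sup>2 \<le> profile n u"
  proof cases
    case 1
    have "s \<le> 2 * u" unfolding s_def using u by (intro sum_min_powers_le_linear) simp
    then have "s\<^sup>2 \<le> (2 * u)\<^sup>2" using s0 by (intro power_mono) auto
    then have "s\<^sup>2 / u\<^sup>2 \<le> 4" using u by (simp add: divide_le_eq power_mult_distrib)
    also have "4 \<le> profile n u" using u 1 by (auto simp: profile_def indicator_def)
    finally show ?thesis .
  next
    case 2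
    have "s \<le> 4 * sqrt u" unfolding s_def using u by (intro sum_min_powers_le) simp
    then have "s\<^sup>2 \<le> (4 * sqrt u)\<^sup>2" using s0 by (intro power_mono) auto
    also have "(4 * sqrt u)\<^sup>2 = 16 * u" using u by (simp add: power_mult_distrib)
    finally have "s\<^sup>2 / u\<^sup>2 \<le> 16 * u / u\<^sup>2" by (rule divide_right_mono) simp
    also have "16 * u / u\<^sup>2 = 16 * (1 / u)" using u by (simp add: power2_eq_square)
    also have "\<dots> \<le> profile n u" using u 2 by (auto simp: profile_def indicator_def)
    finally show ?thesis .
  next
    case 3
    have "s \<le> 2 ^ n" unfolding s_def by (rule sum_min_powers_le_const)
    then have "s\<^sup>2 \<le> (2 ^ n)\<^sup>2" using s0 by (intro power_mono) auto
    also have "(2 ^ n)\<^sup>2 = (4 :: real) ^ n" by (simp add: power2_eq_square flip: power_mult_distrib)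
    finally have "s\<^sup>2 / u\<^sup>2 \<le> 4 ^ n * (1 / u\<^sup>2)"
      by (simp add: divide_right_mono)
    also have "1 / u\<^sup>2 = u powr (- 2)" using u by (simp add: powr_minus_divide powr_numeral)
    also have "4 ^ n * u powr (- 2) \<le> profile n u" using u 3 by (auto simp: profile_def indicator_def)
    finally show ?thesis .
  qed
  then show ?thesis by (simp add: u_def s_def)
qed

lemma energy_hats:
  assumes "1 \<le> \<epsilon>"
  shows "G.E (hats n) (hats n) \<le> 16 * exp 1 * (5 + 16 * (real n * ln 4))"
proof -
  have "energy (hats n) \<le> (\<integral>\<^sup>+h. ennreal (8 * exp 1) * ennreal (profile n \<bar>h\<bar>) \<partial>lborel)"
    unfolding energy_def
  proof (rule nn_integral_mono)
    fix h :: real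
    show "ennreal (lev \<epsilon> h * (norm (tau h (hats n) - hats n))\<^sup>2) \<le> ennreal (8 * exp 1) * ennreal (profile n \<bar>h\<bar>)"
    proof (cases "h = 0")
      case False
      define s where "s = (\<Sum>k<n. min (2 ^ k) (\<bar>h\<bar> / 2 ^ k))"
      have "(norm (tau h (hats n) - hats n))\<^sup>2 \<le> (sqrt 8 * s)\<^sup>2"
        unfolding s_def by (intro power_mono norm_tau_hats) simp
      then have "lev \<epsilon> h * (norm (tau h (hats n) - hats n))\<^sup>2 \<le> (exp 1 / h\<^sup>2) * (8 * s\<^sup>2)"
        using lev_le_inverse_square[OF assms False] by (intro mult_mono) (auto simp: power_mult_distrib)
      also have "\<dots> = 8 * exp 1 * (s\<^sup>2 / h\<^sup>2)" by simp
      also have "\<dots> \<le> 8 * exp 1 * profile n \<bar>h\<bar>"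
        unfolding s_def by (intro mult_left_mono square_increment_le_profile False) simp
      finally show ?thesis
        by (simp add: ennreal_leI profile_nonneg flip: ennreal_mult')
    qed simp
  qed
  also have "\<dots> = ennreal (8 * exp 1) * (\<integral>\<^sup>+h. ennreal (profile n \<bar>h\<bar>) \<partial>lborel)"
    by (rule nn_integral_cmult) measurable
  also have "(\<integral>\<^sup>+h. ennreal (profile n \<bar>h\<bar>) \<partial>lborel)
      \<le> (\<integral>\<^sup>+h. ennreal (profile n h) + ennreal (profile n (- h)) \<partial>lborel)"
    by (intro nn_integral_mono) (auto simp: abs_if add_increasing add_increasing2)
  also have "\<dots> = (\<integral>\<^sup>+h. ennreal (profile n h) \<partial>lborel) + (\<integral>\<^sup>+h. ennreal (profile n (- h)) \<partial>lborel)"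
    by (rule nn_integral_add) measurable
  also have "(\<integral>\<^sup>+h. ennreal (profile n (- h)) \<partial>lborel) = (\<integral>\<^sup>+h. ennreal (profile n h) \<partial>lborel)"
    using nn_integral_real_affine[of "\<lambda>h. ennreal (profile n h)" "-1" 0] by simp
  also have "(\<integral>\<^sup>+h. ennreal (profile n h) \<partial>lborel) + (\<integral>\<^sup>+h. ennreal (profile n h) \<partial>lborel)
      \<le> ennreal (5 + 16 * (real n * ln 4)) + ennreal (5 + 16 * (real n * ln 4))"
    by (intro add_mono profile_nn_integral)
  also have "ennreal (8 * exp 1) * \<dots> = ennreal (16 * exp 1 * (5 + 16 * (real n * ln 4)))"
    by (simp add: algebra_simps flip: ennreal_plus ennreal_mult')
  finally have "energy (hats n) \<le> ennreal (16 * exp 1 * (5 + 16 * (real n * ln 4)))"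
    by (simp add: mult_left_mono)
  then show ?thesis
    by (simp add: energy_eq_E[OF hats_in_D])
qed

text \<open>
  For \<open>\<epsilon> \<ge> 1\<close> constants have zero energy in the limit: the energy of a sum of \<open>n\<close> cutoffs at
  the scales \<open>4\<^sup>k\<close> grows linearly in \<open>n\<close>, whereas its square pairing with a
  nonnegative function grows quadratically.
\<close>

lemma no_energy_bound:
  assumes "1 \<le> \<epsilon>" and nn: "AE t in lborel. 0 \<le> rep_l2 x t"
    and bound: "\<And>v. v \<in> G.D \<Longrightarrow> (inner x v)\<^sup>2 \<le> C * G.E v v" and "0 \<le> C"
  shows "x = 0"
proof (rule ccontr)
  assume "x \<noteq> 0"
  have pair: "inner x (abs_l2 (hat k)) = (LINT t|lborel. rep_l2 x t * hat k t)" for k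
    using inner_abs_l2[OF rep_l2_L2[of x] hat_L2[of k]] by simp
  have int: "integrable lborel (\<lambda>t. rep_l2 x t * hat k t)" for k
    by (rule L2_mult_integrable[OF rep_l2_L2 hat_L2])
  have nn': "AE t in lborel. 0 \<le> rep_l2 x t * hat k t" for k
    using nn by eventually_elim (simp add: hat_bounds)
  have mono: "inner x (abs_l2 (hat j)) \<le> inner x (abs_l2 (hat k))" if "j \<le> k" for j k
    unfolding pair
  proof (rule integral_mono_AE[OF int int])
    show "AE t in lborel. rep_l2 x t * hat j t \<le> rep_l2 x t * hat k t"
      using nn by eventually_elim (simp add: mult_left_mono hat_mono[OF that])
  qed
  have nonneg: "0 \<le> inner x (abs_l2 (hat k))" for k
    unfolding pair by (rule integral_nonneg_AE[OF nn'])
  have "\<exists>k. inner x (abs_l2 (hat k)) \<noteq> 0"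
  proof (rule ccontr)
    assume "\<nexists>k. inner x (abs_l2 (hat k)) \<noteq> 0"
    then have "(LINT t|lborel. rep_l2 x t * hat k t) = 0" for k
      by (simp add: pair)
    then have "AE t in lborel. rep_l2 x t * hat k t = 0" for k
      using integral_nonneg_eq_0_iff_AE[OF int nn'] by simp
    then have "AE t in lborel. \<forall>k. rep_l2 x t * hat k t = 0"
      unfolding AE_all_countable by (rule allI)
    then have "AE t in lborel. rep_l2 x t = 0"
    proof eventually_elim
      case (elim t)
      obtain k where "\<bar>t\<bar> < 4 ^ k"
        using real_arch_pow[of 4 "\<bar>t\<bar>"] by auto
      with elim[rule_format, of k] show ?case by (simp add: hat_eq_1)
    qed
    then have "x = 0"
      unfolding l2_eq_iff using rep_zero by eventually_elim simp
    with \<open>x \<noteq> 0\<close> show False ..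
  qed
  then obtain k0 where "inner x (abs_l2 (hat k0)) \<noteq> 0" by blast
  with nonneg[of k0] have c: "0 < inner x (abs_l2 (hat k0))" by simp
  define c where "c = inner x (abs_l2 (hat k0))"
  \<comment> \<open>The first \<open>k0\<close> cutoffs are discarded; by monotonicity each of the
    remaining n pairs with x by at least c.\<close>
  have lower: "real n * c \<le> inner x (hats (n + k0))" for n
  proof -
    have "real n * c = (\<Sum>k\<in>{k0..<n + k0}. c)" by simp
    also have "\<dots> \<le> (\<Sum>k\<in>{k0..<n + k0}. inner x (abs_l2 (hat k)))"
      unfolding c_def by (intro sum_mono mono) auto
    also have "\<dots> \<le> (\<Sum>k<n + k0. inner x (abs_l2 (hat k)))"
      by (intro sum_mono2 nonneg) auto
    finally show ?thesis by (simp add: hats_def inner_sum_right)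
  qed
  have main: "(real n * c)\<^sup>2 \<le> C * (16 * exp 1 * (5 + 16 * (real (n + k0) * ln 4)))" for n
  proof -
    have "(real n * c)\<^sup>2 \<le> (inner x (hats (n + k0)))\<^sup>2"
      using lower[of n] c by (intro power_mono) (auto simp: c_def)
    also have "\<dots> \<le> C * G.E (hats (n + k0)) (hats (n + k0))"
      by (rule bound[OF hats_in_D])
    also have "\<dots> \<le> C * (16 * exp 1 * (5 + 16 * (real (n + k0) * ln 4)))"
      by (intro mult_left_mono energy_hats assms)
    finally show ?thesis .
  qed
  have "c > 0" using c by (simp add: c_def)
  have "((\<lambda>n::real. (C * (16 * exp 1 * (5 + 16 * ((n + k0) * ln 4)))) / n\<^sup>2) \<longlongrightarrow> 0) at_top"
    by real_asymp
  then have "(\<lambda>n. (C * (16 * exp 1 * (5 + 16 * ((real n + k0) * ln 4)))) / (real n)\<^sup>2) \<longlonglongrightarrow> 0"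
    by (rule filterlim_compose[OF _ filterlim_real_sequentially])
  moreover have "\<forall>\<^sub>F n in sequentially. c\<^sup>2 \<le> (C * (16 * exp 1 * (5 + 16 * ((real n + k0) * ln 4)))) / (real n)\<^sup>2"
    using eventually_gt_at_top[of 0]
  proof eventually_elim
    case (elim n)
    then show ?case using main[of n] by (simp add: pos_le_divide_eq power_mult_distrib mult.commute)
  qed
  ultimately have "c\<^sup>2 \<le> 0"
    by (rule tendsto_lowerbound) simp
  with \<open>c > 0\<close> show False by simp
qed

end

section \<open>Extension of the semigroup to integrable functions\<close>

lemma L2_inner_eq: "f \<in> L2 lborel \<Longrightarrow> g \<in> L2 lborel \<Longrightarrow> L2_inner lborel f g = inner (abs_l2 f) (abs_l2 g)"
  by (simp add: L2_inner_def inner_abs_l2)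

lemma AE_eq_iff_abs_l2:
  "f \<in> L2 lborel \<Longrightarrow> g \<in> L2 lborel \<Longrightarrow> (AE x in lborel. f x = g x) \<longleftrightarrow> abs_l2 f = abs_l2 g"
  by (simp add: abs_l2_eq_iff)

text \<open>A \<open>symmetric_contraction_semigroup\<close> says nothing about time 0, whereas a
  \<open>contraction_semigroup\<close> starts with the identity; hence the case distinction.\<close>

definition lift_semigroup :: "(real \<Rightarrow> (real \<Rightarrow> real) \<Rightarrow> real \<Rightarrow> real) \<Rightarrow> real \<Rightarrow> l2 \<Rightarrow> l2" where
  "lift_semigroup T t x = (if t = 0 then x else abs_l2 (T t (rep_l2 x)))"

text \<open>Independence of the representative is not an axiom. It follows from linearity up to null
  sets and contractivity, applied to the difference of two representatives, which has norm
  0.\<close>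

lemma symmetric_contraction_semigroup_abs_l2:
  assumes "symmetric_contraction_semigroup lborel T" "0 < t" "f \<in> L2 lborel"
  shows "abs_l2 (T t f) = lift_semigroup T t (abs_l2 f)"
proof -
  interpret symmetric_contraction_semigroup lborel T by fact
  define g where "g = rep_l2 (abs_l2 f)"
  have g: "g \<in> L2 lborel" "abs_l2 g = abs_l2 f" by (simp_all add: g_def)
  note Tf = closed_L2[OF assms(2,3)] and Tg = closed_L2[OF assms(2) g(1)]
  have fg: "(\<lambda>y. 1 * f y + (- 1) * g y) \<in> L2 lborel"
    by (rule L2_lincomb[OF assms(3) g(1)])
  have "abs_l2 (T t (\<lambda>y. 1 * f y + (- 1) * g y)) = 1 *\<^sub>R abs_l2 (T t f) + (- 1) *\<^sub>R abs_l2 (T t g)"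
    unfolding abs_l2_lincomb[OF Tf Tg, symmetric]
    using linear[OF assms(2,3) g(1), of 1 "-1"]
    by (subst abs_l2_eq_iff) (auto intro!: closed_L2 assms fg g(1) L2_lincomb Tf Tg L2_diff)
  moreover have "norm (abs_l2 (T t (\<lambda>y. 1 * f y + (- 1) * g y))) \<le> norm (abs_l2 (\<lambda>y. 1 * f y + (- 1) * g y))"
    using contraction[OF assms(2) fg] by (simp only: norm_abs_l2 fg closed_L2[OF assms(2) fg])
  moreover have "abs_l2 (\<lambda>y. 1 * f y + (- 1) * g y) = 0"
    unfolding abs_l2_lincomb[OF assms(3) g(1)] by (simp add: g(2))
  ultimately show ?thesis
    using assms(2) by (simp add: lift_semigroup_def g_def)
qed

lemma contraction_semigroup_lift:
  assumes T: "symmetric_contraction_semigroup lborel T"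
  shows "contraction_semigroup (lift_semigroup T)"
proof (rule contraction_semigroup.intro)
  interpret symmetric_contraction_semigroup lborel T by (rule T)
  note abs = symmetric_contraction_semigroup_abs_l2[OF T]
  have norm: "norm (lift_semigroup T t x) \<le> norm x" if "0 \<le> t" for t x
    using contraction[of t "rep_l2 x"] that
    by (auto simp: lift_semigroup_def norm_abs_l2[symmetric] closed_L2)
  have lincomb: "lift_semigroup T t (a *\<^sub>R x + b *\<^sub>R y) = a *\<^sub>R lift_semigroup T t x + b *\<^sub>R lift_semigroup T t y"
    if "0 \<le> t" for t a b x y
  proof (cases "t = 0")
    case False
    with that have t: "0 < t" by simp
    note Tx = closed_L2[OF t rep_l2_L2]
    have L: "(\<lambda>s. a * rep_l2 x s + b * rep_l2 y s) \<in> L2 lborel"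
      by (intro L2_lincomb) auto
    have "a *\<^sub>R x + b *\<^sub>R y = abs_l2 (\<lambda>s. a * rep_l2 x s + b * rep_l2 y s)"
      by (simp add: abs_l2_lincomb)
    then have "lift_semigroup T t (a *\<^sub>R x + b *\<^sub>R y) = abs_l2 (T t (\<lambda>s. a * rep_l2 x s + b * rep_l2 y s))"
      using abs[OF t L] by simp
    also have "\<dots> = abs_l2 (\<lambda>s. a * T t (rep_l2 x) s + b * T t (rep_l2 y) s)"
      using linear[OF t rep_l2_L2 rep_l2_L2, of a x b y]
      by (subst abs_l2_eq_iff) (auto intro!: closed_L2 t L L2_lincomb Tx)
    finally show ?thesis
      using False by (simp add: abs_l2_lincomb Tx lift_semigroup_def)
  qed (simp add: lift_semigroup_def)
  show "linear (lift_semigroup T t)" if "0 \<le> t" for t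
    using lincomb[OF that, of 1 _ 1] lincomb[OF that, of _ _ 0 0] by (intro linearI) auto
  show "norm (lift_semigroup T t x) \<le> norm x" if "0 \<le> t" for t x
    by (rule norm[OF that])
  show "lift_semigroup T 0 x = x" for x
    by (simp add: lift_semigroup_def)
  show "lift_semigroup T (s + t) x = lift_semigroup T s (lift_semigroup T t x)"
    if "0 \<le> s" "0 \<le> t" for s t x
  proof (cases "s = 0 \<or> t = 0")
    case False
    with that have st: "0 < s" "0 < t" by auto
    have "abs_l2 (T (s + t) (rep_l2 x)) = abs_l2 (T s (T t (rep_l2 x)))"
      using semigroup[OF st rep_l2_L2[of x]] st
      by (subst abs_l2_eq_iff) (auto intro!: closed_L2)
    also have "\<dots> = lift_semigroup T s (abs_l2 (T t (rep_l2 x)))"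
      using st by (intro abs closed_L2) auto
    finally show ?thesis
      using st by (simp add: lift_semigroup_def)
  qed (auto simp: lift_semigroup_def)
  show "((\<lambda>t. lift_semigroup T t x) \<longlongrightarrow> x) (at_right 0)" for x
  proof -
    have "((\<lambda>t. norm (lift_semigroup T t x - x)) \<longlongrightarrow> 0) (at_right 0)"
    proof (rule Lim_transform_eventually[OF strongly_continuous[OF rep_l2_L2[of x]]])
      have "\<forall>\<^sub>F t in at_right (0::real). 0 < t" by (simp add: eventually_at_right_less)
      then show "\<forall>\<^sub>F t in at_right 0. L2_nrm lborel (\<lambda>s. T t (rep_l2 x) s - rep_l2 x s) = norm (lift_semigroup T t x - x)"
        by eventually_elim
          (simp add: lift_semigroup_def norm_abs_l2[symmetric] L2_diff closed_L2 abs_l2_diff)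
    qed
    then show ?thesis
      by (simp add: tendsto_norm_zero_iff LIM_zero_iff)
  qed
qed

lemma generator_iff:
  assumes T: "symmetric_contraction_semigroup lborel T" and u: "u \<in> L2 lborel" and f: "f \<in> L2 lborel"
  shows "(u, f) \<in> generator lborel T \<longleftrightarrow> (abs_l2 u, abs_l2 f) \<in> gen (lift_semigroup T)"
proof -
  interpret symmetric_contraction_semigroup lborel T by (rule T)
  have ev: "\<forall>\<^sub>F t in at_right 0. L2_nrm lborel (\<lambda>x. (T t u x - u x) / t - f x)
      = norm ((lift_semigroup T t (abs_l2 u) - abs_l2 u) /\<^sub>R t - abs_l2 f)"
  proof -
    have "\<forall>\<^sub>F t in at_right (0::real). 0 < t" by (simp add: eventually_at_right_less)
    then show ?thesis
    proof eventually_elim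
      case (elim t)
      note Tu = closed_L2[OF elim u]
      have d: "(\<lambda>x. T t u x - u x) \<in> L2 lborel" by (rule L2_diff[OF Tu u])
      have "(\<lambda>x. (T t u x - u x) / t - f x) = (\<lambda>x. (1 / t) * (T t u x - u x) + (- 1) * f x)"
        by (simp add: fun_eq_iff)
      then have "L2_nrm lborel (\<lambda>x. (T t u x - u x) / t - f x)
          = norm (abs_l2 (\<lambda>x. (1 / t) * (T t u x - u x) + (- 1) * f x))"
        by (simp only: norm_abs_l2 L2_lincomb[OF d f])
      also have "\<dots> = norm ((1 / t) *\<^sub>R (abs_l2 (T t u) - abs_l2 u) + (- 1) *\<^sub>R abs_l2 f)"
        by (simp only: abs_l2_lincomb[OF d f] abs_l2_diff[OF Tu u])
      finally show ?case
        by (simp add: symmetric_contraction_semigroup_abs_l2[OF T elim u] inverse_eq_divide)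
    qed
  qed
  have "(u, f) \<in> generator lborel T \<longleftrightarrow>
      ((\<lambda>t. L2_nrm lborel (\<lambda>x. (T t u x - u x) / t - f x)) \<longlongrightarrow> 0) (at_right 0)"
    using u f by (simp add: generator_def)
  also have "\<dots> \<longleftrightarrow> ((\<lambda>t. norm ((lift_semigroup T t (abs_l2 u) - abs_l2 u) /\<^sub>R t - abs_l2 f)) \<longlongrightarrow> 0) (at_right 0)"
    by (rule tendsto_cong[OF ev])
  finally show ?thesis
    by (simp add: gen_def tendsto_norm_zero_iff LIM_zero_iff)
qed

context levy
begin

definition T :: "real \<Rightarrow> (real \<Rightarrow> real) \<Rightarrow> real \<Rightarrow> real" where
  "T t f = rep_l2 (G.P t (abs_l2 f))"

lemma T_L2 [simp]: "T t f \<in> L2 lborel"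
  by (simp add: T_def)

lemma T_measurable [measurable, simp]: "T t f \<in> borel_measurable borel"
  by (simp add: T_def)

lemma abs_T [simp]: "abs_l2 (T t f) = G.P t (abs_l2 f)"
  by (simp add: T_def)

lemma T_lincomb:
  assumes "0 \<le> t" "f \<in> L2 lborel" "g \<in> L2 lborel"
  shows "AE x in lborel. T t (\<lambda>y. a * f y + b * g y) x = a * T t f x + b * T t g x"
  using assms
  by (subst AE_eq_iff_abs_l2) (simp_all add: L2_lincomb abs_l2_lincomb G.P.plus G.P.scale)

lemma symmetric_contraction_semigroup_T: "symmetric_contraction_semigroup lborel T"
proof
  fix t :: real and f :: "real \<Rightarrow> real" assume t: "0 < t" and f: "f \<in> L2 lborel"
  show "T t f \<in> L2 lborel" by simp
  show "L2_nrm lborel (T t f) \<le> L2_nrm lborel f"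
    using t f by (simp add: norm_abs_l2[symmetric] G.P.contr)
  fix g :: "real \<Rightarrow> real" assume g: "g \<in> L2 lborel"
  show "AE x in lborel. T t (\<lambda>y. a * f y + b * g y) x = a * T t f x + b * T t g x" for a b
    using t f g by (intro T_lincomb) auto
  show "L2_inner lborel (T t f) g = L2_inner lborel f (T t g)"
    using t f g by (simp add: L2_inner_eq G.P_sym)
next
  fix s t :: real and f :: "real \<Rightarrow> real" assume "0 < s" "0 < t" "f \<in> L2 lborel"
  then show "AE x in lborel. T (s + t) f x = T s (T t f) x"
    by (subst AE_eq_iff_abs_l2) (simp_all add: G.P.add)
next
  fix f :: "real \<Rightarrow> real" assume f: "f \<in> L2 lborel"
  have "((\<lambda>t. norm (G.P t (abs_l2 f) - abs_l2 f)) \<longlongrightarrow> 0) (at_right 0)"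
    using G.P.cont0[of "abs_l2 f"] by (simp add: tendsto_norm_zero_iff LIM_zero_iff)
  then show "((\<lambda>t. L2_nrm lborel (\<lambda>x. T t f x - f x)) \<longlongrightarrow> 0) (at_right 0)"
    by (simp add: norm_abs_l2[symmetric] L2_diff f abs_l2_diff)
qed

lemma lift_T: "0 \<le> t \<Longrightarrow> lift_semigroup T t x = G.P t x"
  by (simp add: lift_semigroup_def G.P.at_zero)

lemma form_operator_iff:
  assumes u: "u \<in> L2 lborel" and f: "f \<in> L2 lborel"
  shows "(u, f) \<in> form_operator lborel (levy_form \<epsilon>) (levy_dom \<epsilon>) \<longleftrightarrow> (abs_l2 u, abs_l2 f) \<in> gen G.P"
proof -
  have "(u, f) \<in> form_operator lborel (levy_form \<epsilon>) (levy_dom \<epsilon>) \<longleftrightarrow>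
      u \<in> levy_dom \<epsilon> \<and> (\<forall>v\<in>levy_dom \<epsilon>. levy_form \<epsilon> u v = - L2_inner lborel f v)"
    using f by (simp add: form_operator_def)
  also have "\<dots> \<longleftrightarrow> u \<in> levy_dom \<epsilon> \<and> (\<forall>v\<in>levy_dom \<epsilon>. G.E (abs_l2 u) (abs_l2 v) = - inner (abs_l2 f) (abs_l2 v))"
    using f by (auto simp: levy_form_E L2_inner_eq levy_dom_iff)
  also have "\<dots> \<longleftrightarrow> abs_l2 u \<in> G.D \<and> (\<forall>x\<in>G.D. G.E (abs_l2 u) x = - inner (abs_l2 f) x)"
  proof -
    have "(\<forall>v\<in>levy_dom \<epsilon>. Q (abs_l2 v)) \<longleftrightarrow> (\<forall>x\<in>G.D. Q x)" for Q
    proof (intro iffI ballI)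
      fix x assume all: "\<forall>v\<in>levy_dom \<epsilon>. Q (abs_l2 v)" and "x \<in> G.D"
      from bspec[OF all rep_levy_dom[OF this(2)]] show "Q x" by simp
    qed (simp add: levy_dom_iff)
    from this[of "\<lambda>x. G.E (abs_l2 u) x = - inner (abs_l2 f) x"]
    show ?thesis using u by (simp add: levy_dom_iff)
  qed
  finally show ?thesis by (simp add: G.gen_P)
qed

lemma gen_lift_T: "gen (lift_semigroup T) = gen G.P"
proof -
  have "\<forall>\<^sub>F t in at_right (0::real). 0 < t" by (simp add: eventually_at_right_less)
  then have "\<forall>\<^sub>F t in at_right 0. (lift_semigroup T t u - u) /\<^sub>R t = (G.P t u - u) /\<^sub>R t" for u
    by eventually_elim (simp add: lift_T)
  from tendsto_cong[OF this] show ?thesis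
    unfolding gen_def by presburger
qed

lemma associated_semigroup_T: "associated_semigroup lborel (levy_form \<epsilon>) (levy_dom \<epsilon>) T"
  unfolding associated_semigroup_def
proof (intro conjI symmetric_contraction_semigroup_T set_eqI, clarify)
  fix u f :: "real \<Rightarrow> real"
  have "(u, f) \<in> generator lborel T \<Longrightarrow> u \<in> L2 lborel \<and> f \<in> L2 lborel"
    by (simp add: generator_def)
  moreover have "(u, f) \<in> form_operator lborel (levy_form \<epsilon>) (levy_dom \<epsilon>) \<Longrightarrow> u \<in> L2 lborel \<and> f \<in> L2 lborel"
    by (simp add: form_operator_def levy_dom_iff)
  ultimately show "(u, f) \<in> generator lborel T \<longleftrightarrow> (u, f) \<in> form_operator lborel (levy_form \<epsilon>) (levy_dom \<epsilon>)"
    using generator_iff[OF symmetric_contraction_semigroup_T, of u f, unfolded gen_lift_T]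
      form_operator_iff[of u f] by argo
qed

text \<open>Refuting recurrence means refuting it for every associated semigroup. Each of them has
  the generator of \<open>G.P\<close>, and the generator determines the semigroup.\<close>

lemma associated_semigroup_unique:
  assumes "associated_semigroup lborel (levy_form \<epsilon>) (levy_dom \<epsilon>) T'" "0 < t" "f \<in> L2 lborel"
  shows "AE x in lborel. T' t f x = T t f x"
proof -
  have T': "symmetric_contraction_semigroup lborel T'"
    and gen': "generator lborel T' = form_operator lborel (levy_form \<epsilon>) (levy_dom \<epsilon>)"
    using assms(1) by (simp_all add: associated_semigroup_def)
  have "(x, y) \<in> gen (lift_semigroup T') \<longleftrightarrow> (x, y) \<in> gen G.P" for x y
    using generator_iff[OF T', of "rep_l2 x" "rep_l2 y"] form_operator_iff[of "rep_l2 x" "rep_l2 y"]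
    by (simp add: gen')
  then have "gen (lift_semigroup T') = gen G.P" by auto
  from contraction_semigroup_unique[OF contraction_semigroup_lift[OF T'] G.contraction_semigroup_P this]
  have "lift_semigroup T' t (abs_l2 f) = G.P t (abs_l2 f)" using assms(2) by simp
  then have "abs_l2 (T' t f) = abs_l2 (T t f)"
    by (simp add: symmetric_contraction_semigroup_abs_l2[OF T' assms(2,3)])
  moreover have "T' t f \<in> L2 lborel"
    using T' assms(2,3) by (simp add: symmetric_contraction_semigroup.closed_L2)
  ultimately show ?thesis
    by (subst AE_eq_iff_abs_l2) auto
qed

end

section \<open>Positivity and contractivity in L1\<close>

definition nneg :: "l2 \<Rightarrow> bool" where
  "nneg x \<longleftrightarrow> (AE t in lborel. 0 \<le> rep_l2 x t)"

lemma nneg_iff_pos_mass: "nneg x \<longleftrightarrow> pos_mass (- x) = 0"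
proof -
  have "pos_mass (- x) = (\<integral>\<^sup>+t. ennreal (- rep_l2 x t) \<partial>lborel)"
    unfolding pos_mass_def using rep_uminus[of x] by (intro nn_integral_cong_AE) auto
  then show ?thesis
    by (simp add: nneg_def nn_integral_0_iff_AE ennreal_eq_0_iff)
qed

lemma nneg_abs_l2: "f \<in> L2 lborel \<Longrightarrow> nneg (abs_l2 f) \<longleftrightarrow> (AE t in lborel. 0 \<le> f t)"
  unfolding nneg_def using rep_abs_l2[of f] by (auto elim: AE_mp)

lemma nneg_diff: "nneg (x - y) \<longleftrightarrow> (AE t in lborel. rep_l2 y t \<le> rep_l2 x t)"
  unfolding nneg_def using rep_minus[of x y] by (auto elim: AE_mp)

lemma inner_nneg:
  assumes "nneg x" "nneg y"
  shows "0 \<le> inner x y"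
  unfolding inner_l2_def L2_inner_def
proof (intro integral_nonneg_AE)
  show "AE t in lborel. 0 \<le> rep_l2 x t * rep_l2 y t"
    using assms unfolding nneg_def by eventually_elim simp
qed

lemma nn_integral_abs_eq_pos_mass:
  "(\<integral>\<^sup>+t. ennreal \<bar>rep_l2 x t\<bar> \<partial>lborel) = pos_mass x + pos_mass (- x)"
proof -
  have "pos_mass x + pos_mass (- x) = (\<integral>\<^sup>+t. ennreal (rep_l2 x t) + ennreal (rep_l2 (- x) t) \<partial>lborel)"
    unfolding pos_mass_def by (rule nn_integral_add[symmetric]) auto
  also have "\<dots> = (\<integral>\<^sup>+t. ennreal \<bar>rep_l2 x t\<bar> \<partial>lborel)"
  proof (rule nn_integral_cong_AE)
    show "AE t in lborel. ennreal (rep_l2 x t) + ennreal (rep_l2 (- x) t) = ennreal \<bar>rep_l2 x t\<bar>"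
      using rep_uminus[of x] by eventually_elim (auto simp: abs_if ennreal_neg)
  qed
  finally show ?thesis by simp
qed

context levy
begin

lemma P_minus: "0 \<le> t \<Longrightarrow> G.P t (- x) = - G.P t x"
  using G.P.scale[of t "-1" x] by simp

lemma R_minus: "G.R (- x) = - G.R x"
  by (rule LIMSEQ_unique[OF G.R_LIMSEQ]) (simp add: app.minus_right tendsto_minus G.R_LIMSEQ)

lemma P_nneg: "0 \<le> t \<Longrightarrow> nneg x \<Longrightarrow> nneg (G.P t x)"
  using pos_mass_P[of t "- x"] by (simp add: nneg_iff_pos_mass P_minus)

lemma R_nneg: "nneg x \<Longrightarrow> nneg (G.R x)"
  using pos_mass_R[of "- x"] by (simp add: nneg_iff_pos_mass R_minus)

lemma R_eq_0_imp: "G.R x = 0 \<Longrightarrow> x = 0"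
proof -
  assume "G.R x = 0"
  with G.R_gen[of x] have "(0, - x) \<in> gen G.P" by simp
  then have "((\<lambda>t. (G.P t 0 - 0) /\<^sub>R t) \<longlongrightarrow> - x) (at_right 0)"
    by (simp add: gen_def)
  moreover have "\<forall>\<^sub>F t in at_right (0::real). 0 < t" by (simp add: eventually_at_right_less)
  then have "\<forall>\<^sub>F t in at_right 0. (G.P t 0 - 0) /\<^sub>R t = 0"
    by eventually_elim (use G.P.scale[of _ 0 0] in simp)
  then have "((\<lambda>t. (G.P t 0 - 0) /\<^sub>R t) \<longlongrightarrow> 0) (at_right 0)"
    by (rule tendsto_eventually)
  ultimately have "- x = 0"
    by (rule tendsto_unique[OF trivial_limit_at_right_real])
  then show "x = 0" by simp
qed

lemma T_L1_nn:
  assumes "0 \<le> t" "f \<in> L2 lborel"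
  shows "(\<integral>\<^sup>+x. ennreal \<bar>T t f x\<bar> \<partial>lborel) \<le> (\<integral>\<^sup>+x. ennreal \<bar>f x\<bar> \<partial>lborel)"
proof -
  have "(\<integral>\<^sup>+x. ennreal \<bar>T t f x\<bar> \<partial>lborel) = pos_mass (G.P t (abs_l2 f)) + pos_mass (G.P t (- abs_l2 f))"
    using assms by (simp add: T_def nn_integral_abs_eq_pos_mass P_minus)
  also have "\<dots> \<le> pos_mass (abs_l2 f) + pos_mass (- abs_l2 f)"
    by (intro add_mono pos_mass_P assms)
  also have "\<dots> = (\<integral>\<^sup>+x. ennreal \<bar>f x\<bar> \<partial>lborel)"
    unfolding nn_integral_abs_eq_pos_mass[symmetric]
    using rep_abs_l2[OF assms(2)] by (intro nn_integral_cong_AE) auto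
  finally show ?thesis .
qed

lemma T_L1:
  assumes "0 \<le> t" "f \<in> L1 lborel" "f \<in> L2 lborel"
  shows "T t f \<in> L1 lborel" "(LINT x|lborel. \<bar>T t f x\<bar>) \<le> (LINT x|lborel. \<bar>f x\<bar>)"
proof -
  have f: "integrable lborel f" using assms(2) by (simp add: L1_def)
  have *: "(\<integral>\<^sup>+x. ennreal \<bar>T t f x\<bar> \<partial>lborel) \<le> ennreal (LINT x|lborel. \<bar>f x\<bar>)"
    using T_L1_nn[OF assms(1,3)] f by (simp add: nn_integral_eq_integral)
  then have Tf: "integrable lborel (T t f)"
    by (intro integrableI_bounded) (auto simp: order_le_less_trans)
  then show "T t f \<in> L1 lborel" by (simp add: L1_def)
  show "(LINT x|lborel. \<bar>T t f x\<bar>) \<le> (LINT x|lborel. \<bar>f x\<bar>)"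
    using * Tf by (simp add: nn_integral_eq_integral)
qed

lemma T_L1_diff:
  assumes "0 \<le> t" "f \<in> L1 lborel" "f \<in> L2 lborel" "g \<in> L1 lborel" "g \<in> L2 lborel"
  shows "(LINT x|lborel. \<bar>T t f x - T t g x\<bar>) \<le> (LINT x|lborel. \<bar>f x - g x\<bar>)"
proof -
  have "(LINT x|lborel. \<bar>T t f x - T t g x\<bar>) = (LINT x|lborel. \<bar>T t (\<lambda>y. 1 * f y + (- 1) * g y) x\<bar>)"
    using T_lincomb[OF assms(1,3,5), of 1 "-1"] by (intro integral_cong_AE) auto
  also have "\<dots> \<le> (LINT x|lborel. \<bar>1 * f x + (- 1) * g x\<bar>)"
    by (rule T_L1(2)) (use assms L2_lincomb[of f lborel g 1 "-1"] in \<open>auto simp: L1_def\<close>)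
  finally show ?thesis by simp
qed

end

section \<open>Truncations and the extension to L1\<close>

lemma L1_AE_convergent:
  fixes u :: "nat \<Rightarrow> 'a \<Rightarrow> real"
  assumes u: "\<And>n. integrable M (u n)"
    and small: "\<And>n. (LINT x|M. \<bar>u (Suc n) x - u n x\<bar>) \<le> c * (1 / 2) ^ n"
  shows "AE x in M. convergent (\<lambda>n. u n x)"
proof -
  define d where "d n x = u (Suc n) x - u n x" for n x
  have d: "integrable M (d n)" for n unfolding d_def using u by auto
  have [measurable]: "d n \<in> borel_measurable M" for n using d by auto
  have "0 \<le> (LINT x|M. \<bar>u (Suc 0) x - u 0 x\<bar>)" by simp
  from order_trans[OF this small[of 0]] have "0 \<le> c" by simp
  have "(\<integral>\<^sup>+x. (\<Sum>n. ennreal \<bar>d n x\<bar>) \<partial>M) = (\<Sum>n. \<integral>\<^sup>+x. ennreal \<bar>d n x\<bar> \<partial>M)"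
    by (rule nn_integral_suminf) measurable
  also have "\<dots> \<le> (\<Sum>n. ennreal (c * (1 / 2) ^ n))"
  proof (intro suminf_le)
    fix n
    have "(\<integral>\<^sup>+x. ennreal \<bar>d n x\<bar> \<partial>M) = ennreal (LINT x|M. \<bar>d n x\<bar>)"
      using d by (intro nn_integral_eq_integral) auto
    also have "\<dots> \<le> ennreal (c * (1 / 2) ^ n)"
      using small[of n] by (intro ennreal_leI) (simp add: d_def)
    finally show "(\<integral>\<^sup>+x. ennreal \<bar>d n x\<bar> \<partial>M) \<le> ennreal (c * (1 / 2) ^ n)" .
  qed auto
  also have "\<dots> < \<infinity>"
    using \<open>0 \<le> c\<close> by (subst suminf_ennreal2) (auto intro!: summable_mult summable_geometric)
  finally have "AE x in M. (\<Sum>n. ennreal \<bar>d n x\<bar>) \<noteq> \<infinity>"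
    by (intro nn_integral_noteq_infinite) auto
  then show ?thesis
  proof eventually_elim
    case (elim x)
    then have "summable (\<lambda>n. \<bar>d n x\<bar>)"
      by (intro summable_suminf_not_top) auto
    then have "summable (\<lambda>n. d n x)"
      by (rule summable_rabs_cancel)
    then have "convergent (\<lambda>n. (\<Sum>i<n. d i x) + u 0 x)"
      by (intro convergent_add convergent_const) (simp add: summable_iff_convergent)
    moreover have "(\<Sum>i<n. d i x) + u 0 x = u n x" for n
      by (induction n) (simp_all add: d_def)
    ultimately show ?case by simp
  qed
qed

lemma L1_Fatou:
  fixes u :: "nat \<Rightarrow> 'a \<Rightarrow> real"
  assumes u: "\<And>n. integrable M (u n)" and v: "integrable M v" and [measurable]: "h \<in> borel_measurable M"
    and lim: "AE x in M. (\<lambda>n. u n x) \<longlonglongrightarrow> h x"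
    and bound: "\<And>n. n \<ge> N \<Longrightarrow> (LINT x|M. \<bar>u n x - v x\<bar>) \<le> c"
  shows "integrable M h" "(LINT x|M. \<bar>h x - v x\<bar>) \<le> c"
proof -
  have [measurable]: "u n \<in> borel_measurable M" "v \<in> borel_measurable M" for n using u v by auto
  have "0 \<le> (LINT x|M. \<bar>u N x - v x\<bar>)" by simp
  from order_trans[OF this bound[OF order_refl]] have "0 \<le> c" .
  have "(\<integral>\<^sup>+x. ennreal \<bar>h x - v x\<bar> \<partial>M) = (\<integral>\<^sup>+x. liminf (\<lambda>n. ennreal \<bar>u n x - v x\<bar>) \<partial>M)"
  proof (rule nn_integral_cong_AE)
    show "AE x in M. ennreal \<bar>h x - v x\<bar> = liminf (\<lambda>n. ennreal \<bar>u n x - v x\<bar>)"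
      using lim by eventually_elim (intro lim_imp_Liminf[symmetric] tendsto_ennrealI tendsto_intros, auto)
  qed
  also have "\<dots> \<le> liminf (\<lambda>n. \<integral>\<^sup>+x. ennreal \<bar>u n x - v x\<bar> \<partial>M)"
    by (rule nn_integral_liminf) measurable
  also have "\<dots> \<le> limsup (\<lambda>n. \<integral>\<^sup>+x. ennreal \<bar>u n x - v x\<bar> \<partial>M)"
    by (rule Liminf_le_Limsup) simp
  also have "\<dots> \<le> ennreal c"
  proof (rule Limsup_bounded)
    show "\<forall>\<^sub>F n in sequentially. (\<integral>\<^sup>+x. ennreal \<bar>u n x - v x\<bar> \<partial>M) \<le> ennreal c"
      using eventually_ge_at_top[of N]
      by eventually_elim (simp add: nn_integral_eq_integral u v bound ennreal_leI)
  qed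
  finally have *: "(\<integral>\<^sup>+x. ennreal \<bar>h x - v x\<bar> \<partial>M) \<le> ennreal c" .
  then have d: "integrable M (\<lambda>x. h x - v x)"
    by (intro integrableI_bounded) (auto simp: order_le_less_trans)
  from Bochner_Integration.integrable_add[OF d v] show "integrable M h" by simp
  show "(LINT x|M. \<bar>h x - v x\<bar>) \<le> c"
    using * d \<open>0 \<le> c\<close> by (simp add: nn_integral_eq_integral)
qed

text \<open>Cutting an integrable function at height n makes it square integrable, so that
  \<open>T\<close> applies to it, and changes it little in L1.\<close>

definition trunc :: "nat \<Rightarrow> real \<Rightarrow> real" where
  "trunc n a = max (- real n) (min (real n) a)"

lemma trunc_measurable [measurable]: "trunc n \<in> borel_measurable borel"
  unfolding trunc_def[abs_def] by measurable

lemma abs_trunc_le: "\<bar>trunc n a\<bar> \<le> \<bar>a\<bar>" "\<bar>trunc n a\<bar> \<le> real n"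
  by (auto simp: trunc_def)

lemma trunc_L1: "f \<in> L1 M \<Longrightarrow> (\<lambda>x. trunc n (f x)) \<in> L1 M"
  unfolding L1_def by (auto intro: Bochner_Integration.integrable_bound simp: abs_trunc_le)

lemma trunc_L2:
  assumes "f \<in> L1 M"
  shows "(\<lambda>x. trunc n (f x)) \<in> L2 M"
proof -
  have f: "integrable M f" using assms by (simp add: L1_def)
  have "integrable M (\<lambda>x. (trunc n (f x))\<^sup>2)"
  proof (rule Bochner_Integration.integrable_bound)
    show "integrable M (\<lambda>x. real n * f x)" using f by simp
    show "AE x in M. norm ((trunc n (f x))\<^sup>2) \<le> norm (real n * f x)"
    proof (intro AE_I2)
      fix x
      have "\<bar>trunc n (f x)\<bar> * \<bar>trunc n (f x)\<bar> \<le> real n * \<bar>f x\<bar>"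
        by (intro mult_mono abs_trunc_le) auto
      then show "norm ((trunc n (f x))\<^sup>2) \<le> norm (real n * f x)"
        by (simp add: abs_mult power2_eq_square)
    qed
  qed (use f in measurable)
  with f show ?thesis by (simp add: L2_def)
qed

lemma trunc_LIMSEQ: "(\<lambda>n. trunc n a) \<longlonglongrightarrow> a"
proof -
  obtain N where N: "\<bar>a\<bar> \<le> real N" using real_arch_simple by blast
  have "\<forall>\<^sub>F n in sequentially. trunc n a = a"
    using eventually_ge_at_top[of N]
  proof eventually_elim
    case (elim n)
    then have "\<bar>a\<bar> \<le> real n" using N by linarith
    then show ?case by (auto simp: trunc_def)
  qed
  then show ?thesis by (rule tendsto_eventually)
qed

lemma trunc_L1_LIMSEQ:
  assumes "f \<in> L1 M"
  shows "(\<lambda>n. LINT x|M. \<bar>f x - trunc n (f x)\<bar>) \<longlonglongrightarrow> 0"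
proof -
  have f [measurable]: "integrable M f" using assms by (simp add: L1_def)
  have "(\<lambda>n. LINT x|M. \<bar>f x - trunc n (f x)\<bar>) \<longlonglongrightarrow> (LINT x|M. 0)"
  proof (rule integral_dominated_convergence[where w = "\<lambda>x. 2 * \<bar>f x\<bar>"])
    show "AE x in M. (\<lambda>n. \<bar>f x - trunc n (f x)\<bar>) \<longlonglongrightarrow> 0"
    proof (intro AE_I2)
      fix x
      have "(\<lambda>n. \<bar>f x - trunc n (f x)\<bar>) \<longlonglongrightarrow> \<bar>f x - f x\<bar>"
        by (intro tendsto_intros trunc_LIMSEQ)
      then show "(\<lambda>n. \<bar>f x - trunc n (f x)\<bar>) \<longlonglongrightarrow> 0" by simp
    qed
    show "AE x in M. norm \<bar>f x - trunc n (f x)\<bar> \<le> 2 * \<bar>f x\<bar>" for n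
    proof (intro AE_I2)
      fix x
      have "\<bar>f x - trunc n (f x)\<bar> \<le> \<bar>f x\<bar> + \<bar>trunc n (f x)\<bar>" by (rule abs_triangle_ineq4)
      with abs_trunc_le(1)[of n "f x"] show "norm \<bar>f x - trunc n (f x)\<bar> \<le> 2 * \<bar>f x\<bar>" by simp
    qed
  qed (use f in auto)
  then show ?thesis by simp
qed

lemma incseq_subseq_LIMSEQ:
  fixes X :: "nat \<Rightarrow> real"
  assumes "incseq X" "strict_mono r" "(\<lambda>n. X (r n)) \<longlonglongrightarrow> L"
  shows "X \<longlonglongrightarrow> L"
proof -
  have "incseq (\<lambda>n. X (r n))"
    using assms(1,2) by (auto simp: incseq_def strict_mono_leD)
  then have "X (r n) \<le> L" for n
    by (rule incseq_le[OF _ assms(3)])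
  then have "X n \<le> L" for n
    using assms(1) seq_suble[OF assms(2), of n] by (meson incseqD order_trans)
  then obtain L' where "X \<longlonglongrightarrow> L'"
    using assms(1) incseq_convergent by blast
  moreover from LIMSEQ_subseq_LIMSEQ[OF this assms(2)] have "(\<lambda>n. X (r n)) \<longlonglongrightarrow> L'"
    by (simp add: o_def)
  ultimately show ?thesis
    using LIMSEQ_unique assms(3) by blast
qed

context levy
begin

text \<open>A description of the extended operator without a limit: f' close to f in L1 determines g
  up to a null set, so that the choice made in \<open>S\<close> does no harm.\<close>

definition S_spec :: "real \<Rightarrow> (real \<Rightarrow> real) \<Rightarrow> (real \<Rightarrow> real) \<Rightarrow> bool" where
  "S_spec t f g \<longleftrightarrow> g \<in> L1 lborel \<and>
     (\<forall>f'\<in>L1 lborel \<inter> L2 lborel. (LINT x|lborel. \<bar>g x - T t f' x\<bar>) \<le> (LINT x|lborel. \<bar>f x - f' x\<bar>))"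

definition S :: "real \<Rightarrow> (real \<Rightarrow> real) \<Rightarrow> real \<Rightarrow> real" where
  "S t f = (SOME g. S_spec t f g)"

lemma L1_triangle:
  assumes "f \<in> L1 M" "g \<in> L1 M" "h \<in> L1 M"
  shows "(LINT x|M. \<bar>f x - h x\<bar>) \<le> (LINT x|M. \<bar>f x - g x\<bar>) + (LINT x|M. \<bar>g x - h x\<bar>)"
proof -
  have "(LINT x|M. \<bar>f x - h x\<bar>) \<le> (LINT x|M. \<bar>f x - g x\<bar> + \<bar>g x - h x\<bar>)"
    using assms by (intro integral_mono) (auto simp: L1_def)
  then show ?thesis using assms by (simp add: L1_def)
qed

text \<open>The images of truncations of f, along levels with error \<open>(1 / 2) ^ k\<close>,
  converge almost everywhere. Fatou's lemma carries the estimates over to the limit with an error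
  \<open>(1 / 2) ^ j\<close> for every j, which then disappears.\<close>

lemma S_spec_exists:
  assumes t: "0 < t" and f: "f \<in> L1 lborel"
  shows "\<exists>g. S_spec t f g"
proof -
  define e where "e n = (LINT x|lborel. \<bar>f x - trunc n (f x)\<bar>)" for n
  have e0: "e \<longlonglongrightarrow> 0" unfolding e_def by (rule trunc_L1_LIMSEQ[OF f])
  have "\<exists>N. \<forall>n\<ge>N. e n < (1 / 2) ^ k" for k
    using e0 unfolding LIMSEQ_iff by (force dest: spec[of _ "(1 / 2) ^ k"])
  then obtain r where r: "\<And>k n. n \<ge> r k \<Longrightarrow> e n < (1 / 2) ^ k" by metis
  define q where "q k = (\<Sum>i\<le>k. r i)" for k
  have qr: "r j \<le> q k" if "j \<le> k" for j k
    using member_le_sum[of j "{..k}" r] that by (simp add: q_def)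
  define f' where "f' k x = trunc (q k) (f x)" for k x
  have f': "f' k \<in> L1 lborel" "f' k \<in> L2 lborel" for k
    unfolding f'_def by (intro trunc_L1 trunc_L2 f)+
  define u where "u k = T t (f' k)" for k
  have u: "u k \<in> L1 lborel" "integrable lborel (u k)" for k
    using T_L1(1)[OF _ f'] t by (simp_all add: u_def L1_def)
  have ff': "(LINT x|lborel. \<bar>f x - f' k x\<bar>) \<le> (1 / 2) ^ j" if "j \<le> k" for j k
    using r[OF qr[OF that]] by (simp add: e_def f'_def)
  have "AE x in lborel. convergent (\<lambda>n. u n x)"
  proof (rule L1_AE_convergent[OF u(2), where c = 2])
    fix n
    have "(LINT x|lborel. \<bar>u (Suc n) x - u n x\<bar>) \<le> (LINT x|lborel. \<bar>f' (Suc n) x - f' n x\<bar>)"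
      unfolding u_def using t by (intro T_L1_diff f') auto
    also have "\<dots> \<le> (LINT x|lborel. \<bar>f' (Suc n) x - f x\<bar>) + (LINT x|lborel. \<bar>f x - f' n x\<bar>)"
      by (intro L1_triangle f' f)
    also have "\<dots> \<le> (1 / 2) ^ n + (1 / 2) ^ n"
      using ff'[of n "Suc n"] ff'[of n n] by (simp add: abs_minus_commute)
    finally show "(LINT x|lborel. \<bar>u (Suc n) x - u n x\<bar>) \<le> 2 * (1 / 2) ^ n" by simp
  qed
  define g where "g x = lim (\<lambda>n. u n x)" for x
  have [measurable]: "u n \<in> borel_measurable borel" for n by (simp add: u_def)
  have gm: "g \<in> borel_measurable lborel" unfolding g_def by measurable
  have lim: "AE x in lborel. (\<lambda>n. u n x) \<longlonglongrightarrow> g x"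
    using \<open>AE x in lborel. convergent (\<lambda>n. u n x)\<close>
    by eventually_elim (simp add: g_def convergent_LIMSEQ_iff)
  have bd: "integrable lborel g \<and> (LINT x|lborel. \<bar>g x - T t p x\<bar>) \<le> (LINT x|lborel. \<bar>f x - p x\<bar>) + (1 / 2) ^ j"
    if p: "p \<in> L1 lborel" "p \<in> L2 lborel" for p j
  proof -
    have Tp: "integrable lborel (T t p)" using T_L1(1)[OF _ p] t by (simp add: L1_def)
    have "(LINT x|lborel. \<bar>u n x - T t p x\<bar>) \<le> (LINT x|lborel. \<bar>f x - p x\<bar>) + (1 / 2) ^ j" if "n \<ge> j" for n
    proof -
      have "(LINT x|lborel. \<bar>u n x - T t p x\<bar>) \<le> (LINT x|lborel. \<bar>f' n x - p x\<bar>)"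
        unfolding u_def using t by (intro T_L1_diff f' p) auto
      also have "\<dots> \<le> (LINT x|lborel. \<bar>f' n x - f x\<bar>) + (LINT x|lborel. \<bar>f x - p x\<bar>)"
        by (intro L1_triangle f' f p)
      finally show ?thesis using ff'[OF that] by (simp add: abs_minus_commute)
    qed
    from L1_Fatou[OF u(2) Tp gm lim this] show ?thesis by blast
  qed
  have "S_spec t f g"
    unfolding S_spec_def
  proof (intro conjI ballI)
    show "g \<in> L1 lborel"
      using bd[OF f'[of 0], of 0] by (simp add: L1_def)
    fix p :: "real \<Rightarrow> real" assume "p \<in> L1 lborel \<inter> L2 lborel"
    then have p: "p \<in> L1 lborel" "p \<in> L2 lborel" by auto
    show "(LINT x|lborel. \<bar>g x - T t p x\<bar>) \<le> (LINT x|lborel. \<bar>f x - p x\<bar>)"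
    proof (rule LIMSEQ_le_const)
      have "(\<lambda>j. (LINT x|lborel. \<bar>f x - p x\<bar>) + (1 / 2) ^ j) \<longlonglongrightarrow> (LINT x|lborel. \<bar>f x - p x\<bar>) + 0"
        by (intro tendsto_intros LIMSEQ_power_zero) simp
      then show "(\<lambda>j. (LINT x|lborel. \<bar>f x - p x\<bar>) + (1 / 2) ^ j) \<longlonglongrightarrow> (LINT x|lborel. \<bar>f x - p x\<bar>)"
        by simp
    qed (use bd[OF p] in blast)
  qed
  then show ?thesis by (intro exI[of _ g])
qed

lemma S_spec: "0 < t \<Longrightarrow> f \<in> L1 lborel \<Longrightarrow> S_spec t f (S t f)"
  unfolding S_def by (rule someI_ex[OF S_spec_exists])

lemma S_L1: "0 < t \<Longrightarrow> f \<in> L1 lborel \<Longrightarrow> S t f \<in> L1 lborel"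
  using S_spec by (auto simp: S_spec_def)

lemma S_le:
  "0 < t \<Longrightarrow> f \<in> L1 lborel \<Longrightarrow> p \<in> L1 lborel \<Longrightarrow> p \<in> L2 lborel \<Longrightarrow>
    (LINT x|lborel. \<bar>S t f x - T t p x\<bar>) \<le> (LINT x|lborel. \<bar>f x - p x\<bar>)"
  using S_spec[of t f] by (auto simp: S_spec_def)

lemma AE_eq_of_L1_zero:
  assumes "f \<in> L1 lborel" "g \<in> L1 lborel" "(LINT x|lborel. \<bar>f x - g x\<bar>) \<le> 0"
  shows "AE x in lborel. f x = g x"
proof -
  have "(LINT x|lborel. \<bar>f x - g x\<bar>) = 0"
    using assms(3) by (intro antisym) auto
  then show ?thesis
    using assms by (subst (asm) integral_nonneg_eq_0_iff_AE) (auto simp: L1_def)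
qed

lemma S_eq_T: "0 < t \<Longrightarrow> f \<in> L1 lborel \<Longrightarrow> f \<in> L2 lborel \<Longrightarrow> AE x in lborel. S t f x = T t f x"
  using S_le[of t f f] by (intro AE_eq_of_L1_zero S_L1 T_L1) auto

lemma S_lincomb:
  assumes t: "0 < t" and f: "f \<in> L1 lborel" and g: "g \<in> L1 lborel"
  shows "AE x in lborel. S t (\<lambda>y. a * f y + b * g y) x = a * S t f x + b * S t g x"
proof (rule AE_eq_of_L1_zero)
  define h where "h y = a * f y + b * g y" for y
  have h: "h \<in> L1 lborel" using f g by (simp add: h_def[abs_def] L1_def)
  note SL = S_L1[OF t f] S_L1[OF t g] S_L1[OF t h]
  show "S t (\<lambda>y. a * f y + b * g y) \<in> L1 lborel"
    using SL(3) by (simp add: h_def[abs_def])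
  show "(\<lambda>x. a * S t f x + b * S t g x) \<in> L1 lborel"
    using SL by (simp add: L1_def)
  define e d where "e n = (LINT x|lborel. \<bar>f x - trunc n (f x)\<bar>)"
    and "d n = (LINT x|lborel. \<bar>g x - trunc n (g x)\<bar>)" for n
  have bound: "(LINT x|lborel. \<bar>S t h x - (a * S t f x + b * S t g x)\<bar>) \<le> 2 * (\<bar>a\<bar> * e n + \<bar>b\<bar> * d n)" for n
  proof -
    \<comment> \<open>h' is the combination of the truncations, not the truncation of h, which is
      what linearity of \<open>T\<close> applies to.\<close>
    define f' g' h' where "f' x = trunc n (f x)" and "g' x = trunc n (g x)" and "h' x = a * f' x + b * g' x" for x
    have f': "f' \<in> L1 lborel" "f' \<in> L2 lborel" and g': "g' \<in> L1 lborel" "g' \<in> L2 lborel"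
      unfolding f'_def g'_def by (intro trunc_L1 trunc_L2 f g)+
    have h': "h' \<in> L1 lborel" "h' \<in> L2 lborel"
      using f' g' L2_lincomb[OF f'(2) g'(2)] by (simp_all add: h'_def[abs_def] L1_def)
    note TL = T_L1(1)[OF less_imp_le[OF t] f'] T_L1(1)[OF less_imp_le[OF t] g'] T_L1(1)[OF less_imp_le[OF t] h']
    have "(LINT x|lborel. \<bar>S t h x - (a * S t f x + b * S t g x)\<bar>)
        \<le> (LINT x|lborel. \<bar>S t h x - T t h' x\<bar> + \<bar>a\<bar> * \<bar>S t f x - T t f' x\<bar> + \<bar>b\<bar> * \<bar>S t g x - T t g' x\<bar>)"
    proof (rule integral_mono_AE)
      show "AE x in lborel. \<bar>S t h x - (a * S t f x + b * S t g x)\<bar>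
          \<le> \<bar>S t h x - T t h' x\<bar> + \<bar>a\<bar> * \<bar>S t f x - T t f' x\<bar> + \<bar>b\<bar> * \<bar>S t g x - T t g' x\<bar>"
        using T_lincomb[OF less_imp_le[OF t] f'(2) g'(2), of a b, folded h'_def[abs_def]]
      proof eventually_elim
        case (elim x)
        have eq: "S t h x - (a * S t f x + b * S t g x)
            = (S t h x - T t h' x) - a * (S t f x - T t f' x) - b * (S t g x - T t g' x)"
          by (simp add: elim algebra_simps)
        have "\<bar>(S t h x - T t h' x) - a * (S t f x - T t f' x) - b * (S t g x - T t g' x)\<bar>
            \<le> \<bar>S t h x - T t h' x\<bar> + \<bar>a * (S t f x - T t f' x)\<bar> + \<bar>b * (S t g x - T t g' x)\<bar>"
          by linarith
        then show ?case unfolding eq abs_mult .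
      qed
    qed (use SL TL in \<open>auto simp: L1_def\<close>)
    also have "\<dots> = (LINT x|lborel. \<bar>S t h x - T t h' x\<bar>) + \<bar>a\<bar> * (LINT x|lborel. \<bar>S t f x - T t f' x\<bar>)
        + \<bar>b\<bar> * (LINT x|lborel. \<bar>S t g x - T t g' x\<bar>)"
      using SL TL by (simp add: L1_def)
    also have "\<dots> \<le> (\<bar>a\<bar> * e n + \<bar>b\<bar> * d n) + \<bar>a\<bar> * e n + \<bar>b\<bar> * d n"
    proof (intro add_mono mult_left_mono)
      have "(LINT x|lborel. \<bar>S t h x - T t h' x\<bar>) \<le> (LINT x|lborel. \<bar>h x - h' x\<bar>)"
        by (rule S_le[OF t h h'])
      also have "\<dots> \<le> (LINT x|lborel. \<bar>a\<bar> * \<bar>f x - f' x\<bar> + \<bar>b\<bar> * \<bar>g x - g' x\<bar>)"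
      proof (rule integral_mono)
        fix x
        have "h x - h' x = a * (f x - f' x) + b * (g x - g' x)"
          by (simp add: h_def h'_def algebra_simps)
        then show "\<bar>h x - h' x\<bar> \<le> \<bar>a\<bar> * \<bar>f x - f' x\<bar> + \<bar>b\<bar> * \<bar>g x - g' x\<bar>"
          using abs_triangle_ineq[of "a * (f x - f' x)" "b * (g x - g' x)"] by (simp add: abs_mult)
      qed (use f g h f' g' h' in \<open>auto simp: L1_def\<close>)
      also have "\<dots> = \<bar>a\<bar> * (LINT x|lborel. \<bar>f x - f' x\<bar>) + \<bar>b\<bar> * (LINT x|lborel. \<bar>g x - g' x\<bar>)"
        using f g f'(1) g'(1) by (simp add: L1_def)
      also have "\<dots> = \<bar>a\<bar> * e n + \<bar>b\<bar> * d n"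
        by (simp add: e_def d_def f'_def g'_def)
      finally show "(LINT x|lborel. \<bar>S t h x - T t h' x\<bar>) \<le> \<bar>a\<bar> * e n + \<bar>b\<bar> * d n" .
      show "(LINT x|lborel. \<bar>S t f x - T t f' x\<bar>) \<le> e n"
        using S_le[OF t f f'] by (simp add: e_def f'_def)
      show "(LINT x|lborel. \<bar>S t g x - T t g' x\<bar>) \<le> d n"
        using S_le[OF t g g'] by (simp add: d_def g'_def)
    qed auto
    finally show ?thesis by simp
  qed
  have "(\<lambda>n. 2 * (\<bar>a\<bar> * e n + \<bar>b\<bar> * d n)) \<longlonglongrightarrow> 2 * (\<bar>a\<bar> * 0 + \<bar>b\<bar> * 0)"
    unfolding e_def d_def by (intro tendsto_intros trunc_L1_LIMSEQ f g)
  then have "(LINT x|lborel. \<bar>S t h x - (a * S t f x + b * S t g x)\<bar>) \<le> 2 * (\<bar>a\<bar> * 0 + \<bar>b\<bar> * 0)"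
    by (rule LIMSEQ_le_const) (use bound in blast)
  then show "(LINT x|lborel. \<bar>S t (\<lambda>y. a * f y + b * g y) x - (a * S t f x + b * S t g x)\<bar>) \<le> 0"
    by (simp add: h_def[abs_def])
qed

lemma L1_extension_S: "L1_extension lborel T S"
  unfolding L1_extension_def
proof (intro allI impI conjI ballI)
  fix t :: real assume t: "0 < t"
  fix f :: "real \<Rightarrow> real" assume f: "f \<in> L1 lborel"
  show "S t f \<in> L1 lborel" by (rule S_L1[OF t f])
  have "AE x in lborel. T t (\<lambda>_. 0) x = 0"
    using T_lincomb[OF less_imp_le[OF t] L2_zero L2_zero, of 0 0] by simp
  then have "(LINT x|lborel. \<bar>S t f x - T t (\<lambda>_. 0) x\<bar>) = (LINT x|lborel. \<bar>S t f x\<bar>)"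
    using S_L1[OF t f] by (intro integral_cong_AE) (auto simp: L1_def)
  then show "(LINT x|lborel. \<bar>S t f x\<bar>) \<le> (LINT x|lborel. \<bar>f x\<bar>)"
    using S_le[OF t f, of "\<lambda>_. 0"] by (simp add: L1_def L2_zero)
  fix g :: "real \<Rightarrow> real" and a b :: real assume g: "g \<in> L1 lborel"
  show "AE x in lborel. S t (\<lambda>y. a * f y + b * g y) x = a * S t f x + b * S t g x"
    by (rule S_lincomb[OF t f g])
next
  fix t :: real and f :: "real \<Rightarrow> real" assume "0 < t" "f \<in> L1 lborel \<inter> L2 lborel"
  then show "AE x in lborel. S t f x = T t f x" by (intro S_eq_T) auto
qed

lemma T_mono:
  assumes t: "0 \<le> t" and f: "f \<in> L2 lborel" and g: "g \<in> L2 lborel" and le: "AE x in lborel. f x \<le> g x"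
  shows "AE x in lborel. T t f x \<le> T t g x"
proof -
  have "nneg (abs_l2 g - abs_l2 f)"
    using le by (subst abs_l2_diff[symmetric]) (auto simp: f g nneg_abs_l2 L2_diff)
  then have "nneg (G.P t (abs_l2 g) - G.P t (abs_l2 f))"
    using P_nneg[OF t] G.P.diff[OF t] by metis
  then show ?thesis by (simp add: nneg_diff T_def)
qed

text \<open>Convergence in L1 yields almost everywhere convergence along a subsequence that may
  depend on t. Monotonicity of the truncations removes the subsequence, so that in
  \<open>S_version\<close> one pointwise limit serves all times.\<close>

lemma S_nneg_LIMSEQ:
  assumes t: "0 < t" and f: "f \<in> L1 lborel" and nn: "AE x in lborel. 0 \<le> f x"
  shows "AE x in lborel. incseq (\<lambda>n. T t (\<lambda>x. trunc n (f x)) x) \<and>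
    (\<lambda>n. T t (\<lambda>x. trunc n (f x)) x) \<longlonglongrightarrow> S t f x"
proof -
  define f' where "f' n x = trunc n (f x)" for n x
  have f': "f' n \<in> L1 lborel" "f' n \<in> L2 lborel" for n
    unfolding f'_def by (intro trunc_L1 trunc_L2 f)+
  note TL = T_L1(1)[OF less_imp_le[OF t] f']
  have "AE x in lborel. T t (f' n) x \<le> T t (f' (Suc n)) x" for n
  proof (rule T_mono[OF less_imp_le[OF t] f'(2) f'(2)])
    show "AE x in lborel. f' n x \<le> f' (Suc n) x"
      using nn by eventually_elim (auto simp: f'_def trunc_def)
  qed
  then have inc: "AE x in lborel. \<forall>n. T t (f' n) x \<le> T t (f' (Suc n)) x"
    by (simp add: AE_all_countable)
  have u: "integrable lborel (\<lambda>x. T t (f' n) x - S t f x)" for n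
    using TL[of n] S_L1[OF t f] by (simp add: L1_def)
  have "(\<lambda>n. LINT x|lborel. norm (T t (f' n) x - S t f x)) \<longlonglongrightarrow> 0"
  proof (rule Lim_null_comparison[OF always_eventually trunc_L1_LIMSEQ[OF f]], intro allI)
    fix n
    have "(LINT x|lborel. norm (T t (f' n) x - S t f x)) = (LINT x|lborel. \<bar>S t f x - T t (f' n) x\<bar>)"
      by (simp add: abs_minus_commute)
    then show "norm (LINT x|lborel. norm (T t (f' n) x - S t f x)) \<le> (LINT x|lborel. \<bar>f x - trunc n (f x)\<bar>)"
      using S_le[OF t f f'] by (simp add: f'_def)
  qed
  from tendsto_L1_AE_subseq[OF u this] obtain r where r: "strict_mono r"
    "AE x in lborel. (\<lambda>n. T t (f' (r n)) x - S t f x) \<longlonglongrightarrow> 0" by blast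
  from inc r(2) have "AE x in lborel. incseq (\<lambda>n. T t (f' n) x) \<and> (\<lambda>n. T t (f' n) x) \<longlonglongrightarrow> S t f x"
  proof eventually_elim
    case (elim x)
    have i: "incseq (\<lambda>n. T t (f' n) x)" using elim(1) by (simp add: incseq_Suc_iff)
    have "(\<lambda>n. T t (f' (r n)) x) \<longlonglongrightarrow> S t f x" using elim(2) by (simp add: LIM_zero_iff)
    from incseq_subseq_LIMSEQ[OF i r(1) this] i show ?case by simp
  qed
  then show ?thesis by (simp add: f'_def[abs_def])
qed

text \<open>
  Strong continuity is uniform in \<open>t\<close>, so one sequence of step functions in time converges
  almost everywhere for every \<open>t\<close>.
\<close>

lemma joint_version:
  obtains F where "F \<in> borel_measurable (lborel \<Otimes>\<^sub>M lborel)"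
    "\<And>t. 0 \<le> t \<Longrightarrow> AE s in lborel. F (t, s) = rep_l2 (G.P t x) s"
proof -
  \<comment> \<open>Half the square root of the rate \<open>(1 / 8) ^ m\<close> in
    \<open>L2_AE_convergent\<close>, because consecutive approximations differ by at most the sum of
    two errors.\<close>
  define \<eta> :: "nat \<Rightarrow> real" where "\<eta> m = sqrt ((1 / 8) ^ m) / 2" for m
  have \<eta>: "0 < \<eta> m" "\<eta> (Suc m) \<le> \<eta> m" for m
    by (auto simp: \<eta>_def)
  have "\<exists>d>0. \<forall>r. 0 \<le> r \<longrightarrow> r < d \<longrightarrow> norm (G.P r x - x) < \<eta> m" for m
    using G.P.near_zero[OF \<eta>(1)[of m], of x] by metis
  then obtain \<delta> where \<delta>: "\<And>m. 0 < \<delta> m" "\<And>m r. 0 \<le> r \<Longrightarrow> r < \<delta> m \<Longrightarrow> norm (G.P r x - x) < \<eta> m"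
    by metis
  define grid where "grid m t = \<delta> m * real (nat \<lfloor>t / \<delta> m\<rfloor>)" for m t
  have grid: "0 \<le> grid m t" "grid m t \<le> t" "t - grid m t < \<delta> m" if "0 \<le> t" for m t
  proof -
    have "real (nat \<lfloor>t / \<delta> m\<rfloor>) = of_int \<lfloor>t / \<delta> m\<rfloor>"
      using that \<delta>(1)[of m] by simp
    moreover have "of_int \<lfloor>t / \<delta> m\<rfloor> * \<delta> m \<le> t" "t < (of_int \<lfloor>t / \<delta> m\<rfloor> + 1) * \<delta> m"
      using \<delta>(1)[of m] by (rule floor_divide_lower floor_divide_upper)+
    ultimately show "0 \<le> grid m t" "grid m t \<le> t" "t - grid m t < \<delta> m"
      using \<delta>(1)[of m] that unfolding grid_def by (auto simp: algebra_simps)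
  qed
  have close: "norm (G.P (grid m t) x - G.P t x) \<le> \<eta> m" if "0 \<le> t" for m t
    using G.P.norm_diff_le[of "grid m t" t x] grid[OF that, of m] \<delta>(2)[of "t - grid m t" m] that
    by (simp add: norm_minus_commute)
  define Fm where "Fm m p = rep_l2 (G.P (grid m (fst p)) x) (snd p)" for m and p :: "real \<times> real"
  have [measurable]: "Fm m \<in> borel_measurable (lborel \<Otimes>\<^sub>M lborel)" for m
  proof -
    have "(\<lambda>p. (\<lambda>i p. rep_l2 (G.P (\<delta> m * real i) x) (snd p)) (nat \<lfloor>fst p / \<delta> m\<rfloor>) p)
        \<in> borel_measurable (lborel \<Otimes>\<^sub>M lborel)"
      by (rule measurable_compose_countable) measurable
    then show ?thesis by (simp add: Fm_def[abs_def] grid_def)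
  qed
  define F where "F p = lim (\<lambda>m. Fm m p)" for p
  show thesis
  proof (rule that)
    show "F \<in> borel_measurable (lborel \<Otimes>\<^sub>M lborel)"
      unfolding F_def[abs_def] by measurable
    fix t :: real assume t: "0 \<le> t"
    define X where "X m = G.P (grid m t) x" for m
    have conv: "AE s in lborel. convergent (\<lambda>m. rep_l2 (X m) s)"
    proof (rule L2_AE_convergent)
      fix m
      have "norm (X (Suc m) - X m) \<le> \<eta> (Suc m) + \<eta> m"
        using close[OF t, of m] close[OF t, of "Suc m"] norm_triangle_ineq4[of "X (Suc m) - G.P t x" "X m - G.P t x"]
        by (simp add: X_def)
      also have "\<dots> \<le> 2 * \<eta> m"
        using \<eta>(2)[of m] by linarith
      also have "\<dots> = sqrt ((1 / 8) ^ m)"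
        by (simp add: \<eta>_def)
      finally have "(norm (X (Suc m) - X m))\<^sup>2 \<le> (sqrt ((1 / 8) ^ m))\<^sup>2"
        by (intro power_mono) auto
      then show "(LINT s|lborel. (rep_l2 (X (Suc m)) s - rep_l2 (X m) s)\<^sup>2) \<le> (1 / 8) ^ m"
        using norm_abs_l2[OF L2_diff[OF rep_l2_L2 rep_l2_L2], of "X (Suc m)" "X m"]
        by (simp add: abs_l2_diff L2_nrm_def L2_inner_def power2_eq_square)
    qed simp
    have "X \<longlonglongrightarrow> G.P t x"
    proof -
      have "\<eta> \<longlonglongrightarrow> 0"
        using tendsto_divide[OF tendsto_real_sqrt[OF LIMSEQ_power_zero[of "1 / 8 :: real"]] tendsto_const[of 2]]
        by (simp add: \<eta>_def[abs_def])
      then have "(\<lambda>m. X m - G.P t x) \<longlonglongrightarrow> 0"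
        by (rule Lim_null_comparison[rotated]) (simp add: X_def close[OF t])
      then show ?thesis by (simp add: LIM_zero_iff)
    qed
    then obtain r where r: "strict_mono r" "AE s in lborel. (\<lambda>n. rep_l2 (X (r n)) s) \<longlonglongrightarrow> rep_l2 (G.P t x) s"
      by (rule l2_AE_subseq)
    from conv r(2) show "AE s in lborel. F (t, s) = rep_l2 (G.P t x) s"
    proof eventually_elim
      case (elim s)
      then obtain L where L: "(\<lambda>m. rep_l2 (X m) s) \<longlonglongrightarrow> L" by (auto simp: convergent_def)
      from LIMSEQ_subseq_LIMSEQ[OF this r(1)] elim(2) have "L = rep_l2 (G.P t x) s"
        by (intro LIMSEQ_unique) (auto simp: o_def)
      moreover have "F (t, s) = L"
        unfolding F_def using L by (intro limI) (simp add: Fm_def X_def)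
      ultimately show ?case by simp
    qed
  qed
qed

end

section \<open>Potentials and the Green function\<close>

context levy
begin

text \<open>The Green function of x paired with y, without choosing a version of it.\<close>

definition pot :: "l2 \<Rightarrow> l2 \<Rightarrow> ennreal" where
  "pot x y = (\<integral>\<^sup>+t\<in>{0<..}. ennreal (inner (G.P t x) y) \<partial>lborel)"

lemma P_inner_nneg: "nneg x \<Longrightarrow> nneg y \<Longrightarrow> 0 \<le> t \<Longrightarrow> 0 \<le> inner (G.P t x) y"
  by (intro inner_nneg P_nneg)

lemma nn_integral_P_inner:
  assumes "nneg x" "nneg y"
  shows "(\<integral>\<^sup>+t. ennreal (inner (G.P t x) y) * indicator {0..s} t \<partial>lborel)
    = ennreal (integral {0..s} (\<lambda>t. inner (G.P t x) y))"
  using P_inner_nneg[OF assms] G.inner_integrable[of 0 x y s]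
  by (intro nn_integral_has_integral_lebesgue' integrable_integral) auto

lemma integral_le_pot:
  assumes "nneg x" "nneg y" "pot x y \<le> ennreal C" "0 \<le> C"
  shows "integral {0..s} (\<lambda>t. inner (G.P t x) y) \<le> C"
proof -
  have "ennreal (integral {0..s} (\<lambda>t. inner (G.P t x) y)) \<le> pot x y"
    unfolding nn_integral_P_inner[OF assms(1,2), symmetric] pot_def
  proof (rule nn_integral_mono_AE)
    show "AE t in lborel. ennreal (inner (G.P t x) y) * indicator {0..s} t
        \<le> ennreal (inner (G.P t x) y) * indicator {0<..} t"
      using AE_lborel_singleton[of "0::real"] by eventually_elim (auto simp: indicator_def)
  qed
  with assms(3) have "ennreal (integral {0..s} (\<lambda>t. inner (G.P t x) y)) \<le> ennreal C"
    by (rule order_trans[rotated])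
  then show ?thesis using assms(4) by simp
qed

lemma pot_le:
  assumes x: "nneg x" and y: "nneg y"
    and le: "\<And>s. 0 \<le> s \<Longrightarrow> integral {0..s} (\<lambda>t. inner (G.P t x) y) \<le> C"
  shows "pot x y \<le> ennreal C"
proof -
  define \<psi> where "\<psi> n t = ennreal (inner (G.P t x) y) * indicator {0..real n} t" for n :: nat and t
  have [measurable]: "\<psi> n \<in> borel_measurable lborel" for n
  proof -
    have "continuous_on {0..real n} (\<lambda>t. inner (G.P t x) y)"
      by (intro continuous_intros continuous_on_subset[OF G.P.continuous]) auto
    then have "(\<lambda>t. indicator {0..real n} t *\<^sub>R inner (G.P t x) y) \<in> borel_measurable borel"
      by (intro borel_measurable_continuous_on_indicator) auto
    then have "(\<lambda>t. ennreal (indicator {0..real n} t *\<^sub>R inner (G.P t x) y)) \<in> borel_measurable lborel"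
      by simp
    also have "(\<lambda>t. ennreal (indicator {0..real n} t *\<^sub>R inner (G.P t x) y)) = \<psi> n"
      by (auto simp: \<psi>_def indicator_def fun_eq_iff)
    finally show ?thesis .
  qed
  have "pot x y \<le> (\<integral>\<^sup>+t. (SUP n. \<psi> n t) \<partial>lborel)"
    unfolding pot_def
  proof (rule nn_integral_mono)
    fix t :: real
    show "ennreal (inner (G.P t x) y) * indicator {0<..} t \<le> (SUP n. \<psi> n t)"
    proof (cases "0 < t")
      case True
      obtain n where "t \<le> real n" using real_arch_simple by blast
      with True have "ennreal (inner (G.P t x) y) * indicator {0<..} t \<le> \<psi> n t"
        by (simp add: \<psi>_def)
      also have "\<dots> \<le> (SUP n. \<psi> n t)" by (rule SUP_upper) simp
      finally show ?thesis .
    qed simp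
  qed
  also have "\<dots> = (SUP n. \<integral>\<^sup>+t. \<psi> n t \<partial>lborel)"
  proof (rule nn_integral_monotone_convergence_SUP)
    show "incseq \<psi>"
      by (auto simp: incseq_def le_fun_def \<psi>_def indicator_def)
  qed measurable
  also have "\<dots> \<le> ennreal C"
    unfolding \<psi>_def nn_integral_P_inner[OF x y]
    by (intro SUP_least ennreal_leI le) simp
  finally show ?thesis .
qed

lemma nneg_antisym: "nneg x \<Longrightarrow> nneg (- x) \<Longrightarrow> x = 0"
proof -
  assume "nneg x" "nneg (- x)"
  then have "AE t in lborel. rep_l2 x t = rep_l2 0 t"
    unfolding nneg_def using rep_uminus[of x] rep_zero by eventually_elim simp
  then show "x = 0" by (simp add: l2_eq_iff)
qed

lemma pos_mass_pos: "nneg x \<Longrightarrow> x \<noteq> 0 \<Longrightarrow> pos_mass x \<noteq> 0"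
  using nneg_antisym[of x] nneg_iff_pos_mass[of "- x"] by auto

text \<open>By Tonelli the integral of \<open>inner (tau h u) w\<close> over h is the product of the
  total masses of u and w, neither of which is 0.\<close>

lemma translates_not_orthogonal:
  assumes u: "nneg u" "u \<noteq> 0" and w: "nneg w" "w \<noteq> 0"
  shows "\<not> (AE h in lborel. inner (tau h u) w = 0)"
proof
  assume zero: "AE h in lborel. inner (tau h u) w = 0"
  have "ennreal (inner (tau h u) w) = (\<integral>\<^sup>+t. ennreal (rep_l2 u (t + h)) * ennreal (rep_l2 w t) \<partial>lborel)" for h
  proof -
    have nn: "AE t in lborel. 0 \<le> rep_l2 u (t + h)"
      using u(1) unfolding nneg_def by (rule AE_lborel_shift) measurable
    have "ennreal (inner (tau h u) w) = (\<integral>\<^sup>+t. ennreal (rep_l2 u (t + h) * rep_l2 w t) \<partial>lborel)"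
      unfolding inner_tau_rep
    proof (rule nn_integral_eq_integral[symmetric])
      show "integrable lborel (\<lambda>t. rep_l2 u (t + h) * rep_l2 w t)"
        by (intro L2_mult_integrable L2_shift) auto
      show "AE t in lborel. 0 \<le> rep_l2 u (t + h) * rep_l2 w t"
        using nn w(1) unfolding nneg_def by eventually_elim simp
    qed
    also have "\<dots> = (\<integral>\<^sup>+t. ennreal (rep_l2 u (t + h)) * ennreal (rep_l2 w t) \<partial>lborel)"
      using nn by (intro nn_integral_cong_AE) (auto simp: ennreal_mult')
    finally show ?thesis .
  qed
  then have "(\<integral>\<^sup>+h. ennreal (inner (tau h u) w) \<partial>lborel)
      = (\<integral>\<^sup>+h. \<integral>\<^sup>+t. ennreal (rep_l2 u (t + h)) * ennreal (rep_l2 w t) \<partial>lborel \<partial>lborel)"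
    by simp
  also have "\<dots> = (\<integral>\<^sup>+t. \<integral>\<^sup>+h. ennreal (rep_l2 u (t + h)) * ennreal (rep_l2 w t) \<partial>lborel \<partial>lborel)"
    by (rule lborel_pair.Fubini') measurable
  also have "\<dots> = (\<integral>\<^sup>+t. pos_mass u * ennreal (rep_l2 w t) \<partial>lborel)"
    using lborel_nn_integral_shift[of "\<lambda>t. ennreal (rep_l2 u t)"]
    by (simp add: nn_integral_multc pos_mass_def add.commute)
  also have "\<dots> = pos_mass u * pos_mass w"
    by (simp add: nn_integral_cmult pos_mass_def)
  finally have "(\<integral>\<^sup>+h. ennreal (inner (tau h u) w) \<partial>lborel) = pos_mass u * pos_mass w" .
  moreover have "(\<integral>\<^sup>+h. ennreal (inner (tau h u) w) \<partial>lborel) = (\<integral>\<^sup>+h. 0 \<partial>(lborel :: real measure))"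
    using zero by (intro nn_integral_cong_AE) auto
  ultimately show False
    using pos_mass_pos[OF u] pos_mass_pos[OF w] by simp
qed

text \<open>
  Irreducibility: if \<open>u = R x\<close> and \<open>w = R y\<close> had disjoint supports, then \<open>E u w < 0\<close>
  because every pair of points interacts, whereas \<open>E u w = \<langle>x, w\<rangle> - \<langle>u, w\<rangle> = \<langle>x, w\<rangle> \<ge> 0\<close>.
\<close>

lemma resolvents_not_disjoint:
  assumes x: "nneg x" "x \<noteq> 0" and y: "nneg y" "y \<noteq> 0"
  shows "inner (G.R x) (G.R y) \<noteq> 0"
proof
  define u w where "u = G.R x" and "w = G.R y"
  assume "inner (G.R x) (G.R y) = 0"
  then have uw: "inner u w = 0" by (simp add: u_def w_def)
  have u: "nneg u" "u \<noteq> 0" "u \<in> G.D" and w: "nneg w" "w \<noteq> 0" "w \<in> G.D"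
    using x y R_nneg R_eq_0_imp G.R_in_D by (auto simp: u_def w_def)
  have tau_nn: "0 \<le> inner (tau h u) w" for h
  proof (rule inner_nneg[OF _ w(1)])
    have "AE t in lborel. 0 \<le> rep_l2 u (t + h)"
      using u(1) unfolding nneg_def by (rule AE_lborel_shift) measurable
    then show "nneg (tau h u)"
      unfolding nneg_def using rep_tau[of h u] by eventually_elim simp
  qed
  have Fk: "G.F k u w = - (LINT h|lborel. kap \<epsilon> k h * inner (tau h u) w)" for k
    using uw by (simp add: G.F_def G.app_A inner_diff_left inner_N)
  \<comment> \<open>As u and w are orthogonal, these values are minus integrals of nonnegative
    functions that increase with k. Since their limit \<open>G.E u w\<close> is nonnegative, all of
    them vanish.\<close>
  have "decseq (\<lambda>k. G.F k u w)"
    unfolding decseq_def Fk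
    by (auto intro!: integral_mono K.integrable_inner_tau mult_right_mono kap_mono tau_nn)
  then have "G.E u w \<le> G.F k u w" for k
    by (rule decseq_ge[OF _ G.E_LIMSEQ[OF u(3) w(3)]])
  moreover have "G.E u w = inner x w"
    using G.E_R[OF w(3), of x] uw by (simp add: u_def inner_diff_left)
  ultimately have "0 \<le> G.F k u w" for k
    using inner_nneg[OF x(1) w(1)] by (metis order_trans)
  then have "(LINT h|lborel. kap \<epsilon> k h * inner (tau h u) w) = 0" for k
    unfolding Fk using tau_nn by (intro antisym integral_nonneg_AE) auto
  then have "AE h in lborel. kap \<epsilon> k h * inner (tau h u) w = 0" for k
    using integral_nonneg_eq_0_iff_AE[OF K.integrable_inner_tau, of k u w] tau_nn by simp
  then have "AE h in lborel. \<forall>k. kap \<epsilon> k h * inner (tau h u) w = 0"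
    unfolding AE_all_countable by (rule allI)
  moreover have "AE h in lborel. h \<noteq> (0::real)"
    by (rule AE_lborel_singleton)
  ultimately have "AE h in lborel. inner (tau h u) w = 0"
  proof eventually_elim
    case (elim h)
    have "(\<lambda>k. kap \<epsilon> k h * inner (tau h u) w) \<longlonglongrightarrow> 2 * lev \<epsilon> h * inner (tau h u) w"
      by (intro tendsto_intros kap_LIMSEQ)
    then have "2 * lev \<epsilon> h * inner (tau h u) w = 0"
      using elim(1) by (simp add: LIMSEQ_const_iff)
    then show ?case using lev_pos[OF elim(2), of \<epsilon>] by simp
  qed
  with translates_not_orthogonal[OF u(1,2) w(1,2)] show False ..
qed

text \<open>A finite potential stays finite when x and y are replaced by their resolvents, and then,
  by positivity of the semigroup, when both resolvents are replaced by their minimum h. A finite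
  potential of h against itself gives an energy bound, so \<open>no_energy_bound\<close> forces h =
  0, contrary to \<open>resolvents_not_disjoint\<close>.\<close>

lemma pot_infinite:
  assumes "1 \<le> \<epsilon>" and x: "nneg x" "x \<noteq> 0" and y: "nneg y" "y \<noteq> 0"
  shows "pot x y = \<infinity>"
proof (rule ccontr)
  assume "pot x y \<noteq> \<infinity>"
  then obtain C where C: "pot x y \<le> ennreal C" "0 \<le> C" by (cases "pot x y") auto
  define u w where "u = G.R x" and "w = G.R y"
  have u: "nneg u" and w: "nneg w" using x y R_nneg by (auto simp: u_def w_def)
  define h where "h = abs_l2 (\<lambda>t. min (rep_l2 u t) (rep_l2 w t))"
  have minL: "(\<lambda>t. min (rep_l2 u t) (rep_l2 w t)) \<in> L2 lborel"
    by (rule L2_dominated[OF L2_add[OF L2_abs L2_abs], of "rep_l2 u" _ "rep_l2 w"]) auto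
  have rep_h: "AE t in lborel. rep_l2 h t = min (rep_l2 u t) (rep_l2 w t)"
    unfolding h_def by (rule rep_abs_l2[OF minL])
  have h: "nneg h" "nneg (u - h)" "nneg (w - h)"
  proof -
    show "nneg h"
      using rep_h u w unfolding nneg_def by eventually_elim simp
    show "nneg (u - h)" "nneg (w - h)"
      unfolding nneg_diff using rep_h by (eventually_elim, simp)+
  qed
  define C' where "C' = C + 2 * norm y * norm x + 2 * norm x * norm w"
  have bound: "integral {0..s} (\<lambda>t. inner (G.P t u) w) \<le> C'" if "0 \<le> s" for s
  proof -
    have sym: "integral {0..s} (\<lambda>t. inner (G.P t a) b) = integral {0..s} (\<lambda>t. inner (G.P t b) a)" for a b
      by (intro integral_cong) (simp add: G.P_sym[of _ a b] inner_commute[of a])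
    have "integral {0..s} (\<lambda>t. inner (G.P t u) w) \<le> integral {0..s} (\<lambda>t. inner (G.P t w) x) + 2 * norm x * norm w"
      using G.integral_P_R_le[OF that, of x w] by (simp add: u_def sym[of w x])
    also have "integral {0..s} (\<lambda>t. inner (G.P t w) x) \<le> integral {0..s} (\<lambda>t. inner (G.P t x) y) + 2 * norm y * norm x"
      using G.integral_P_R_le[OF that, of y x] by (simp add: w_def sym[of x y])
    also have "integral {0..s} (\<lambda>t. inner (G.P t x) y) \<le> C"
      by (rule integral_le_pot[OF x(1) y(1) C])
    finally show ?thesis by (simp add: C'_def)
  qed
  have "integral {0..s} (\<lambda>t. inner (G.P t h) h) \<le> C'" if "0 \<le> s" for s
  proof -
    have "integral {0..s} (\<lambda>t. inner (G.P t h) h) \<le> integral {0..s} (\<lambda>t. inner (G.P t u) w)"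
    proof (rule integral_le)
      fix t assume t: "t \<in> {0..s}"
      have "0 \<le> inner (G.P t (u - h)) h" "0 \<le> inner (G.P t u) (w - h)"
        using t h u by (auto intro!: P_inner_nneg)
      then show "inner (G.P t h) h \<le> inner (G.P t u) w"
        using t by (simp add: G.P.diff inner_diff_left inner_diff_right)
    qed (auto intro: G.inner_integrable)
    with bound[OF that] show ?thesis by simp
  qed
  then have "(inner h v)\<^sup>2 \<le> C' * G.E v v" if "v \<in> G.D" for v
    using that by (rule G.energy_bound_of_potential)
  moreover have "0 \<le> C'" using C(2) by (simp add: C'_def)
  ultimately have "h = 0"
    using no_energy_bound[OF assms(1)] h(1) unfolding nneg_def by blast
  have "AE t in lborel. rep_l2 u t * rep_l2 w t = 0"
    using rep_h rep_zero u w unfolding \<open>h = 0\<close> nneg_def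
    by eventually_elim (auto simp: min_def split: if_splits)
  then have "inner u w = 0"
    unfolding inner_l2_def L2_inner_def by (subst integral_eq_zero_AE) auto
  with resolvents_not_disjoint[OF x y] show False by (simp add: u_def w_def)
qed

text \<open>The lower bound by the truncation at height 1 links the Green function of an integrable
  f to the potential of an element of \<open>l2\<close>.\<close>

lemma S_version:
  assumes f: "f \<in> L1 lborel" and nn: "AE x in lborel. 0 \<le> f x"
  shows "\<exists>F\<in>borel_measurable (lborel \<Otimes>\<^sub>M lborel). \<forall>t>0.
    AE s in lborel. F (t, s) = S t f s \<and> T t (\<lambda>x. trunc 1 (f x)) s \<le> F (t, s)"
proof -
  define x where "x n = abs_l2 (\<lambda>t. trunc n (f t))" for n
  have "\<exists>F. F \<in> borel_measurable (lborel \<Otimes>\<^sub>M lborel) \<and> (\<forall>t\<ge>0. AE s in lborel. F (t, s) = rep_l2 (G.P t (x n)) s)" for n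
    using joint_version[of "x n"] by metis
  then obtain Fn where Fn [measurable]: "\<And>n. Fn n \<in> borel_measurable (lborel \<Otimes>\<^sub>M lborel)"
    and Fn_eq: "\<And>n t. 0 \<le> t \<Longrightarrow> AE s in lborel. Fn n (t, s) = rep_l2 (G.P t (x n)) s"
    by metis
  define F where "F p = lim (\<lambda>n. Fn n p)" for p
  show ?thesis
  proof (intro bexI[of _ F] allI impI)
    show "F \<in> borel_measurable (lborel \<Otimes>\<^sub>M lborel)"
      unfolding F_def[abs_def] by measurable
    fix t :: real assume t: "0 < t"
    have "AE s in lborel. \<forall>n. Fn n (t, s) = T t (\<lambda>x. trunc n (f x)) s"
      unfolding AE_all_countable using Fn_eq[of t] t by (simp add: T_def x_def)
    with S_nneg_LIMSEQ[OF t f nn]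
    show "AE s in lborel. F (t, s) = S t f s \<and> T t (\<lambda>x. trunc 1 (f x)) s \<le> F (t, s)"
    proof eventually_elim
      case (elim s)
      then have "F (t, s) = S t f s"
        unfolding F_def by (intro limI) simp
      moreover have "T t (\<lambda>x. trunc 1 (f x)) s \<le> S t f s"
        using elim(1) by (intro incseq_le[of "\<lambda>n. T t (\<lambda>x. trunc n (f x)) s"]) auto
      ultimately show ?case by simp
    qed
  qed
qed

lemma green_pairing:
  fixes F :: "real \<times> real \<Rightarrow> real"
  assumes [measurable]: "F \<in> borel_measurable (lborel \<Otimes>\<^sub>M lborel)" "B \<in> sets borel"
  shows "(\<integral>\<^sup>+s\<in>B. (\<integral>\<^sup>+t\<in>{0<..}. ennreal (F (t, s)) \<partial>lborel) \<partial>lborel)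
    = (\<integral>\<^sup>+t\<in>{0<..}. (\<integral>\<^sup>+s\<in>B. ennreal (F (t, s)) \<partial>lborel) \<partial>lborel)"
proof -
  have "(\<integral>\<^sup>+s\<in>B. (\<integral>\<^sup>+t\<in>{0<..}. ennreal (F (t, s)) \<partial>lborel) \<partial>lborel)
      = (\<integral>\<^sup>+s. \<integral>\<^sup>+t. ennreal (F (t, s)) * indicator {0<..} t * indicator B s \<partial>lborel \<partial>lborel)"
  proof (rule nn_integral_cong)
    fix s :: real
    show "(\<integral>\<^sup>+t\<in>{0<..}. ennreal (F (t, s)) \<partial>lborel) * indicator B s
        = (\<integral>\<^sup>+t. ennreal (F (t, s)) * indicator {0<..} t * indicator B s \<partial>lborel)"
      by (rule nn_integral_multc[symmetric]) measurable
  qed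
  also have "\<dots> = (\<integral>\<^sup>+t. \<integral>\<^sup>+s. ennreal (F (t, s)) * indicator {0<..} t * indicator B s \<partial>lborel \<partial>lborel)"
    by (rule lborel_pair.Fubini') measurable
  also have "\<dots> = (\<integral>\<^sup>+t\<in>{0<..}. (\<integral>\<^sup>+s\<in>B. ennreal (F (t, s)) \<partial>lborel) \<partial>lborel)"
  proof (rule nn_integral_cong)
    fix t :: real
    have "(\<integral>\<^sup>+s. ennreal (F (t, s)) * indicator {0<..} t * indicator B s \<partial>lborel)
        = (\<integral>\<^sup>+s. ennreal (F (t, s)) * indicator B s * indicator {0<..} t \<partial>lborel)"
      by (simp add: mult_ac)
    also have "\<dots> = (\<integral>\<^sup>+s\<in>B. ennreal (F (t, s)) \<partial>lborel) * indicator {0<..} t"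
      by (rule nn_integral_multc) measurable
    finally show "(\<integral>\<^sup>+s. ennreal (F (t, s)) * indicator {0<..} t * indicator B s \<partial>lborel)
        = (\<integral>\<^sup>+s\<in>B. ennreal (F (t, s)) \<partial>lborel) * indicator {0<..} t" .
  qed
  finally show ?thesis .
qed

lemma ennreal_inner_indicator:
  assumes x: "nneg x" and B: "B \<in> sets borel" "B \<subseteq> {- r..r}" and t: "0 \<le> t"
  shows "ennreal (inner (G.P t x) (abs_l2 (indicator B))) = (\<integral>\<^sup>+s\<in>B. ennreal (rep_l2 (G.P t x) s) \<partial>lborel)"
proof -
  note L = L2_indicator_bounded[OF B]
  have "inner (G.P t x) (abs_l2 (indicator B)) = (LINT s|lborel. rep_l2 (G.P t x) s * indicator B s)"
    using inner_abs_l2[OF rep_l2_L2 L] by simp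
  also have "ennreal \<dots> = (\<integral>\<^sup>+s. ennreal (rep_l2 (G.P t x) s * indicator B s) \<partial>lborel)"
  proof (rule nn_integral_eq_integral[symmetric, OF L2_mult_integrable[OF rep_l2_L2 L]])
    show "AE s in lborel. 0 \<le> rep_l2 (G.P t x) s * indicator B s"
      using P_nneg[OF t x] unfolding nneg_def by eventually_elim simp
  qed
  also have "\<dots> = (\<integral>\<^sup>+s\<in>B. ennreal (rep_l2 (G.P t x) s) \<partial>lborel)"
    by (intro nn_integral_cong) (simp add: indicator_def)
  finally show ?thesis .
qed

text \<open>Let B be the part of a bounded interval where the Green function is at most n. The
  potential of x against the indicator of B is then finite, so \<open>pot_infinite\<close> makes B a
  null set.\<close>

lemma green_infinite:
  assumes "1 \<le> \<epsilon>" and x: "nneg x" "x \<noteq> 0"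
    and F [measurable]: "F \<in> borel_measurable (lborel \<Otimes>\<^sub>M lborel)"
    and le: "\<And>t. 0 < t \<Longrightarrow> AE s in lborel. rep_l2 (G.P t x) s \<le> F (t, s)"
  shows "AE s in lborel. (\<integral>\<^sup>+t\<in>{0<..}. ennreal (F (t, s)) \<partial>lborel) = \<infinity>"
proof -
  define g where "g s = (\<integral>\<^sup>+t\<in>{0<..}. ennreal (F (t, s)) \<partial>lborel)" for s
  have [measurable]: "g \<in> borel_measurable borel"
    unfolding g_def[abs_def] by measurable
  have null: "AE s in lborel. \<not> (s \<in> {- real n..real n} \<and> g s \<le> of_nat n)" for n
  proof -
    define B where "B = {s. s \<in> {- real n..real n} \<and> g s \<le> of_nat n}"
    have B: "B \<in> sets borel" "B \<subseteq> {- real n..real n}"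
      unfolding B_def by (measurable, auto)
    note L = L2_indicator_bounded[OF B]
    have nnB: "nneg (abs_l2 (indicator B))"
      by (simp add: nneg_abs_l2 L)
    have "pot x (abs_l2 (indicator B)) \<le> (\<integral>\<^sup>+t\<in>{0<..}. (\<integral>\<^sup>+s\<in>B. ennreal (F (t, s)) \<partial>lborel) \<partial>lborel)"
      unfolding pot_def
    proof (rule nn_integral_mono)
      fix t :: real
      show "ennreal (inner (G.P t x) (abs_l2 (indicator B))) * indicator {0<..} t
          \<le> (\<integral>\<^sup>+s\<in>B. ennreal (F (t, s)) \<partial>lborel) * indicator {0<..} t"
      proof (cases "0 < t")
        case True
        have "(\<integral>\<^sup>+s\<in>B. ennreal (rep_l2 (G.P t x) s) \<partial>lborel) \<le> (\<integral>\<^sup>+s\<in>B. ennreal (F (t, s)) \<partial>lborel)"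
        proof (rule nn_integral_mono_AE)
          show "AE s in lborel. ennreal (rep_l2 (G.P t x) s) * indicator B s \<le> ennreal (F (t, s)) * indicator B s"
            using le[OF True] by eventually_elim (intro mult_right_mono ennreal_leI, auto)
        qed
        with True show ?thesis
          by (simp add: ennreal_inner_indicator[OF x(1) B])
      qed simp
    qed
    also have "\<dots> = (\<integral>\<^sup>+s\<in>B. g s \<partial>lborel)"
      unfolding g_def by (rule green_pairing[symmetric]) (use B in auto)
    also have "\<dots> \<le> (\<integral>\<^sup>+s. of_nat n * indicator {- real n..real n} s \<partial>lborel)"
      by (intro nn_integral_mono) (auto simp: B_def indicator_def)
    also have "\<dots> = of_nat n * emeasure lborel {- real n..real n}"
      by (rule nn_integral_cmult_indicator) simp
    also have "\<dots> < \<infinity>"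
      by (simp add: ennreal_mult_less_top ennreal_of_nat_eq_real_of_nat)
    finally have finite: "pot x (abs_l2 (indicator B)) < \<infinity>" .
    have z: "abs_l2 (indicator B) = 0"
    proof (rule ccontr)
      assume "abs_l2 (indicator B) \<noteq> 0"
      from pot_infinite[OF assms(1) x nnB this] finite show False by simp
    qed
    from rep_abs_l2[OF L, unfolded z] rep_zero
    have "AE s in lborel. indicator B s = (0 :: real)" by eventually_elim simp
    then show ?thesis
      by eventually_elim (auto simp: B_def indicator_def split: if_splits)
  qed
  have "AE s in lborel. \<forall>n. \<not> (s \<in> {- real n..real n} \<and> g s \<le> of_nat n)"
    unfolding AE_all_countable using null by (rule allI)
  then show ?thesis
    unfolding g_def[symmetric]
  proof eventually_elim
    case (elim s)
    show ?case
    proof (rule ccontr)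
      assume "g s \<noteq> \<infinity>"
      then obtain n1 where n1: "g s < of_nat n1"
        using ennreal_Ex_less_of_nat[of "g s"] by (auto simp: less_top)
      obtain n2 where n2: "\<bar>s\<bar> \<le> real n2" using real_arch_simple by blast
      have "g s \<le> of_nat (max n1 n2)"
        using n1 by (meson less_imp_le max.cobounded1 of_nat_le_iff order_less_le_trans of_nat_mono)
      moreover have "s \<in> {- real (max n1 n2)..real (max n1 n2)}"
        using n2 by (auto simp: abs_le_iff)
      ultimately show False using elim by blast
    qed
  qed
qed

lemma recurrent:
  assumes "1 \<le> \<epsilon>"
  shows "recurrent lborel (levy_form \<epsilon>) (levy_dom \<epsilon>)"
  unfolding recurrent_def
proof (rule exI[of _ T], rule exI[of _ S], intro conjI ballI impI associated_semigroup_T L1_extension_S)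
  fix f :: "real \<Rightarrow> real"
  assume f: "f \<in> L1 lborel" and nn: "AE x in lborel. 0 \<le> f x"
  have trunc1: "(\<lambda>t. trunc 1 (f t)) \<in> L2 lborel" by (rule trunc_L2[OF f])
  define x where "x = abs_l2 (\<lambda>t. trunc 1 (f t))"
  have x: "nneg x"
    unfolding x_def nneg_abs_l2[OF trunc1] using nn by eventually_elim (simp add: trunc_def)
  show "\<exists>g. green_version lborel S f g \<and> (AE x in lborel. g x = 0 \<or> g x = \<infinity>)"
  proof (cases "x = 0")
    case True
    \<comment> \<open>Truncation at height 1 does not create zeros, so f itself vanishes almost
      everywhere and 0 is a version of its Green function.\<close>
    have "AE t in lborel. trunc 1 (f t) = 0"
      using rep_abs_l2[OF trunc1] rep_zero True unfolding x_def by (auto elim: AE_mp)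
    then have f0: "AE t in lborel. 0 = f t"
      by eventually_elim (auto simp: trunc_def min_def max_def split: if_splits)
    have fL: "f \<in> L2 lborel"
      using f by (intro L2_cong_AE[OF L2_zero _ f0]) (auto simp: L1_def)
    have "abs_l2 f = 0"
      unfolding zero_l2_def using f0 fL L2_zero by (subst abs_l2_eq_iff) (auto elim: AE_mp)
    then have "AE s in lborel. 0 = S t f s" if "0 < t" for t
    proof -
      have "G.P t 0 = 0" using G.P.scale[of t 0 0] that by simp
      with \<open>abs_l2 f = 0\<close> S_eq_T[OF that f fL] rep_zero show ?thesis
        unfolding T_def by (auto elim: AE_mp)
    qed
    then have "green_version lborel S f (\<lambda>s. \<integral>\<^sup>+t\<in>{0<..}. ennreal ((\<lambda>_. 0) (t, s)) \<partial>lborel)"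
      unfolding green_version_def by (intro bexI[of _ "\<lambda>_. 0"]) auto
    then show ?thesis by (intro exI conjI) auto
  next
    case False
    obtain F where F: "F \<in> borel_measurable (lborel \<Otimes>\<^sub>M lborel)"
      "\<And>t. 0 < t \<Longrightarrow> AE s in lborel. F (t, s) = S t f s \<and> T t (\<lambda>x. trunc 1 (f x)) s \<le> F (t, s)"
      using S_version[OF f nn] by blast
    have "AE s in lborel. (\<integral>\<^sup>+t\<in>{0<..}. ennreal (F (t, s)) \<partial>lborel) = \<infinity>"
    proof (rule green_infinite[OF assms x False F(1)])
      fix t :: real assume "0 < t"
      from F(2)[OF this] show "AE s in lborel. rep_l2 (G.P t x) s \<le> F (t, s)"
        by eventually_elim (simp add: T_def x_def)
    qed
    moreover have "green_version lborel S f (\<lambda>s. \<integral>\<^sup>+t\<in>{0<..}. ennreal (F (t, s)) \<partial>lborel)"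
      unfolding green_version_def using F(2) by (intro bexI[OF _ F(1)]) auto
    ultimately show ?thesis by (intro exI conjI) auto
  qed
qed

text \<open>For x the indicator of B = [1, 2) the energy bound makes the Green function integrable
  over B. With values in {0, \<infinity>} it would vanish there, and so would the potential of x
  against itself. But \<open>G.P.U s x /\<^sub>R s\<close> tends to x as s tends to 0, which gives
  \<open>inner x x \<le> 0\<close>.\<close>

lemma not_recurrent:
  assumes "\<epsilon> < 1"
  shows "\<not> recurrent lborel (levy_form \<epsilon>) (levy_dom \<epsilon>)"
proof
  assume "recurrent lborel (levy_form \<epsilon>) (levy_dom \<epsilon>)"
  then obtain T' S' where T': "associated_semigroup lborel (levy_form \<epsilon>) (levy_dom \<epsilon>) T'"
    and S': "L1_extension lborel T' S'"
    and rec: "\<And>f. f \<in> L1 lborel \<Longrightarrow> AE x in lborel. 0 \<le> f x \<Longrightarrow>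
      \<exists>g. green_version lborel S' f g \<and> (AE x in lborel. g x = 0 \<or> g x = \<infinity>)"
    unfolding recurrent_def by blast
  define B :: "real set" where "B = {1..<2}"
  have B: "B \<in> sets borel" "B \<subseteq> {- 2..2}" by (auto simp: B_def)
  note L = L2_indicator_bounded[OF B]
  have L1: "indicator B \<in> L1 lborel"
    using L2_mult_integrable[OF L L] by (simp add: L1_def flip: indicator_inter_arith)
  define x where "x = abs_l2 (indicator B)"
  have x: "nneg x" by (simp add: x_def nneg_abs_l2 L)
  have "AE s in lborel. 0 \<le> (indicator B s :: real)" by simp
  from rec[OF L1 this] obtain g where "green_version lborel S' (indicator B) g"
    and g: "AE s in lborel. g s = 0 \<or> g s = \<infinity>" by blast
  then obtain F where F [measurable]: "F \<in> borel_measurable (lborel \<Otimes>\<^sub>M lborel)"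
    and F': "\<And>t. 0 < t \<Longrightarrow> AE s in lborel. F (t, s) = S' t (indicator B) s"
    and g_eq: "g = (\<lambda>s. \<integral>\<^sup>+t\<in>{0<..}. ennreal (F (t, s)) \<partial>lborel)"
    unfolding green_version_def by blast
  have [measurable]: "g \<in> borel_measurable borel"
    unfolding g_eq by measurable
  have FP: "AE s in lborel. F (t, s) = rep_l2 (G.P t x) s" if "0 < t" for t
  proof -
    have "AE s in lborel. S' t (indicator B) s = T' t (indicator B) s"
      using S' that L L1 by (auto simp: L1_extension_def)
    with F'[OF that] associated_semigroup_unique[OF T' that L] show ?thesis
      by eventually_elim (simp add: T_def x_def)
  qed
  have pot_eq: "pot x x = (\<integral>\<^sup>+s\<in>B. g s \<partial>lborel)"
  proof -
    have "(\<integral>\<^sup>+s\<in>B. g s \<partial>lborel) = (\<integral>\<^sup>+t\<in>{0<..}. (\<integral>\<^sup>+s\<in>B. ennreal (F (t, s)) \<partial>lborel) \<partial>lborel)"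
      unfolding g_eq by (rule green_pairing[OF F B(1)])
    also have "\<dots> = pot x x"
      unfolding pot_def
    proof (rule nn_integral_cong)
      fix t :: real
      show "(\<integral>\<^sup>+s\<in>B. ennreal (F (t, s)) \<partial>lborel) * indicator {0<..} t
          = ennreal (inner (G.P t x) x) * indicator {0<..} t"
      proof (cases "0 < t")
        case True
        have "(\<integral>\<^sup>+s\<in>B. ennreal (F (t, s)) \<partial>lborel) = (\<integral>\<^sup>+s\<in>B. ennreal (rep_l2 (G.P t x) s) \<partial>lborel)"
          using FP[OF True] by (intro nn_integral_cong_AE) auto
        also have "\<dots> = ennreal (inner (G.P t x) x)"
          using ennreal_inner_indicator[OF x B, of t] True by (simp add: x_def)
        finally show ?thesis by simp
      qed simp
    qed
    finally show ?thesis by simp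
  qed
  obtain C where C: "0 \<le> C" "\<And>v. v \<in> G.D \<Longrightarrow> (inner x v)\<^sup>2 \<le> C * G.E v v"
    using transience_bound[OF assms] unfolding x_def B_def by metis
  have "pot x x \<le> ennreal C"
    using G.potential_bounded[OF C(2,1)] by (intro pot_le x) auto
  then have "(\<integral>\<^sup>+s\<in>B. g s \<partial>lborel) \<noteq> \<infinity>"
    unfolding pot_eq by (auto simp: top_unique)
  then have "AE s in lborel. g s * indicator B s \<noteq> \<infinity>"
    using B(1) by (intro nn_integral_noteq_infinite) auto
  with g have "AE s in lborel. g s * indicator B s = 0"
    by eventually_elim (auto simp: indicator_def split: if_splits)
  then have "pot x x = 0"
    unfolding pot_eq using B(1) by (subst nn_integral_0_iff_AE) auto
  then have "integral {0..s} (\<lambda>t. inner (G.P t x) x) \<le> 0" for s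
    using integral_le_pot[OF x x, of 0 s] by simp
  then have le: "inner (G.P.U s x) x \<le> 0" for s
    by (simp add: G.P.U_inner)
  have "((\<lambda>s. inner (G.P.U s x /\<^sub>R s) x) \<longlongrightarrow> inner x x) (at_right 0)"
    by (intro tendsto_intros G.P.U_limit)
  moreover have "\<forall>\<^sub>F s in at_right (0::real). 0 < s"
    by (simp add: eventually_at_right_less)
  then have "\<forall>\<^sub>F s in at_right 0. inner (G.P.U s x /\<^sub>R s) x \<le> 0"
    by eventually_elim (use le in \<open>simp add: mult_nonneg_nonpos\<close>)
  ultimately have "inner x x \<le> 0"
    by (rule tendsto_upperbound) simp
  moreover have "inner x x = (LINT t|lborel. indicator B t)"
    unfolding x_def inner_abs_l2[OF L L] by (simp flip: indicator_inter_arith)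
  ultimately show False by (simp add: B_def)
qed

end

theorem theorem4p2:
  fixes \<epsilon> :: real
  assumes "\<epsilon> > 0"
  shows "dirichlet_form lborel (levy_form \<epsilon>) (levy_dom \<epsilon>) \<and>
         translation_invariant (levy_form \<epsilon>) (levy_dom \<epsilon>) \<and>
         (recurrent lborel (levy_form \<epsilon>) (levy_dom \<epsilon>) \<longleftrightarrow> \<epsilon> \<ge> 1)"
proof -
  interpret levy \<epsilon> by standard (rule assms)
  show ?thesis
    using dirichlet_form translation_invariant recurrent not_recurrent by force
qed

end
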